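(* Let $m\ge0$ be an integer. (i) $A_{2m+1}$ is a free $\mathcal D$-module; more precisely there is an isomorphism of $\mathcal D$-modules $$A_{2m+1}\simeq\mathcal D\otimes_{\mathbb C}W_{2m+1,0}.$$ (ii) $$\mathrm{ch}\,A_{2m+1}=\frac{p^{m(m+1)}(1-p^{2m+2})}{\prod_{n\ge1}(1-p^n)}.$$
   Context: Let $q$ be an indeterminate, $A=\mathbb{C}[q,q^{-1}]$, and for $m\in\mathbb Z$ let $V_A(\Lambda_1)_{2m+1}=A[b_n\mid n<0]\,\mathrm e^{\Lambda_1+m\alpha_1}$ (free $A$-module, formal symbols $\mathrm e^{\Lambda_1+m\alpha_1}$). On $\bigoplus_m V_A(\Lambda_1)_{2m+1}$ (and on its extension of scalars to $\mathbb C(q)$) let $b_n$ ($n<0$) act by multiplication, $b_n=n(q^n+q^{-n})\,\partial/\partial b_{-n}$ for $n>0$, let $\mathrm e^{-\alpha_1}$ send $P\mathrm e^{\Lambda_1+m\alpha_1}$ to $P\mathrm e^{\Lambda_1+(m-1)\alpha_1}$, and let $\partial$ act on $V_A(\Lambda_1)_{2m+1}$ by the scalar $2m+1$. Define operators $x_n^-$ by $$\sum_{n\in\mathbb Z}x_n^-z^{-n-1}=\exp\Big(-\sum_{n\ge1}\tfrac{b_{-n}}{n}(qz)^n\Big)\exp\Big(\sum_{n\ge1}\tfrac{b_n}{n}z^{-n}\Big)\mathrm e^{-\alpha_1}z^{-\partial}.$$ The operators $x_0^-$ and $(x_0^-)^{(2)}=(x_0^-)^2/(q+q^{-1})$ preserve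 the $A$-lattice. Put $\mathcal V_{2m+1}=\big(A/(q-\sqrt{-1})A\big)\otimes_A V_A(\Lambda_1)_{2m+1}=\mathbb C[b_{-1},b_{-2},\dots]\mathrm e^{\Lambda_1+m\alpha_1}$, and denote again by $x_0^-:\mathcal V_{2m+1}\to\mathcal V_{2m-1}$ and $(x_0^-)^{(2)}:\mathcal V_{2m+1}\to\mathcal V_{2m-3}$ the specialized operators. They commute with multiplication by $b_{-1},b_{-3},\dots$. Let $\mathcal D=\mathbb C[b_{-1},b_{-3},b_{-5},\dots]$, acting by multiplication, and for $m\ge0$ let $$A_{2m+1}=\frac{\mathcal V_{2m+1}}{x_0^-\mathcal V_{2m+3}+(x_0^-)^{(2)}\mathcal V_{2m+5}}.$$ Grading: $\deg b_n=n$, $\deg \mathrm e^{\Lambda_1+m\alpha_1}=-m^2-m$; $x_0^-$ and $(x_0^-)^{(2)}$ are homogeneous of degree $0$, so $A_{2m+1}$ is graded. For a graded space $V=\bigoplus_dV_d$ with finite dimensional $V_d$, $\mathrm{ch}\,V=\sum_d(\dim V_d)\,p^{-d}$. Fermionic Fock space: let $\tilde\psi_{2n+1},\tilde\psi_{2n+1}^*$ ($n\in\mathbb Z$) satisfy the canonical anticommutation relations $[\tilde\psi_{k},\tilde\psi_{l}]_+=[\tilde\psi^*_{k},\tilde\psi^*_{l}]_+=0$, $[\tilde\psi_{k},\tilde\psi^*_{l}]_+=\delta_{k,l}$, and let $|1\rangle$ be the vacuum with $\tilde\psi_{2n+1}|1\rangle=0$ for $n>0$ and $\tilde\psi^*_{2n+1}|1\rangle=0$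 for $n\le0$. For $m\in\mathbb Z$, $\tilde H_{2m+1,0}$ is the complex vector space with basis $\tilde\psi_{2r_1+1}\cdots\tilde\psi_{2r_k+1}\tilde\psi^*_{2s_1+1}\cdots\tilde\psi^*_{2s_{k+m}+1}|1\rangle$, $r_1<\dots<r_k<0<s_1<\dots<s_{k+m}$ ($k\ge\max(0,-m)$). Let $\omega=-\sum_{n\ge1}\tilde\psi_{-(2n-1)}\tilde\psi_{2n+1}$, so $\omega:\tilde H_{2n+5,0}\to\tilde H_{2n+1,0}$, and $W_{2n+1,0}=\tilde H_{2n+1,0}/\omega\tilde H_{2n+5,0}$. *)

theory Defs
  imports
    "HOL-Analysis.Analysis"
    "HOL-Algebra.AbelCoset"
    "HOL-Algebra.Module"
    "HOL-Library.Poly_Mapping"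
    "HOL-Library.Groups_Big_Fun"
    "HOL-Library.FSet"
    "HOL-Computational_Algebra.Formal_Laurent_Series"
begin

section \<open>Modules\<close>

subsection \<open>Quotients, isomorphisms, bases\<close>

text \<open>Only the additive structure and the scalar multiplication of a module record are used; the
  ring multiplication and unit of a quotient are left unspecified.\<close>

definition quot_module :: "('r, 'a, 'x) module_scheme \<Rightarrow> 'a set \<Rightarrow> ('r, 'a set) module" where
  "quot_module M N =
    \<lparr>carrier = a_rcosets\<^bsub>M\<^esub> N, mult = undefined, one = undefined, zero = N, add = set_add M,
     smult = (\<lambda>r X. \<Union>x\<in>X. N +>\<^bsub>M\<^esub> (r \<odot>\<^bsub>M\<^esub> x))\<rparr>"

definition modules_isomorphic ::
    "('r, 'c) ring_scheme \<Rightarrow> ('r, 'a, 'x) module_scheme \<Rightarrow> ('r, 'b, 'y) module_scheme \<Rightarrow> bool" where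
  "modules_isomorphic R M N \<longleftrightarrow> Module.module R M \<and> Module.module R N \<and>
    (\<exists>h. bij_betw h (carrier M) (carrier N) \<and>
      (\<forall>x\<in>carrier M. \<forall>y\<in>carrier M. h (x \<oplus>\<^bsub>M\<^esub> y) = h x \<oplus>\<^bsub>N\<^esub> h y) \<and>
      (\<forall>r\<in>carrier R. \<forall>x\<in>carrier M. h (r \<odot>\<^bsub>M\<^esub> x) = r \<odot>\<^bsub>N\<^esub> h x))"

definition module_basis ::
    "('r, 'c) ring_scheme \<Rightarrow> ('r, 'a, 'x) module_scheme \<Rightarrow> 'a set \<Rightarrow> bool" where
  "module_basis R M B \<longleftrightarrow> B \<subseteq> carrier M \<and>
    (\<forall>x\<in>carrier M. \<exists>!c. (\<forall>b. c b \<in> carrier R) \<and>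
      finite {b. c b \<noteq> \<zero>\<^bsub>R\<^esub>} \<and> {b. c b \<noteq> \<zero>\<^bsub>R\<^esub>} \<subseteq> B \<and>
      x = (\<Oplus>\<^bsub>M\<^esub>b\<in>{b. c b \<noteq> \<zero>\<^bsub>R\<^esub>}. c b \<odot>\<^bsub>M\<^esub> b))"

definition free_module :: "('r, 'c) ring_scheme \<Rightarrow> ('r, 'a, 'x) module_scheme \<Rightarrow> bool" where
  "free_module R M \<longleftrightarrow> Module.module R M \<and> (\<exists>B. module_basis R M B)"

text \<open>Dimension of a vector space over a field; it is \<open>0\<close> when the dimension is infinite.\<close>

definition vdim :: "('r, 'c) ring_scheme \<Rightarrow> ('r, 'a, 'x) module_scheme \<Rightarrow> nat" where
  "vdim R M = card (SOME B. module_basis R M B)"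

definition complex_ring :: "complex ring" where
  "complex_ring = \<lparr>carrier = UNIV, mult = (*), one = 1, zero = 0, add = (+)\<rparr>"

subsection \<open>Vector spaces with a given basis, tensor products\<close>

definition pm_scale :: "'r::semiring_0 \<Rightarrow> ('x \<Rightarrow>\<^sub>0 'r) \<Rightarrow> ('x \<Rightarrow>\<^sub>0 'r)" where
  "pm_scale c v = Poly_Mapping.map ((*) c) v"

text \<open>The linear map that sends the basis vector \<open>x\<close> to \<open>g x\<close>.\<close>

definition lin_ext :: "('x \<Rightarrow> ('y \<Rightarrow>\<^sub>0 'r::semiring_0)) \<Rightarrow> ('x \<Rightarrow>\<^sub>0 'r) \<Rightarrow> ('y \<Rightarrow>\<^sub>0 'r)" where
  "lin_ext g v = (\<Sum>x\<in>Poly_Mapping.keys v. pm_scale (Poly_Mapping.lookup v x) (g x))"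

lemma lookup_pm_scale [simp]:
  "Poly_Mapping.lookup (pm_scale c v) x = c * Poly_Mapping.lookup v x"
  by (simp add: pm_scale_def Poly_Mapping.map.rep_eq when_def)

lemma lookup_lin_ext:
  assumes "finite S" "Poly_Mapping.keys v \<subseteq> S"
  shows "Poly_Mapping.lookup (lin_ext g v) y =
    (\<Sum>x\<in>S. Poly_Mapping.lookup v x * Poly_Mapping.lookup (g x) y)"
  unfolding lin_ext_def lookup_sum lookup_pm_scale
  by (rule sum.mono_neutral_left) (use assms in \<open>auto simp: in_keys_iff\<close>)

lemma lin_ext_add: "lin_ext g (u + v) = lin_ext g u + lin_ext g v"
proof (rule poly_mapping_eqI)
  fix y
  let ?S = "Poly_Mapping.keys u \<union> Poly_Mapping.keys v"
  have *: "finite ?S" "Poly_Mapping.keys (u + v) \<subseteq> ?S" "Poly_Mapping.keys u \<subseteq> ?S"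
    "Poly_Mapping.keys v \<subseteq> ?S"
    using Poly_Mapping.keys_add[of u v] by auto
  show "Poly_Mapping.lookup (lin_ext g (u + v)) y = Poly_Mapping.lookup (lin_ext g u + lin_ext g v) y"
    unfolding lookup_add lookup_lin_ext[OF *(1,2)] lookup_lin_ext[OF *(1,3)] lookup_lin_ext[OF *(1,4)]
    by (simp add: algebra_simps sum.distrib)
qed

lemma lin_ext_zero [simp]: "lin_ext g 0 = 0"
  by (simp add: lin_ext_def)

lemma lin_ext_sum: "lin_ext g (\<Sum>i\<in>I. f i) = (\<Sum>i\<in>I. lin_ext g (f i))"
  by (induction I rule: infinite_finite_induct) (simp_all add: lin_ext_add)

lemma lin_ext_scale: "lin_ext g (pm_scale c v) = pm_scale c (lin_ext g v)"
proof (rule poly_mapping_eqI)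
  fix y
  have *: "Poly_Mapping.keys (pm_scale c v) \<subseteq> Poly_Mapping.keys v"
    by (auto simp: in_keys_iff)
  show "Poly_Mapping.lookup (lin_ext g (pm_scale c v)) y = Poly_Mapping.lookup (pm_scale c (lin_ext g v)) y"
    by (subst lookup_lin_ext[OF finite_keys *])
      (simp add: lookup_lin_ext[OF finite_keys subset_refl] sum_distrib_left mult.assoc)
qed

lemma lin_ext_single: "lin_ext g (Poly_Mapping.single x c) = pm_scale c (g x)"
  by (cases "c = 0") (auto simp: lin_ext_def intro!: poly_mapping_eqI)

lemma lin_ext_lin_ext: "lin_ext g (lin_ext h v) = lin_ext (\<lambda>x. lin_ext g (h x)) v"
  by (simp add: lin_ext_def[of h] lin_ext_def[of "\<lambda>x. lin_ext g (h x)"] lin_ext_sum lin_ext_scale)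

lemma lin_ext_plus_fun: "lin_ext g v + lin_ext h v = lin_ext (\<lambda>x. g x + h x) v"
  by (rule poly_mapping_eqI)
    (simp add: lookup_add lookup_lin_ext[OF finite_keys subset_refl] sum.distrib algebra_simps)

lemma lin_ext_const_zero [simp]: "lin_ext (\<lambda>x. 0) v = 0"
  by (rule poly_mapping_eqI) (simp add: lookup_lin_ext[OF finite_keys subset_refl])

lemma lin_ext_id: "lin_ext (\<lambda>x. Poly_Mapping.single x 1) v = (v :: _ \<Rightarrow>\<^sub>0 'r::semiring_1)"
proof (rule poly_mapping_eqI)
  fix y
  show "Poly_Mapping.lookup (lin_ext (\<lambda>x. Poly_Mapping.single x 1) v) y = Poly_Mapping.lookup v y"
    unfolding lookup_lin_ext[OF finite_keys subset_refl]
    by (cases "y \<in> Poly_Mapping.keys v")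
      (auto simp: lookup_single when_def in_keys_iff sum.remove[of _ y] intro!: sum.neutral)
qed

lemma pm_scale_single [simp]: "pm_scale c (Poly_Mapping.single x d) = Poly_Mapping.single x (c * d)"
  by (rule poly_mapping_eqI) (simp add: lookup_single when_def)

lemma pm_scale_zero [simp]: "pm_scale c 0 = 0"
  by (rule poly_mapping_eqI) simp

definition free_space :: "'x set \<Rightarrow> (complex, 'x \<Rightarrow>\<^sub>0 complex) module" where
  "free_space X =
    \<lparr>carrier = {v. Poly_Mapping.keys v \<subseteq> X}, mult = undefined, one = undefined, zero = 0,
     add = (+), smult = pm_scale\<rparr>"

definition tensor_rels ::
    "(complex, 'a, 'x) module_scheme \<Rightarrow> (complex, 'b, 'y) module_scheme \<Rightarrow>
     (('a \<times> 'b) \<Rightarrow>\<^sub>0 complex) set" where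
  "tensor_rels M N =
    {Poly_Mapping.single (a \<oplus>\<^bsub>M\<^esub> a', w) 1 - Poly_Mapping.single (a, w) 1
       - Poly_Mapping.single (a', w) 1 | a a' w.
       a \<in> carrier M \<and> a' \<in> carrier M \<and> w \<in> carrier N} \<union>
    {Poly_Mapping.single (a, w \<oplus>\<^bsub>N\<^esub> w') 1 - Poly_Mapping.single (a, w) 1
       - Poly_Mapping.single (a, w') 1 | a w w'.
       a \<in> carrier M \<and> w \<in> carrier N \<and> w' \<in> carrier N} \<union>
    {Poly_Mapping.single (c \<odot>\<^bsub>M\<^esub> a, w) 1 - Poly_Mapping.single (a, w) c | c a w.
       a \<in> carrier M \<and> w \<in> carrier N} \<union>
    {Poly_Mapping.single (a, c \<odot>\<^bsub>N\<^esub> w) 1 - Poly_Mapping.single (a, w) c | c a w.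
       a \<in> carrier M \<and> w \<in> carrier N}"

definition tensor_null ::
    "(complex, 'a, 'x) module_scheme \<Rightarrow> (complex, 'b, 'y) module_scheme \<Rightarrow>
     (('a \<times> 'b) \<Rightarrow>\<^sub>0 complex) set" where
  "tensor_null M N =
    \<Inter>{S. submodule S complex_ring (free_space (carrier M \<times> carrier N)) \<and> tensor_rels M N \<subseteq> S}"

text \<open>\<open>D \<otimes>\<^sub>\<complex> W\<close> as a module over the complex algebra \<open>D\<close>, which acts on the left factor.\<close>

definition ext_scalars ::
    "(complex, 'a) module \<Rightarrow> (complex, 'b, 'y) module_scheme \<Rightarrow>
     ('a, (('a \<times> 'b) \<Rightarrow>\<^sub>0 complex) set) module" where
  "ext_scalars D W =
    (let F = free_space (carrier D \<times> carrier W); N = tensor_null D W in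
     \<lparr>carrier = a_rcosets\<^bsub>F\<^esub> N, mult = undefined, one = undefined, zero = N, add = set_add F,
      smult = (\<lambda>d X. \<Union>f\<in>X.
        N +>\<^bsub>F\<^esub> lin_ext (\<lambda>(a, w). Poly_Mapping.single (d \<otimes>\<^bsub>D\<^esub> a, w) 1) f)\<rparr>)"


section \<open>Bosonic side\<close>

text \<open>Laurent polynomials in \<open>q\<close> form the group algebra of the integers. In a polynomial in the
  \<open>b\<^sub>n\<close>, \<open>n < 0\<close>, the variable with index \<open>k :: nat\<close> is \<open>b\<^bsub>-(k+1)\<^esub>\<close>.
  A vector \<open>P e\<^bsup>\<Lambda>\<^sub>1 + m \<alpha>\<^sub>1\<^esup>\<close> is represented by \<open>P\<close> alone; operators take the
  index \<open>m\<close> of their source as an argument.\<close>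

type_synonym laurent = "int \<Rightarrow>\<^sub>0 complex"
type_synonym 'r bpoly = "(nat \<Rightarrow>\<^sub>0 nat) \<Rightarrow>\<^sub>0 'r"

definition q_pow :: "int \<Rightarrow> laurent" where
  "q_pow k = Poly_Mapping.single k 1"

definition cnst :: "complex \<Rightarrow> laurent" where
  "cnst c = Poly_Mapping.single 0 c"

definition b_var :: "nat \<Rightarrow> 'r::{zero_neq_one} bpoly" where
  "b_var n = Poly_Mapping.single (Poly_Mapping.single (n - 1) 1) 1"

definition b_diff :: "nat \<Rightarrow> 'r::semiring_1 bpoly \<Rightarrow> 'r bpoly" where
  "b_diff n = lin_ext (\<lambda>\<mu>. Poly_Mapping.single (\<mu> - Poly_Mapping.single (n - 1) 1)
                            (of_nat (Poly_Mapping.lookup \<mu> (n - 1))))"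

text \<open>The action of \<open>b\<^sub>n\<close>, \<open>n \<noteq> 0\<close>.\<close>

definition b_op :: "int \<Rightarrow> laurent bpoly \<Rightarrow> laurent bpoly" where
  "b_op n P =
    (if n < 0 then b_var (nat (- n)) * P
     else pm_scale (of_int n * (q_pow n + q_pow (- n))) (b_diff (nat n) P))"

text \<open>For commuting operators \<open>c 1, c 2, \<dots>\<close>, the coefficient of \<open>t\<^sup>N\<close> in
  \<open>(\<Sum>n\<ge>1. c n t\<^sup>n)\<^sup>k\<close> and in \<open>exp (\<Sum>n\<ge>1. c n t\<^sup>n)\<close>.\<close>

primrec series_pow_coeff ::
    "(nat \<Rightarrow> 'v \<Rightarrow> 'v) \<Rightarrow> nat \<Rightarrow> nat \<Rightarrow> 'v \<Rightarrow> 'v::comm_monoid_add" where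
  "series_pow_coeff c 0 N v = (if N = 0 then v else 0)"
| "series_pow_coeff c (Suc k) N v = (\<Sum>n=1..N. c n (series_pow_coeff c k (N - n) v))"

definition series_exp_coeff ::
    "(nat \<Rightarrow> laurent bpoly \<Rightarrow> laurent bpoly) \<Rightarrow> nat \<Rightarrow> laurent bpoly \<Rightarrow> laurent bpoly" where
  "series_exp_coeff c N v = (\<Sum>k\<le>N. pm_scale (cnst (1 / fact k)) (series_pow_coeff c k N v))"

text \<open>\<open>E_minus k\<close> is the coefficient of \<open>z\<^sup>k\<close> in the first exponential of the vertex operator,
  \<open>E_plus j\<close> that of \<open>z\<^bsup>-j\<^esup>\<close> in the second.\<close>

definition E_minus :: "nat \<Rightarrow> laurent bpoly \<Rightarrow> laurent bpoly" where
  "E_minus = series_exp_coeff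
    (\<lambda>n P. pm_scale (cnst (- (1 / of_nat n)) * q_pow (int n)) (b_op (- int n) P))"

definition E_plus :: "nat \<Rightarrow> laurent bpoly \<Rightarrow> laurent bpoly" where
  "E_plus = series_exp_coeff (\<lambda>n P. pm_scale (cnst (1 / of_nat n)) (b_op (int n) P))"

text \<open>The operator \<open>x\<^sub>n\<^sup>-\<close> from the summand \<open>2m+1\<close> to the summand \<open>2m-1\<close>, i.e. the coefficient of
  \<open>z\<^bsup>-n-1\<^esup>\<close>, where \<open>z\<^bsup>-\<partial>\<^esup>\<close> contributes \<open>z\<^bsup>-(2m+1)\<^esup>\<close>. On each vector all but finitely many
  \<open>E_plus j\<close> vanish.\<close>

definition x_minus :: "int \<Rightarrow> int \<Rightarrow> laurent bpoly \<Rightarrow> laurent bpoly" where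
  "x_minus n m P = Sum_any (\<lambda>j::nat.
     let k = int j + (2 * m + 1) - n - 1
     in if k \<ge> 0 then E_minus (nat k) (E_plus j P) else 0)"

text \<open>The divided power \<open>(x\<^sub>0\<^sup>-)\<^sup>2 / (q + q\<^sup>-\<^sup>1)\<close> on the lattice, which has no torsion.\<close>

definition x_minus_div2 :: "int \<Rightarrow> laurent bpoly \<Rightarrow> laurent bpoly" where
  "x_minus_div2 m P =
    (THE Q. pm_scale (q_pow 1 + q_pow (- 1)) Q = x_minus 0 (m - 1) (x_minus 0 m P))"

lemma x_minus_div2_unique:
  assumes "pm_scale (q_pow 1 + q_pow (- 1)) Q = x_minus 0 (m - 1) (x_minus 0 m P)"
  shows "x_minus_div2 m P = Q"
  unfolding x_minus_div2_def
proof (rule the_equality)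
  fix Q' assume "pm_scale (q_pow 1 + q_pow (- 1)) Q' = x_minus 0 (m - 1) (x_minus 0 m P)"
  then have eq: "pm_scale (q_pow 1 + q_pow (- 1)) Q' = pm_scale (q_pow 1 + q_pow (- 1)) Q"
    using assms by simp
  have "Poly_Mapping.lookup (q_pow 1 + q_pow (- 1)) 1 \<noteq> Poly_Mapping.lookup 0 1"
    by (simp add: q_pow_def lookup_add lookup_single)
  then have "q_pow 1 + q_pow (- 1) \<noteq> 0" by metis
  then show "Q' = Q"
    using eq by (metis lookup_pm_scale mult_left_cancel poly_mapping_eqI)
qed (fact assms)

subsection \<open>Specialization at \<open>q = \<i>\<close>\<close>

definition laurent_eval :: "complex \<Rightarrow> laurent \<Rightarrow> complex" where
  "laurent_eval z a = (\<Sum>k\<in>Poly_Mapping.keys a. Poly_Mapping.lookup a k * z powi k)"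

text \<open>The reduction map from the lattice to its quotient by \<open>q - \<i>\<close>, a section of it, and the
  induced operators on the quotient.\<close>

definition spec :: "laurent bpoly \<Rightarrow> complex bpoly" where
  "spec P = Poly_Mapping.map (laurent_eval \<i>) P"

definition lift_const :: "complex bpoly \<Rightarrow> laurent bpoly" where
  "lift_const P = Poly_Mapping.map cnst P"

definition spec_op :: "(laurent bpoly \<Rightarrow> laurent bpoly) \<Rightarrow> complex bpoly \<Rightarrow> complex bpoly" where
  "spec_op T P = spec (T (lift_const P))"

definition x0 :: "int \<Rightarrow> complex bpoly \<Rightarrow> complex bpoly" where
  "x0 m = spec_op (x_minus 0 m)"

definition x0_div2 :: "int \<Rightarrow> complex bpoly \<Rightarrow> complex bpoly" where
  "x0_div2 m = spec_op (x_minus_div2 m)"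

subsection \<open>The modules \<open>A\<^bsub>2m+1\<^esub>\<close>\<close>

text \<open>The complex algebra generated by the \<open>b\<^bsub>-(k+1)\<^esub>\<close> with \<open>k + 1\<close> odd.\<close>

definition D_alg :: "(complex, complex bpoly) module" where
  "D_alg =
    \<lparr>carrier = {P. \<forall>\<mu>\<in>Poly_Mapping.keys P. \<forall>k\<in>Poly_Mapping.keys \<mu>. odd (k + 1)},
     mult = (*), one = 1, zero = 0, add = (+), smult = pm_scale\<rparr>"

definition V_over_D :: "(complex bpoly, complex bpoly) module" where
  "V_over_D = \<lparr>carrier = UNIV, mult = (*), one = 1, zero = 0, add = (+), smult = (*)\<rparr>"

definition V_over_C :: "(complex, complex bpoly) module" where
  "V_over_C = free_space UNIV"

definition A_rels :: "int \<Rightarrow> complex bpoly set" where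
  "A_rels m = {x0 (m + 1) P + x0_div2 (m + 2) Q | P Q. True}"

definition A_mod :: "int \<Rightarrow> (complex bpoly, complex bpoly set) module" where
  "A_mod m = quot_module V_over_D (A_rels m)"

definition b_deg :: "int \<Rightarrow> (nat \<Rightarrow>\<^sub>0 nat) \<Rightarrow> int" where
  "b_deg m \<mu> =
    (\<Sum>k\<in>Poly_Mapping.keys \<mu>. - (int k + 1) * int (Poly_Mapping.lookup \<mu> k)) - m\<^sup>2 - m"

definition V_deg :: "int \<Rightarrow> int \<Rightarrow> complex bpoly set" where
  "V_deg m d = {P. \<forall>\<mu>\<in>Poly_Mapping.keys P. b_deg m \<mu> = d}"

definition A_deg :: "int \<Rightarrow> int \<Rightarrow> (complex, complex bpoly set) module" where
  "A_deg m d = (quot_module V_over_C (A_rels m))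
     \<lparr>carrier := (\<lambda>P. A_rels m +>\<^bsub>V_over_C\<^esub> P) ` V_deg m d\<rparr>"

text \<open>The character of a graded space with finite-dimensional components that vanish in all large
  degrees, as a Laurent series in \<open>p\<close>.\<close>

definition ch :: "(int \<Rightarrow> (complex, 'a, 'x) module_scheme) \<Rightarrow> rat fls" where
  "ch V = Abs_fls (\<lambda>k. of_nat (vdim complex_ring (V (- k))))"


section \<open>Fermionic side\<close>

text \<open>Fock space has a basis indexed by finite sets of integers: \<open>F = {n\<^sub>1 < \<dots> < n\<^sub>r}\<close> stands for
  \<open>c n\<^sub>1 \<cdots> c n\<^sub>r |1\<rangle>\<close>, where the creation operator \<open>c n\<close> is \<open>\<psi>\<^bsub>2n+1\<^esub>\<close> for \<open>n \<le> 0\<close> and \<open>\<psi>\<^sup>*\<^bsub>2n+1\<^esub>\<close> for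
  \<open>n > 0\<close>. Below, \<open>psi n\<close> and \<open>psi_star n\<close> are \<open>\<psi>\<^bsub>2n+1\<^esub>\<close> and \<open>\<psi>\<^sup>*\<^bsub>2n+1\<^esub>\<close>.\<close>

type_synonym fock = "int fset \<Rightarrow>\<^sub>0 complex"

definition vacuum :: fock where
  "vacuum = Poly_Mapping.single {||} 1"

definition fsign :: "int \<Rightarrow> int fset \<Rightarrow> complex" where
  "fsign n F = (- 1) ^ card {k \<in> fset F. k < n}"

definition create :: "int \<Rightarrow> fock \<Rightarrow> fock" where
  "create n = lin_ext (\<lambda>F. if n |\<in>| F then 0 else Poly_Mapping.single (finsert n F) (fsign n F))"

definition annihilate :: "int \<Rightarrow> fock \<Rightarrow> fock" where
  "annihilate n =
    lin_ext (\<lambda>F. if n |\<in>| F then Poly_Mapping.single (F |-| {|n|}) (fsign n F) else 0)"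

definition psi :: "int \<Rightarrow> fock \<Rightarrow> fock" where
  "psi n = (if n \<le> 0 then create n else annihilate n)"

definition psi_star :: "int \<Rightarrow> fock \<Rightarrow> fock" where
  "psi_star n = (if n \<le> 0 then annihilate n else create n)"

lemma fsign_finsert:
  "n |\<notin>| F \<Longrightarrow> fsign l (finsert n F) = (if n < l then - fsign l F else fsign l F)"
proof -
  assume "n |\<notin>| F"
  have "{k \<in> fset (finsert n F). k < l} =
    (if n < l then insert n {k \<in> fset F. k < l} else {k \<in> fset F. k < l})" by auto
  then show ?thesis using \<open>n |\<notin>| F\<close> by (auto simp: fsign_def)
qed

lemma fsign_fminus:
  "n |\<in>| F \<Longrightarrow> fsign l (F |-| {|n|}) = (if n < l then - fsign l F else fsign l F)"
  using fsign_finsert[of n "F |-| {|n|}" l] by (auto simp: finsert_absorb split: if_splits)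

lemma fsign_square [simp]: "fsign l F * fsign l F = 1"
  by (simp add: fsign_def flip: power_mult_distrib)

lemma create_create: "create k (create l v) + create l (create k v) = 0"
  unfolding create_def lin_ext_lin_ext lin_ext_plus_fun
  apply (rule trans[OF _ lin_ext_const_zero])
  apply (rule arg_cong2[where f = lin_ext, OF ext refl])
  subgoal for F
    by (cases "k = l")
      (auto simp: lin_ext_single fsign_finsert finsert_commute mult.commute simp flip: single_add)
  done

lemma annihilate_annihilate: "annihilate k (annihilate l v) + annihilate l (annihilate k v) = 0"
  unfolding annihilate_def lin_ext_lin_ext lin_ext_plus_fun
  apply (rule trans[OF _ lin_ext_const_zero])
  apply (rule arg_cong2[where f = lin_ext, OF ext refl])
  subgoal for F
  proof (cases "k = l")
    case False
    have "F |-| {|k|} |-| {|l|} = F |-| {|l|} |-| {|k|}" by auto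
    then show ?thesis using False
      by (auto simp: lin_ext_single fsign_fminus mult.commute simp flip: single_add)
  qed (auto simp: lin_ext_single)
  done

lemma create_annihilate:
  "create k (annihilate l v) + annihilate l (create k v) = (if k = l then v else 0)"
proof -
  have "create k (annihilate l v) + annihilate l (create k v) =
     lin_ext (\<lambda>F. if k = l then Poly_Mapping.single F 1 else 0) v"
    unfolding create_def annihilate_def lin_ext_lin_ext lin_ext_plus_fun
    apply (rule arg_cong2[where f = lin_ext, OF ext refl])
    subgoal for F
    proof (cases "k = l")
      case True
      then show ?thesis
        by (auto simp: lin_ext_single fsign_fminus fsign_finsert finsert_absorb simp flip: single_add)
    next
      case False
      have "finsert k (F |-| {|l|}) = finsert k F |-| {|l|}" using False by auto
      then show ?thesis using False
        by (auto simp: lin_ext_single fsign_fminus fsign_finsert finsert_absorb mult.commute simp flip: single_add)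
    qed
    done
  also have "\<dots> = (if k = l then v else 0)" by (simp add: lin_ext_id)
  finally show ?thesis .
qed

text \<open>Canonical anticommutation relations, vacuum conditions, and the states as products.\<close>

lemma psi_psi: "psi k (psi l v) + psi l (psi k v) = 0"
  using create_create[of k l v] annihilate_annihilate[of k l v] create_annihilate[of k l v]
    create_annihilate[of l k v]
  by (auto simp: psi_def add.commute split: if_splits)

lemma psi_star_psi_star: "psi_star k (psi_star l v) + psi_star l (psi_star k v) = 0"
  using create_create[of k l v] annihilate_annihilate[of k l v] create_annihilate[of k l v]
    create_annihilate[of l k v]
  by (auto simp: psi_star_def add.commute split: if_splits)

lemma psi_psi_star: "psi k (psi_star l v) + psi_star l (psi k v) = (if k = l then v else 0)"
  using create_create[of k l v] annihilate_annihilate[of k l v] create_annihilate[of k l v]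
    create_annihilate[of l k v]
  by (auto simp: psi_def psi_star_def add.commute split: if_splits)

lemma psi_vacuum: "n > 0 \<Longrightarrow> psi n vacuum = 0"
  by (simp add: psi_def annihilate_def vacuum_def lin_ext_single)

lemma psi_star_vacuum: "n \<le> 0 \<Longrightarrow> psi_star n vacuum = 0"
  by (simp add: psi_star_def annihilate_def vacuum_def lin_ext_single)

lemma create_min:
  assumes "\<And>k. k |\<in>| F \<Longrightarrow> n < k"
  shows "create n (Poly_Mapping.single F 1) = Poly_Mapping.single (finsert n F) 1"
proof -
  have *: "{k \<in> fset F. k < n} = {}" "n |\<notin>| F" using assms by force+
  then have "fsign n F = 1" unfolding fsign_def by (metis card.empty power_0)
  then show ?thesis using * by (simp add: create_def lin_ext_single)
qed

lemma state_eq_product: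
  assumes "sorted_wrt (<) rs" "sorted_wrt (<) ss" "\<forall>r\<in>set rs. r \<le> 0" "\<forall>s\<in>set ss. s > 0"
  shows "foldr psi rs (foldr psi_star ss vacuum) = Poly_Mapping.single (fset_of_list (rs @ ss)) 1"
proof -
  have *: "foldr psi_star ss vacuum = Poly_Mapping.single (fset_of_list ss) 1"
    using assms(2,4)
  proof (induction ss)
    case (Cons s ss)
    then show ?case by (auto simp: psi_star_def fset_of_list_elem intro!: create_min)
  qed (simp add: vacuum_def)
  show ?thesis using assms(1,3)
  proof (induction rs)
    case (Cons r rs)
    then show ?case using assms(4) by (force simp: psi_def fset_of_list_elem intro!: create_min)
  qed (simp add: *)
qed

text \<open>With \<open>r\<close> ranging over the negative and \<open>s\<close> over the positive elements, \<open>0\<close> excluded.\<close>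

definition H_states :: "int \<Rightarrow> int fset set" where
  "H_states m = {F. 0 |\<notin>| F \<and>
     int (card {s \<in> fset F. s > 0}) = int (card {r \<in> fset F. r < 0}) + m}"

definition H_space :: "int \<Rightarrow> (complex, fock) module" where
  "H_space m = free_space (H_states m)"

definition omega :: "fock \<Rightarrow> fock" where
  "omega v = - Sum_any (\<lambda>n::nat. if n \<ge> 1 then psi (- int n) (psi (int n) v) else 0)"

definition W_space :: "int \<Rightarrow> (complex, fock set) module" where
  "W_space m = quot_module (H_space m) (omega ` carrier (H_space (m + 2)))"

end

theory Submission
  imports Defs
begin

text \<open>Let \<open>F = x\<^sub>0\<^sup>-\<close> and \<open>E = x\<^sub>0\<^sup>+\<close>, and let \<open>f\<close> and \<open>e\<close> be their divided squares. The quantum affine relations,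
  obtained from operator product expansions at generic \<open>q\<close>, specialize at \<open>q = \<i>\<close> to \<open>E\<^sup>2 = F\<^sup>2 = 0\<close>,
  \<open>E F - F E = (-1)\<^sup>m\<close> and \<open>e f - f e = (-1)\<^sup>m F E - m\<close> on the summand \<open>2m+1\<close>, while \<open>E\<close>, \<open>F\<close>, \<open>e\<close>, \<open>f\<close>
  become linear over the odd variables, because \<open>q\<^sup>n + q\<^bsup>-n\<^esup> = 0\<close> for odd \<open>n\<close>. Hence \<open>(-1)\<^sup>m E F\<close> is an idempotent
  onto \<open>ker E\<close>, where \<open>-e\<close> and \<open>f\<close> generate \<open>sl\<^sub>2\<close>; composed with the extremal projector of this \<open>sl\<^sub>2\<close> it is a
  homogeneous idempotent, linear over the odd variables, with kernel the space of relations, so that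
  its range is isomorphic to \<open>A\<^bsub>2m+1\<^esub>\<close>. A unipotent operator conjugates it into the extension of its reduction modulo the
  odd variables, so its range is free, of countably infinite rank like \<open>\<D> \<otimes> W\<close>. The map \<open>F + f E\<close> from the
  summand \<open>2m+3\<close> is injective onto the relations, so the character is a difference of two characters of
  polynomial rings.\<close>

text \<open>The divided squares are of the form 0/0 at q = i, because q + q^{-1} vanishes there.
  They are therefore computed on the lattice, where q + q^{-1} can be cancelled, and a relation is
  specialized only once it is free of that denominator. For m \<ge> 0 the extremal projector is
  available: e strictly lowers the weight, so the series is a finite sum on each vector, and the
  Cartan element acts by m, so the denominators are nonzero. Linearity over the odd variables alone
  would only make the range of the idempotent projective. Freeness comes from homogeneity: the odd
  weight is bounded by the total weight, so the unipotent conjugation can be inverted. No explicit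
  map to the fermionic side is built; the two modules are compared through their common rank. That
  this rank is infinite on the bosonic side needs a count of monomials in the even variables. The
  map F + f E arises from the splitting into ker E and ker F, a consequence of E F - F E being a
  sign: F is injective on ker E, and f E on ker F.\<close>

abbreviation sgl :: "'x \<Rightarrow> 'r::zero \<Rightarrow> 'x \<Rightarrow>\<^sub>0 'r" where
  "sgl \<equiv> Poly_Mapping.single"

abbreviation coef :: "('x \<Rightarrow>\<^sub>0 'r::zero) \<Rightarrow> 'x \<Rightarrow> 'r" where
  "coef \<equiv> Poly_Mapping.lookup"

abbreviation supp :: "('x \<Rightarrow>\<^sub>0 'r::zero) \<Rightarrow> 'x set" where
  "supp \<equiv> Poly_Mapping.keys"

abbreviation scal :: "'r \<Rightarrow> 'r::zero bpoly" where
  "scal \<equiv> sgl 0"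

lemma pm_scale_eq_mult: "pm_scale c (v::'r::comm_ring_1 bpoly) = scal c * v"
  by (simp add: pm_scale_def mult_map_scale_conv_mult)

lemma scal_add: "scal (c + d) = scal c + scal (d::'r::comm_ring_1)"
  by (simp add: single_add)

lemma scal_mult: "scal (c * d) = scal c * scal (d::'r::comm_ring_1)"
  by (simp add: mult_single)

lemma scal_uminus: "scal (- c) = - scal (c::'r::comm_ring_1)"
  by (simp add: single_uminus)

lemma scal_sum: "scal (\<Sum>i\<in>I. f i) = (\<Sum>i\<in>I. scal (f i :: 'r::comm_ring_1))"
  by (induction I rule: infinite_finite_induct) (simp_all add: scal_add)

section \<open>Operators linear over the coefficients, tested on monomials\<close>

definition lin :: "('r::comm_ring_1 bpoly \<Rightarrow> 'r bpoly) \<Rightarrow> bool" where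
  "lin T \<longleftrightarrow> (\<forall>P Q. T (P + Q) = T P + T Q) \<and> (\<forall>c P. T (scal c * P) = scal c * T P)"

lemma linI:
  "(\<And>P Q. T (P + Q) = T P + T Q) \<Longrightarrow> (\<And>c P. T (scal c * P) = scal c * T P) \<Longrightarrow> lin T"
  by (simp add: lin_def)

lemma lin_add: "lin T \<Longrightarrow> T (P + Q) = T P + T Q"
  and lin_scal: "lin T \<Longrightarrow> T (scal c * P) = scal c * T P"
  by (simp_all add: lin_def)

lemma lin_zero: "lin T \<Longrightarrow> T 0 = 0"
  using lin_add[of T 0 0] by simp

lemma lin_uminus: "lin T \<Longrightarrow> T (- P) = - T P"
  using lin_add[of T P "- P"] lin_zero[of T] by (simp add: eq_neg_iff_add_eq_0 add.commute)

lemma lin_diff: "lin T \<Longrightarrow> T (P - Q) = T P - T Q"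
  using lin_add[of T P "- Q"] lin_uminus[of T Q] by simp

lemma lin_sum: "lin T \<Longrightarrow> T (\<Sum>i\<in>I. f i) = (\<Sum>i\<in>I. T (f i))"
  by (induction I rule: infinite_finite_induct) (simp_all add: lin_add lin_zero)

lemma lin_of_nat: "lin T \<Longrightarrow> T (of_nat n * P) = of_nat n * T P"
  using lin_scal[of T "of_nat n" P] by simp

lemma lin_id: "lin (\<lambda>P. P)"
  by (simp add: lin_def)

lemma lin_zero_fun: "lin (\<lambda>P. 0)"
  by (simp add: lin_def)

lemma lin_mult: "lin T \<Longrightarrow> lin (\<lambda>P. X * T P)"
  by (simp add: lin_def algebra_simps)

lemma lin_mult_right: "lin T \<Longrightarrow> lin (\<lambda>P. T P * X)"
  by (simp add: lin_def algebra_simps)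

lemma lin_plus: "lin T \<Longrightarrow> lin U \<Longrightarrow> lin (\<lambda>P. T P + U P)"
  by (simp add: lin_def algebra_simps)

lemma lin_comp: "lin T \<Longrightarrow> lin U \<Longrightarrow> lin (\<lambda>P. T (U P))"
  by (simp add: lin_def)

lemma lin_setsum: "(\<And>i. i \<in> I \<Longrightarrow> lin (T i)) \<Longrightarrow> lin (\<lambda>P. \<Sum>i\<in>I. T i P)"
  by (induction I rule: infinite_finite_induct) (simp_all add: lin_zero_fun lin_plus)

lemma bpoly_expand: "P = (\<Sum>\<mu>\<in>supp P. scal (coef P \<mu>) * sgl \<mu> (1::'r::comm_ring_1))"
  by (rule poly_mapping_eqI)
    (auto simp: mult_single lookup_sum lookup_single when_def in_keys_iff sum.delta')

lemma lin_expand: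
  assumes "lin T" shows "T P = (\<Sum>\<mu>\<in>supp P. scal (coef P \<mu>) * T (sgl \<mu> 1))"
  using arg_cong[OF bpoly_expand[of P], of T] by (simp only: lin_sum[OF assms] lin_scal[OF assms])

lemma lin_eqI:
  assumes "lin T" "lin U" "\<And>\<mu>. T (sgl \<mu> 1) = U (sgl \<mu> 1)" shows "T P = U P"
  using lin_expand[OF assms(1), of P] lin_expand[OF assms(2), of P] by (simp only: assms(3))

lemma lin_eqI2:
  assumes "\<And>Q. lin (\<lambda>P. T P Q)" "\<And>Q. lin (\<lambda>P. U P Q)" "\<And>P. lin (T P)" "\<And>P. lin (U P)"
    and "\<And>\<mu> \<nu>. T (sgl \<mu> 1) (sgl \<nu> 1) = U (sgl \<mu> 1) (sgl \<nu> 1)"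
  shows "T P Q = U P Q"
  by (rule lin_eqI[OF assms(1,2)], rule lin_eqI[OF assms(3,4)], rule assms(5))

section \<open>Derivations\<close>

lemma lin_b_diff: "lin (b_diff n)"
  by (rule linI) (simp_all add: b_diff_def lin_ext_add lin_ext_scale flip: pm_scale_eq_mult)

lemma b_diff_mon:
  "b_diff n (sgl \<mu> c) =
    sgl (\<mu> - sgl (n - 1) 1) (c * of_nat (coef \<mu> (n - 1)) :: 'r::comm_ring_1)"
  by (simp add: b_diff_def lin_ext_single)

text \<open>Subtraction of exponents is truncated at 0, so it commutes with adding \<nu> only where
  the variable occurs in \<mu>.\<close>

lemma exponent_diff_assoc:
  fixes \<mu> \<nu> :: "nat \<Rightarrow>\<^sub>0 nat"
  assumes "coef \<mu> k \<noteq> 0"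
  shows "(\<mu> + \<nu>) - sgl k 1 = (\<mu> - sgl k 1) + \<nu>"
  by (rule poly_mapping_eqI) (use assms in \<open>auto simp: lookup_add lookup_minus lookup_single when_def\<close>)

lemma b_diff_mult: "b_diff n (P * Q) = b_diff n P * Q + P * b_diff n (Q::'r::comm_ring_1 bpoly)"
proof (rule lin_eqI2[where T = "\<lambda>P Q. b_diff n (P * Q)"
      and U = "\<lambda>P Q. b_diff n P * Q + P * b_diff n Q"])
  fix \<mu> \<nu> :: "nat \<Rightarrow>\<^sub>0 nat"
  let ?k = "n - 1"
  \<comment> \<open>Where the truncated difference is wrong, the coefficient of the monomial is 0
    and both sides vanish.\<close>
  have 1: "sgl (\<mu> + \<nu> - sgl ?k 1) (of_nat (coef \<mu> ?k)) =
      sgl (\<mu> - sgl ?k 1 + \<nu>) (of_nat (coef \<mu> ?k) :: 'r)"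
    by (cases "coef \<mu> ?k = 0") (simp_all add: exponent_diff_assoc del: One_nat_def)
  have 2: "sgl (\<mu> + \<nu> - sgl ?k 1) (of_nat (coef \<nu> ?k)) =
      sgl (\<mu> + (\<nu> - sgl ?k 1)) (of_nat (coef \<nu> ?k) :: 'r)"
    by (cases "coef \<nu> ?k = 0")
      (simp_all add: exponent_diff_assoc add.commute[of \<mu>] del: One_nat_def)
  show "b_diff n (sgl \<mu> 1 * sgl \<nu> 1) =
      b_diff n (sgl \<mu> 1) * sgl \<nu> 1 + sgl \<mu> 1 * b_diff n (sgl \<nu> (1::'r))"
    by (simp add: mult_single b_diff_mon lookup_add single_add 1 2 del: One_nat_def)
qed (intro lin_plus lin_mult lin_mult_right lin_comp[OF lin_b_diff] lin_id lin_b_diff)+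

lemma b_diff_commute: "b_diff n (b_diff k P) = b_diff k (b_diff n (P::'r::comm_ring_1 bpoly))"
proof (rule lin_eqI[where T = "\<lambda>P. b_diff n (b_diff k P)" and U = "\<lambda>P. b_diff k (b_diff n P)"])
  fix \<mu> :: "nat \<Rightarrow>\<^sub>0 nat"
  show "b_diff n (b_diff k (sgl \<mu> 1)) = b_diff k (b_diff n (sgl \<mu> (1::'r)))"
  \<comment> \<open>The index enters as \<open>n - 1\<close>, so \<open>b_diff 0\<close> and
    \<open>b_diff 1\<close> coincide; the case split has to be on the shifted indices.\<close>
  proof (cases "n - 1 = k - 1")
    case True
    then have "b_diff n = (b_diff k :: 'r bpoly \<Rightarrow> _)" unfolding b_diff_def by (simp only:)
    then show ?thesis by simp
  next
    case False
    have e: "\<mu> - sgl (k - 1) 1 - sgl (n - 1) 1 = \<mu> - sgl (n - 1) 1 - sgl (k - 1) (1::nat)"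
      by (rule poly_mapping_eqI) (simp add: lookup_minus)
    have c: "coef (\<mu> - sgl (k - 1) 1) (n - 1) = coef \<mu> (n - 1)"
      "coef (\<mu> - sgl (n - 1) 1) (k - 1) = coef \<mu> (k - 1)"
      using False by (simp_all only: lookup_minus lookup_single when_def) simp_all
    show ?thesis
      by (simp only: b_diff_mon c mult_1_left e mult.commute[of "of_nat (coef \<mu> (k - 1))"])
  qed
qed (rule lin_comp[OF lin_b_diff lin_b_diff])+

lemma b_diff_b_var:
  "n \<ge> 1 \<Longrightarrow> k \<ge> 1 \<Longrightarrow> b_diff n (b_var k) = (if n = k then 1 else 0 :: 'r::comm_ring_1 bpoly)"
  by (auto simp: b_var_def b_diff_mon lookup_single when_def)

section \<open>Exponentials of commuting operators\<close>

lemma sum_triangle_swap: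
  fixes N :: nat
  shows "(\<Sum>n=1..N. \<Sum>l=1..N-n. g n l) = (\<Sum>l=1..N. \<Sum>n=1..N-l. (g n l :: 'a::comm_monoid_add))"
proof -
  have "(\<Sum>n=1..N. \<Sum>l=1..N-n. g n l) = (\<Sum>n\<in>{1..N}. \<Sum>l\<in>{l\<in>{1..N}. n + l \<le> N}. g n l)"
    by (intro sum.cong) auto
  also have "\<dots> = (\<Sum>l\<in>{1..N}. \<Sum>n\<in>{n\<in>{1..N}. n + l \<le> N}. g n l)"
    by (rule sum.swap_restrict) auto
  also have "\<dots> = (\<Sum>l=1..N. \<Sum>n=1..N-l. g n l)"
    by (intro sum.cong) auto
  finally show ?thesis .
qed

context
  fixes c :: "nat \<Rightarrow> laurent bpoly \<Rightarrow> laurent bpoly"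
  assumes lin_c: "\<And>n. lin (c n)" and comm_c: "\<And>n l v. c n (c l v) = c l (c n v)"
begin

lemma lin_series_pow_coeff: "lin (series_pow_coeff c k N)"
proof (induction k arbitrary: N)
  case 0
  show ?case by (cases "N = 0") (simp_all add: lin_def)
next
  case (Suc k)
  show ?case
    unfolding series_pow_coeff.simps by (intro lin_setsum lin_comp[OF lin_c Suc])
qed

lemma lin_series_exp_coeff: "lin (series_exp_coeff c N)"
  unfolding series_exp_coeff_def pm_scale_eq_mult
  by (intro lin_setsum lin_mult lin_series_pow_coeff)

text \<open>This is t d/dt C^(k+1) = (k+1) (t dC/dt) C^k for C = \<Sum> c n t^n, read off at t^N.
  Commutation of the \<open>c n\<close> is what lets the derivative be collected in front.\<close>

lemma series_pow_coeff_newton: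
  "of_nat N * series_pow_coeff c (Suc k) N v =
     of_nat (Suc k) * (\<Sum>n=1..N. of_nat n * c n (series_pow_coeff c k (N - n) v))"
proof (induction k arbitrary: N)
  case 0
  have *: "of_nat N * c n (if N - n = 0 then v else 0) = of_nat n * c n (if N - n = 0 then v else 0)"
    if "n \<in> {1..N}" for n
    using that by (cases "n = N") (simp_all add: lin_zero[OF lin_c])
  have "of_nat N * (\<Sum>n=1..N. c n (if N - n = 0 then v else 0)) =
      (\<Sum>n=1..N. of_nat n * c n (if N - n = 0 then v else 0))"
    unfolding sum_distrib_left by (intro sum.cong refl *)
  then show ?case by simp
next
  case (Suc k)
  let ?p = "series_pow_coeff c"
  have "of_nat N * ?p (Suc (Suc k)) N v =
      (\<Sum>n=1..N. of_nat n * c n (?p (Suc k) (N - n) v)) +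
      (\<Sum>n=1..N. c n (of_nat (N - n) * ?p (Suc k) (N - n) v))"
    unfolding series_pow_coeff.simps(2)[of c "Suc k"] sum_distrib_left sum.distrib[symmetric]
  proof (intro sum.cong refl)
    fix n assume "n \<in> {1..N}"
    then have N: "(of_nat N :: laurent bpoly) = of_nat n + of_nat (N - n)"
      by (metis atLeastAtMost_iff le_add_diff_inverse of_nat_add)
    show "of_nat N * c n (?p (Suc k) (N - n) v) = of_nat n * c n (?p (Suc k) (N - n) v) +
        c n (of_nat (N - n) * ?p (Suc k) (N - n) v)"
      by (simp only: N lin_of_nat[OF lin_c] distrib_right)
  qed
  also have "(\<Sum>n=1..N. c n (of_nat (N - n) * ?p (Suc k) (N - n) v)) =
      of_nat (Suc k) * (\<Sum>n=1..N. \<Sum>l=1..N-n. of_nat l * c n (c l (?p k (N - n - l) v)))"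
    unfolding Suc lin_of_nat[OF lin_c] lin_sum[OF lin_c] sum_distrib_left ..
  also have "(\<Sum>n=1..N. \<Sum>l=1..N-n. of_nat l * c n (c l (?p k (N - n - l) v))) =
      (\<Sum>l=1..N. \<Sum>n=1..N-l. of_nat l * c l (c n (?p k (N - l - n) v)))"
    by (subst sum_triangle_swap, subst comm_c, intro sum.cong refl) (simp add: add.commute)
  also have "\<dots> = (\<Sum>l=1..N. of_nat l * c l (?p (Suc k) (N - l) v))"
    by (simp add: lin_sum[OF lin_c] sum_distrib_left)
  finally show ?case by (simp add: algebra_simps)
qed

lemma series_pow_coeff_eq_0: "k > N \<Longrightarrow> series_pow_coeff c k N v = 0"
proof (induction k arbitrary: N)
  case (Suc k)
  then show ?case by (auto intro!: sum.neutral simp: lin_zero[OF lin_c])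
qed simp

lemma series_exp_coeff_0: "series_exp_coeff c 0 v = v"
  by (simp add: series_exp_coeff_def pm_scale_eq_mult cnst_def)

text \<open>This is t d/dt exp C = (t dC/dt) exp C, obtained from the powers with weights 1/k!. From
  here on exponentials are handled through this recursion, which determines every coefficient from
  the 0th one because N can be cancelled in characteristic 0.\<close>

lemma series_exp_coeff_newton:
  "of_nat N * series_exp_coeff c N v = (\<Sum>n=1..N. of_nat n * c n (series_exp_coeff c (N - n) v))"
proof (cases N)
  case (Suc M)
  let ?p = "series_pow_coeff c" and ?f = "\<lambda>k. scal (cnst (1 / fact k)) :: laurent bpoly"
  have f: "?f (Suc k) * of_nat (Suc k) = ?f k" for k
  proof -
    have 1: "(of_nat (Suc k) :: laurent bpoly) = scal (cnst (of_nat (Suc k)))"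
      by (simp only: cnst_def single_of_nat)
    have "cnst (1 / fact (Suc k)) * cnst (of_nat (Suc k)) = cnst (1 / fact k)"
      unfolding cnst_def mult_single by (simp add: field_simps del: of_nat_Suc)
    then show ?thesis unfolding 1 scal_mult[symmetric] by simp
  qed
  have "of_nat N * series_exp_coeff c N v = (\<Sum>k\<le>N. ?f k * (of_nat N * ?p k N v))"
    by (simp add: series_exp_coeff_def pm_scale_eq_mult sum_distrib_left algebra_simps)
  also have "\<dots> = (\<Sum>k\<le>M. ?f (Suc k) * (of_nat N * ?p (Suc k) N v))"
    unfolding Suc sum.atMost_Suc_shift by simp
  also have "\<dots> = (\<Sum>k\<le>M. ?f k * (\<Sum>n=1..N. of_nat n * c n (?p k (N - n) v)))"
    unfolding series_pow_coeff_newton mult.assoc[symmetric] f ..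
  also have "\<dots> = (\<Sum>n=1..N. of_nat n * c n (\<Sum>k\<le>M. ?f k * ?p k (N - n) v))"
    unfolding lin_sum[OF lin_c] lin_scal[OF lin_c] sum_distrib_left
    by (subst sum.swap) (simp only: mult.left_commute)
  also have "\<dots> = (\<Sum>n=1..N. of_nat n * c n (series_exp_coeff c (N - n) v))"
  proof (intro sum.cong refl)
    fix n assume n: "n \<in> {1..N}"
    have "(\<Sum>k\<le>M. ?f k * ?p k (N - n) v) = (\<Sum>k\<le>N - n. ?f k * ?p k (N - n) v)"
      by (rule sum.mono_neutral_right) (use n Suc in \<open>auto simp: series_pow_coeff_eq_0\<close>)
    then show "of_nat n * c n (\<Sum>k\<le>M. ?f k * ?p k (N - n) v) =
        of_nat n * c n (series_exp_coeff c (N - n) v)"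
      by (simp add: series_exp_coeff_def pm_scale_eq_mult)
  qed
  finally show ?thesis .
qed simp

end

section \<open>Exponentials of multiplications and of derivations\<close>

lemma of_nat_mult_cancel:
  "n \<noteq> 0 \<Longrightarrow> of_nat n * x = of_nat n * y \<Longrightarrow> x = (y :: 'r::{idom,ring_char_0} bpoly)"
  by simp

text \<open>The coefficient of t^k in exp(\<Sum> \<alpha> n b_{-n} t^n / n). A multiplication
  operator is determined by its value at 1, so it is stored as a polynomial.\<close>

definition exp_mult :: "(nat \<Rightarrow> laurent) \<Rightarrow> nat \<Rightarrow> laurent bpoly" where
  "exp_mult \<alpha> k =
    series_exp_coeff (\<lambda>n P. scal (cnst (1 / of_nat n) * \<alpha> n) * (b_var n * P)) k 1"

text \<open>The coefficient of t^j in exp(\<Sum> \<beta> n \<partial>_n t^n) with \<partial>_n =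
  \<open>b_diff n\<close>. There is no 1/n, because it cancels against the factor n in the action of
  b_n.\<close>

definition exp_diff :: "(nat \<Rightarrow> laurent) \<Rightarrow> nat \<Rightarrow> laurent bpoly \<Rightarrow> laurent bpoly" where
  "exp_diff \<beta> = series_exp_coeff (\<lambda>n P. scal (\<beta> n) * b_diff n P)"

lemma exp_mult_general:
  "series_exp_coeff (\<lambda>n P. scal (cnst (1 / of_nat n) * \<alpha> n) * (b_var n * P)) k P = exp_mult \<alpha> k * P"
proof -
  let ?c = "\<lambda>n P. scal (cnst (1 / of_nat n) * \<alpha> n) * (b_var n * P)"
  have "series_pow_coeff ?c j N P = series_pow_coeff ?c j N 1 * P" for j N
    by (induction j arbitrary: N) (simp_all add: sum_distrib_right mult.assoc)
  then show ?thesis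
    unfolding exp_mult_def series_exp_coeff_def sum_distrib_right pm_scale_eq_mult mult.assoc
    by (intro sum.cong refl arg_cong2[where f = "(*)"])
qed

lemma cnst_of_nat_inverse: "n \<noteq> 0 \<Longrightarrow> of_nat n * scal (cnst (1 / of_nat n) * a) = scal a"
proof -
  assume "n \<noteq> 0"
  then have "cnst (of_nat n) * cnst (1 / of_nat n) = 1"
    unfolding cnst_def mult_single by simp
  moreover have "(of_nat n :: laurent bpoly) = scal (cnst (of_nat n))"
    by (simp only: cnst_def single_of_nat)
  ultimately show ?thesis by (simp add: mult.assoc[symmetric] flip: scal_mult)
qed

lemma exp_mult_0 [simp]: "exp_mult \<alpha> 0 = 1"
  unfolding exp_mult_def
  by (rule series_exp_coeff_0) (auto simp: algebra_simps intro!: linI)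

lemma exp_mult_newton:
  "of_nat k * exp_mult \<alpha> k = (\<Sum>n=1..k. scal (\<alpha> n) * (b_var n * exp_mult \<alpha> (k - n)))"
proof -
  have "of_nat k * exp_mult \<alpha> k =
      (\<Sum>n=1..k. of_nat n * (scal (cnst (1 / of_nat n) * \<alpha> n) * (b_var n * exp_mult \<alpha> (k - n))))"
    unfolding exp_mult_def
    by (rule series_exp_coeff_newton) (auto simp: algebra_simps intro!: linI)
  also have "\<dots> = (\<Sum>n=1..k. scal (\<alpha> n) * (b_var n * exp_mult \<alpha> (k - n)))"
    by (intro sum.cong refl) (simp add: cnst_of_nat_inverse flip: mult.assoc)
  finally show ?thesis .
qed

lemma lin_exp_diff: "lin (exp_diff \<beta> j)"
  unfolding exp_diff_def
  by (rule lin_series_exp_coeff)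
    (simp_all add: lin_mult lin_b_diff lin_scal[OF lin_b_diff] b_diff_commute mult.left_commute)

lemma exp_diff_0 [simp]: "exp_diff \<beta> 0 P = P"
  unfolding exp_diff_def
  by (rule series_exp_coeff_0)
    (simp_all add: lin_mult lin_b_diff lin_scal[OF lin_b_diff] b_diff_commute mult.left_commute)

lemma exp_diff_newton:
  "of_nat j * exp_diff \<beta> j P =
    (\<Sum>n=1..j. of_nat n * (scal (\<beta> n) * b_diff n (exp_diff \<beta> (j - n) P)))"
  unfolding exp_diff_def
  by (rule series_exp_coeff_newton)
    (simp_all add: lin_mult lin_b_diff lin_scal[OF lin_b_diff] b_diff_commute mult.left_commute)

lemma exp_diff_commute_lin:
  assumes "lin U" "\<And>n P. b_diff n (U P) = U (b_diff n P)"
  shows "exp_diff \<beta> j (U P) = U (exp_diff \<beta> j P)"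
proof (induction j arbitrary: P rule: less_induct)
  case (less j)
  show ?case
  proof (cases "j = 0")
    case False
    have "of_nat j * exp_diff \<beta> j (U P) =
        (\<Sum>n=1..j. of_nat n * (scal (\<beta> n) * U (b_diff n (exp_diff \<beta> (j - n) P))))"
      unfolding exp_diff_newton using less by (intro sum.cong refl) (simp add: assms(2))
    also have "\<dots> = of_nat j * U (exp_diff \<beta> j P)"
      unfolding lin_of_nat[OF assms(1), symmetric] exp_diff_newton
      by (simp add: lin_sum[OF assms(1)] lin_of_nat[OF assms(1)] lin_scal[OF assms(1)])
    finally show ?thesis by (rule of_nat_mult_cancel[OF False])
  qed simp
qed

lemma b_diff_exp_diff: "b_diff n (exp_diff \<beta> j P) = exp_diff \<beta> j (b_diff n P)"
  by (rule exp_diff_commute_lin[symmetric]) (rule lin_b_diff, rule b_diff_commute)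

lemma exp_diff_commute: "exp_diff \<beta> j (exp_diff \<beta>' i P) = exp_diff \<beta>' i (exp_diff \<beta> j P)"
  by (rule exp_diff_commute_lin) (rule lin_exp_diff, rule b_diff_exp_diff)

lemma sum_convolution_newton:
  fixes g :: "nat \<Rightarrow> nat \<Rightarrow> nat \<Rightarrow> 'a::comm_monoid_add"
  shows "(\<Sum>i\<le>j. \<Sum>n=1..i. g n (i - n) (j - i)) = (\<Sum>n=1..j. \<Sum>i\<le>j - n. g n i (j - n - i))"
proof -
  have "(\<Sum>i\<le>j. \<Sum>n=1..i. g n (i - n) (j - i)) =
      (\<Sum>(i,n)\<in>Sigma {..j} (\<lambda>i. {1..i}). g n (i - n) (j - i))"
    by (simp add: sum.Sigma)
  also have "\<dots> = (\<Sum>(n,i)\<in>Sigma {1..j} (\<lambda>n. {..j - n}). g n i (j - n - i))"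
    by (rule sum.reindex_bij_witness[of _ "\<lambda>(n,i). (n + i, n)" "\<lambda>(i,n). (n, i - n)"]) auto
  finally show ?thesis by (simp add: sum.Sigma)
qed

lemma sum_convolution_newton':
  fixes g :: "nat \<Rightarrow> nat \<Rightarrow> nat \<Rightarrow> 'a::comm_monoid_add"
  shows "(\<Sum>i\<le>j. \<Sum>n=1..j-i. g n i (j - i - n)) = (\<Sum>n=1..j. \<Sum>i\<le>j - n. g n i (j - n - i))"
proof -
  have "(\<Sum>i\<le>j. \<Sum>n=1..j-i. g n i (j - i - n)) =
      (\<Sum>(i,n)\<in>Sigma {..j} (\<lambda>i. {1..j-i}). g n i (j - i - n))"
    by (simp add: sum.Sigma)
  also have "\<dots> = (\<Sum>(n,i)\<in>Sigma {1..j} (\<lambda>n. {..j - n}). g n i (j - n - i))"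
    by (rule sum.reindex_bij_witness[of _ "\<lambda>(n,i). (i, n)" "\<lambda>(i,n). (n, i)"])
      (auto simp: add.commute)
  finally show ?thesis by (simp add: sum.Sigma)
qed

text \<open>The series of operators \<open>exp_diff \<beta>\<close> is the exponential of a derivation, hence multiplicative.\<close>

lemma exp_diff_mult:
  "exp_diff \<beta> j (P * Q) = (\<Sum>i\<le>j. exp_diff \<beta> i P * exp_diff \<beta> (j - i) Q)"
proof (induction j rule: less_induct)
  case (less j)
  show ?case
  proof (cases "j = 0")
    case False
    let ?T = "exp_diff \<beta>"
    have "of_nat j * (\<Sum>i\<le>j. ?T i P * ?T (j - i) Q) =
        (\<Sum>i\<le>j. (of_nat i * ?T i P) * ?T (j - i) Q) + (\<Sum>i\<le>j. ?T i P * (of_nat (j - i) * ?T (j - i) Q))"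
      unfolding sum_distrib_left sum.distrib[symmetric]
    proof (intro sum.cong refl)
      fix i assume "i \<in> {..j}"
      then have j: "(of_nat j :: laurent bpoly) = of_nat i + of_nat (j - i)"
        by (metis atMost_iff le_add_diff_inverse of_nat_add)
      show "of_nat j * (?T i P * ?T (j - i) Q) =
          (of_nat i * ?T i P) * ?T (j - i) Q + ?T i P * (of_nat (j - i) * ?T (j - i) Q)"
        unfolding j by (simp add: algebra_simps del: of_nat_add)
    qed
    also have "(\<Sum>i\<le>j. (of_nat i * ?T i P) * ?T (j - i) Q) =
        (\<Sum>i\<le>j. \<Sum>n=1..i. of_nat n * (scal (\<beta> n) * b_diff n (?T (i - n) P)) * ?T (j - i) Q)"
      by (simp only: exp_diff_newton sum_distrib_right)
    also have "\<dots> = (\<Sum>n=1..j. \<Sum>i\<le>j-n. of_nat n * (scal (\<beta> n) * b_diff n (?T i P)) * ?T (j - n - i) Q)"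
      by (rule sum_convolution_newton)
    also have "(\<Sum>i\<le>j. ?T i P * (of_nat (j - i) * ?T (j - i) Q)) =
        (\<Sum>i\<le>j. \<Sum>n=1..j-i. ?T i P * (of_nat n * (scal (\<beta> n) * b_diff n (?T (j - i - n) Q))))"
      by (simp only: exp_diff_newton sum_distrib_left)
    also have "\<dots> = (\<Sum>n=1..j. \<Sum>i\<le>j-n. ?T i P * (of_nat n * (scal (\<beta> n) * b_diff n (?T (j - n - i) Q))))"
      by (rule sum_convolution_newton')
    also have "(\<Sum>n=1..j. \<Sum>i\<le>j-n. of_nat n * (scal (\<beta> n) * b_diff n (?T i P)) * ?T (j - n - i) Q) + \<dots> =
        (\<Sum>n=1..j. of_nat n * (scal (\<beta> n) * b_diff n (\<Sum>i\<le>j-n. ?T i P * ?T (j - n - i) Q)))"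
      by (simp only: lin_sum[OF lin_b_diff] b_diff_mult sum_distrib_left distrib_left sum.distrib mult_ac)
    also have "\<dots> = of_nat j * ?T j (P * Q)"
      unfolding exp_diff_newton
    proof (intro sum.cong refl)
      fix n assume "n \<in> {1..j}"
      then have "j - n < j" by auto
      from less[OF this] show "of_nat n * (scal (\<beta> n) * b_diff n (\<Sum>i\<le>j-n. ?T i P * ?T (j - n - i) Q)) =
          of_nat n * (scal (\<beta> n) * b_diff n (?T (j - n) (P * Q)))"
        by (simp only:)
    qed
    finally show ?thesis by (rule of_nat_mult_cancel[OF False, symmetric])
  qed simp
qed

lemma b_diff_one [simp]: "b_diff n (1 :: 'r::comm_ring_1 bpoly) = 0"
  by (simp add: b_diff_mon flip: single_one)

lemma b_diff_scal [simp]: "b_diff n (scal c :: 'r::comm_ring_1 bpoly) = 0"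
  by (simp add: b_diff_mon)

text \<open>The exponential is an eigenvector: \<partial>_l exp(...) = (\<alpha> l t^l / l)
  exp(...). The exponential is given by a recursion for k times its k-th coefficient, so the
  induction compares both sides after multiplication by k.\<close>

lemma b_diff_exp_mult:
  assumes "l \<ge> 1"
  shows "of_nat l * b_diff l (exp_mult \<alpha> k) = (if l \<le> k then scal (\<alpha> l) * exp_mult \<alpha> (k - l) else 0)"
proof (induction k rule: less_induct)
  case (less k)
  show ?case
  proof (cases "k = 0")
    case False
    let ?S = "exp_mult \<alpha>"
    have eq: "of_nat l * (scal (\<alpha> n) * b_diff l (b_var n * ?S (k - n))) =
        (if n = l then of_nat l * (scal (\<alpha> l) * ?S (k - l)) else 0) +
        (if l \<le> k - n then scal (\<alpha> n) * (b_var n * (scal (\<alpha> l) * ?S (k - n - l))) else 0)"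
      if "n \<in> {1..k}" for n
    proof -
      have *: "of_nat l * b_diff l (?S (k - n)) = (if l \<le> k - n then scal (\<alpha> l) * ?S (k - n - l) else 0)"
        using less[of "k - n"] that False by auto
      have "of_nat l * (scal (\<alpha> n) * b_diff l (b_var n * ?S (k - n))) =
          of_nat l * (scal (\<alpha> n) * (b_diff l (b_var n) * ?S (k - n))) +
          scal (\<alpha> n) * (b_var n * (of_nat l * b_diff l (?S (k - n))))"
        unfolding b_diff_mult by (simp add: algebra_simps)
      then show ?thesis using that assms unfolding * by (auto simp: b_diff_b_var)
    qed
    have "of_nat k * (of_nat l * b_diff l (?S k)) = of_nat l * b_diff l (of_nat k * ?S k)"
      by (simp add: lin_of_nat[OF lin_b_diff] mult.left_commute)
    also have "\<dots> = (\<Sum>n=1..k. of_nat l * (scal (\<alpha> n) * b_diff l (b_var n * ?S (k - n))))"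
      unfolding exp_mult_newton
      by (simp add: lin_sum[OF lin_b_diff] lin_scal[OF lin_b_diff] sum_distrib_left)
    also have "\<dots> = (\<Sum>n=1..k. (if n = l then of_nat l * (scal (\<alpha> l) * ?S (k - l)) else 0) +
        (if l \<le> k - n then scal (\<alpha> n) * (b_var n * (scal (\<alpha> l) * ?S (k - n - l))) else 0))"
      by (intro sum.cong refl eq)
    also have "\<dots> = (if l \<le> k then of_nat l * (scal (\<alpha> l) * ?S (k - l)) else 0) +
        (\<Sum>n=1..k. if l \<le> k - n then scal (\<alpha> n) * (b_var n * (scal (\<alpha> l) * ?S (k - n - l))) else 0)"
      using assms by (simp add: sum.distrib)
    also have "(\<Sum>n=1..k. if l \<le> k - n then scal (\<alpha> n) * (b_var n * (scal (\<alpha> l) * ?S (k - n - l))) else 0) =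
        (\<Sum>n=1..k-l. scal (\<alpha> n) * (b_var n * (scal (\<alpha> l) * ?S (k - n - l))))"
      using assms by (intro sum.mono_neutral_cong_right) auto
    also have "\<dots> = scal (\<alpha> l) * (of_nat (k - l) * ?S (k - l))"
      unfolding exp_mult_newton sum_distrib_left
      by (intro sum.cong refl) (simp add: add.commute mult.left_commute)
    \<comment> \<open>The summand in which the derivative hits \<open>b_var l\<close> contributes
      the factor l, the recursion at k - l contributes k - l.\<close>
    also have "(if l \<le> k then of_nat l * (scal (\<alpha> l) * ?S (k - l)) else 0) + \<dots> =
        of_nat k * (if l \<le> k then scal (\<alpha> l) * ?S (k - l) else 0)"
    proof (cases "l \<le> k")
      case True
      then have k: "(of_nat k :: laurent bpoly) = of_nat l + of_nat (k - l)"
        by (metis le_add_diff_inverse of_nat_add)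
      show ?thesis unfolding k using True by (simp add: algebra_simps del: of_nat_add)
    qed simp
    finally show ?thesis by (rule of_nat_mult_cancel[OF False])
  qed (use assms in simp)
qed

text \<open>The scalars \<open>\<gamma>\<close> are the coefficients of the two-point function of the two exponentials.\<close>

lemma exp_diff_exp_mult:
  assumes "\<gamma> 0 = 1" and \<gamma>: "\<And>j. of_nat j * \<gamma> j = (\<Sum>n=1..j. \<alpha> n * \<beta> n * \<gamma> (j - n))"
  shows "exp_diff \<beta> j (exp_mult \<alpha> k) = (if j \<le> k then scal (\<gamma> j) * exp_mult \<alpha> (k - j) else 0)"
proof (induction j rule: less_induct)
  case (less j)
  show ?case
  proof (cases "j = 0")
    case False
    have "of_nat j * exp_diff \<beta> j (exp_mult \<alpha> k) =
        (\<Sum>n=1..j. scal (\<beta> n) * (of_nat n * b_diff n (exp_diff \<beta> (j - n) (exp_mult \<alpha> k))))"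
      unfolding exp_diff_newton by (simp add: mult.left_commute)
    also have "\<dots> = (\<Sum>n=1..j. if j \<le> k then scal (\<alpha> n * \<beta> n * \<gamma> (j - n)) * exp_mult \<alpha> (k - j) else 0)"
    proof (intro sum.cong refl)
      fix n assume n: "n \<in> {1..j}"
      have "scal (\<beta> n) * (of_nat n * b_diff n (exp_diff \<beta> (j - n) (exp_mult \<alpha> k))) =
          (if j - n \<le> k then scal (\<beta> n) * (scal (\<gamma> (j - n)) * (of_nat n * b_diff n (exp_mult \<alpha> (k - (j - n))))) else 0)"
        using n False less[of "j - n"] by (simp add: lin_scal[OF lin_b_diff] lin_zero[OF lin_b_diff] mult.left_commute)
      also have "\<dots> = (if j \<le> k then scal (\<alpha> n * \<beta> n * \<gamma> (j - n)) * exp_mult \<alpha> (k - j) else 0)"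
        using n by (subst b_diff_exp_mult) (auto simp: scal_mult mult_ac)
      finally show "scal (\<beta> n) * (of_nat n * b_diff n (exp_diff \<beta> (j - n) (exp_mult \<alpha> k))) = \<dots>" .
    qed
    also have "\<dots> = of_nat j * (if j \<le> k then scal (\<gamma> j) * exp_mult \<alpha> (k - j) else 0)"
    proof (cases "j \<le> k")
      case True
      have "(\<Sum>n=1..j. scal (\<alpha> n * \<beta> n * \<gamma> (j - n)) * exp_mult \<alpha> (k - j)) =
          scal (of_nat j * \<gamma> j) * exp_mult \<alpha> (k - j)"
        by (simp only: \<gamma> scal_sum sum_distrib_right)
      then show ?thesis using True by (simp add: scal_mult mult.assoc)
    qed simp
    finally show ?thesis by (rule of_nat_mult_cancel[OF False])
  qed (simp add: assms)
qed

section \<open>Weights\<close>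

definition wt :: "(nat \<Rightarrow>\<^sub>0 nat) \<Rightarrow> nat" where
  "wt \<mu> = (\<Sum>k\<in>supp \<mu>. (k + 1) * coef \<mu> k)"

lemma wt_superset: "finite S \<Longrightarrow> supp \<mu> \<subseteq> S \<Longrightarrow> wt \<mu> = (\<Sum>k\<in>S. (k + 1) * coef \<mu> k)"
  unfolding wt_def by (rule sum.mono_neutral_left) (auto simp: in_keys_iff)

lemma wt_add: "wt (\<mu> + \<nu>) = wt \<mu> + wt \<nu>"
proof -
  let ?S = "supp \<mu> \<union> supp \<nu>"
  have "supp (\<mu> + \<nu>) \<subseteq> ?S" by (rule Poly_Mapping.keys_add)
  then have "wt (\<mu> + \<nu>) = (\<Sum>k\<in>?S. (k + 1) * coef (\<mu> + \<nu>) k)"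
    by (intro wt_superset) auto
  also have "\<dots> = (\<Sum>k\<in>?S. (k + 1) * coef \<mu> k) + (\<Sum>k\<in>?S. (k + 1) * coef \<nu> k)"
    by (simp only: lookup_add distrib_left sum.distrib)
  also have "\<dots> = wt \<mu> + wt \<nu>"
    by (intro arg_cong2[where f = "(+)"] wt_superset[symmetric]) auto
  finally show ?thesis .
qed

lemma wt_zero [simp]: "wt 0 = 0"
  by (simp add: wt_def)

lemma wt_single [simp]: "wt (sgl k e) = (k + 1) * e"
  by (simp add: wt_def)

lemma exponent_minus_single: "coef \<mu> k \<noteq> 0 \<Longrightarrow> (\<mu> - sgl k 1) + sgl k (1::nat) = \<mu>"
  by (rule poly_mapping_eqI) (auto simp: lookup_add lookup_minus lookup_single when_def)

text \<open>Phrased through supports, so that it passes to sums and composites without splitting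
  vectors into homogeneous components; for linear T it says that T shifts the weight by c.\<close>

definition wt_hom :: "('r::comm_ring_1 bpoly \<Rightarrow> 'r bpoly) \<Rightarrow> int \<Rightarrow> bool" where
  "wt_hom T c \<longleftrightarrow> (\<forall>P. \<forall>\<nu>\<in>supp (T P). \<exists>\<mu>\<in>supp P. int (wt \<nu>) = int (wt \<mu>) + c)"

lemma wt_homD: "wt_hom T c \<Longrightarrow> \<nu> \<in> supp (T P) \<Longrightarrow> \<exists>\<mu>\<in>supp P. int (wt \<nu>) = int (wt \<mu>) + c"
  by (auto simp: wt_hom_def)

lemma wt_hom_id: "wt_hom (\<lambda>P. P) 0"
  by (auto simp: wt_hom_def)

lemma wt_hom_zero: "wt_hom (\<lambda>P. 0) c"
  by (auto simp: wt_hom_def)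

lemma wt_hom_comp: "wt_hom T c \<Longrightarrow> wt_hom U d \<Longrightarrow> wt_hom (\<lambda>P. T (U P)) (c + d)"
  unfolding wt_hom_def
proof (intro allI ballI)
  fix P \<nu>
  assume T: "\<forall>P. \<forall>\<nu>\<in>supp (T P). \<exists>\<mu>\<in>supp P. int (wt \<nu>) = int (wt \<mu>) + c"
    and U: "\<forall>P. \<forall>\<nu>\<in>supp (U P). \<exists>\<mu>\<in>supp P. int (wt \<nu>) = int (wt \<mu>) + d"
    and "\<nu> \<in> supp (T (U P))"
  then obtain \<rho> where \<rho>: "\<rho> \<in> supp (U P)" "int (wt \<nu>) = int (wt \<rho>) + c" by blast
  then obtain \<mu> where "\<mu> \<in> supp P" "int (wt \<rho>) = int (wt \<mu>) + d" using U by blast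
  then show "\<exists>\<mu>\<in>supp P. int (wt \<nu>) = int (wt \<mu>) + (c + d)" using \<rho> by (intro bexI[of _ \<mu>]) auto
qed

lemma wt_hom_plus: "wt_hom T c \<Longrightarrow> wt_hom U c \<Longrightarrow> wt_hom (\<lambda>P. T P + U P) c"
  unfolding wt_hom_def
proof (intro allI ballI)
  fix P \<nu>
  assume *: "\<forall>P. \<forall>\<nu>\<in>supp (T P). \<exists>\<mu>\<in>supp P. int (wt \<nu>) = int (wt \<mu>) + c"
    "\<forall>P. \<forall>\<nu>\<in>supp (U P). \<exists>\<mu>\<in>supp P. int (wt \<nu>) = int (wt \<mu>) + c"
    and \<nu>: "\<nu> \<in> supp (T P + U P)"
  have "\<nu> \<in> supp (T P) \<union> supp (U P)" using \<nu> by (rule subsetD[OF Poly_Mapping.keys_add])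
  then show "\<exists>\<mu>\<in>supp P. int (wt \<nu>) = int (wt \<mu>) + c" using * by auto
qed

lemma wt_hom_uminus: "wt_hom T c \<Longrightarrow> wt_hom (\<lambda>P. - T P) c"
  by (auto simp: wt_hom_def in_keys_iff)

lemma wt_hom_minus: "wt_hom T c \<Longrightarrow> wt_hom U c \<Longrightarrow> wt_hom (\<lambda>P. T P - U P) c"
  using wt_hom_plus[OF _ wt_hom_uminus, of T c U] by simp

lemma wt_hom_sum: "(\<And>i. i \<in> I \<Longrightarrow> wt_hom (T i) c) \<Longrightarrow> wt_hom (\<lambda>P. \<Sum>i\<in>I. T i P) c"
  by (induction I rule: infinite_finite_induct) (simp_all add: wt_hom_zero wt_hom_plus)

lemma wt_hom_Sum_any: "(\<And>i. wt_hom (T i) c) \<Longrightarrow> wt_hom (\<lambda>P. Sum_any (\<lambda>i. T i P)) c"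
  unfolding wt_hom_def Sum_any.expand_set
proof (intro allI ballI)
  fix P \<nu>
  assume *: "\<And>i. \<forall>P. \<forall>\<nu>\<in>supp (T i P). \<exists>\<mu>\<in>supp P. int (wt \<nu>) = int (wt \<mu>) + c"
    and \<nu>: "\<nu> \<in> supp (\<Sum>i | T i P \<noteq> 0. T i P)"
  have "\<nu> \<in> (\<Union>i\<in>{i. T i P \<noteq> 0}. supp (T i P))" using \<nu> by (rule subsetD[OF Poly_Mapping.keys_sum])
  then show "\<exists>\<mu>\<in>supp P. int (wt \<nu>) = int (wt \<mu>) + c" using * by auto
qed

lemma wt_hom_mult:
  assumes "wt_hom T c" "\<And>\<mu>. \<mu> \<in> supp X \<Longrightarrow> int (wt \<mu>) = d"
  shows "wt_hom (\<lambda>P. X * T P) (c + d)"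
  unfolding wt_hom_def
proof (intro allI ballI)
  fix P \<nu> assume "\<nu> \<in> supp (X * T P)"
  then obtain \<mu> \<rho> where *: "\<mu> \<in> supp X" "\<rho> \<in> supp (T P)" "\<nu> = \<mu> + \<rho>"
    using Poly_Mapping.keys_mult[of X "T P"] by blast
  then obtain \<mu>' where "\<mu>' \<in> supp P" "int (wt \<rho>) = int (wt \<mu>') + c"
    using wt_homD[OF assms(1)] by blast
  then show "\<exists>\<mu>'\<in>supp P. int (wt \<nu>) = int (wt \<mu>') + (c + d)"
    using assms(2)[OF *(1)] by (auto simp: *(3) wt_add)
qed

lemma wt_hom_scal: "wt_hom T c \<Longrightarrow> wt_hom (\<lambda>P. scal a * T P) c"
proof -
  assume "wt_hom T c"
  then have "wt_hom (\<lambda>P. scal a * T P) (c + 0)"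
    by (rule wt_hom_mult) (auto split: if_splits)
  then show ?thesis by simp
qed

lemma supp_of_nat_mult:
  assumes "n \<noteq> 0" shows "supp (of_nat n * (P :: 'r::{idom,ring_char_0} bpoly)) = supp P"
proof -
  have "of_nat n * P = pm_scale (of_nat n) P"
    by (simp add: pm_scale_eq_mult)
  then have "coef (of_nat n * P) \<mu> = of_nat n * coef P \<mu>" for \<mu>
    by (simp only: lookup_pm_scale)
  then show ?thesis using assms by (simp add: set_eq_iff in_keys_iff)
qed

lemma wt_hom_b_diff:
  assumes "n \<ge> 1" shows "wt_hom (b_diff n) (- int n)"
  unfolding wt_hom_def
proof (intro allI ballI)
  fix P :: "'r::comm_ring_1 bpoly" and \<nu> assume "\<nu> \<in> supp (b_diff n P)"
  then have "\<nu> \<in> supp (\<Sum>\<mu>\<in>supp P. scal (coef P \<mu>) * b_diff n (sgl \<mu> 1))"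
    by (simp only: lin_expand[OF lin_b_diff, of n P, symmetric])
  then have "\<nu> \<in> (\<Union>\<mu>\<in>supp P. supp (scal (coef P \<mu>) * b_diff n (sgl \<mu> 1)))"
    by (rule subsetD[OF Poly_Mapping.keys_sum])
  then obtain \<mu> where *: "\<mu> \<in> supp P" "\<nu> \<in> supp (scal (coef P \<mu>) * b_diff n (sgl \<mu> 1))"
    by blast
  then have \<nu>: "\<nu> = \<mu> - sgl (n - 1) 1" "coef \<mu> (n - 1) \<noteq> 0"
    by (auto simp: b_diff_mon mult_single split: if_splits intro!: Nat.gr0I)
  have "wt \<mu> = wt \<nu> + n"
    using exponent_minus_single[OF \<nu>(2)] assms wt_add[of \<nu> "sgl (n - 1) 1"]
    by (simp add: \<nu>(1))
  then show "\<exists>\<mu>\<in>supp P. int (wt \<nu>) = int (wt \<mu>) + - int n"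
    using *(1) by (intro bexI[of _ \<mu>]) auto
qed

lemma wt_b_var: "n \<ge> 1 \<Longrightarrow> \<mu> \<in> supp (b_var n :: 'r::comm_ring_1 bpoly) \<Longrightarrow> wt \<mu> = n"
  by (auto simp: b_var_def)

lemma wt_exp_mult: "\<mu> \<in> supp (exp_mult \<alpha> k) \<Longrightarrow> wt \<mu> = k"
proof (induction k arbitrary: \<mu> rule: less_induct)
  case (less k)
  show ?case
  proof (cases "k = 0")
    case False
    have "\<mu> \<in> supp (of_nat k * exp_mult \<alpha> k)"
      using less.prems False by (simp add: supp_of_nat_mult)
    then have "\<mu> \<in> (\<Union>n\<in>{1..k}. supp (scal (\<alpha> n) * (b_var n * exp_mult \<alpha> (k - n))))"
      unfolding exp_mult_newton by (rule subsetD[OF Poly_Mapping.keys_sum])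
    then obtain n where n: "n \<in> {1..k}" "\<mu> \<in> supp (scal (\<alpha> n) * (b_var n * exp_mult \<alpha> (k - n)))"
      by blast
    then obtain \<mu>1 \<mu>2 where *: "\<mu>1 \<in> supp (b_var n :: laurent bpoly)" "\<mu>2 \<in> supp (exp_mult \<alpha> (k - n))" "\<mu> = \<mu>1 + \<mu>2"
      using Poly_Mapping.keys_mult[of "scal (\<alpha> n)" "b_var n * exp_mult \<alpha> (k - n)"]
        Poly_Mapping.keys_mult[of "b_var n :: laurent bpoly" "exp_mult \<alpha> (k - n)"]
      by (auto split: if_splits)
    then show ?thesis
      using less.IH[of "k - n" \<mu>2] n wt_b_var[OF _ *(1)] by (auto simp: wt_add)
  qed (use less in \<open>simp split: if_splits\<close>)
qed

lemma wt_hom_exp_diff: "wt_hom (exp_diff \<beta> j) (- int j)"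
proof (induction j rule: less_induct)
  case (less j)
  show ?case
  proof (cases "j = 0")
    case False
    have "wt_hom (\<lambda>P. \<Sum>n=1..j. of_nat n * (scal (\<beta> n) * b_diff n (exp_diff \<beta> (j - n) P))) (- int j)"
    proof (rule wt_hom_sum)
      fix n assume n: "n \<in> {1..j}"
      have "wt_hom (exp_diff \<beta> (j - n)) (- int (j - n))" by (rule less) (use n in auto)
      with wt_hom_b_diff[of n] n
      have "wt_hom (\<lambda>P. b_diff n (exp_diff \<beta> (j - n) P)) (- int n + - int (j - n))"
        by (intro wt_hom_comp) auto
      then have "wt_hom (\<lambda>P. scal (of_nat n) * (scal (\<beta> n) * b_diff n (exp_diff \<beta> (j - n) P))) (- int n + - int (j - n))"
        by (intro wt_hom_scal)
      then show "wt_hom (\<lambda>P. of_nat n * (scal (\<beta> n) * b_diff n (exp_diff \<beta> (j - n) P))) (- int j)"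
        using n by (simp add: of_nat_diff)
    qed
    then show ?thesis
      unfolding exp_diff_newton[symmetric] wt_hom_def supp_of_nat_mult[OF False] .
  qed (simp add: wt_hom_id)
qed

text \<open>The bound does not depend on \<beta>, so composites with different coefficient sequences
  can be truncated at the same place.\<close>

lemma exp_diff_bound:
  obtains N :: nat where "\<And>\<beta> j. j > N \<Longrightarrow> exp_diff \<beta> j P = 0"
proof
  fix \<beta> j assume j: "j > Max (insert 0 (wt ` supp P))"
  show "exp_diff \<beta> j P = 0"
  proof (rule ccontr)
    assume "exp_diff \<beta> j P \<noteq> 0"
    then obtain \<nu> where "\<nu> \<in> supp (exp_diff \<beta> j P)"
      by (auto simp: poly_mapping_eq_iff fun_eq_iff in_keys_iff)
    then obtain \<mu> where "\<mu> \<in> supp P" "int (wt \<nu>) = int (wt \<mu>) - int j"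
      using wt_homD[OF wt_hom_exp_diff] by fastforce
    then show False using j by (auto simp: Max_less_iff)
  qed
qed

section \<open>Vertex operators\<close>

text \<open>Extending by 0 to negative indices lets the index sums below be shifted and reflected
  over all integers.\<close>

definition em :: "(nat \<Rightarrow> laurent) \<Rightarrow> int \<Rightarrow> laurent bpoly" where
  "em \<alpha> k = (if k < 0 then 0 else exp_mult \<alpha> (nat k))"

definition ed :: "(nat \<Rightarrow> laurent) \<Rightarrow> int \<Rightarrow> laurent bpoly \<Rightarrow> laurent bpoly" where
  "ed \<beta> j P = (if j < 0 then 0 else exp_diff \<beta> (nat j) P)"

text \<open>With \<open>em\<close> the coefficients of z^k in the first exponential and
  \<open>ed\<close> those of z^{-j} in the second, this is the coefficient of z^a in their
  product.\<close>

definition vop :: "(nat \<Rightarrow> laurent) \<Rightarrow> (nat \<Rightarrow> laurent) \<Rightarrow> int \<Rightarrow> laurent bpoly \<Rightarrow> laurent bpoly" where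
  "vop \<alpha> \<beta> a P = Sum_any (\<lambda>j. em \<alpha> (j + a) * ed \<beta> j P)"

lemma em_neg [simp]: "k < 0 \<Longrightarrow> em \<alpha> k = 0" and em_0 [simp]: "em \<alpha> 0 = 1"
  by (simp_all add: em_def)

lemma ed_neg [simp]: "j < 0 \<Longrightarrow> ed \<beta> j P = 0" and ed_0 [simp]: "ed \<beta> 0 P = P"
  by (simp_all add: ed_def)

lemma lin_ed: "lin (ed \<beta> j)"
  by (cases "j < 0") (simp_all add: ed_def[abs_def] lin_zero_fun lin_exp_diff)

lemma ed_zero [simp]: "ed \<beta> j 0 = 0"
  by (rule lin_zero[OF lin_ed])

lemma ed_commute: "ed \<beta> j (ed \<beta>' i P) = ed \<beta>' i (ed \<beta> j P)"
  by (simp add: ed_def exp_diff_commute lin_zero[OF lin_exp_diff])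

definition ed_bounded :: "int \<Rightarrow> laurent bpoly \<Rightarrow> bool" where
  "ed_bounded N P \<longleftrightarrow> (\<forall>\<beta>. \<forall>j>N. ed \<beta> j P = 0)"

lemma ed_bounded_exists: "\<exists>N\<ge>0. ed_bounded N P"
proof -
  obtain N where "\<And>\<beta> j. j > N \<Longrightarrow> exp_diff \<beta> j P = 0"
    using exp_diff_bound[of P] by blast
  then have "ed_bounded (int N) P"
    by (auto simp: ed_bounded_def ed_def)
  then show ?thesis by (intro exI[of _ "int N"]) auto
qed

lemma ed_bounded_mono: "ed_bounded N P \<Longrightarrow> N \<le> M \<Longrightarrow> ed_bounded M P"
  by (auto simp: ed_bounded_def)

lemma ed_bounded_ed: "ed_bounded N P \<Longrightarrow> ed_bounded N (ed \<beta> i P)"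
  unfolding ed_bounded_def by (subst ed_commute) simp

lemma Sum_any_ed:
  assumes "ed_bounded N P"
  shows "Sum_any (\<lambda>j. f j * ed \<beta> j P) = (\<Sum>j=0..N. f j * ed \<beta> j P)"
proof (rule Sum_any.expand_superset)
  show "{j. f j * ed \<beta> j P \<noteq> 0} \<subseteq> {0..N}"
  proof
    fix j assume "j \<in> {j. f j * ed \<beta> j P \<noteq> 0}"
    then have "\<not> j < 0" "\<not> j > N" using assms by (auto simp: ed_bounded_def)
    then show "j \<in> {0..N}" by auto
  qed
qed simp

lemma vop_eq_sum:
  "ed_bounded N P \<Longrightarrow> vop \<alpha> \<beta> a P = (\<Sum>j=0..N. em \<alpha> (j + a) * ed \<beta> j P)"
  unfolding vop_def by (rule Sum_any_ed)

lemma lin_vop: "lin (vop \<alpha> \<beta> a)"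
proof (rule linI)
  fix P Q
  obtain N M where "ed_bounded N P" "ed_bounded M Q"
    using ed_bounded_exists by meson
  then have *: "ed_bounded (max N M) P" "ed_bounded (max N M) Q"
    by (auto intro: ed_bounded_mono)
  then have "ed_bounded (max N M) (P + Q)"
    by (simp add: ed_bounded_def lin_add[OF lin_ed])
  then show "vop \<alpha> \<beta> a (P + Q) = vop \<alpha> \<beta> a P + vop \<alpha> \<beta> a Q"
    using * by (simp add: vop_eq_sum lin_add[OF lin_ed] distrib_left sum.distrib)
next
  fix c P
  obtain N where *: "ed_bounded N P"
    using ed_bounded_exists by meson
  then have "ed_bounded N (scal c * P)"
    by (simp add: ed_bounded_def lin_scal[OF lin_ed])
  then show "vop \<alpha> \<beta> a (scal c * P) = scal c * vop \<alpha> \<beta> a P"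
    using * by (simp add: vop_eq_sum lin_scal[OF lin_ed] sum_distrib_left mult.left_commute)
qed

lemma wt_em: "\<mu> \<in> supp (em \<alpha> k) \<Longrightarrow> int (wt \<mu>) = k"
  by (auto simp: em_def wt_exp_mult split: if_splits)

lemma wt_hom_ed: "wt_hom (ed \<beta> j) (- j)"
  using wt_hom_exp_diff[of \<beta> "nat j"] by (cases "j < 0") (simp_all add: ed_def[abs_def] wt_hom_zero)

lemma wt_hom_vop: "wt_hom (vop \<alpha> \<beta> a) a"
proof -
  have "wt_hom (\<lambda>P. em \<alpha> (j + a) * ed \<beta> j P) (- j + (j + a))" for j
    by (rule wt_hom_mult[OF wt_hom_ed]) (rule wt_em)
  then show ?thesis unfolding vop_def[abs_def] by (intro wt_hom_Sum_any) simp
qed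

section \<open>Two-point functions and normal ordering\<close>

definition int_ext :: "(nat \<Rightarrow> laurent) \<Rightarrow> int \<Rightarrow> laurent" where
  "int_ext \<gamma> l = (if l < 0 then 0 else \<gamma> (nat l))"

text \<open>The recursion for \<gamma>(t) = exp(\<Sum> \<alpha> n \<beta> n t^n / n), the scalar
  series that appears when the derivation part of one vertex operator is moved past the
  multiplication part of another.\<close>

definition two_point :: "(nat \<Rightarrow> laurent) \<Rightarrow> (nat \<Rightarrow> laurent) \<Rightarrow> (nat \<Rightarrow> laurent) \<Rightarrow> bool" where
  "two_point \<alpha> \<beta> \<gamma> \<longleftrightarrow> \<gamma> 0 = 1 \<and> (\<forall>j. of_nat j * \<gamma> j = (\<Sum>n=1..j. \<alpha> n * \<beta> n * \<gamma> (j - n)))"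

text \<open>Combines the multiplicativity of \<open>exp_diff\<close> with the eigenvector property
  \<open>exp_diff_exp_mult\<close>. Summing l over all integers absorbs the side conditions, since
  each factor vanishes outside its range.\<close>

lemma ed_em_mult:
  assumes "two_point \<alpha> \<beta> \<gamma>"
  shows "ed \<beta> j (em \<alpha> k * X) = Sum_any (\<lambda>l. scal (int_ext \<gamma> l) * em \<alpha> (k - l) * ed \<beta> (j - l) X)"
proof (cases "k < 0 \<or> j < 0")
  case True
  then have "scal (int_ext \<gamma> l) * em \<alpha> (k - l) * ed \<beta> (j - l) X = 0" for l
    by (auto simp: int_ext_def)
  then have "(\<lambda>l. scal (int_ext \<gamma> l) * em \<alpha> (k - l) * ed \<beta> (j - l) X) = (\<lambda>l. 0)"
    by (intro ext)
  then have "Sum_any (\<lambda>l. scal (int_ext \<gamma> l) * em \<alpha> (k - l) * ed \<beta> (j - l) X) = 0"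
    by (simp only: Sum_any.neutral)
  then show ?thesis using True by auto
next
  case False
  let ?f = "\<lambda>l. scal (int_ext \<gamma> l) * em \<alpha> (k - l) * ed \<beta> (j - l) X"
  have "ed \<beta> j (em \<alpha> k * X) = (\<Sum>i\<le>nat j. exp_diff \<beta> i (exp_mult \<alpha> (nat k)) * exp_diff \<beta> (nat j - i) X)"
    using False by (simp add: ed_def em_def exp_diff_mult)
  also have "\<dots> = (\<Sum>i\<le>nat j. ?f (int i))"
  proof (intro sum.cong refl)
    fix i assume i: "i \<in> {..nat j}"
    have "nat (k - int i) = nat k - i" "nat (j - int i) = nat j - i" by auto
    moreover have "k - int i < 0 \<longleftrightarrow> \<not> i \<le> nat k" using False by auto
    ultimately show "exp_diff \<beta> i (exp_mult \<alpha> (nat k)) * exp_diff \<beta> (nat j - i) X = ?f (int i)"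
      using assms i False
      by (auto simp: two_point_def exp_diff_exp_mult[of \<gamma> \<alpha> \<beta>] em_def ed_def int_ext_def)
  qed
  also have "\<dots> = (\<Sum>l\<in>int ` {..nat j}. ?f l)"
    by (simp add: sum.reindex)
  also have "\<dots> = Sum_any ?f"
  proof (rule Sum_any.expand_superset[symmetric])
    show "{l. ?f l \<noteq> 0} \<subseteq> int ` {..nat j}"
    proof
      fix l assume "l \<in> {l. ?f l \<noteq> 0}"
      then have "\<not> l < 0" "\<not> j - l < 0" by (auto simp: int_ext_def)
      then show "l \<in> int ` {..nat j}" by (intro image_eqI[of _ _ "nat l"]) auto
    qed
  qed simp
  finally show ?thesis .
qed

lemma Sum_any_shift: "Sum_any (\<lambda>j. g (j + c)) = Sum_any (g :: int \<Rightarrow> 'a::comm_monoid_add)"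
  by (rule Sum_any.reindex_cong[symmetric, of "\<lambda>j. j + c"])
    (auto intro!: bij_betwI[of _ _ _ "\<lambda>j. j - c"])

lemma finite_kernel_support:
  "finite {l::int. scal (int_ext \<gamma> l) * f l * em \<alpha> (k - l) \<noteq> 0}"
proof (rule finite_subset[of _ "{0..k}"])
  show "{l. scal (int_ext \<gamma> l) * f l * em \<alpha> (k - l) \<noteq> 0} \<subseteq> {0..k}"
  proof
    fix l assume "l \<in> {l. scal (int_ext \<gamma> l) * f l * em \<alpha> (k - l) \<noteq> 0}"
    then have "\<not> l < 0" "\<not> k - l < 0" by (auto simp: int_ext_def)
    then show "l \<in> {0..k}" by auto
  qed
qed simp

lemma vop_em_mult:
  assumes "two_point \<alpha> \<beta>' \<gamma>"
  shows "vop \<alpha>' \<beta>' a' (em \<alpha> k * X) =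
    Sum_any (\<lambda>j. Sum_any (\<lambda>l. scal (int_ext \<gamma> l) * em \<alpha>' (j + l + a') * em \<alpha> (k - l)) * ed \<beta>' j X)"
proof -
  obtain N where N: "ed_bounded N X" using ed_bounded_exists by meson
  define g where "g j l = scal (int_ext \<gamma> l) * em \<alpha>' (j + a') * em \<alpha> (k - l) * ed \<beta>' (j - l) X" for j l
  define h where "h j l = scal (int_ext \<gamma> l) * em \<alpha>' (j + l + a') * em \<alpha> (k - l) * ed \<beta>' j X" for j l
  have g0: "0 \<le> l \<and> l \<le> k \<and> l \<le> j \<and> j \<le> k + N" if "g j l \<noteq> 0" for j l
  proof -
    have "\<not> l < 0" "\<not> k - l < 0" "\<not> j - l < 0" "\<not> j - l > N"
      using that N by (auto simp: g_def int_ext_def ed_bounded_def)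
    then show ?thesis by auto
  qed
  have h0: "0 \<le> l \<and> l \<le> k \<and> 0 \<le> j \<and> j \<le> N" if "h j l \<noteq> 0" for j l
  proof -
    have "\<not> l < 0" "\<not> k - l < 0" "\<not> j < 0" "\<not> j > N"
      using that N by (auto simp: h_def int_ext_def ed_bounded_def)
    then show ?thesis by auto
  qed
  have "vop \<alpha>' \<beta>' a' (em \<alpha> k * X) = Sum_any (\<lambda>j. Sum_any (g j))"
    unfolding vop_def
  proof (rule Sum_any.cong)
    fix j
    have "finite {l. scal (int_ext \<gamma> l) * em \<alpha> (k - l) * ed \<beta>' (j - l) X \<noteq> 0}"
      by (rule finite_subset[OF _ finite_kernel_support[of \<gamma> "\<lambda>_. 1" \<alpha> k]]) auto
    then show "em \<alpha>' (j + a') * ed \<beta>' j (em \<alpha> k * X) = Sum_any (g j)"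
      unfolding ed_em_mult[OF assms] g_def
      by (subst Sum_any_right_distrib) (auto simp: mult_ac intro!: Sum_any.cong)
  qed
  \<comment> \<open>The substitution j \<rightarrow> j + l depends on l, so l is made the outer
    index for it and the order is restored afterwards.\<close>
  also have "\<dots> = Sum_any (\<lambda>l. Sum_any (\<lambda>j. g j l))"
    by (rule Sum_any.swap[of "{0..k + N} \<times> {0..k}"]) (use g0 in force)+
  also have "\<dots> = Sum_any (\<lambda>l. Sum_any (\<lambda>j. h j l))"
  proof (rule Sum_any.cong)
    fix l
    show "Sum_any (\<lambda>j. g j l) = Sum_any (\<lambda>j. h j l)"
      using Sum_any_shift[of "\<lambda>j. g j l" l] by (simp add: g_def h_def)
  qed
  also have "\<dots> = Sum_any (\<lambda>j. Sum_any (h j))"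
    by (rule Sum_any.swap[of "{0..k} \<times> {0..N}"]) (use h0 in force)+
  also have "\<dots> = Sum_any (\<lambda>j. Sum_any (\<lambda>l. scal (int_ext \<gamma> l) * em \<alpha>' (j + l + a') * em \<alpha> (k - l)) * ed \<beta>' j X)"
    unfolding h_def by (intro Sum_any.cong Sum_any_left_distrib[symmetric] finite_kernel_support)
  finally show ?thesis .
qed

text \<open>The two-point function pairs the multiplication part of the inner operator with the
  derivation part of the outer one; this decides which of the instances below belongs to which
  composite.\<close>

lemma vop_vop:
  assumes "two_point \<alpha> \<beta>' \<gamma>" "ed_bounded N P"
  shows "vop \<alpha>' \<beta>' a' (vop \<alpha> \<beta> a P) =
    (\<Sum>i=0..N. \<Sum>j=0..N.
      Sum_any (\<lambda>l. scal (int_ext \<gamma> l) * em \<alpha>' (j + l + a') * em \<alpha> (i + a - l)) * ed \<beta>' j (ed \<beta> i P))"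
  by (simp add: vop_eq_sum[OF assms(2)] lin_sum[OF lin_vop] vop_em_mult[OF assms(1)]
      Sum_any_ed[OF ed_bounded_ed[OF assms(2)]])

text \<open>The antisymmetric part of the kernel of the composite does not contribute, because the
  operators \<open>ed \<beta> i\<close> commute.\<close>

lemma vop_square:
  assumes tp: "two_point \<alpha> \<beta> (\<lambda>l. if l = 0 then 1 else if l = 1 then - (1 + s) else if l = 2 then s else 0)"
    and N: "ed_bounded N P"
  shows "vop \<alpha> \<beta> (a - 2) (vop \<alpha> \<beta> a P) = scal (1 + s) *
    (\<Sum>i=0..N. \<Sum>j=0..N. (em \<alpha> (j + a - 2) * em \<alpha> (i + a) - em \<alpha> (j + a - 1) * em \<alpha> (i + a - 1)) *
       ed \<beta> j (ed \<beta> i P))"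
proof -
  let ?\<gamma> = "\<lambda>l::nat. if l = 0 then 1 else if l = 1 then - (1 + s) else if l = 2 then s else (0::laurent)"
  let ?K = "\<lambda>i j. em \<alpha> (j + a - 2) * em \<alpha> (i + a) - em \<alpha> (j + a - 1) * em \<alpha> (i + a - 1)"
  let ?t = "\<lambda>i j. ed \<beta> j (ed \<beta> i P)"
  define g where "g i j = em \<alpha> (j + a) * em \<alpha> (i + a - 2) * ?t i j" for i j
  define g' where "g' i j = em \<alpha> (i + a) * em \<alpha> (j + a - 2) * ?t i j" for i j
  have K: "Sum_any (\<lambda>l. scal (int_ext ?\<gamma> l) * em \<alpha> (j + l + (a - 2)) * em \<alpha> (i + a - l)) * ?t i j =
      scal (1 + s) * (?K i j * ?t i j) + scal s * (g i j - g' i j)" for i j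
  proof -
    have "{l. scal (int_ext ?\<gamma> l) * em \<alpha> (j + l + (a - 2)) * em \<alpha> (i + a - l) \<noteq> 0} \<subseteq> {0,1,2}"
    proof
      fix l assume "l \<in> {l. scal (int_ext ?\<gamma> l) * em \<alpha> (j + l + (a - 2)) * em \<alpha> (i + a - l) \<noteq> 0}"
      then have "int_ext ?\<gamma> l \<noteq> 0" by auto
      then show "l \<in> {0,1,2}" by (auto simp: int_ext_def split: if_splits)
    qed
    then have "Sum_any (\<lambda>l. scal (int_ext ?\<gamma> l) * em \<alpha> (j + l + (a - 2)) * em \<alpha> (i + a - l)) =
        (\<Sum>l\<in>{0,1,2}. scal (int_ext ?\<gamma> l) * em \<alpha> (j + l + (a - 2)) * em \<alpha> (i + a - l))"
      by (intro Sum_any.expand_superset) auto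
    also have "\<dots> = em \<alpha> (j + a - 2) * em \<alpha> (i + a)
        - scal (1 + s) * (em \<alpha> (j + a - 1) * em \<alpha> (i + a - 1))
        + scal s * (em \<alpha> (j + a) * em \<alpha> (i + a - 2))"
    proof -
      have "scal (- 1 - s) = - scal (1 + s)" by (simp flip: scal_uminus)
      then show ?thesis by (simp add: int_ext_def algebra_simps)
    qed
    finally have K: "Sum_any (\<lambda>l. scal (int_ext ?\<gamma> l) * em \<alpha> (j + l + (a - 2)) * em \<alpha> (i + a - l)) =
        em \<alpha> (j + a - 2) * em \<alpha> (i + a)
        - scal (1 + s) * (em \<alpha> (j + a - 1) * em \<alpha> (i + a - 1))
        + scal s * (em \<alpha> (j + a) * em \<alpha> (i + a - 2))" .
    show ?thesis
      unfolding K g_def g'_def scal_add by (simp add: algebra_simps)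
  qed
  have "(\<Sum>i=0..N. \<Sum>j=0..N. g i j) = (\<Sum>i=0..N. \<Sum>j=0..N. g' i j)"
    unfolding g_def g'_def by (subst sum.swap, subst ed_commute) simp
  then show ?thesis
    unfolding vop_vop[OF tp N] K
    by (simp add: sum.distrib sum_subtractf flip: sum_distrib_left)
qed

section \<open>The quantum group relations\<close>

lemma q_pow_mult: "q_pow a * q_pow b = q_pow (a + b)"
  by (simp add: q_pow_def mult_single)

lemma q_pow_0 [simp]: "q_pow 0 = 1"
  by (simp add: q_pow_def)

lemma q_pow_power: "q_pow a ^ n = q_pow (int n * a)"
  by (induction n) (simp_all add: q_pow_mult algebra_simps)

lemma q_pow_inj: "q_pow a = q_pow b \<longleftrightarrow> a = b"
  unfolding q_pow_def by (metis (no_types, lifting) keys_single singleton_inject zero_neq_one)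

abbreviation q_diff :: laurent where
  "q_diff \<equiv> q_pow 1 - q_pow (- 1)"

lemma q_diff_nonzero: "q_diff \<noteq> 0"
  by (simp add: q_pow_inj)

text \<open>The quantum integer [n]. The two branches make it odd in n, which is what matches the
  two opposite expansions in \<open>opE_opF_commutator\<close>.\<close>

definition qint :: "int \<Rightarrow> laurent" where
  "qint n = (if n \<ge> 0 then (\<Sum>k<nat n. q_pow (n - 1 - 2 * int k))
    else - (\<Sum>k<nat (- n). q_pow (- n - 1 - 2 * int k)))"

lemma q_diff_qint: "q_diff * qint n = q_pow n - q_pow (- n)"
proof -
  have *: "q_diff * (\<Sum>k<N. q_pow (n - 1 - 2 * int k)) = q_pow n - q_pow (n - 2 * int N)" for n N
    by (induction N) (simp_all add: algebra_simps q_pow_mult)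
  show ?thesis
    using *[of n "nat n"] *[of "- n" "nat (- n)"] by (auto simp: qint_def)
qed

lemma qint_eqI: "q_diff * x = q_pow n - q_pow (- n) \<Longrightarrow> qint n = x"
  using q_diff_qint[of n] mult_left_cancel[OF q_diff_nonzero, of "qint n" x] by simp

lemma qint_uminus: "qint (- n) = - qint n"
  by (rule qint_eqI) (simp add: q_diff_qint)

lemma qint_0 [simp]: "qint 0 = 0" and qint_1 [simp]: "qint 1 = 1"
  by (simp_all add: qint_def)

text \<open>Since log(1 - x) = - \<Sum> x^n / n, the two-point function is exp(- \<Sum> (1 + s^n)
  t^n / n) = (1 - t)(1 - s t).\<close>

lemma two_point_quadratic:
  assumes "\<And>n. n \<ge> 1 \<Longrightarrow> \<alpha> n * \<beta> n = - (1 + s ^ n)"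
  shows "two_point \<alpha> \<beta> (\<lambda>l. if l = 0 then 1 else if l = 1 then - (1 + s) else if l = 2 then s else 0)"
  unfolding two_point_def
proof (intro conjI allI)
  fix j :: nat
  let ?g = "\<lambda>l::nat. if l = 0 then 1 else if l = 1 then - (1 + s) else if l = 2 then s else (0::laurent)"
  have "j = 0 \<or> j = 1 \<or> j = 2 \<or> (\<exists>i. j = i + 3)" by presburger
  then consider "j = 0" | "j = 1" | "j = 2" | i where "j = i + 3" by blast
  then show "of_nat j * ?g j = (\<Sum>n=1..j. \<alpha> n * \<beta> n * ?g (j - n))"
  proof cases
    case 3
    have a: "\<alpha> 1 * \<beta> 1 = - (1 + s)" "\<alpha> 2 * \<beta> 2 = - (1 + s\<^sup>2)"
      using assms[of 1] assms[of 2] by simp_all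
    have "{1..2::nat} = {1,2}" by auto
    then have "(\<Sum>n=1..j. \<alpha> n * \<beta> n * ?g (j - n)) = (\<alpha> 1 * \<beta> 1) * ?g 1 + (\<alpha> 2 * \<beta> 2) * ?g 0"
      using 3 by simp
    also have "\<dots> = of_nat j * ?g j"
      unfolding a using 3 by (simp add: power2_eq_square algebra_simps)
    finally show ?thesis by simp
  next
    case (4 i)
    have a: "\<alpha> (i+1) * \<beta> (i+1) = - (1 + s ^ (i+1))" "\<alpha> (i+2) * \<beta> (i+2) = - (1 + s ^ (i+2))"
      "\<alpha> (i+3) * \<beta> (i+3) = - (1 + s ^ (i+3))"
      by (rule assms; simp)+
    have "(\<Sum>n=1..j. \<alpha> n * \<beta> n * ?g (j - n)) = (\<Sum>n\<in>{i+1,i+2,i+3}. \<alpha> n * \<beta> n * ?g (j - n))"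
      by (rule sum.mono_neutral_right) (use 4 in auto)
    also have "\<dots> = (\<alpha> (i+1) * \<beta> (i+1)) * ?g 2 + (\<alpha> (i+2) * \<beta> (i+2)) * ?g 1 + (\<alpha> (i+3) * \<beta> (i+3)) * ?g 0"
      using 4 by simp
    also have "\<dots> = 0"
      unfolding a by (simp add: power_add numeral_3_eq_3 algebra_simps)
    finally show ?thesis using 4 by simp
  qed (use assms[of 1] in simp_all)
qed simp

lemma laurent_eq_neg_self:
  assumes "(x::laurent) = - x" shows "x = 0"
proof (rule poly_mapping_eqI)
  fix k
  have "coef x k = - coef x k" using arg_cong[OF assms, of "\<lambda>x. coef x k"] by (simp only: lookup_uminus)
  then show "coef x k = coef 0 k" by (simp add: complex_eq_iff)
qed

text \<open>Here the two-point function is exp(\<Sum> (q^n + q^{-n}) t^n / n) = 1 / ((1 - q t)(1 -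
  q^{-1} t)), a product of geometric series in which t^l has the coefficient [l+1].\<close>

lemma two_point_qint:
  assumes "\<And>n. n \<ge> 1 \<Longrightarrow> \<alpha> n * \<beta> n = q_pow (int n) + q_pow (- int n)"
  shows "two_point \<alpha> \<beta> (\<lambda>l. qint (int l + 1))"
  unfolding two_point_def
proof (intro conjI allI)
  fix j :: nat
  \<comment> \<open>After multiplication by q - q^{-1}, the n-th summand is q^{j+1} - q^{-j-1} plus
    this error term, which is odd under n \<rightarrow> j + 1 - n and therefore sums to 0.\<close>
  define s where "s n = q_pow (int j + 1 - 2 * int n) - q_pow (- (int j + 1 - 2 * int n))" for n
  have "(\<Sum>n=1..j. s n) = (\<Sum>n=1..j. s (j + 1 - n))"
    by (rule sum.reindex_bij_witness[of _ "\<lambda>n. j + 1 - n" "\<lambda>n. j + 1 - n"]) auto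
  also have "\<dots> = (\<Sum>n=1..j. - s n)"
    by (intro sum.cong refl) (simp add: s_def of_nat_diff algebra_simps)
  also have "\<dots> = - (\<Sum>n=1..j. s n)" by (simp add: sum_negf)
  finally have s: "(\<Sum>n=1..j. s n) = 0" by (rule laurent_eq_neg_self)
  have "q_diff * (\<Sum>n=1..j. \<alpha> n * \<beta> n * qint (int (j - n) + 1)) =
      (\<Sum>n=1..j. (q_pow (int j + 1) - q_pow (- (int j + 1))) + s n)"
    unfolding sum_distrib_left
  proof (intro sum.cong refl)
    fix n assume n: "n \<in> {1..j}"
    have "q_diff * (\<alpha> n * \<beta> n * qint (int (j - n) + 1)) =
        \<alpha> n * \<beta> n * (q_pow (int (j - n) + 1) - q_pow (- (int (j - n) + 1)))"
      unfolding q_diff_qint[symmetric, of "int (j - n) + 1"] by (simp only: mult_ac)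
    also have "\<dots> = (q_pow (int j + 1) - q_pow (- (int j + 1))) + s n"
      using n assms[of n] by (simp add: s_def of_nat_diff algebra_simps q_pow_mult)
    finally show "q_diff * (\<alpha> n * \<beta> n * qint (int (j - n) + 1)) = \<dots>" .
  qed
  also have "\<dots> = q_diff * (of_nat j * qint (int j + 1))"
    unfolding sum.distrib s mult.left_commute[of q_diff] q_diff_qint by simp
  finally show "of_nat j * qint (int j + 1) = (\<Sum>n=1..j. \<alpha> n * \<beta> n * qint (int (j - n) + 1))"
    by (simp only: mult_left_cancel[OF q_diff_nonzero])
qed simp

section \<open>Uniqueness, rescaling and products of exponential series\<close>

lemma exp_mult_unique:
  assumes "X 0 = 1" "\<And>k. of_nat k * X k = (\<Sum>n=1..k. scal (\<alpha> n) * (b_var n * X (k - n)))"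
  shows "X k = exp_mult \<alpha> k"
proof (induction k rule: less_induct)
  case (less k)
  show ?case
  proof (cases "k = 0")
    case False
    have "of_nat k * X k = of_nat k * exp_mult \<alpha> k"
      unfolding assms(2) exp_mult_newton by (intro sum.cong refl) (simp add: less)
    then show ?thesis by (rule of_nat_mult_cancel[OF False])
  qed (simp add: assms(1))
qed

lemma exp_diff_unique:
  assumes "X 0 = P" "\<And>k. of_nat k * X k = (\<Sum>n=1..k. of_nat n * (scal (\<alpha> n) * b_diff n (X (k - n))))"
  shows "X k = exp_diff \<alpha> k P"
proof (induction k rule: less_induct)
  case (less k)
  show ?case
  proof (cases "k = 0")
    case False
    have "of_nat k * X k = of_nat k * exp_diff \<alpha> k P"
      unfolding assms(2) exp_diff_newton by (intro sum.cong refl) (simp add: less)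
    then show ?thesis by (rule of_nat_mult_cancel[OF False])
  qed (simp add: assms(1))
qed

lemma exp_mult_rescale: "scal (t ^ k) * exp_mult \<alpha> k = exp_mult (\<lambda>n. t ^ n * \<alpha> n) k"
proof (rule exp_mult_unique)
  fix k
  have "of_nat k * (scal (t ^ k) * exp_mult \<alpha> k) = scal (t ^ k) * (\<Sum>n=1..k. scal (\<alpha> n) * (b_var n * exp_mult \<alpha> (k - n)))"
    unfolding mult.left_commute[of "of_nat k"] exp_mult_newton ..
  also have "\<dots> = (\<Sum>n=1..k. scal (t ^ n * \<alpha> n) * (b_var n * (scal (t ^ (k - n)) * exp_mult \<alpha> (k - n))))"
    unfolding sum_distrib_left
  proof (intro sum.cong refl)
    fix n assume "n \<in> {1..k}"
    then have t: "t ^ k = t ^ n * t ^ (k - n)" by (simp flip: power_add)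
    show "scal (t ^ k) * (scal (\<alpha> n) * (b_var n * exp_mult \<alpha> (k - n))) =
        scal (t ^ n * \<alpha> n) * (b_var n * (scal (t ^ (k - n)) * exp_mult \<alpha> (k - n)))"
      unfolding t scal_mult by (simp only: mult_ac)
  qed
  finally show "of_nat k * (scal (t ^ k) * exp_mult \<alpha> k) = \<dots>" .
qed simp

lemma exp_diff_rescale: "scal (t ^ k) * exp_diff \<alpha> k P = exp_diff (\<lambda>n. t ^ n * \<alpha> n) k P"
proof (rule exp_diff_unique)
  fix k
  have "of_nat k * (scal (t ^ k) * exp_diff \<alpha> k P) =
      scal (t ^ k) * (\<Sum>n=1..k. of_nat n * (scal (\<alpha> n) * b_diff n (exp_diff \<alpha> (k - n) P)))"
    unfolding mult.left_commute[of "of_nat k"] exp_diff_newton ..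
  also have "\<dots> = (\<Sum>n=1..k. of_nat n * (scal (t ^ n * \<alpha> n) * b_diff n (scal (t ^ (k - n)) * exp_diff \<alpha> (k - n) P)))"
    unfolding sum_distrib_left
  proof (intro sum.cong refl)
    fix n assume "n \<in> {1..k}"
    then have t: "t ^ k = t ^ n * t ^ (k - n)" by (simp flip: power_add)
    show "scal (t ^ k) * (of_nat n * (scal (\<alpha> n) * b_diff n (exp_diff \<alpha> (k - n) P))) =
        of_nat n * (scal (t ^ n * \<alpha> n) * b_diff n (scal (t ^ (k - n)) * exp_diff \<alpha> (k - n) P))"
      unfolding t scal_mult lin_scal[OF lin_b_diff] by (simp only: mult_ac)
  qed
  finally show "of_nat k * (scal (t ^ k) * exp_diff \<alpha> k P) = \<dots>" .
qed simp

lemma convolution_newton: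
  fixes A B :: "nat \<Rightarrow> laurent bpoly"
  shows "of_nat j * (\<Sum>i\<le>j. A i * B (j - i)) =
    (\<Sum>i\<le>j. (of_nat i * A i) * B (j - i)) + (\<Sum>i\<le>j. A i * (of_nat (j - i) * B (j - i)))"
  unfolding sum_distrib_left sum.distrib[symmetric]
proof (intro sum.cong refl)
  fix i assume "i \<in> {..j}"
  then have j: "(of_nat j :: laurent bpoly) = of_nat i + of_nat (j - i)"
    by (metis atMost_iff le_add_diff_inverse of_nat_add)
  show "of_nat j * (A i * B (j - i)) = (of_nat i * A i) * B (j - i) + A i * (of_nat (j - i) * B (j - i))"
    unfolding j by (simp add: algebra_simps del: of_nat_add)
qed

lemma exp_mult_convolution:
  "(\<Sum>i\<le>k. exp_mult \<alpha> i * exp_mult \<beta> (k - i)) = exp_mult (\<lambda>n. \<alpha> n + \<beta> n) k"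
proof (rule exp_mult_unique)
  fix j
  let ?A = "exp_mult \<alpha>" and ?B = "exp_mult \<beta>"
  have 1: "(\<Sum>i\<le>j. (of_nat i * ?A i) * ?B (j - i)) =
      (\<Sum>n=1..j. \<Sum>i\<le>j-n. scal (\<alpha> n) * (b_var n * ?A i) * ?B (j - n - i))"
    unfolding exp_mult_newton sum_distrib_right by (rule sum_convolution_newton)
  have 2: "(\<Sum>i\<le>j. ?A i * (of_nat (j - i) * ?B (j - i))) =
      (\<Sum>n=1..j. \<Sum>i\<le>j-n. ?A i * (scal (\<beta> n) * (b_var n * ?B (j - n - i))))"
    unfolding exp_mult_newton sum_distrib_left by (rule sum_convolution_newton')
  show "of_nat j * (\<Sum>i\<le>j. ?A i * ?B (j - i)) =
      (\<Sum>n=1..j. scal (\<alpha> n + \<beta> n) * (b_var n * (\<Sum>i\<le>j-n. ?A i * ?B (j - n - i))))"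
    unfolding convolution_newton 1 2
    unfolding sum_distrib_left sum.distrib[symmetric] scal_add
    by (intro sum.cong refl) (simp only: distrib_right distrib_left mult_ac)
qed simp

lemma exp_diff_convolution:
  "(\<Sum>i\<le>k. exp_diff \<alpha> i (exp_diff \<beta> (k - i) P)) = exp_diff (\<lambda>n. \<alpha> n + \<beta> n) k P"
proof (rule exp_diff_unique)
  fix j
  let ?A = "exp_diff \<alpha>" and ?B = "exp_diff \<beta>"
  have 0: "of_nat j * (\<Sum>i\<le>j. ?A i (?B (j - i) P)) =
      (\<Sum>i\<le>j. of_nat i * ?A i (?B (j - i) P)) + (\<Sum>i\<le>j. ?A i (of_nat (j - i) * ?B (j - i) P))"
    unfolding sum_distrib_left sum.distrib[symmetric]
  proof (intro sum.cong refl)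
    fix i assume "i \<in> {..j}"
    then have j: "(of_nat j :: laurent bpoly) = of_nat i + of_nat (j - i)"
      by (metis atMost_iff le_add_diff_inverse of_nat_add)
    show "of_nat j * ?A i (?B (j - i) P) = of_nat i * ?A i (?B (j - i) P) + ?A i (of_nat (j - i) * ?B (j - i) P)"
      unfolding j lin_of_nat[OF lin_exp_diff] distrib_right ..
  qed
  have 1: "(\<Sum>i\<le>j. of_nat i * ?A i (?B (j - i) P)) =
      (\<Sum>n=1..j. \<Sum>i\<le>j-n. of_nat n * (scal (\<alpha> n) * b_diff n (?A i (?B (j - n - i) P))))"
    unfolding exp_diff_newton by (rule sum_convolution_newton)
  have 2: "(\<Sum>i\<le>j. ?A i (of_nat (j - i) * ?B (j - i) P)) =
      (\<Sum>n=1..j. \<Sum>i\<le>j-n. of_nat n * (scal (\<beta> n) * b_diff n (?A i (?B (j - n - i) P))))"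
    unfolding exp_diff_newton[of _ \<beta>] lin_sum[OF lin_exp_diff] lin_of_nat[OF lin_exp_diff]
      lin_scal[OF lin_exp_diff] b_diff_exp_diff[of _ \<alpha>]
    by (rule sum_convolution_newton')
  show "of_nat j * (\<Sum>i\<le>j. ?A i (?B (j - i) P)) =
      (\<Sum>n=1..j. of_nat n * (scal (\<alpha> n + \<beta> n) * b_diff n (\<Sum>i\<le>j-n. ?A i (?B (j - n - i) P))))"
    unfolding 0 1 2 lin_sum[OF lin_b_diff]
    unfolding sum_distrib_left sum.distrib[symmetric] scal_add
    by (intro sum.cong refl) (simp only: distrib_right distrib_left)
qed simp

lemma exp_mult_trivial: "(\<And>n. n \<ge> 1 \<Longrightarrow> \<alpha> n = 0) \<Longrightarrow> exp_mult \<alpha> k = (if k = 0 then 1 else 0)"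
  by (rule exp_mult_unique[symmetric]) auto

lemma exp_diff_trivial: "(\<And>n. n \<ge> 1 \<Longrightarrow> \<alpha> n = 0) \<Longrightarrow> exp_diff \<alpha> k P = (if k = 0 then P else 0)"
  by (rule exp_diff_unique[symmetric]) auto

text \<open>Read off from the vertex operators: the multiplication parts are \<Sum> \<alpha> n
  b_{-n} z^n / n, and the derivation parts contain b_n / n = (q^n + q^{-n}) \<partial>_n, in the
  case of E with the further factor -q^{-n}.\<close>

definition alphaF :: "nat \<Rightarrow> laurent" where "alphaF n = - q_pow (int n)"
definition betaF :: "nat \<Rightarrow> laurent" where "betaF n = q_pow (int n) + q_pow (- int n)"
definition alphaE :: "nat \<Rightarrow> laurent" where "alphaE n = 1"
definition betaE :: "nat \<Rightarrow> laurent" where "betaE n = - (1 + q_pow (- 2 * int n))"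

text \<open>\<open>opF m\<close> is \<open>x\<^sub>0\<^sup>-\<close> on the summand \<open>2m+1\<close>; \<open>opE m\<close> is the operator \<open>x\<^sub>0\<^sup>+\<close> of the quantum affine
  algebra, the zero mode of
  \<open>exp (\<Sum> b\<^bsub>-n\<^esub> z\<^sup>n / n) exp (- \<Sum> b\<^sub>n (q z)\<^bsup>-n\<^esup> / n) e\<^bsup>\<alpha>\<^sub>1\<^esup> z\<^bsup>\<partial>\<^esup>\<close>.\<close>

definition opF :: "int \<Rightarrow> laurent bpoly \<Rightarrow> laurent bpoly" where
  "opF m = vop alphaF betaF (2 * m)"

definition opE :: "int \<Rightarrow> laurent bpoly \<Rightarrow> laurent bpoly" where
  "opE m = vop alphaE betaE (- 2 * m - 2)"

lemma two_point_FF: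
  "two_point alphaF betaF (\<lambda>l. if l = 0 then 1 else if l = 1 then - (1 + q_pow 2) else if l = 2 then q_pow 2 else 0)"
  by (rule two_point_quadratic)
    (simp add: alphaF_def betaF_def q_pow_power distrib_left q_pow_mult mult.commute)

lemma two_point_EE:
  "two_point alphaE betaE (\<lambda>l. if l = 0 then 1 else if l = 1 then - (1 + q_pow (-2)) else if l = 2 then q_pow (-2) else 0)"
  by (rule two_point_quadratic)
    (simp add: alphaE_def betaE_def q_pow_power mult.commute)

lemma two_point_EF: "two_point alphaF betaE (\<lambda>l. qint (int l + 1))"
  by (rule two_point_qint)
    (simp add: alphaF_def betaE_def algebra_simps q_pow_mult)

lemma two_point_FE: "two_point alphaE betaF (\<lambda>l. qint (int l + 1))"
  by (rule two_point_qint) (simp add: alphaE_def betaF_def)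

lemma Sum_any_reflect: "Sum_any (\<lambda>j. g (c - j)) = Sum_any (g :: int \<Rightarrow> 'a::comm_monoid_add)"
  by (rule Sum_any.reindex_cong[symmetric, of "\<lambda>j. c - j"])
    (auto intro!: bij_betwI[of _ _ _ "\<lambda>j. c - j"])

lemma Sum_any_em_convolution:
  assumes "n \<ge> 0"
  shows "Sum_any (\<lambda>x. scal (q_pow (e * x)) * em \<alpha> x * em \<beta> (n - x)) =
    exp_mult (\<lambda>k. q_pow (e * int k) * \<alpha> k + \<beta> k) (nat n)"
proof -
  let ?f = "\<lambda>x. scal (q_pow (e * x)) * em \<alpha> x * em \<beta> (n - x)"
  have "{x. ?f x \<noteq> 0} \<subseteq> int ` {..nat n}"
  proof
    fix x assume "x \<in> {x. ?f x \<noteq> 0}"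
    then have "\<not> x < 0" "\<not> n - x < 0" by auto
    then show "x \<in> int ` {..nat n}" by (intro image_eqI[of _ _ "nat x"]) auto
  qed
  then have "Sum_any ?f = (\<Sum>x\<in>int ` {..nat n}. ?f x)"
    by (intro Sum_any.expand_superset) auto
  also have "\<dots> = (\<Sum>i\<le>nat n. ?f (int i))"
    by (simp add: sum.reindex)
  also have "\<dots> = (\<Sum>i\<le>nat n. exp_mult (\<lambda>k. q_pow e ^ k * \<alpha> k) i * exp_mult \<beta> (nat n - i))"
  proof (intro sum.cong refl)
    fix i assume "i \<in> {..nat n}"
    then have "\<not> n - int i < 0" "nat (n - int i) = nat n - i" using assms by auto
    then show "?f (int i) = exp_mult (\<lambda>k. q_pow e ^ k * \<alpha> k) i * exp_mult \<beta> (nat n - i)"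
      unfolding exp_mult_rescale[symmetric] by (simp add: em_def q_pow_power mult.commute)
  qed
  also have "\<dots> = exp_mult (\<lambda>k. q_pow e ^ k * \<alpha> k + \<beta> k) (nat n)"
    by (rule exp_mult_convolution)
  finally show ?thesis by (simp add: q_pow_power mult.commute)
qed

lemma sum_square_antidiagonal:
  fixes g :: "int \<Rightarrow> int \<Rightarrow> 'a::comm_monoid_add"
  assumes "\<And>i j. i > int M \<or> j > int M \<Longrightarrow> g i j = 0"
  shows "(\<Sum>i=0..int M. \<Sum>j=0..int M. g i j) = (\<Sum>n\<le>2 * M. \<Sum>j\<le>n. g (int (n - j)) (int j))"
proof -
  have "(\<Sum>i=0..int M. \<Sum>j=0..int M. g i j) = (\<Sum>(i,j)\<in>{0..int M} \<times> {0..int M}. g i j)"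
    by (simp add: sum.cartesian_product)
  also have "\<dots> = (\<Sum>(n,j)\<in>Sigma {..2 * M} (\<lambda>n. {..n}). g (int (n - j)) (int j))"
  proof (rule sum.reindex_bij_witness_not_neutral[
      of "Sigma {} (\<lambda>n. {})" "{(n,j)\<in>Sigma {..2 * M} (\<lambda>n. {..n}). n - j > M \<or> j > M}" _
        "\<lambda>(n,j). (int (n - j), int j)" "\<lambda>(i,j). (nat (i + j), nat j)"])
    show "finite {(n,j)\<in>Sigma {..2 * M} (\<lambda>n. {..n}). n - j > M \<or> j > M}"
      by (rule finite_subset[of _ "Sigma {..2 * M} (\<lambda>n. {..n})"]) auto
  qed (auto intro: assms)
  also have "\<dots> = (\<Sum>n\<le>2 * M. \<Sum>j\<le>n. g (int (n - j)) (int j))"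
    by (rule sum.Sigma[symmetric]) auto
  finally show ?thesis .
qed

text \<open>After rescaling, the derivation part of E becomes the inverse of that of F; this is one
  of the two cancellations in the commutator.\<close>

lemma ed_E_rescale: "scal (q_pow j) * ed betaE j P = ed (\<lambda>n. - betaF n) j P"
proof (cases "j < 0")
  case False
  have "scal (q_pow 1 ^ nat j) * exp_diff betaE (nat j) P = exp_diff (\<lambda>n. q_pow 1 ^ n * betaE n) (nat j) P"
    by (rule exp_diff_rescale)
  moreover have "(\<lambda>n. q_pow 1 ^ n * betaE n) = (\<lambda>n. - betaF n)"
    by (simp add: fun_eq_iff betaE_def betaF_def q_pow_power algebra_simps q_pow_mult)
  ultimately show ?thesis using False by (simp add: ed_def q_pow_power)
qed simp

lemma scal_nonzero: "c \<noteq> 0 \<Longrightarrow> scal c \<noteq> 0"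
  by (metis lookup_single_eq lookup_zero)

text \<open>Up to a monomial in the ratio x of the two variables, the two orders of the product give
  the expansions of 1 / ((1 - q x)(1 - q^{-1} x)) in opposite directions. The difference has the
  two-sided kernel \<Sum> [l+1] x^l, which times q - q^{-1} is a difference of two delta functions.
  At one pole the multiplication parts of E and F cancel, at the other the derivation parts do; as
  the composite has weight 0, the remaining part then contributes only its constant term, and a
  power of q is left.\<close>

theorem opE_opF_commutator:
  "scal q_diff * (opE (m - 1) (opF m P) - opF (m + 1) (opE m P)) =
    scal (q_pow (2 * m + 1) - q_pow (- (2 * m + 1))) * P"
proof -
  obtain N' where N': "N' \<ge> 0" "ed_bounded N' P" using ed_bounded_exists by meson
  define M where "M = nat N'"
  have N: "ed_bounded (int M) P" using N' by (simp add: M_def)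
  let ?N = "int M"
  define t where "t i j = ed betaE j (ed betaF i P)" for i j
  have t0: "t i j = 0" if "i > int M \<or> j > int M" for i j
    using that N ed_bounded_ed[OF N] by (auto simp: t_def ed_bounded_def lin_zero[OF lin_ed])
  \<comment> \<open>One kernel describes both composites. E F uses its part with l \<ge> 0; F E is
    minus its part with l \<le> -2, by l \<rightarrow> -2 - l and oddness of the quantum integer.
    The missing l = -1 carries the coefficient [0] = 0.\<close>
  define G where "G i j l = scal (qint (l + 1)) * em alphaE (j + l - 2 * m) * em alphaF (i + 2 * m - l)" for i j l
  define K1 where "K1 i j = Sum_any (\<lambda>l. if l \<ge> 0 then G i j l else 0)" for i j
  define K2 where "K2 i j = Sum_any (\<lambda>l. if l \<le> -2 then G i j l else 0)" for i j
  have fin: "finite {l. G i j l \<noteq> 0}" for i j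
  proof (rule finite_subset[of _ "{2 * m - j..i + 2 * m}"])
    show "{l. G i j l \<noteq> 0} \<subseteq> {2 * m - j..i + 2 * m}"
    proof
      fix l assume "l \<in> {l. G i j l \<noteq> 0}"
      then have "\<not> j + l - 2 * m < 0" "\<not> i + 2 * m - l < 0" by (auto simp: G_def)
      then show "l \<in> {2 * m - j..i + 2 * m}" by auto
    qed
  qed simp
  have EF: "opE (m - 1) (opF m P) = (\<Sum>i=0..?N. \<Sum>j=0..?N. K1 i j * t i j)"
    unfolding opE_def opF_def vop_vop[OF two_point_EF N] K1_def t_def
    by (intro sum.cong refl arg_cong2[where f = "(*)"] Sum_any.cong)
      (simp add: int_ext_def G_def algebra_simps)
  have FE: "opF (m + 1) (opE m P) = - (\<Sum>i=0..?N. \<Sum>j=0..?N. K2 i j * t i j)"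
  proof -
    have "Sum_any (\<lambda>l. scal (int_ext (\<lambda>l. qint (int l + 1)) l) * em alphaF (i + l + 2 * (m + 1)) * em alphaE (j + (- 2 * m - 2) - l)) =
        - K2 i j" for i j
    proof -
      let ?h = "\<lambda>l. if l \<le> -2 then G i j l else 0"
      have "Sum_any (\<lambda>l. scal (int_ext (\<lambda>l. qint (int l + 1)) l) * em alphaF (i + l + 2 * (m + 1)) * em alphaE (j + (- 2 * m - 2) - l)) =
          Sum_any (\<lambda>l. - ?h (- 2 - l))"
      proof (rule Sum_any.cong)
        fix l
        have "qint (- 1 - l) = - qint (l + 1)"
          using qint_uminus[of "l + 1"] by (simp add: algebra_simps)
        then show "scal (int_ext (\<lambda>l. qint (int l + 1)) l) * em alphaF (i + l + 2 * (m + 1)) * em alphaE (j + (- 2 * m - 2) - l) =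
            - ?h (- 2 - l)"
          by (simp add: int_ext_def G_def scal_uminus algebra_simps)
      qed
      also have "\<dots> = Sum_any (\<lambda>l. - ?h l)"
        by (rule Sum_any_reflect)
      also have "\<dots> = - Sum_any ?h"
        by (simp add: Sum_any.expand_set sum_negf)
      finally show ?thesis by (simp add: K2_def)
    qed
    then have "opF (m + 1) (opE m P) = (\<Sum>j=0..?N. \<Sum>i=0..?N. - K2 i j * ed betaF i (ed betaE j P))"
      unfolding opE_def opF_def vop_vop[OF two_point_FE N] by simp
    also have "\<dots> = (\<Sum>i=0..?N. \<Sum>j=0..?N. - K2 i j * t i j)"
      unfolding t_def by (subst sum.swap, subst ed_commute) simp
    finally show ?thesis by (simp add: sum_negf)
  qed
  have K: "K1 i j + K2 i j = Sum_any (G i j)" for i j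
  proof -
    have "Sum_any (G i j) = Sum_any (\<lambda>l. (if l \<ge> 0 then G i j l else 0) + (if l \<le> -2 then G i j l else 0))"
    proof (rule Sum_any.cong)
      fix l :: int
      have "l = -1 \<or> l \<ge> 0 \<or> l \<le> -2" by presburger
      then show "G i j l = (if l \<ge> 0 then G i j l else 0) + (if l \<le> -2 then G i j l else 0)"
        by (auto simp: G_def)
    qed
    also have "\<dots> = K1 i j + K2 i j"
      unfolding K1_def K2_def
      by (rule Sum_any.distrib; rule finite_subset[OF _ fin[of i j]]) auto
    finally show ?thesis by simp
  qed
  define R where "R = exp_mult (\<lambda>k. q_pow (- int k) * alphaE k + alphaF k)"
  have K': "scal q_diff * Sum_any (G i j) =
      scal (q_pow (2 * m + 1 - j)) * (if nat (i + j) = 0 then 1 else 0) -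
      scal (q_pow (- (2 * m + 1))) * (scal (q_pow j) * R (nat (i + j)))"
    if "i \<ge> 0" "j \<ge> 0" for i j
  proof -
    let ?A = "\<lambda>e x. scal (q_pow (e * x)) * em alphaE x * em alphaF (i + j - x)"
    have fin': "finite {x. ?A e x \<noteq> 0}" for e
      by (rule finite_subset[OF _ finite_kernel_support[of "\<lambda>_. 1" "\<lambda>x. scal (q_pow (e * x)) * em alphaE x" alphaF "i + j"]])
        (auto simp: int_ext_def)
    have "scal q_diff * Sum_any (G i j) = Sum_any (\<lambda>l. scal q_diff * G i j l)"
      by (rule Sum_any_right_distrib[OF fin])
    also have "\<dots> = Sum_any (\<lambda>l. scal (q_pow (2 * m + 1 - j)) * ?A 1 (l + (j - 2 * m)) +
        (- scal (q_pow (j - (2 * m + 1)))) * ?A (- 1) (l + (j - 2 * m)))"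
    proof (rule Sum_any.cong)
      fix l
      have "scal q_diff * scal (qint (l + 1)) = scal (q_pow (l + 1)) - scal (q_pow (- (l + 1)))"
        unfolding scal_mult[symmetric] q_diff_qint by (rule single_diff)
      moreover have "scal (q_pow (2 * m + 1 - j)) * scal (q_pow (1 * (l + (j - 2 * m)))) = scal (q_pow (l + 1))"
        "scal (q_pow (j - (2 * m + 1))) * scal (q_pow (- 1 * (l + (j - 2 * m)))) = scal (q_pow (- (l + 1)))"
        by (simp_all add: scal_mult[symmetric] q_pow_mult add.commute)
      moreover have "i + j - (l + (j - 2 * m)) = i + 2 * m - l" "l + (j - 2 * m) = j + l - 2 * m" by auto
      ultimately show "scal q_diff * G i j l = scal (q_pow (2 * m + 1 - j)) * ?A 1 (l + (j - 2 * m)) +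
        (- scal (q_pow (j - (2 * m + 1)))) * ?A (- 1) (l + (j - 2 * m))"
        unfolding G_def by (simp only: mult.assoc[symmetric] mult_minus_left left_diff_distrib) simp
    qed
    also have "\<dots> = Sum_any (\<lambda>x. scal (q_pow (2 * m + 1 - j)) * ?A 1 x +
        (- scal (q_pow (j - (2 * m + 1)))) * ?A (- 1) x)"
      by (rule Sum_any_shift)
    also have "\<dots> = Sum_any (\<lambda>x. scal (q_pow (2 * m + 1 - j)) * ?A 1 x) +
        Sum_any (\<lambda>x. (- scal (q_pow (j - (2 * m + 1)))) * ?A (- 1) x)"
    proof (rule Sum_any.distrib)
      show "finite {x. scal (q_pow (2 * m + 1 - j)) * ?A 1 x \<noteq> 0}"
        by (rule finite_subset[OF _ fin'[of 1]]) auto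
      show "finite {x. (- scal (q_pow (j - (2 * m + 1)))) * ?A (- 1) x \<noteq> 0}"
        by (rule finite_subset[OF _ fin'[of "- 1"]]) auto
    qed
    also have "\<dots> = scal (q_pow (2 * m + 1 - j)) * Sum_any (?A 1) - scal (q_pow (j - (2 * m + 1))) * Sum_any (?A (- 1))"
      unfolding Sum_any_right_distrib[OF fin', symmetric] by simp
    \<comment> \<open>At this pole the rescaled \<open>alphaE\<close> is the negative of
      \<open>alphaF\<close>, so the multiplication parts cancel.\<close>
    also have "Sum_any (?A 1) = (if nat (i + j) = 0 then 1 else 0)"
    proof -
      have "Sum_any (?A 1) = exp_mult (\<lambda>k. q_pow (1 * int k) * alphaE k + alphaF k) (nat (i + j))"
        by (rule Sum_any_em_convolution) (use that in simp)
      also have "\<dots> = (if nat (i + j) = 0 then 1 else 0)"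
        by (rule exp_mult_trivial) (simp add: alphaE_def alphaF_def)
      finally show ?thesis .
    qed
    also have "Sum_any (?A (- 1)) = R (nat (i + j))"
      using that Sum_any_em_convolution[of "i + j" "- 1" alphaE alphaF] by (simp add: R_def)
    also have "scal (q_pow (j - (2 * m + 1))) = scal (q_pow (- (2 * m + 1))) * scal (q_pow j)"
    proof -
      have "j - (2 * m + 1) = - (2 * m + 1) + j" by simp
      then show ?thesis by (simp only: scal_mult[symmetric] q_pow_mult)
    qed
    finally show ?thesis by (simp only: mult.assoc)
  qed
  have "scal q_diff * (opE (m - 1) (opF m P) - opF (m + 1) (opE m P)) =
      (\<Sum>i=0..?N. \<Sum>j=0..?N. scal q_diff * Sum_any (G i j) * t i j)"
    unfolding EF FE K[symmetric] diff_minus_eq_add sum.distrib[symmetric] sum_distrib_left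
      mult.assoc distrib_right[symmetric] ..
  also have "\<dots> = (\<Sum>i=0..?N. \<Sum>j=0..?N. (scal (q_pow (2 * m + 1 - j)) * (if nat (i + j) = 0 then 1 else 0)) * t i j) -
      scal (q_pow (- (2 * m + 1))) * (\<Sum>i=0..?N. \<Sum>j=0..?N. R (nat (i + j)) * (scal (q_pow j) * t i j))"
    unfolding sum_distrib_left sum_subtractf[symmetric]
  proof (intro sum.cong refl)
    fix i j assume "i \<in> {0..?N}" "j \<in> {0..?N}"
    then have ij: "i \<ge> 0" "j \<ge> 0" by auto
    show "scal q_diff * Sum_any (G i j) * t i j =
        (scal (q_pow (2 * m + 1 - j)) * (if nat (i + j) = 0 then 1 else 0)) * t i j -
        scal (q_pow (- (2 * m + 1))) * (R (nat (i + j)) * (scal (q_pow j) * t i j))"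
      unfolding K'[OF ij] left_diff_distrib by (simp only: mult_ac)
  qed
  also have "(\<Sum>i=0..?N. \<Sum>j=0..?N. (scal (q_pow (2 * m + 1 - j)) * (if nat (i + j) = 0 then 1 else 0)) * t i j) =
      scal (q_pow (2 * m + 1)) * P"
  proof -
    have "(\<Sum>i=0..?N. \<Sum>j=0..?N. (scal (q_pow (2 * m + 1 - j)) * (if nat (i + j) = 0 then 1 else 0)) * t i j) =
        (\<Sum>i=0..?N. \<Sum>j=0..?N. if j = 0 then if i = 0 then scal (q_pow (2 * m + 1)) * P else 0 else 0)"
      by (intro sum.cong refl) (auto simp: t_def)
    then show ?thesis by (simp add: sum.delta')
  qed
  \<comment> \<open>At the other pole the derivation parts are inverse to each other on every
    antidiagonal, so of all the \<open>R n\<close> only \<open>R 0\<close> = 1 survives.\<close>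
  also have "(\<Sum>i=0..?N. \<Sum>j=0..?N. R (nat (i + j)) * (scal (q_pow j) * t i j)) = P"
  proof -
    have "(\<Sum>i=0..?N. \<Sum>j=0..?N. R (nat (i + j)) * (scal (q_pow j) * t i j)) =
        (\<Sum>n\<le>2 * M. \<Sum>j\<le>n. R (nat (int (n - j) + int j)) * (scal (q_pow (int j)) * t (int (n - j)) (int j)))"
      by (rule sum_square_antidiagonal) (auto simp: t0)
    also have "\<dots> = (\<Sum>n\<le>2 * M. R n * (\<Sum>j\<le>n. exp_diff (\<lambda>n. - betaF n) j (exp_diff betaF (n - j) P)))"
      unfolding sum_distrib_left t_def ed_E_rescale
      by (intro sum.cong refl) (auto simp: ed_def nat_add_distrib simp del: of_nat_diff)
    also have "\<dots> = (\<Sum>n\<le>2 * M. if n = 0 then P else 0)"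
    proof (intro sum.cong refl)
      fix n
      have "exp_diff (\<lambda>n. - betaF n + betaF n) n P = (if n = 0 then P else 0)"
        by (rule exp_diff_trivial) simp
      then show "R n * (\<Sum>j\<le>n. exp_diff (\<lambda>n. - betaF n) j (exp_diff betaF (n - j) P)) = (if n = 0 then P else 0)"
        unfolding exp_diff_convolution by (cases "n = 0") (simp_all add: R_def)
    qed
    also have "\<dots> = P" by simp
    finally show ?thesis .
  qed
  finally show ?thesis by (simp add: single_diff left_diff_distrib)
qed

corollary opE_opF: "opE (m - 1) (opF m P) = opF (m + 1) (opE m P) + scal (qint (2 * m + 1)) * P"
proof -
  have "scal q_diff * (opE (m - 1) (opF m P) - opF (m + 1) (opE m P)) = scal q_diff * (scal (qint (2 * m + 1)) * P)"
    unfolding opE_opF_commutator q_diff_qint[of "2 * m + 1", symmetric] scal_mult mult.assoc ..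
  then have "opE (m - 1) (opF m P) - opF (m + 1) (opE m P) = scal (qint (2 * m + 1)) * P"
    by (simp only: mult_left_cancel[OF scal_nonzero[OF q_diff_nonzero]])
  then show ?thesis by (simp add: diff_eq_eq add.commute)
qed

section \<open>Divided powers\<close>

text \<open>The composite in \<open>vop_square\<close> with its factor 1 + s removed, which makes
  sense also at q = i, where 1 + q^2 and 1 + q^{-2} vanish. The powers of q in \<open>opF2\<close>
  and \<open>opE2\<close> come from 1 + q^2 = q (q + q^{-1}) and its inverse-q analogue.\<close>

definition vop2 :: "(nat \<Rightarrow> laurent) \<Rightarrow> (nat \<Rightarrow> laurent) \<Rightarrow> int \<Rightarrow> laurent bpoly \<Rightarrow> laurent bpoly" where
  "vop2 \<alpha> \<beta> a P = Sum_any (\<lambda>i. Sum_any (\<lambda>j.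
     (em \<alpha> (j + a - 2) * em \<alpha> (i + a) - em \<alpha> (j + a - 1) * em \<alpha> (i + a - 1)) * ed \<beta> j (ed \<beta> i P)))"

lemma vop2_eq_sum:
  assumes "ed_bounded N P"
  shows "vop2 \<alpha> \<beta> a P = (\<Sum>i=0..N. \<Sum>j=0..N.
    (em \<alpha> (j + a - 2) * em \<alpha> (i + a) - em \<alpha> (j + a - 1) * em \<alpha> (i + a - 1)) * ed \<beta> j (ed \<beta> i P))"
proof -
  let ?K = "\<lambda>i j. em \<alpha> (j + a - 2) * em \<alpha> (i + a) - em \<alpha> (j + a - 1) * em \<alpha> (i + a - 1)"
  have "vop2 \<alpha> \<beta> a P = Sum_any (\<lambda>i. \<Sum>j=0..N. ?K i j * ed \<beta> j (ed \<beta> i P))"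
    unfolding vop2_def by (intro Sum_any.cong Sum_any_ed ed_bounded_ed assms)
  also have "\<dots> = (\<Sum>i=0..N. \<Sum>j=0..N. ?K i j * ed \<beta> j (ed \<beta> i P))"
  proof (rule Sum_any.expand_superset)
    show "{i. (\<Sum>j=0..N. ?K i j * ed \<beta> j (ed \<beta> i P)) \<noteq> 0} \<subseteq> {0..N}"
    proof
      fix i assume "i \<in> {i. (\<Sum>j=0..N. ?K i j * ed \<beta> j (ed \<beta> i P)) \<noteq> 0}"
      then have "\<not> i < 0" "\<not> i > N" using assms by (auto simp: ed_bounded_def)
      then show "i \<in> {0..N}" by auto
    qed
  qed simp
  finally show ?thesis .
qed

lemma ed_bounded_pair: "\<exists>N. ed_bounded N P \<and> ed_bounded N Q"
  using ed_bounded_exists[of P] ed_bounded_exists[of Q] ed_bounded_mono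
  by (meson max.cobounded1 max.cobounded2)

lemma lin_vop2: "lin (vop2 \<alpha> \<beta> a)"
proof (rule linI)
  fix P Q
  obtain N where *: "ed_bounded N P" "ed_bounded N Q"
    using ed_bounded_pair by blast
  then have "ed_bounded N (P + Q)"
    by (simp add: ed_bounded_def lin_add[OF lin_ed])
  then show "vop2 \<alpha> \<beta> a (P + Q) = vop2 \<alpha> \<beta> a P + vop2 \<alpha> \<beta> a Q"
    using * by (simp add: vop2_eq_sum lin_add[OF lin_ed] distrib_left sum.distrib)
next
  fix c P
  obtain N where *: "ed_bounded N P"
    using ed_bounded_exists by meson
  then have "ed_bounded N (scal c * P)"
    by (simp add: ed_bounded_def lin_scal[OF lin_ed])
  then show "vop2 \<alpha> \<beta> a (scal c * P) = scal c * vop2 \<alpha> \<beta> a P"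
    using * by (simp add: vop2_eq_sum lin_scal[OF lin_ed] sum_distrib_left mult.left_commute)
qed

lemma wt_hom_vop2: "wt_hom (vop2 \<alpha> \<beta> a) (2 * a - 2)"
proof -
  have *: "wt_hom (\<lambda>P. em \<alpha> k * (em \<alpha> l * ed \<beta> j (ed \<beta> i P))) (2 * a - 2)"
    if "k + l = i + j + 2 * a - 2" for i j k l
  proof -
    have "wt_hom (\<lambda>P. em \<alpha> k * (em \<alpha> l * ed \<beta> j (ed \<beta> i P))) (- j + - i + l + k)"
      by (intro wt_hom_mult wt_hom_comp[OF wt_hom_ed wt_hom_ed]) (auto simp: wt_em)
    moreover have "- j + - i + l + k = 2 * a - 2" using that by simp
    ultimately show ?thesis by simp
  qed
  show ?thesis
    unfolding vop2_def[abs_def] left_diff_distrib mult.assoc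
    by (intro wt_hom_Sum_any wt_hom_minus *) auto
qed

abbreviation q_sum :: laurent where
  "q_sum \<equiv> q_pow 1 + q_pow (- 1)"

lemma q_sum_nonzero: "q_sum \<noteq> 0"
proof
  assume "q_sum = 0"
  then have "coef q_sum 1 = 0" by simp
  then show False by (simp add: q_pow_def lookup_add lookup_single)
qed

lemma q_sum_cancel: "scal q_sum * P = scal q_sum * Q \<Longrightarrow> P = Q"
  by (simp only: mult_left_cancel[OF scal_nonzero[OF q_sum_nonzero]])

definition opF2 :: "int \<Rightarrow> laurent bpoly \<Rightarrow> laurent bpoly" where
  "opF2 m P = scal (q_pow 1) * vop2 alphaF betaF (2 * m) P"

definition opE2 :: "int \<Rightarrow> laurent bpoly \<Rightarrow> laurent bpoly" where
  "opE2 m P = scal (q_pow (- 1)) * vop2 alphaE betaE (- 2 * m - 2) P"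

lemma lin_op: "lin (opF m)" "lin (opE m)" "lin (opF2 m)" "lin (opE2 m)"
  unfolding opF_def opE_def opF2_def[abs_def] opE2_def[abs_def]
  by (intro lin_vop lin_mult lin_vop2)+

lemma opF_opF: "opF (m - 1) (opF m P) = scal q_sum * opF2 m P"
proof -
  obtain N where N: "ed_bounded N P" using ed_bounded_exists by meson
  have "1 + q_pow 2 = q_sum * q_pow 1" by (simp add: algebra_simps q_pow_mult)
  then show ?thesis
    using vop_square[OF two_point_FF N, of "2 * m"]
    by (simp add: opF_def opF2_def vop2_eq_sum[OF N] scal_mult mult.assoc)
qed

lemma opE_opE: "opE (m + 1) (opE m P) = scal q_sum * opE2 m P"
proof -
  obtain N where N: "ed_bounded N P" using ed_bounded_exists by meson
  have "1 + q_pow (- 2) = q_sum * q_pow (- 1)" by (simp add: algebra_simps q_pow_mult)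
  then show ?thesis
    using vop_square[OF two_point_EE N, of "- 2 * m - 2"]
    by (simp add: opE_def opE2_def vop2_eq_sum[OF N] scal_mult mult.assoc)
qed

lemma qint_sum: "qint (n + 1) + qint (n - 1) = q_sum * qint n"
proof -
  have "q_diff * (qint (n + 1) + qint (n - 1)) = q_sum * (q_diff * qint n)"
    unfolding distrib_left q_diff_qint by (simp add: algebra_simps q_pow_mult)
  then have "q_diff * (qint (n + 1) + qint (n - 1)) = q_diff * (q_sum * qint n)"
    by (simp only: mult.left_commute)
  then show ?thesis by (simp only: mult_left_cancel[OF q_diff_nonzero])
qed

text \<open>This is [2m] / [2], the quantum integer of m at q^2, with the division by q + q^{-1}
  carried out so that it can be specialized.\<close>

definition qint2 :: "int \<Rightarrow> laurent" where
  "qint2 m = (\<Sum>k<nat m. q_pow (2 * (m - 1 - 2 * int k)))"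

lemma q_sum_qint2: "m \<ge> 0 \<Longrightarrow> q_sum * qint2 m = qint (2 * m)"
proof -
  assume m: "m \<ge> 0"
  have "(q_diff * q_sum) * (\<Sum>k<N. q_pow (2 * (m - 1 - 2 * int k))) = q_pow (2 * m) - q_pow (2 * m - 4 * int N)" for N
    by (induction N) (simp_all add: algebra_simps q_pow_mult)
  from this[of "nat m"] show ?thesis
    using m by (intro qint_eqI[symmetric]) (simp add: qint2_def mult.assoc)
qed

text \<open>Multiplication by q + q^{-1} replaces the divided square by a composite, to which
  \<open>opE_opF\<close> applies twice; the two quantum integers combine by \<open>qint_sum\<close>,
  and the factor cancels because the lattice has no torsion.\<close>

lemma opE_opF2: "opE (m - 2) (opF2 m P) = opF2 (m + 1) (opE m P) + scal (qint (2 * m)) * opF m P"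
proof (rule q_sum_cancel)
  have "scal q_sum * opE (m - 2) (opF2 m P) = opE ((m - 1) - 1) (opF (m - 1) (opF m P))"
    by (simp add: opF_opF lin_scal[OF lin_op(2)])
  also have "\<dots> = opF m (opE (m - 1) (opF m P)) + scal (qint (2 * m - 1)) * opF m P"
    using opE_opF[of "m - 1" "opF m P"] by (simp add: algebra_simps)
  also have "\<dots> = opF m (opF (m + 1) (opE m P)) + (scal (qint (2 * m + 1)) + scal (qint (2 * m - 1))) * opF m P"
    by (simp add: opE_opF lin_add[OF lin_op(1)] lin_scal[OF lin_op(1)] distrib_right add.assoc)
  also have "opF m (opF (m + 1) (opE m P)) = scal q_sum * opF2 (m + 1) (opE m P)"
    using opF_opF[of "m + 1"] by simp
  also have "scal (qint (2 * m + 1)) + scal (qint (2 * m - 1)) = scal q_sum * scal (qint (2 * m))"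
    by (simp only: scal_add[symmetric] qint_sum scal_mult)
  finally show "scal q_sum * opE (m - 2) (opF2 m P) =
      scal q_sum * (opF2 (m + 1) (opE m P) + scal (qint (2 * m)) * opF m P)"
    by (simp only: distrib_left mult.assoc)
qed

lemma opF_opF2: "opF (m - 2) (opF2 m P) = opF2 (m - 1) (opF m P)"
proof (rule q_sum_cancel)
  have "scal q_sum * opF (m - 2) (opF2 m P) = opF (m - 1 - 1) (opF (m - 1) (opF m P))"
    by (simp add: opF_opF lin_scal[OF lin_op(1)])
  also have "\<dots> = scal q_sum * opF2 (m - 1) (opF m P)" by (rule opF_opF)
  finally show "scal q_sum * opF (m - 2) (opF2 m P) = scal q_sum * opF2 (m - 1) (opF m P)" .
qed

lemma opE_opE2: "opE (m + 2) (opE2 m P) = opE2 (m + 1) (opE m P)"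
proof (rule q_sum_cancel)
  have "scal q_sum * opE (m + 2) (opE2 m P) = opE (m + 1 + 1) (opE (m + 1) (opE m P))"
    by (simp add: opE_opE lin_scal[OF lin_op(2)] add.assoc)
  also have "\<dots> = scal q_sum * opE2 (m + 1) (opE m P)" by (rule opE_opE)
  finally show "scal q_sum * opE (m + 2) (opE2 m P) = scal q_sum * opE2 (m + 1) (opE m P)" .
qed

text \<open>The factor q + q^{-1} is produced in each summand separately: by \<open>opE_opE\<close>,
  by \<open>qint_sum\<close>, and by [2m] = [2] \<open>qint2 m\<close>, which is where m \<ge> 0
  enters.\<close>

lemma opE2_opF2:
  assumes "m \<ge> 0"
  shows "opE2 (m - 2) (opF2 m P) = opF2 (m + 2) (opE2 m P) +
    scal (qint (2 * m + 1)) * opF (m + 1) (opE m P) + scal (qint2 m * qint (2 * m + 1)) * P"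
proof (rule q_sum_cancel)
  have "scal q_sum * opE2 (m - 2) (opF2 m P) = opE (m - 1) (opE (m - 2) (opF2 m P))"
    using opE_opE[of "m - 2"] by simp
  also have "\<dots> = opE (m - 1) (opF2 (m + 1) (opE m P)) + scal (qint (2 * m)) * opE (m - 1) (opF m P)"
    by (simp add: opE_opF2 lin_add[OF lin_op(2)] lin_scal[OF lin_op(2)])
  also have "opE (m - 1) (opF2 (m + 1) (opE m P)) =
      opF2 (m + 2) (opE (m + 1) (opE m P)) + scal (qint (2 * m + 2)) * opF (m + 1) (opE m P)"
    using opE_opF2[of "m + 1" "opE m P"] by (simp add: algebra_simps)
  also have "opF2 (m + 2) (opE (m + 1) (opE m P)) = scal q_sum * opF2 (m + 2) (opE2 m P)"
    by (simp add: opE_opE lin_scal[OF lin_op(3)])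
  also have "opE (m - 1) (opF m P) = opF (m + 1) (opE m P) + scal (qint (2 * m + 1)) * P"
    by (rule opE_opF)
  also have "scal q_sum * opF2 (m + 2) (opE2 m P) + scal (qint (2 * m + 2)) * opF (m + 1) (opE m P) +
      scal (qint (2 * m)) * (opF (m + 1) (opE m P) + scal (qint (2 * m + 1)) * P) =
      scal q_sum * opF2 (m + 2) (opE2 m P) +
      (scal (qint (2 * m + 1 + 1)) + scal (qint (2 * m + 1 - 1))) * opF (m + 1) (opE m P) +
      scal (qint (2 * m)) * (scal (qint (2 * m + 1)) * P)"
    by (simp add: algebra_simps)
  also have "scal (qint (2 * m + 1 + 1)) + scal (qint (2 * m + 1 - 1)) = scal q_sum * scal (qint (2 * m + 1))"
    by (simp only: scal_add[symmetric] qint_sum scal_mult)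
  also have "scal (qint (2 * m)) = scal q_sum * scal (qint2 m)"
    by (simp only: q_sum_qint2[OF assms, symmetric] scal_mult)
  finally show "scal q_sum * opE2 (m - 2) (opF2 m P) = scal q_sum * (opF2 (m + 2) (opE2 m P) +
    scal (qint (2 * m + 1)) * opF (m + 1) (opE m P) + scal (qint2 m * qint (2 * m + 1)) * P)"
    by (simp only: scal_mult distrib_left mult.assoc)
qed

section \<open>The operators of the statement as vertex operators\<close>

lemma series_pow_coeff_cong:
  assumes "\<And>n v. n \<ge> 1 \<Longrightarrow> c n v = d n v"
  shows "series_pow_coeff c k N v = series_pow_coeff d k N v"
  by (induction k arbitrary: N) (simp_all add: assms)

lemma series_exp_coeff_cong:
  assumes "\<And>n v. n \<ge> 1 \<Longrightarrow> c n v = d n v"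
  shows "series_exp_coeff c N v = series_exp_coeff d N v"
  unfolding series_exp_coeff_def using series_pow_coeff_cong[OF assms] by simp

lemma E_minus_eq: "E_minus k P = exp_mult alphaF k * P"
  unfolding E_minus_def exp_mult_general[symmetric]
proof (rule series_exp_coeff_cong)
  fix n :: nat and P assume "n \<ge> 1"
  then show "pm_scale (cnst (- (1 / of_nat n)) * q_pow (int n)) (b_op (- int n) P) =
      scal (cnst (1 / of_nat n) * alphaF n) * (b_var n * P)"
    by (simp add: pm_scale_eq_mult b_op_def alphaF_def cnst_def single_uminus)
qed

lemma E_plus_eq: "E_plus j P = exp_diff betaF j P"
  unfolding E_plus_def exp_diff_def
proof (rule series_exp_coeff_cong)
  fix n :: nat and P assume n: "n \<ge> 1"
  then have "cnst (1 / of_nat n) * of_nat n = 1"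
    unfolding cnst_def single_of_nat[symmetric] mult_single by simp
  then have "scal (cnst (1 / of_nat n)) * scal (of_nat n * betaF n) = scal (betaF n)"
    by (simp add: scal_mult[symmetric] mult.assoc[symmetric])
  then show "pm_scale (cnst (1 / of_nat n)) (b_op (int n) P) = scal (betaF n) * b_diff n P"
    using n by (simp add: pm_scale_eq_mult b_op_def betaF_def mult.assoc[symmetric])
qed

lemma x_minus_eq: "x_minus 0 m P = opF m P"
proof -
  obtain N' where N': "N' \<ge> 0" "ed_bounded N' P" using ed_bounded_exists by meson
  define M where "M = nat N'"
  have N: "ed_bounded (int M) P" using N' by (simp add: M_def)
  have ed: "exp_diff betaF j P = ed betaF (int j) P" for j by (simp add: ed_def)
  have zero: "ed betaF (int j) P = 0" if "j > M" for j
    using N that by (auto simp: ed_bounded_def)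
  have "x_minus 0 m P = Sum_any (\<lambda>j. em alphaF (int j + 2 * m) * ed betaF (int j) P)"
    unfolding x_minus_def Let_def E_minus_eq E_plus_eq ed
    by (intro Sum_any.cong) (simp add: em_def)
  also have "\<dots> = (\<Sum>j\<le>M. em alphaF (int j + 2 * m) * ed betaF (int j) P)"
    by (rule Sum_any.expand_superset) (use zero in \<open>auto simp: not_less[symmetric]\<close>)
  also have "\<dots> = (\<Sum>j\<in>int ` {..M}. em alphaF (j + 2 * m) * ed betaF j P)"
    by (simp add: sum.reindex)
  also have "int ` {..M} = {0..int M}"
    using image_int_atLeastAtMost[of 0 M] by (simp add: atLeast0AtMost)
  finally show ?thesis by (simp add: opF_def vop_eq_sum[OF N])
qed

lemma x_minus_div2_eq: "x_minus_div2 m P = opF2 m P"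
  by (rule x_minus_div2_unique) (simp add: x_minus_eq opF_opF pm_scale_eq_mult)

section \<open>Specialization\<close>

abbreviation ev :: "laurent \<Rightarrow> complex" where
  "ev \<equiv> laurent_eval \<i>"

lemma ev_superset: "finite S \<Longrightarrow> supp a \<subseteq> S \<Longrightarrow> ev a = (\<Sum>k\<in>S. coef a k * \<i> powi k)"
  unfolding laurent_eval_def by (rule sum.mono_neutral_left) (auto simp: in_keys_iff)

lemma ev_0 [simp]: "ev 0 = 0"
  by (simp add: laurent_eval_def)

lemma ev_single: "ev (sgl k c) = c * \<i> powi k"
  by (simp add: laurent_eval_def)

lemma ev_add: "ev (a + b) = ev a + ev b"
proof -
  have "supp (a + b) \<subseteq> supp a \<union> supp b" by (rule Poly_Mapping.keys_add)
  then show ?thesis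
    using ev_superset[of "supp a \<union> supp b" "a + b"] ev_superset[of "supp a \<union> supp b" a]
      ev_superset[of "supp a \<union> supp b" b]
    by (simp add: lookup_add distrib_right sum.distrib)
qed

lemma ev_sum: "ev (\<Sum>i\<in>I. f i) = (\<Sum>i\<in>I. ev (f i))"
  by (induction I rule: infinite_finite_induct) (simp_all add: ev_add)

lemma ev_uminus: "ev (- a) = - ev a"
  using ev_add[of a "- a"] by (simp add: eq_neg_iff_add_eq_0 add.commute)

lemma ev_diff: "ev (a - b) = ev a - ev b"
  using ev_add[of a "- b"] by (simp add: ev_uminus)

lemma laurent_expand: "a = (\<Sum>k\<in>supp a. sgl k (coef a k))"
  by (rule poly_mapping_eqI) (auto simp: lookup_sum lookup_single when_def in_keys_iff sum.delta')

lemma ev_mult: "ev (a * b) = ev a * ev b"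
proof -
  have "a * b = (\<Sum>k\<in>supp a. sgl k (coef a k)) * (\<Sum>l\<in>supp b. sgl l (coef b l))"
    using laurent_expand[of a] laurent_expand[of b] by simp
  also have "\<dots> = (\<Sum>k\<in>supp a. \<Sum>l\<in>supp b. sgl (k + l) (coef a k * coef b l))"
    by (simp add: sum_product mult_single)
  finally have "ev (a * b) = (\<Sum>k\<in>supp a. \<Sum>l\<in>supp b. coef a k * coef b l * \<i> powi (k + l))"
    by (simp add: ev_sum ev_single)
  then show ?thesis
    by (simp add: laurent_eval_def sum_product power_int_add mult_ac)
qed

lemma ev_1 [simp]: "ev 1 = 1"
  using ev_single[of 0 1] by simp

lemma ev_cnst [simp]: "ev (cnst c) = c"
  by (simp add: cnst_def ev_single)

lemma ev_q_pow: "ev (q_pow n) = \<i> powi n"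
  by (simp add: q_pow_def ev_single)

lemma i_powi_even: "\<i> powi (2 * n) = (if even n then 1 else - 1)"
  by (simp add: power_int_mult)

lemma i_powi_odd: "\<i> powi (2 * n + 1) = (if even n then \<i> else - \<i>)"
  using power_int_add[of \<i> "2 * n" 1] by (simp add: i_powi_even)

lemma i_powi_minus_even: "\<i> powi (- (2 * n)) = (if even n then 1 else - 1)"
  using i_powi_even[of "- n"] by simp

lemma i_powi_minus_odd: "\<i> powi (- (2 * n + 1)) = (if even n then - \<i> else \<i>)"
  using i_powi_odd[of "- n - 1"] by (simp add: algebra_simps)

lemma ev_q_sum: "ev q_sum = 0"
  using i_powi_odd[of 0] i_powi_minus_odd[of 0] by (simp add: ev_add ev_q_pow)

lemma ev_q_diff: "ev q_diff = 2 * \<i>"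
  using i_powi_odd[of 0] i_powi_minus_odd[of 0] by (simp add: ev_diff ev_q_pow)

lemma ev_qint_odd: "ev (qint (2 * m + 1)) = (if even m then 1 else - 1)"
proof -
  have "2 * \<i> * ev (qint (2 * m + 1)) = \<i> powi (2 * m + 1) - \<i> powi (- (2 * m + 1))"
    using arg_cong[OF q_diff_qint[of "2 * m + 1"], of ev, unfolded ev_mult ev_q_diff]
    by (simp only: ev_diff ev_q_pow)
  also have "\<dots> = 2 * \<i> * (if even m then 1 else - 1)"
    unfolding i_powi_odd i_powi_minus_odd by simp
  finally have *: "2 * \<i> * ev (qint (2 * m + 1)) = 2 * \<i> * (if even m then 1 else - 1)" .
  have "2 * \<i> \<noteq> 0" by simp
  from mult_left_cancel[OF this, THEN iffD1, OF *] show ?thesis .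
qed

lemma ev_qint_even: "ev (qint (2 * m)) = 0"
proof -
  have "2 * \<i> * ev (qint (2 * m)) = \<i> powi (2 * m) - \<i> powi (- (2 * m))"
    using arg_cong[OF q_diff_qint[of "2 * m"], of ev, unfolded ev_mult ev_q_diff]
    by (simp only: ev_diff ev_q_pow)
  also have "\<dots> = 0"
    unfolding i_powi_even i_powi_minus_even by simp
  finally show ?thesis by simp
qed

text \<open>The exponents of the m summands differ by multiples of 4, so all of them take the same
  value (-1)^(m-1) at q = i.\<close>

lemma ev_qint2: "m \<ge> 0 \<Longrightarrow> ev (qint2 m) = (if even m then - of_int m else of_int m)"
proof -
  assume m: "m \<ge> 0"
  have "ev (qint2 m) = (\<Sum>k<nat m. if even m then - 1 else 1)"
    unfolding qint2_def ev_sum ev_q_pow i_powi_even by (intro sum.cong refl) auto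
  then show ?thesis using m by (simp add: of_nat_nat)
qed

lemma coef_spec: "coef (spec P) \<mu> = ev (coef P \<mu>)"
  by (simp add: spec_def Poly_Mapping.map.rep_eq when_def)

lemma coef_lift_const: "coef (lift_const P) \<mu> = cnst (coef P \<mu>)"
  by (simp add: lift_const_def Poly_Mapping.map.rep_eq when_def cnst_def)

lemma spec_lift_const [simp]: "spec (lift_const P) = P"
  by (rule poly_mapping_eqI) (simp add: coef_spec coef_lift_const)

lemma spec_add: "spec (P + Q) = spec P + spec Q"
  by (rule poly_mapping_eqI) (simp add: coef_spec lookup_add ev_add)

lemma spec_0 [simp]: "spec 0 = 0"
  by (rule poly_mapping_eqI) (simp add: coef_spec)

lemma spec_sum: "spec (\<Sum>i\<in>I. f i) = (\<Sum>i\<in>I. spec (f i))"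
  by (induction I rule: infinite_finite_induct) (simp_all add: spec_add)

lemma spec_single: "spec (sgl \<mu> c) = sgl \<mu> (ev c)"
  by (rule poly_mapping_eqI) (simp add: coef_spec lookup_single when_def)

lemma bpoly_expand': "P = (\<Sum>\<mu>\<in>supp P. sgl \<mu> (coef P \<mu>))"
  by (rule poly_mapping_eqI) (auto simp: lookup_sum lookup_single when_def in_keys_iff sum.delta')

lemma spec_mult: "spec (P * Q) = spec P * spec Q"
proof -
  have "P * Q = (\<Sum>k\<in>supp P. sgl k (coef P k)) * (\<Sum>l\<in>supp Q. sgl l (coef Q l))"
    using bpoly_expand'[of P] bpoly_expand'[of Q] by simp
  also have "\<dots> = (\<Sum>k\<in>supp P. \<Sum>l\<in>supp Q. sgl k (coef P k) * sgl l (coef Q l))"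
    by (simp add: sum_product)
  finally have "spec (P * Q) = (\<Sum>k\<in>supp P. \<Sum>l\<in>supp Q. spec (sgl k (coef P k)) * spec (sgl l (coef Q l)))"
    by (simp add: spec_sum spec_single mult_single ev_mult)
  also have "\<dots> = spec (\<Sum>k\<in>supp P. sgl k (coef P k)) * spec (\<Sum>l\<in>supp Q. sgl l (coef Q l))"
    by (simp add: spec_sum sum_product)
  finally show ?thesis
    using bpoly_expand'[of P] bpoly_expand'[of Q] by simp
qed

lemma spec_1 [simp]: "spec 1 = 1"
  using spec_single[of 0 1] by simp

lemma spec_b_var [simp]: "spec (b_var n) = b_var n"
  by (simp add: b_var_def spec_single)

lemma spec_of_nat: "spec (of_nat n * P) = of_nat n * spec P"
  by (induction n) (simp_all add: algebra_simps spec_add)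

lemma supp_spec: "supp (spec P) \<subseteq> supp P"
  by (auto simp: in_keys_iff coef_spec)

lemma cnst_eq_0_iff: "cnst c = 0 \<longleftrightarrow> c = 0"
  by (auto simp: cnst_def poly_mapping_eq_iff fun_eq_iff lookup_single when_def)

lemma supp_lift_const: "supp (lift_const P) = supp P"
  by (auto simp: in_keys_iff coef_lift_const cnst_eq_0_iff)

text \<open>Linearity over Laurent polynomials makes T preserve the kernel of the reduction, so the
  induced operator does not depend on the lift. This is what carries relations at generic q over to
  q = i.\<close>

lemma spec_op_spec:
  assumes "lin T" shows "spec_op T (spec P) = spec (T P)"
proof -
  let ?R = "lift_const (spec P)"
  have *: "spec (T R) = (\<Sum>\<mu>\<in>supp P. scal (coef (spec R) \<mu>) * spec (T (sgl \<mu> 1)))"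
    if "supp R \<subseteq> supp P" for R
  proof -
    have "T R = (\<Sum>\<mu>\<in>supp P. scal (coef R \<mu>) * T (sgl \<mu> 1))"
      by (subst lin_expand[OF assms]) (use that in \<open>auto simp: in_keys_iff intro!: sum.mono_neutral_left\<close>)
    then show ?thesis by (simp add: spec_sum spec_mult spec_single coef_spec)
  qed
  have "supp ?R \<subseteq> supp P" using supp_spec by (simp add: supp_lift_const)
  then show ?thesis unfolding spec_op_def by (simp add: *)
qed

lemma lin_spec_op: "lin T \<Longrightarrow> lin (spec_op T)"
proof (rule linI)
  assume T: "lin T"
  show "spec_op T (P + Q) = spec_op T P + spec_op T Q" for P Q
    using spec_op_spec[OF T, of "lift_const P + lift_const Q"] by (simp add: spec_add lin_add[OF T] spec_op_def)
  show "spec_op T (scal c * P) = scal c * spec_op T P" for c P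
    using spec_op_spec[OF T, of "scal (cnst c) * lift_const P"]
    by (simp add: spec_mult spec_single lin_scal[OF T] spec_op_def)
qed

lemma spec_op_comp: "lin T \<Longrightarrow> spec_op T (spec_op U P) = spec (T (U (lift_const P)))"
  by (simp add: spec_op_def[of U] spec_op_spec)

lemma wt_hom_spec_op: "wt_hom T c \<Longrightarrow> wt_hom (spec_op T) c"
  unfolding wt_hom_def spec_op_def
proof (intro allI ballI)
  fix P \<nu>
  assume T: "\<forall>P. \<forall>\<nu>\<in>supp (T P). \<exists>\<mu>\<in>supp P. int (wt \<nu>) = int (wt \<mu>) + c"
    and \<nu>: "\<nu> \<in> supp (spec (T (lift_const P)))"
  from subsetD[OF supp_spec \<nu>] T have "\<exists>\<mu>\<in>supp (lift_const P). int (wt \<nu>) = int (wt \<mu>) + c" by blast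
  then show "\<exists>\<mu>\<in>supp P. int (wt \<nu>) = int (wt \<mu>) + c" unfolding supp_lift_const .
qed

section \<open>The operators at \<open>q = \<i>\<close>\<close>

definition y0 :: "int \<Rightarrow> complex bpoly \<Rightarrow> complex bpoly" where
  "y0 m = spec_op (opE m)"

definition y0_div2 :: "int \<Rightarrow> complex bpoly \<Rightarrow> complex bpoly" where
  "y0_div2 m = spec_op (opE2 m)"

lemma x0_eq: "x0 m = spec_op (opF m)" and x0_div2_eq: "x0_div2 m = spec_op (opF2 m)"
  by (simp_all add: x0_def x0_div2_def x_minus_eq[abs_def] x_minus_div2_eq[abs_def])

lemmas ops_eq = x0_eq x0_div2_eq y0_def y0_div2_def

lemma lin_ops: "lin (x0 m)" "lin (y0 m)" "lin (x0_div2 m)" "lin (y0_div2 m)"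
  unfolding ops_eq by (intro lin_spec_op lin_op)+

lemma wt_hom_x0: "wt_hom (x0 m) (2 * m)"
  unfolding ops_eq by (intro wt_hom_spec_op) (simp add: opF_def wt_hom_vop)

lemma wt_hom_y0: "wt_hom (y0 m) (- 2 * m - 2)"
  unfolding ops_eq by (intro wt_hom_spec_op) (simp only: opE_def wt_hom_vop)

lemma wt_hom_x0_div2: "wt_hom (x0_div2 m) (4 * m - 2)"
  unfolding ops_eq opF2_def[abs_def] using wt_hom_vop2[of _ _ "2 * m"]
  by (intro wt_hom_spec_op wt_hom_scal) simp

lemma wt_hom_y0_div2: "wt_hom (y0_div2 m) (- 4 * m - 6)"
proof -
  have eq: "2 * (- 2 * m - 2) - 2 = - 4 * m - 6" by simp
  show ?thesis
    unfolding ops_eq opE2_def[abs_def] by (intro wt_hom_spec_op wt_hom_scal wt_hom_vop2[of _ _ "- 2 * m - 2", unfolded eq])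
qed

lemma y0_x0: "y0 (m - 1) (x0 m v) = x0 (m + 1) (y0 m v) + (if even m then v else - v)"
  unfolding ops_eq
  by (simp add: spec_op_comp lin_op opE_opF spec_add spec_mult spec_single ev_qint_odd single_uminus)

lemma x0_x0: "x0 (m - 1) (x0 m v) = 0"
  unfolding ops_eq by (simp only: spec_op_comp lin_op opF_opF spec_mult spec_single ev_q_sum) simp

lemma y0_y0: "y0 (m + 1) (y0 m v) = 0"
  unfolding ops_eq by (simp only: spec_op_comp lin_op opE_opE spec_mult spec_single ev_q_sum) simp

lemma y0_x0_div2: "y0 (m - 2) (x0_div2 m v) = x0_div2 (m + 1) (y0 m v)"
  unfolding ops_eq
  by (simp add: spec_op_comp lin_op opE_opF2 spec_add spec_mult spec_single ev_qint_even)

lemma x0_x0_div2: "x0 (m - 2) (x0_div2 m v) = x0_div2 (m - 1) (x0 m v)"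
  unfolding ops_eq by (simp add: spec_op_comp lin_op opF_opF2)

lemma y0_y0_div2: "y0 (m + 2) (y0_div2 m v) = y0_div2 (m + 1) (y0 m v)"
  unfolding ops_eq by (simp add: spec_op_comp lin_op opE_opE2)

lemma y0_div2_x0_div2:
  assumes "m \<ge> 0"
  shows "y0_div2 (m - 2) (x0_div2 m v) = x0_div2 (m + 2) (y0_div2 m v) +
    (if even m then x0 (m + 1) (y0 m v) else - x0 (m + 1) (y0 m v)) - of_int m * v"
proof -
  have "ev (qint2 m * qint (2 * m + 1)) = - of_int m"
    using assms by (simp add: ev_mult ev_qint2 ev_qint_odd)
  then show ?thesis
    unfolding ops_eq
    by (simp add: spec_op_comp lin_op opE2_opF2[OF assms] spec_add spec_mult spec_single ev_qint_odd single_uminus)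
qed

section \<open>Linearity over the odd variables\<close>

text \<open>Commutation with the odd variables holds only after reduction. Stating it for operators
  on the lattice allows the sums that define them to be reduced term by term.\<close>

definition odd_lin :: "(laurent bpoly \<Rightarrow> laurent bpoly) \<Rightarrow> bool" where
  "odd_lin T \<longleftrightarrow> lin T \<and> (\<forall>n P. odd n \<longrightarrow> spec (T (b_var n * P)) = b_var n * spec (T P))"

lemma odd_linD: "odd_lin T \<Longrightarrow> odd n \<Longrightarrow> spec (T (b_var n * P)) = b_var n * spec (T P)"
  by (simp add: odd_lin_def)

lemma odd_lin_comp:
  assumes "odd_lin T" "odd_lin U"
  shows "odd_lin (\<lambda>P. T (U P))"
proof -
  have T: "lin T" and U: "lin U" using assms by (simp_all add: odd_lin_def)
  have "spec (T (U (b_var n * P))) = b_var n * spec (T (U P))" if "odd n" for n P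
  proof -
    have "spec (T (U (b_var n * P))) = spec_op T (spec (b_var n * U P))"
      by (simp add: spec_op_spec[OF T, symmetric] odd_linD[OF assms(2) that] spec_mult)
    also have "\<dots> = b_var n * spec (T (U P))"
      by (simp only: spec_op_spec[OF T] odd_linD[OF assms(1) that])
    finally show ?thesis .
  qed
  then show ?thesis using lin_comp[OF T U] by (simp add: odd_lin_def)
qed

lemma spec_scal_mult: "spec (scal c * P) = scal (ev c) * spec P"
  by (simp only: spec_mult spec_single)

text \<open>In the recursion only the derivation with respect to b_{-n} itself fails to commute with
  multiplication by b_{-n}, and its coefficient \<beta> n specializes to 0.\<close>

lemma spec_exp_diff_odd:
  assumes "ev (\<beta> n) = 0" "n \<ge> 1"
  shows "spec (exp_diff \<beta> j (b_var n * P)) = b_var n * spec (exp_diff \<beta> j P)"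
proof (induction j arbitrary: P rule: less_induct)
  case (less j)
  show ?case
  proof (cases "j = 0")
    case False
    have "of_nat j * spec (exp_diff \<beta> j (b_var n * P)) =
        (\<Sum>l=1..j. of_nat l * (scal (ev (\<beta> l)) * spec (exp_diff \<beta> (j - l) (b_diff l (b_var n * P)))))"
      unfolding spec_of_nat[symmetric] exp_diff_newton b_diff_exp_diff
      by (simp only: spec_sum spec_of_nat spec_scal_mult)
    also have "\<dots> = (\<Sum>l=1..j. b_var n * (of_nat l * (scal (ev (\<beta> l)) * spec (exp_diff \<beta> (j - l) (b_diff l P)))))"
    proof (intro sum.cong refl)
      fix l assume l: "l \<in> {1..j}"
      have "spec (exp_diff \<beta> (j - l) (b_diff l (b_var n * P))) =
          (if l = n then spec (exp_diff \<beta> (j - l) P) else 0) + b_var n * spec (exp_diff \<beta> (j - l) (b_diff l P))"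
        using l assms(2) less[of "j - l" "b_diff l P"]
        by (auto simp: b_diff_mult b_diff_b_var lin_add[OF lin_exp_diff] lin_zero[OF lin_exp_diff] spec_add)
      then show "of_nat l * (scal (ev (\<beta> l)) * spec (exp_diff \<beta> (j - l) (b_diff l (b_var n * P)))) =
          b_var n * (of_nat l * (scal (ev (\<beta> l)) * spec (exp_diff \<beta> (j - l) (b_diff l P))))"
        using assms(1) by (auto simp: algebra_simps)
    qed
    also have "\<dots> = b_var n * (of_nat j * spec (exp_diff \<beta> j P))"
      unfolding spec_of_nat[symmetric] exp_diff_newton b_diff_exp_diff
      by (simp only: spec_sum spec_of_nat spec_scal_mult sum_distrib_left)
    also have "\<dots> = of_nat j * (b_var n * spec (exp_diff \<beta> j P))"
      by (rule mult.left_commute)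
    finally show ?thesis by (rule of_nat_mult_cancel[OF False])
  qed (simp add: spec_mult)
qed

lemma odd_lin_ed:
  assumes "\<And>n. odd n \<Longrightarrow> ev (\<beta> n) = 0"
  shows "odd_lin (ed \<beta> j)"
  unfolding odd_lin_def
proof (intro conjI allI impI lin_ed)
  fix n :: nat and P assume "odd n"
  then show "spec (ed \<beta> j (b_var n * P)) = b_var n * spec (ed \<beta> j P)"
    using spec_exp_diff_odd[of \<beta> n "nat j" P] assms[of n] odd_pos[of n] by (simp add: ed_def)
qed

lemma odd_lin_vop:
  assumes "\<And>n. odd n \<Longrightarrow> ev (\<beta> n) = 0"
  shows "odd_lin (vop \<alpha> \<beta> a)"
  unfolding odd_lin_def
proof (intro conjI allI impI lin_vop)
  fix n :: nat and P assume n: "odd n"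
  obtain N where N: "ed_bounded N P" "ed_bounded N (b_var n * P)" using ed_bounded_pair by blast
  show "spec (vop \<alpha> \<beta> a (b_var n * P)) = b_var n * spec (vop \<alpha> \<beta> a P)"
    by (simp add: vop_eq_sum[OF N(1)] vop_eq_sum[OF N(2)] spec_sum spec_mult
        odd_linD[OF odd_lin_ed[OF assms] n] sum_distrib_left mult.left_commute)
qed

lemma odd_lin_vop2:
  assumes "\<And>n. odd n \<Longrightarrow> ev (\<beta> n) = 0"
  shows "odd_lin (vop2 \<alpha> \<beta> a)"
  unfolding odd_lin_def
proof (intro conjI allI impI lin_vop2)
  fix n :: nat and P assume n: "odd n"
  obtain N where N: "ed_bounded N P" "ed_bounded N (b_var n * P)" using ed_bounded_pair by blast
  have "odd_lin (\<lambda>P. ed \<beta> j (ed \<beta> i P))" for i j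
    by (rule odd_lin_comp[OF odd_lin_ed[OF assms] odd_lin_ed[OF assms]])
  from odd_linD[OF this n] show "spec (vop2 \<alpha> \<beta> a (b_var n * P)) = b_var n * spec (vop2 \<alpha> \<beta> a P)"
    by (simp add: vop2_eq_sum[OF N(1)] vop2_eq_sum[OF N(2)] spec_sum spec_mult
        sum_distrib_left mult.left_commute)
qed

lemma odd_lin_mult: "odd_lin T \<Longrightarrow> odd_lin (\<lambda>P. X * T P)"
  by (simp add: odd_lin_def lin_mult spec_mult mult.left_commute)

lemma ev_beta: "odd n \<Longrightarrow> ev (betaF n) = 0" "odd n \<Longrightarrow> ev (betaE n) = 0"
proof -
  assume "odd n"
  then obtain l where "n = 2 * l + 1" by (rule oddE)
  then have k: "int n = 2 * int l + 1" by simp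
  show "ev (betaF n) = 0"
    unfolding betaF_def ev_add ev_q_pow k i_powi_odd i_powi_minus_odd by simp
  have "ev (q_pow (- 2 * int n)) = - 1"
    using i_powi_minus_even[of "int n"] \<open>odd n\<close> by (simp add: ev_q_pow)
  then show "ev (betaE n) = 0" by (simp add: betaE_def ev_uminus ev_diff)
qed

definition dlin :: "(complex bpoly \<Rightarrow> complex bpoly) \<Rightarrow> bool" where
  "dlin T \<longleftrightarrow> (\<forall>P Q. T (P + Q) = T P + T Q) \<and> (\<forall>d\<in>carrier D_alg. \<forall>P. T (d * P) = d * T P)"

lemma carrier_D_alg: "d \<in> carrier D_alg \<longleftrightarrow> (\<forall>\<mu>\<in>supp d. \<forall>k\<in>supp \<mu>. even k)"
  by (auto simp: D_alg_def)

lemma scal_in_D [simp]: "scal c \<in> carrier D_alg"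
  by (auto simp: carrier_D_alg)

lemma dlinI:
  "(\<And>P Q. T (P + Q) = T P + T Q) \<Longrightarrow> (\<And>d P. d \<in> carrier D_alg \<Longrightarrow> T (d * P) = d * T P) \<Longrightarrow> dlin T"
  by (simp add: dlin_def)

lemma dlin_add: "dlin T \<Longrightarrow> T (P + Q) = T P + T Q"
  and dlin_mult: "dlin T \<Longrightarrow> d \<in> carrier D_alg \<Longrightarrow> T (d * P) = d * T P"
  by (simp_all add: dlin_def)

lemma dlin_lin: "dlin T \<Longrightarrow> lin T"
  by (simp add: dlin_def lin_def)

lemma dlin_comp: "dlin T \<Longrightarrow> dlin U \<Longrightarrow> dlin (\<lambda>P. T (U P))"
  by (simp add: dlin_def)

lemma dlin_id: "dlin (\<lambda>P. P)"
  by (simp add: dlin_def)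

lemma dlin_plus: "dlin T \<Longrightarrow> dlin U \<Longrightarrow> dlin (\<lambda>P. T P + U P)"
  by (simp add: dlin_def algebra_simps)

lemma dlin_minus: "dlin T \<Longrightarrow> dlin U \<Longrightarrow> dlin (\<lambda>P. T P - U P)"
  by (simp add: dlin_def algebra_simps)

lemma dlin_times: "dlin T \<Longrightarrow> dlin (\<lambda>P. X * T P)"
  by (simp add: dlin_def algebra_simps)

lemma b_var_Suc_mult: "b_var (Suc k) * sgl \<nu> (1::complex) = sgl (sgl k 1 + \<nu>) 1"
  by (simp add: b_var_def mult_single)

lemma dlin_of_b_var:
  assumes T: "lin T" and b: "\<And>n P. odd n \<Longrightarrow> T (b_var n * P) = b_var n * T P"
  shows "dlin T"
proof (rule dlinI)
  fix d P assume d: "d \<in> carrier D_alg"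
  have mono: "T (sgl \<mu> 1 * P) = sgl \<mu> 1 * T P" if "\<forall>k\<in>supp \<mu>. even k" for \<mu>
    using that
  proof (induction "wt \<mu>" arbitrary: \<mu> rule: less_induct)
    case (less \<mu>)
    show ?case
    proof (cases "\<mu> = 0")
      case False
      then obtain k where k: "k \<in> supp \<mu>" by (auto simp: poly_mapping_eq_iff fun_eq_iff in_keys_iff)
      define \<nu> where "\<nu> = \<mu> - sgl k 1"
      have \<mu>: "sgl k 1 + \<nu> = \<mu>"
        using exponent_minus_single[of \<mu> k] k by (simp add: \<nu>_def in_keys_iff add.commute)
      have "wt \<nu> < wt \<mu>" using wt_add[of "sgl k 1" \<nu>] by (simp only: \<mu> wt_single) simp
      moreover have "\<forall>k\<in>supp \<nu>. even k"
        using less.prems by (auto simp: \<nu>_def in_keys_iff lookup_minus)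
      ultimately have IH: "T (sgl \<nu> 1 * P) = sgl \<nu> 1 * T P" by (rule less.hyps)
      have "odd (Suc k)" using k less.prems by simp
      have *: "b_var (Suc k) * (sgl \<nu> 1 * Q) = sgl \<mu> 1 * Q" for Q :: "complex bpoly"
        by (simp only: mult.assoc[symmetric] b_var_Suc_mult \<mu>)
      from b[OF \<open>odd (Suc k)\<close>, of "sgl \<nu> 1 * P"] show ?thesis
        by (simp only: IH *)
    qed simp
  qed
  have d': "d = (\<Sum>\<mu>\<in>supp d. scal (coef d \<mu>) * sgl \<mu> 1)" by (rule bpoly_expand)
  have "T (d * P) = (\<Sum>\<mu>\<in>supp d. scal (coef d \<mu>) * T (sgl \<mu> 1 * P))"
    by (subst d') (simp only: sum_distrib_right lin_sum[OF T] mult.assoc lin_scal[OF T])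
  also have "\<dots> = (\<Sum>\<mu>\<in>supp d. scal (coef d \<mu>) * sgl \<mu> 1) * T P"
    using d mono by (simp add: sum_distrib_right mult.assoc carrier_D_alg)
  finally show "T (d * P) = d * T P" by (simp only: d'[symmetric])
qed (rule lin_add[OF T])

lemma dlin_spec_op:
  assumes "odd_lin T" shows "dlin (spec_op T)"
proof (rule dlin_of_b_var)
  have T: "lin T" using assms by (simp add: odd_lin_def)
  then show "lin (spec_op T)" by (rule lin_spec_op)
  fix n :: nat and P assume "odd n"
  have "spec_op T (b_var n * P) = spec_op T (spec (b_var n * lift_const P))"
    by (simp add: spec_mult)
  also have "\<dots> = b_var n * spec_op T P"
    unfolding spec_op_spec[OF T] odd_linD[OF assms \<open>odd n\<close>] by (simp add: spec_op_def)
  finally show "spec_op T (b_var n * P) = b_var n * spec_op T P" .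
qed

lemma dlin_ops: "dlin (x0 m)" "dlin (y0 m)" "dlin (x0_div2 m)" "dlin (y0_div2 m)"
  unfolding ops_eq opF_def opE_def opF2_def[abs_def] opE2_def[abs_def]
  by (intro dlin_spec_op odd_lin_vop odd_lin_mult odd_lin_vop2 ev_beta; assumption)+

section \<open>The extremal projector\<close>

lemma lin_of_int: "lin T \<Longrightarrow> T (of_int n * P) = of_int n * T P"
  using lin_scal[of T "of_int n" P] by simp

text \<open>The sign makes \<open>epow\<close> and \<open>fpow\<close> powers of an sl(2) pair on
  the kernels of \<open>y0\<close>, with Cartan element acting by m on the summand 2m+1. The
  argument m names the source of \<open>epow\<close> and the target of \<open>fpow\<close>, so that
  \<open>fpow k m\<close> after \<open>epow k m\<close> is an endomorphism.\<close>

primrec epow :: "nat \<Rightarrow> int \<Rightarrow> complex bpoly \<Rightarrow> complex bpoly" where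
  "epow 0 m v = v"
| "epow (Suc k) m v = - y0_div2 (m + 2 * int k) (epow k m v)"

primrec fpow :: "nat \<Rightarrow> int \<Rightarrow> complex bpoly \<Rightarrow> complex bpoly" where
  "fpow 0 m v = v"
| "fpow (Suc k) m v = fpow k m (x0_div2 (m + 2 * int k + 2) v)"

lemma dlin_uminus: "dlin T \<Longrightarrow> dlin (\<lambda>P. - T P)"
  by (simp add: dlin_def)

lemma dlin_epow: "dlin (epow k m)"
proof (induction k)
  case (Suc k)
  have "dlin (\<lambda>v. - y0_div2 (m + 2 * int k) (epow k m v))"
    by (rule dlin_uminus, rule dlin_comp[OF dlin_ops(4) Suc])
  then show ?case by simp
qed (simp add: dlin_id)

lemma dlin_fpow: "dlin (fpow k m)"
proof (induction k)
  case (Suc k)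
  show ?case using dlin_comp[OF Suc dlin_ops(3)] by simp
qed (simp add: dlin_id)

lemma wt_hom_epow: "wt_hom (epow k m) (- int k * (4 * m + 4 * int k + 2))"
proof (induction k)
  case (Suc k)
  have "wt_hom (\<lambda>v. - y0_div2 (m + 2 * int k) (epow k m v)) (- 4 * (m + 2 * int k) - 6 + - int k * (4 * m + 4 * int k + 2))"
    by (rule wt_hom_uminus, rule wt_hom_comp[OF wt_hom_y0_div2 Suc])
  moreover have "- 4 * (m + 2 * int k) - 6 + - int k * (4 * m + 4 * int k + 2) =
      - int (Suc k) * (4 * m + 4 * int (Suc k) + 2)"
    by (simp add: algebra_simps)
  ultimately show ?case by simp
qed (simp add: wt_hom_id)

lemma wt_hom_fpow: "wt_hom (fpow k m) (int k * (4 * m + 4 * int k + 2))"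
proof (induction k)
  case (Suc k)
  have "wt_hom (\<lambda>v. fpow k m (x0_div2 (m + 2 * int k + 2) v)) (int k * (4 * m + 4 * int k + 2) + (4 * (m + 2 * int k + 2) - 2))"
    by (rule wt_hom_comp[OF Suc wt_hom_x0_div2])
  moreover have "int k * (4 * m + 4 * int k + 2) + (4 * (m + 2 * int k + 2) - 2) =
      int (Suc k) * (4 * m + 4 * int (Suc k) + 2)"
    by (simp add: algebra_simps)
  ultimately show ?case by simp
qed (simp add: wt_hom_id)

text \<open>For m \<ge> 0 the total drop in weight, k (4m + 4k + 2), is at least k, and weights are
  never negative.\<close>

lemma epow_eq_0:
  assumes "m \<ge> 0" "\<And>\<mu>. \<mu> \<in> supp v \<Longrightarrow> wt \<mu> < k"
  shows "epow k m v = 0"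
proof (rule ccontr)
  assume "epow k m v \<noteq> 0"
  then obtain \<nu> where "\<nu> \<in> supp (epow k m v)" by (auto simp: poly_mapping_eq_iff fun_eq_iff in_keys_iff)
  then obtain \<mu> where \<mu>: "\<mu> \<in> supp v" "int (wt \<nu>) = int (wt \<mu>) + - int k * (4 * m + 4 * int k + 2)"
    using wt_homD[OF wt_hom_epow] by blast
  have "int k * 1 \<le> int k * (4 * m + 4 * int k + 2)" using assms(1) by (intro mult_left_mono) auto
  moreover have "int (wt \<mu>) < int k" using assms(2)[OF \<mu>(1)] by simp
  ultimately show False using \<mu>(2) by (simp only: mult_minus_left)
qed

text \<open>One bound serves all m \<ge> 0, as the arguments below compare powers that start at m
  with powers that start at m + 2.\<close>

lemma weight_bound: "\<exists>N::nat. \<forall>k>N. \<forall>m\<ge>0. epow k m v = 0"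
proof (intro exI allI impI)
  fix k :: nat and m :: int assume k: "k > Max (insert 0 (wt ` supp v))" and "m \<ge> 0"
  show "epow k m v = 0"
    by (rule epow_eq_0[OF \<open>m \<ge> 0\<close>]) (use k in auto)
qed

lemma y0_epow: "y0 m v = 0 \<Longrightarrow> y0 (m + 2 * int k) (epow k m v) = 0"
proof (induction k)
  case (Suc k)
  have "y0 (m + 2 * int k + 2) (y0_div2 (m + 2 * int k) (epow k m v)) = 0"
    unfolding y0_y0_div2 using Suc by (simp add: lin_zero[OF lin_ops(4)])
  then show ?case by (simp add: lin_uminus[OF lin_ops(2)] algebra_simps)
qed simp

text \<open>The sl(2) commutator of e^k with f: moving f to the left past the k factors e meets the
  Cartan values m + 2, m + 4, ..., m + 2k, and these add up to k (m + k + 1).\<close>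

lemma epow_x0_div2:
  assumes "m \<ge> 0" "y0 (m + 2) v = 0"
  shows "epow k m (x0_div2 (m + 2) v) = x0_div2 (m + 2 + 2 * int k) (epow k (m + 2) v) +
    of_int (int k * (m + int k + 1)) * epow (k - 1) (m + 2) v"
proof (induction k)
  case (Suc k)
  let ?w = "\<lambda>k. epow k (m + 2) v"
  have w: "y0 (m + 2 + 2 * int k) (?w k) = 0" by (rule y0_epow[OF assms(2)])
  have ef: "- y0_div2 (m + 2 * int k) (x0_div2 (m + 2 + 2 * int k) (?w k)) =
      x0_div2 (m + 2 + 2 * int (Suc k)) (?w (Suc k)) + of_int (m + 2 + 2 * int k) * ?w k"
    using y0_div2_x0_div2[of "m + 2 + 2 * int k" "?w k", unfolded w lin_zero[OF lin_ops(1)]] assms(1)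
    by (simp add: lin_uminus[OF lin_ops(3)] algebra_simps)
  \<comment> \<open>For k = 0 the truncated \<open>k - 1\<close> is harmless, as the coefficient is
    0.\<close>
  have e: "of_int (int k * (m + int k + 1)) * - y0_div2 (m + 2 * int k) (?w (k - 1)) =
      of_int (int k * (m + int k + 1)) * ?w k"
    by (cases k) (simp_all add: algebra_simps)
  have "epow (Suc k) m (x0_div2 (m + 2) v) =
      - y0_div2 (m + 2 * int k) (x0_div2 (m + 2 + 2 * int k) (?w k)) +
      of_int (int k * (m + int k + 1)) * - y0_div2 (m + 2 * int k) (?w (k - 1))"
    by (simp only: epow.simps Suc lin_add[OF lin_ops(4)] lin_of_int[OF lin_ops(4)]
        minus_add_distrib mult_minus_right)
  also have "\<dots> = x0_div2 (m + 2 + 2 * int (Suc k)) (?w (Suc k)) +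
      (of_int (m + 2 + 2 * int k) + of_int (int k * (m + int k + 1))) * ?w k"
    unfolding ef e by (simp only: distrib_right add.assoc)
  also have "of_int (m + 2 + 2 * int k) + of_int (int k * (m + int k + 1)) =
      (of_int (int (Suc k) * (m + int (Suc k) + 1)) :: complex bpoly)"
    unfolding of_int_add[symmetric] by (rule arg_cong[of _ _ of_int]) (simp add: algebra_simps)
  finally show ?case by simp
qed simp

text \<open>If f v = 0, then e^k v = 0 forces k (m + k + 1) e^(k-1) v = 0 by
  \<open>epow_x0_div2\<close>, with a positive factor. Since e^k v = 0 for large k, this descends to
  v = 0.\<close>

lemma x0_div2_inject:
  assumes "m \<ge> 0" "y0 (m + 2) v = 0" "x0_div2 (m + 2) v = 0"
  shows "v = 0"
proof -
  obtain N where N: "\<forall>k>N. \<forall>m\<ge>0. epow k m v = 0" using weight_bound by blast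
  have step: "epow k (m + 2) v = 0" if "epow (Suc k) (m + 2) v = 0" for k
  proof -
    have "of_int (int (Suc k) * (m + int (Suc k) + 1)) * epow k (m + 2) v = 0"
      using epow_x0_div2[OF assms(1,2), of "Suc k"] that
      by (simp only: assms(3) lin_zero[OF dlin_lin[OF dlin_epow]] lin_zero[OF lin_ops(3)]) simp
    moreover have "int (Suc k) * (m + int (Suc k) + 1) \<noteq> 0" using assms(1) by simp
    ultimately show ?thesis by (metis mult_eq_0_iff of_int_eq_0_iff)
  qed
  have "epow (Suc N - k) (m + 2) v = 0" for k
  proof (induction k)
    case 0
    have "epow (Suc N) (m + 2) v = 0" using N assms(1) by (simp del: epow.simps)
    then show ?case by (simp del: epow.simps)
  next
    case (Suc k)
    then show ?case using step[of "Suc N - Suc k"] by (cases "k \<le> N") (simp_all add: Suc_diff_le)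
  qed
  from this[of "Suc N"] show ?thesis by simp
qed

text \<open>The coefficients of the extremal projector: they make \<open>ext_proj m\<close> annihilate \<open>x0_div2 (m + 2) v\<close>
  when \<open>y0 (m + 2) v = 0\<close>.\<close>

primrec proj_coeff :: "int \<Rightarrow> nat \<Rightarrow> complex" where
  "proj_coeff m 0 = 1"
| "proj_coeff m (Suc k) = - proj_coeff m k / of_int (int (Suc k) * (m + int k + 2))"

definition ext_proj :: "int \<Rightarrow> complex bpoly \<Rightarrow> complex bpoly" where
  "ext_proj m v = Sum_any (\<lambda>k. scal (proj_coeff m k) * fpow k m (epow k m v))"

definition ker_proj :: "int \<Rightarrow> complex bpoly \<Rightarrow> complex bpoly" where
  "ker_proj m v = scal (if even m then 1 else - 1) * y0 (m - 1) (x0 m v)"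

definition A_proj :: "int \<Rightarrow> complex bpoly \<Rightarrow> complex bpoly" where
  "A_proj m v = ext_proj m (ker_proj m v)"

lemma ext_proj_eq_sum:
  assumes "\<forall>k>N. epow k m v = 0"
  shows "ext_proj m v = (\<Sum>k\<le>N. scal (proj_coeff m k) * fpow k m (epow k m v))"
  unfolding ext_proj_def
  by (rule Sum_any.expand_superset)
    (use assms in \<open>auto simp: not_le[symmetric] lin_zero[OF dlin_lin[OF dlin_fpow]]\<close>)

lemma weight_bound2: "\<exists>N::nat. \<forall>k>N. \<forall>m\<ge>0. epow k m v = 0 \<and> epow k m w = 0"
proof -
  obtain N M where "\<forall>k>N. \<forall>m\<ge>0. epow k m v = 0" "\<forall>k>M. \<forall>m\<ge>0. epow k m w = 0"
    using weight_bound by meson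
  then show ?thesis by (intro exI[of _ "max N M"]) simp
qed

lemma dlin_ext_proj:
  assumes "m \<ge> 0" shows "dlin (ext_proj m)"
proof (rule dlinI)
  fix P Q
  obtain N where N: "\<forall>k>N. \<forall>m\<ge>0. epow k m P = 0 \<and> epow k m Q = 0" using weight_bound2 by blast
  have *: "\<forall>k>N. epow k m P = 0" "\<forall>k>N. epow k m Q = 0" "\<forall>k>N. epow k m (P + Q) = 0"
    using N assms by (simp_all add: dlin_add[OF dlin_epow])
  show "ext_proj m (P + Q) = ext_proj m P + ext_proj m Q"
    unfolding ext_proj_eq_sum[OF *(1)] ext_proj_eq_sum[OF *(2)] ext_proj_eq_sum[OF *(3)]
    by (simp only: dlin_add[OF dlin_epow] dlin_add[OF dlin_fpow] distrib_left sum.distrib)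
next
  fix d P assume d: "d \<in> carrier D_alg"
  obtain N where N: "\<forall>k>N. \<forall>m\<ge>0. epow k m P = 0" using weight_bound by blast
  have *: "\<forall>k>N. epow k m P = 0" "\<forall>k>N. epow k m (d * P) = 0"
    using N assms by (simp_all add: dlin_mult[OF dlin_epow d])
  show "ext_proj m (d * P) = d * ext_proj m P"
    unfolding ext_proj_eq_sum[OF *(1)] ext_proj_eq_sum[OF *(2)]
    by (simp only: dlin_mult[OF dlin_epow d] dlin_mult[OF dlin_fpow d] sum_distrib_left mult.left_commute)
qed

lemma wt_hom_ext_proj: "wt_hom (ext_proj m) 0"
  unfolding ext_proj_def[abs_def]
proof (intro wt_hom_Sum_any wt_hom_scal)
  fix k
  have "wt_hom (\<lambda>P. fpow k m (epow k m P))
      (int k * (4 * m + 4 * int k + 2) + - int k * (4 * m + 4 * int k + 2))"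
    by (rule wt_hom_comp[OF wt_hom_fpow wt_hom_epow])
  then show "wt_hom (\<lambda>P. fpow k m (epow k m P)) 0" by simp
qed

text \<open>By \<open>epow_x0_div2\<close> the k-th summand is a multiple of f^(k+1) e^k v plus a
  multiple of f^k e^(k-1) v; the recursion for \<open>proj_coeff\<close> is exactly the condition
  that these cancel between neighbouring k.\<close>

lemma ext_proj_x0_div2:
  assumes "m \<ge> 0" "y0 (m + 2) v = 0"
  shows "ext_proj m (x0_div2 (m + 2) v) = 0"
proof -
  let ?w = "\<lambda>k. epow k (m + 2) v" and ?u = "x0_div2 (m + 2) v"
  obtain N where N: "\<forall>k>N. \<forall>m\<ge>0. epow k m v = 0 \<and> epow k m ?u = 0" using weight_bound2 by blast
  define g where "g k = fpow (Suc k) m (?w k)" for k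
  define M where "M = Suc N"
  have g0: "g M = 0"
    using N assms(1) lin_zero[OF dlin_lin[OF dlin_fpow]] by (simp add: g_def M_def del: epow.simps fpow.simps)
  have "ext_proj m ?u = (\<Sum>k\<le>M. scal (proj_coeff m k) * fpow k m (epow k m ?u))"
    by (rule ext_proj_eq_sum) (use N assms(1) in \<open>simp add: M_def\<close>)
  also have "\<dots> = (\<Sum>k\<le>M. scal (proj_coeff m k) * g k +
      scal (proj_coeff m k * of_int (int k * (m + int k + 1))) * g (k - 1))"
  proof (intro sum.cong refl)
    fix k
    have "fpow k m (of_int (int k * (m + int k + 1)) * ?w (k - 1)) =
        of_int (int k * (m + int k + 1)) * g (k - 1)"
      by (cases k) (simp_all only: lin_of_int[OF dlin_lin[OF dlin_fpow]] g_def, simp_all)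
    moreover have "fpow k m (x0_div2 (m + 2 + 2 * int k) (?w k)) = g k"
      by (simp add: g_def algebra_simps)
    moreover have "(of_int i :: complex bpoly) = scal (of_int i)" for i by simp
    ultimately show "scal (proj_coeff m k) * fpow k m (epow k m ?u) =
        scal (proj_coeff m k) * g k + scal (proj_coeff m k * of_int (int k * (m + int k + 1))) * g (k - 1)"
      unfolding epow_x0_div2[OF assms] dlin_add[OF dlin_fpow]
      by (simp only: distrib_left scal_mult mult.assoc)
  qed
  also have "\<dots> = (\<Sum>k\<le>M. scal (proj_coeff m k) * g k) +
      (\<Sum>k\<le>M. scal (proj_coeff m k * of_int (int k * (m + int k + 1))) * g (k - 1))"
    by (rule sum.distrib)
  also have "(\<Sum>k\<le>M. scal (proj_coeff m k * of_int (int k * (m + int k + 1))) * g (k - 1)) =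
      (\<Sum>k\<le>N. scal (proj_coeff m (Suc k) * of_int (int (Suc k) * (m + int (Suc k) + 1))) * g k)"
    unfolding M_def sum.atMost_Suc_shift by simp
  also have "\<dots> = (\<Sum>k\<le>N. scal (- proj_coeff m k) * g k)"
  proof (intro sum.cong refl arg_cong2[where f = "(*)"] arg_cong[where f = scal])
    fix k
    have eq: "int (Suc k) * (m + int (Suc k) + 1) = int (Suc k) * (m + int k + 2)" by simp
    have "int (Suc k) * (m + int k + 2) \<noteq> 0" using assms(1) by simp
    then have ne: "of_int (int (Suc k) * (m + int k + 2)) \<noteq> (0::complex)" by (simp only: of_int_eq_0_iff not_False_eq_True)
    have cancel: "x \<noteq> 0 \<Longrightarrow> - a / x * x = - a" for a x :: complex by simp
    show "proj_coeff m (Suc k) * of_int (int (Suc k) * (m + int (Suc k) + 1)) = - proj_coeff m k"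
      by (simp only: eq proj_coeff.simps cancel[OF ne])
  qed
  also have "(\<Sum>k\<le>M. scal (proj_coeff m k) * g k) = (\<Sum>k\<le>N. scal (proj_coeff m k) * g k)"
    using g0 by (simp add: M_def)
  finally show ?thesis by (simp add: scal_uminus sum_negf)
qed

lemma fpow_Suc_range: "\<exists>Y. fpow (Suc k) m X = x0_div2 (m + 2) Y"
proof (induction k arbitrary: X)
  case (Suc k)
  then show ?case unfolding fpow.simps(2)[of "Suc k"] by blast
qed auto

section \<open>The space of relations as the kernel of the projector\<close>

lemma A_rels_add: "u \<in> A_rels m \<Longrightarrow> v \<in> A_rels m \<Longrightarrow> u + v \<in> A_rels m"
proof -
  assume "u \<in> A_rels m" "v \<in> A_rels m"
  then obtain P Q P' Q' where "u = x0 (m + 1) P + x0_div2 (m + 2) Q" "v = x0 (m + 1) P' + x0_div2 (m + 2) Q'"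
    by (auto simp: A_rels_def)
  then have "u + v = x0 (m + 1) (P + P') + x0_div2 (m + 2) (Q + Q')"
    by (simp add: lin_add[OF lin_ops(1)] lin_add[OF lin_ops(3)])
  then show ?thesis by (auto simp: A_rels_def)
qed

lemma A_rels_mult: "d \<in> carrier D_alg \<Longrightarrow> u \<in> A_rels m \<Longrightarrow> d * u \<in> A_rels m"
proof -
  assume d: "d \<in> carrier D_alg" and "u \<in> A_rels m"
  then obtain P Q where "u = x0 (m + 1) P + x0_div2 (m + 2) Q"
    by (auto simp: A_rels_def)
  then have "d * u = x0 (m + 1) (d * P) + x0_div2 (m + 2) (d * Q)"
    by (simp add: distrib_left dlin_mult[OF dlin_ops(1) d] dlin_mult[OF dlin_ops(3) d])
  then show ?thesis by (auto simp: A_rels_def)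
qed

lemma A_rels_x0: "x0 (m + 1) P \<in> A_rels m"
  unfolding A_rels_def using lin_zero[OF lin_ops(3)] by (metis (mono_tags, lifting) add.right_neutral mem_Collect_eq)

lemma A_rels_x0_div2: "x0_div2 (m + 2) Q \<in> A_rels m"
  unfolding A_rels_def using lin_zero[OF lin_ops(1)] by (metis (mono_tags, lifting) add.left_neutral mem_Collect_eq)

lemma A_rels_0: "0 \<in> A_rels m"
  using A_rels_x0[of m 0] by (simp add: lin_zero[OF lin_ops(1)])

lemma A_rels_uminus: "u \<in> A_rels m \<Longrightarrow> - u \<in> A_rels m"
  using A_rels_mult[OF scal_in_D[of "- 1"], of u m] by (simp add: scal_uminus)

lemma A_rels_sum: "(\<And>i. i \<in> I \<Longrightarrow> f i \<in> A_rels m) \<Longrightarrow> (\<Sum>i\<in>I. f i) \<in> A_rels m"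
  by (induction I rule: infinite_finite_induct) (auto simp: A_rels_0 A_rels_add)

lemma dlin_ker_proj: "dlin (ker_proj m)"
  unfolding ker_proj_def[abs_def] by (rule dlin_times[OF dlin_comp[OF dlin_ops(2) dlin_ops(1)]])

lemma dlin_A_proj: "m \<ge> 0 \<Longrightarrow> dlin (A_proj m)"
  unfolding A_proj_def[abs_def] by (rule dlin_comp[OF dlin_ext_proj dlin_ker_proj])

lemma wt_hom_A_proj: "wt_hom (A_proj m) 0"
proof -
  have "wt_hom (\<lambda>v. y0 (m - 1) (x0 m v)) (- 2 * (m - 1) - 2 + 2 * m)"
    by (rule wt_hom_comp[OF wt_hom_y0 wt_hom_x0])
  then have "wt_hom (ker_proj m) 0"
    unfolding ker_proj_def[abs_def] by (intro wt_hom_scal) simp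
  from wt_hom_comp[OF wt_hom_ext_proj this] show ?thesis
    unfolding A_proj_def[abs_def] by simp
qed

lemma y0_ker_proj: "y0 m (ker_proj m v) = 0"
  using y0_y0[of "m - 1"] by (simp add: ker_proj_def lin_scal[OF lin_ops(2)])

lemma ker_proj_compl: "v - ker_proj m v \<in> A_rels m"
proof -
  have "v - ker_proj m v = (if even m then - x0 (m + 1) (y0 m v) else x0 (m + 1) (y0 m v))"
    by (simp add: ker_proj_def y0_x0 scal_uminus)
  then show ?thesis by (simp add: A_rels_x0 A_rels_uminus)
qed

text \<open>The summand for k = 0 is v itself, and in all others \<open>x0_div2\<close> is applied
  last.\<close>

lemma ext_proj_compl:
  assumes "m \<ge> 0" shows "v - ext_proj m v \<in> A_rels m"
proof -
  obtain N where N: "\<forall>k>N. \<forall>m\<ge>0. epow k m v = 0" using weight_bound by blast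
  have "ext_proj m v = (\<Sum>k\<le>Suc N. scal (proj_coeff m k) * fpow k m (epow k m v))"
    by (rule ext_proj_eq_sum) (use N assms in auto)
  also have "\<dots> = v + (\<Sum>k\<le>N. scal (proj_coeff m (Suc k)) * fpow (Suc k) m (epow (Suc k) m v))"
    unfolding sum.atMost_Suc_shift by simp
  finally have "v - ext_proj m v = - (\<Sum>k\<le>N. scal (proj_coeff m (Suc k)) * fpow (Suc k) m (epow (Suc k) m v))"
    by (simp only:) simp
  moreover have "scal (proj_coeff m (Suc k)) * fpow (Suc k) m (epow (Suc k) m v) \<in> A_rels m" for k
    using fpow_Suc_range[of k m "epow (Suc k) m v"] A_rels_x0_div2 A_rels_mult[OF scal_in_D] by metis
  ultimately show ?thesis by (simp only: A_rels_uminus A_rels_sum)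
qed

lemma A_proj_compl: "m \<ge> 0 \<Longrightarrow> v - A_proj m v \<in> A_rels m"
  using A_rels_add[OF ker_proj_compl[of v m] ext_proj_compl[of m "ker_proj m v"]]
  by (simp add: A_proj_def)

text \<open>Relations F P die because F^2 = 0. In f Q, the operator f commutes with E and F, so
  \<open>ker_proj\<close> moves inside and leaves f applied to a vector of ker E, which the extremal
  projector annihilates.\<close>

lemma A_proj_rels:
  assumes "m \<ge> 0" "u \<in> A_rels m" shows "A_proj m u = 0"
proof -
  obtain P Q where u: "u = x0 (m + 1) P + x0_div2 (m + 2) Q"
    using assms(2) by (auto simp: A_rels_def)
  have "x0 m (x0 (m + 1) P) = 0"
    using x0_x0[of "m + 1"] by simp
  moreover have "y0 (m - 1) (x0 m (x0_div2 (m + 2) Q)) = x0_div2 (m + 2) (y0 (m + 1) (x0 (m + 2) Q))"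
    using x0_x0_div2[of "m + 2" Q] y0_x0_div2[of "m + 1" "x0 (m + 2) Q"] by (simp add: add.commute)
  ultimately have "ker_proj m u = x0_div2 (m + 2) (ker_proj (m + 2) Q)"
    by (simp add: u ker_proj_def lin_add[OF lin_ops(1)] lin_add[OF lin_ops(2)] lin_zero[OF lin_ops(2)]
        lin_scal[OF lin_ops(3)] add.commute)
  then show ?thesis
    using ext_proj_x0_div2[OF assms(1) y0_ker_proj] by (simp add: A_proj_def)
qed

lemma A_proj_eq_0_iff: "m \<ge> 0 \<Longrightarrow> A_proj m v = 0 \<longleftrightarrow> v \<in> A_rels m"
  using A_proj_compl[of m v] A_proj_rels[of m v] by auto

lemma A_proj_idem: "m \<ge> 0 \<Longrightarrow> A_proj m (A_proj m v) = A_proj m v"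
  using A_proj_rels[OF _ A_proj_compl[of m v]] by (simp add: lin_diff[OF dlin_lin[OF dlin_A_proj]])

text \<open>Injective with range the space of relations, which makes the character of the quotient a
  difference of two characters.\<close>

definition rel_map :: "int \<Rightarrow> complex bpoly \<Rightarrow> complex bpoly" where
  "rel_map m v = x0 (m + 1) v + x0_div2 (m + 2) (y0 (m + 1) v)"

lemma dlin_rel_map: "dlin (rel_map m)"
  unfolding rel_map_def[abs_def] by (rule dlin_plus[OF dlin_ops(1) dlin_comp[OF dlin_ops(3) dlin_ops(2)]])

lemma wt_hom_rel_map: "wt_hom (rel_map m) (2 * m + 2)"
proof -
  have "wt_hom (\<lambda>v. x0_div2 (m + 2) (y0 (m + 1) v)) (4 * (m + 2) - 2 + (- 2 * (m + 1) - 2))"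
    by (rule wt_hom_comp[OF wt_hom_x0_div2 wt_hom_y0])
  moreover have "wt_hom (x0 (m + 1)) (2 * (m + 1))" by (rule wt_hom_x0)
  ultimately show ?thesis
    unfolding rel_map_def[abs_def] by (intro wt_hom_plus) (simp_all add: add.commute)
qed

text \<open>Applying E removes the second summand, since E f E = f E^2 = 0. Then E F v = 0 gives v =
  F E v up to sign, hence F v = 0, hence f (E v) = 0; as E v lies in ker E, where f is injective, E
  v = 0 and so v = 0.\<close>

lemma rel_map_inject:
  assumes "m \<ge> 0" "rel_map m v = 0" shows "v = 0"
proof -
  have yy: "y0 (m + 2) (y0 (m + 1) v) = 0"
    using y0_y0[of "m + 1" v] by (simp add: add.commute)
  have "y0 m (x0_div2 (m + 2) (y0 (m + 1) v)) = 0"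
    using y0_x0_div2[of "m + 2" "y0 (m + 1) v"] yy lin_zero[OF lin_ops(3)] by (simp add: add.commute)
  then have "y0 m (x0 (m + 1) v) = 0"
    using arg_cong[OF assms(2), of "y0 m"] by (simp add: rel_map_def lin_add[OF lin_ops(2)] lin_zero[OF lin_ops(2)])
  then have v: "x0 (m + 2) (y0 (m + 1) v) = (if even m then v else - v)"
    using y0_x0[of "m + 1" v] by (auto simp: add.commute eq_neg_iff_add_eq_0 split: if_splits)
  have "x0 (m + 1) (x0 (m + 2) (y0 (m + 1) v)) = 0"
    using x0_x0[of "m + 2"] by (simp add: add.commute)
  then have "x0 (m + 1) v = 0"
    unfolding v by (simp add: lin_uminus[OF lin_ops(1)] split: if_splits)
  then have "y0 (m + 1) v = 0"
    using x0_div2_inject[OF assms(1) yy] assms(2) by (simp add: rel_map_def)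
  then show ?thesis using v by (simp add: lin_zero[OF lin_ops(1)] split: if_splits)
qed

text \<open>The preimages: F P is up to sign the image of E F P, because F E F P is F P up to sign;
  the image of F Q is f E F Q, which is f Q up to sign plus F f E Q, an element already
  covered.\<close>

lemma range_rel_map: "range (rel_map m) = A_rels m"
proof
  show "range (rel_map m) \<subseteq> A_rels m"
    by (auto simp: rel_map_def A_rels_def)
  have add: "u + v \<in> range (rel_map m)" if "u \<in> range (rel_map m)" "v \<in> range (rel_map m)" for u v
    using that by (auto simp: dlin_add[OF dlin_rel_map, symmetric])
  have sgn: "(if even k then u else - u) \<in> range (rel_map m)" if "u \<in> range (rel_map m)" for u and k :: int
    using that by (auto simp: lin_uminus[OF dlin_lin[OF dlin_rel_map], symmetric])
  have x0: "x0 (m + 1) P \<in> range (rel_map m)" for P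
  proof -
    have "rel_map m (y0 m (x0 (m + 1) P)) = x0 (m + 1) (y0 m (x0 (m + 1) P))"
      by (simp add: rel_map_def y0_y0 lin_zero[OF lin_ops(3)])
    also have "\<dots> = (if even (m + 1) then x0 (m + 1) P else - x0 (m + 1) P)"
      using y0_x0[of "m + 1" P] x0_x0[of "m + 2"]
      by (simp add: lin_add[OF lin_ops(1)] lin_uminus[OF lin_ops(1)] add.commute)
    finally have "(if even (m + 1) then x0 (m + 1) P else - x0 (m + 1) P) \<in> range (rel_map m)"
      by (metis rangeI)
    from sgn[OF this, of "m + 1"] show ?thesis by (simp split: if_splits)
  qed
  have "x0_div2 (m + 2) Q \<in> range (rel_map m)" for Q
  proof -
    let ?a = "x0 (m + 2) Q" and ?b = "y0 (m + 2) Q"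
    have "rel_map m ?a = x0_div2 (m + 2) (y0 (m + 1) ?a)"
      using x0_x0[of "m + 2" Q] by (simp add: rel_map_def add.commute)
    moreover have "x0_div2 (m + 2) (x0 (m + 3) ?b) = x0 (m + 1) (x0_div2 (m + 3) ?b)"
      using x0_x0_div2[of "m + 3" ?b] by (simp add: add.commute)
    moreover have "y0 (m + 1) ?a = x0 (m + 3) ?b + (if even m then Q else - Q)"
      using y0_x0[of "m + 2" Q] by (simp add: add.commute)
    ultimately have "(if even m then x0_div2 (m + 2) Q else - x0_div2 (m + 2) Q) =
        rel_map m ?a + - x0 (m + 1) (x0_div2 (m + 3) ?b)"
      by (simp add: lin_add[OF lin_ops(3)] lin_uminus[OF lin_ops(3)])
    moreover have "- x0 (m + 1) (x0_div2 (m + 3) ?b) \<in> range (rel_map m)"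
      using sgn[OF x0, of 1] by simp
    ultimately have "(if even m then x0_div2 (m + 2) Q else - x0_div2 (m + 2) Q) \<in> range (rel_map m)"
      using add by (metis rangeI)
    from sgn[OF this, of m] show ?thesis by (simp split: if_splits)
  qed
  then show "A_rels m \<subseteq> range (rel_map m)"
    using x0 add by (auto simp: A_rels_def)
qed

section \<open>Separating odd and even variables\<close>

text \<open>The variable with index \<open>k\<close> is \<open>b\<^bsub>-(k+1)\<^esub>\<close>: odd variables have even indices.\<close>

definition odd_part :: "(nat \<Rightarrow>\<^sub>0 nat) \<Rightarrow> (nat \<Rightarrow>\<^sub>0 nat)" where
  "odd_part \<mu> = Poly_Mapping.mapp (\<lambda>k e. if even k then e else 0) \<mu>"

definition even_part :: "(nat \<Rightarrow>\<^sub>0 nat) \<Rightarrow> (nat \<Rightarrow>\<^sub>0 nat)" where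
  "even_part \<mu> = Poly_Mapping.mapp (\<lambda>k e. if odd k then e else 0) \<mu>"

lemma coef_odd_part: "coef (odd_part \<mu>) k = (if even k then coef \<mu> k else 0)"
  by (auto simp: odd_part_def lookup_mapp when_def in_keys_iff)

lemma coef_even_part: "coef (even_part \<mu>) k = (if odd k then coef \<mu> k else 0)"
  by (auto simp: even_part_def lookup_mapp when_def in_keys_iff)

lemma odd_part_add: "odd_part (\<mu> + \<nu>) = odd_part \<mu> + odd_part \<nu>"
  by (rule poly_mapping_eqI) (simp add: coef_odd_part lookup_add)

lemma even_part_add: "even_part (\<mu> + \<nu>) = even_part \<mu> + even_part \<nu>"
  by (rule poly_mapping_eqI) (simp add: coef_even_part lookup_add)

lemma odd_even_part: "odd_part \<mu> + even_part \<mu> = \<mu>"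
  by (rule poly_mapping_eqI) (simp add: coef_even_part coef_odd_part lookup_add)

lemma part_simps [simp]: "odd_part (odd_part \<mu>) = odd_part \<mu>" "odd_part (even_part \<mu>) = 0"
  "even_part (even_part \<mu>) = even_part \<mu>" "even_part (odd_part \<mu>) = 0" "odd_part 0 = 0" "even_part 0 = 0"
  by (rule poly_mapping_eqI; simp add: coef_even_part coef_odd_part)+

lemma odd_part_eq_0D: "odd_part \<mu> = 0 \<Longrightarrow> even_part \<mu> = \<mu>"
  using odd_even_part[of \<mu>] by simp

lemma even_part_eq_0D: "even_part \<mu> = 0 \<Longrightarrow> odd_part \<mu> = \<mu>"
  using odd_even_part[of \<mu>] by simp

lemma wt_parts: "wt \<mu> = wt (odd_part \<mu>) + wt (even_part \<mu>)"
  using wt_add[of "odd_part \<mu>" "even_part \<mu>"] by (simp add: odd_even_part)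

lemma even_part_eq_0_iff: "even_part \<mu> = 0 \<longleftrightarrow> (\<forall>k\<in>supp \<mu>. even k)"
  by (auto simp: poly_mapping_eq_iff fun_eq_iff coef_even_part in_keys_iff)

lemma carrier_D_alg': "d \<in> carrier D_alg \<longleftrightarrow> (\<forall>\<mu>\<in>supp d. even_part \<mu> = 0)"
  by (simp add: carrier_D_alg even_part_eq_0_iff)

lemma sgl_in_D: "even_part \<mu> = 0 \<Longrightarrow> sgl \<mu> c \<in> carrier D_alg"
  by (auto simp: carrier_D_alg')

text \<open>Reduction modulo the odd variables, with even polynomials as representatives.\<close>

definition rho :: "complex bpoly \<Rightarrow> complex bpoly" where
  "rho v = Poly_Mapping.mapp (\<lambda>\<mu> c. if odd_part \<mu> = 0 then c else 0) v"

lemma coef_rho: "coef (rho v) \<mu> = (if odd_part \<mu> = 0 then coef v \<mu> else 0)"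
  by (auto simp: rho_def lookup_mapp when_def in_keys_iff)

lemma lookup_scal_mult: "coef (scal c * v) \<mu> = c * coef (v::'r::comm_ring_1 bpoly) \<mu>"
  by (simp flip: pm_scale_eq_mult)

lemma lin_rho: "lin rho"
  by (rule linI; rule poly_mapping_eqI) (simp_all add: coef_rho lookup_add lookup_scal_mult)

definition even_poly :: "complex bpoly \<Rightarrow> bool" where
  "even_poly v \<longleftrightarrow> (\<forall>\<mu>\<in>supp v. odd_part \<mu> = 0)"

lemma rho_even: "even_poly v \<Longrightarrow> rho v = v"
  by (rule poly_mapping_eqI) (auto simp: coef_rho even_poly_def in_keys_iff)

lemma even_rho: "even_poly (rho v)"
  by (auto simp: even_poly_def in_keys_iff coef_rho split: if_splits)

lemma rho_rho [simp]: "rho (rho v) = rho v"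
  by (rule rho_even[OF even_rho])

text \<open>A filtration for the ideal of the odd variables, indexed by weight and not by degree:
  the odd weight is at most the total weight, so the filtration is finite on vectors of bounded
  weight.\<close>

definition odd_filt :: "nat \<Rightarrow> complex bpoly \<Rightarrow> bool" where
  "odd_filt k v \<longleftrightarrow> (\<forall>\<mu>\<in>supp v. k \<le> wt (odd_part \<mu>))"

lemma odd_filt_0 [simp]: "odd_filt 0 v" "odd_filt k 0"
  by (simp_all add: odd_filt_def)

lemma odd_filt_mono: "odd_filt k v \<Longrightarrow> j \<le> k \<Longrightarrow> odd_filt j v"
  by (auto simp: odd_filt_def)

lemma odd_filt_add: "odd_filt k u \<Longrightarrow> odd_filt k v \<Longrightarrow> odd_filt k (u + v)"
  using Poly_Mapping.keys_add[of u v] by (auto simp: odd_filt_def)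

lemma odd_filt_scal: "odd_filt k v \<Longrightarrow> odd_filt k (scal c * v)"
  by (auto simp: odd_filt_def in_keys_iff lookup_scal_mult)

lemma odd_filt_uminus: "odd_filt k v \<Longrightarrow> odd_filt k (- v)"
  by (auto simp: odd_filt_def in_keys_iff)

lemma odd_filt_diff: "odd_filt k u \<Longrightarrow> odd_filt k v \<Longrightarrow> odd_filt k (u - v)"
  using odd_filt_add[OF _ odd_filt_uminus, of k u v] by simp

lemma odd_filt_sum: "(\<And>i. i \<in> I \<Longrightarrow> odd_filt k (f i)) \<Longrightarrow> odd_filt k (\<Sum>i\<in>I. f i)"
  by (induction I rule: infinite_finite_induct) (simp_all add: odd_filt_add)

lemma odd_filt_times:
  assumes "odd_filt k v" shows "odd_filt (wt (odd_part \<alpha>) + k) (sgl \<alpha> c * v)"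
  unfolding odd_filt_def
proof
  fix \<nu> assume "\<nu> \<in> supp (sgl \<alpha> c * v)"
  then obtain \<beta> where "\<beta> \<in> supp v" "\<nu> = \<alpha> + \<beta>"
    using Poly_Mapping.keys_mult[of "sgl \<alpha> c" v] by (auto split: if_splits)
  then show "wt (odd_part \<alpha>) + k \<le> wt (odd_part \<nu>)"
    using assms by (simp add: odd_part_add wt_add odd_filt_def)
qed

lemma odd_filt_eq_0:
  assumes "odd_filt k v" "\<And>\<mu>. \<mu> \<in> supp v \<Longrightarrow> wt \<mu> < k" shows "v = 0"
proof (rule ccontr)
  assume "v \<noteq> 0"
  then obtain \<mu> where \<mu>: "\<mu> \<in> supp v" by (auto simp: poly_mapping_eq_iff fun_eq_iff in_keys_iff)
  then show False using assms(1) assms(2)[OF \<mu>] wt_parts[of \<mu>] by (force simp: odd_filt_def)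
qed

lemma odd_part_eq_0_iff: "odd_part \<mu> = 0 \<longleftrightarrow> wt (odd_part \<mu>) = 0"
proof
  assume "wt (odd_part \<mu>) = 0"
  then show "odd_part \<mu> = 0"
    by (auto simp: wt_def poly_mapping_eq_iff fun_eq_iff in_keys_iff)
qed simp

lemma rho_eq_0_iff: "rho v = 0 \<longleftrightarrow> odd_filt 1 v"
proof -
  have "rho v = 0 \<longleftrightarrow> (\<forall>\<mu>. odd_part \<mu> = 0 \<longrightarrow> coef v \<mu> = 0)"
    by (auto simp: poly_mapping_eq_iff fun_eq_iff coef_rho split: if_splits)
  also have "\<dots> \<longleftrightarrow> odd_filt 1 v"
  proof
    assume "\<forall>\<mu>. odd_part \<mu> = 0 \<longrightarrow> coef v \<mu> = 0"
    then have "odd_part \<mu> \<noteq> 0" if "\<mu> \<in> supp v" for \<mu> using that by (auto simp: in_keys_iff)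
    then show "odd_filt 1 v" unfolding odd_filt_def odd_part_eq_0_iff by (simp add: Suc_le_eq)
  next
    assume v: "odd_filt 1 v"
    show "\<forall>\<mu>. odd_part \<mu> = 0 \<longrightarrow> coef v \<mu> = 0"
    proof (intro allI impI, rule ccontr)
      fix \<mu> assume 0: "odd_part \<mu> = 0" and "coef v \<mu> \<noteq> 0"
      then have "\<mu> \<in> supp v" by (simp add: in_keys_iff)
      then have "1 \<le> wt (odd_part \<mu>)" using v unfolding odd_filt_def by blast
      then show False by (simp add: 0)
    qed
  qed
  finally show ?thesis .
qed

lemma odd_filt_rho: "odd_filt 1 (v - rho v)"
  by (rule rho_eq_0_iff[THEN iffD1]) (simp add: lin_diff[OF lin_rho])

lemma dlin_sgl: "dlin T \<Longrightarrow> T (sgl \<mu> 1) = sgl (odd_part \<mu>) 1 * T (sgl (even_part \<mu>) 1)"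
  using dlin_mult[OF _ sgl_in_D[of "odd_part \<mu>" 1], of T "sgl (even_part \<mu>) 1"]
  by (simp add: mult_single odd_even_part)

text \<open>By linearity over the odd variables, the odd part of a monomial passes through T
  unchanged, so only the effect of T on even monomials can alter the filtration.\<close>

lemma dlin_odd_filt_gen:
  assumes "dlin T" "\<And>\<epsilon>. odd_part \<epsilon> = 0 \<Longrightarrow> odd_filt j (T (sgl \<epsilon> 1))" "odd_filt k v"
  shows "odd_filt (k + j) (T v)"
proof -
  have *: "odd_filt (k + j) (T (sgl \<mu> 1))" if "\<mu> \<in> supp v" for \<mu>
  proof -
    have "odd_filt (wt (odd_part (odd_part \<mu>)) + j) (sgl (odd_part \<mu>) 1 * T (sgl (even_part \<mu>) 1))"
      by (rule odd_filt_times, rule assms(2)) simp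
    then show ?thesis
      using assms(3) that unfolding dlin_sgl[OF assms(1), of \<mu>] by (fastforce simp: odd_filt_def)
  qed
  show ?thesis
    by (subst lin_expand[OF dlin_lin[OF assms(1)]]) (intro odd_filt_sum odd_filt_scal *)
qed

lemma dlin_odd_filt: "dlin T \<Longrightarrow> odd_filt k v \<Longrightarrow> odd_filt k (T v)"
  using dlin_odd_filt_gen[of T 0 k v] by simp

lemma rho_dlin_rho:
  assumes "dlin T" shows "rho (T (rho v)) = rho (T v)"
proof -
  have "rho (T (v - rho v)) = 0"
    by (rule rho_eq_0_iff[THEN iffD2, OF dlin_odd_filt[OF assms odd_filt_rho]])
  then show ?thesis by (simp add: lin_diff[OF dlin_lin[OF assms]] lin_diff[OF lin_rho])
qed

text \<open>Over \<D> the polynomial ring is \<D> tensored with the even polynomials. This extends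
  the reduction of T on the even polynomials linearly over \<D>; for T linear over \<D> it is the
  operator induced on the graded ring of the filtration.\<close>

definition assoc_graded :: "(complex bpoly \<Rightarrow> complex bpoly) \<Rightarrow> complex bpoly \<Rightarrow> complex bpoly" where
  "assoc_graded T v =
    (\<Sum>\<mu>\<in>supp v. scal (coef v \<mu>) * (sgl (odd_part \<mu>) 1 * rho (T (sgl (even_part \<mu>) 1))))"

lemma sum_supp_superset:
  assumes "finite S" "supp v \<subseteq> S" "\<And>\<mu>. h \<mu> 0 = 0"
  shows "(\<Sum>\<mu>\<in>supp v. h \<mu> (coef v \<mu>)) = (\<Sum>\<mu>\<in>S. (h \<mu> (coef v \<mu>) :: 'a::comm_monoid_add))"
  by (rule sum.mono_neutral_left) (use assms in \<open>auto simp: in_keys_iff\<close>)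

lemma sum_supp_add:
  assumes "\<And>\<mu>. h \<mu> 0 = 0" "\<And>\<mu> c d. h \<mu> (c + d) = h \<mu> c + (h \<mu> d :: 'a::comm_monoid_add)"
  shows "(\<Sum>\<mu>\<in>supp (u + v). h \<mu> (coef (u + v) \<mu>)) =
    (\<Sum>\<mu>\<in>supp u. h \<mu> (coef u \<mu>)) + (\<Sum>\<mu>\<in>supp v. h \<mu> (coef v \<mu>))"
proof -
  let ?S = "supp u \<union> supp v"
  have *: "finite ?S" "supp (u + v) \<subseteq> ?S" "supp u \<subseteq> ?S" "supp v \<subseteq> ?S"
    using Poly_Mapping.keys_add[of u v] by auto
  show ?thesis
    unfolding sum_supp_superset[where h = h, OF *(1,2) assms(1)]
      sum_supp_superset[where h = h, OF *(1,3) assms(1)]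
      sum_supp_superset[where h = h, OF *(1,4) assms(1)]
    by (simp add: lookup_add assms(2) sum.distrib)
qed

lemma assoc_graded_sgl: "assoc_graded T (sgl \<mu> c) = scal c * (sgl (odd_part \<mu>) 1 * rho (T (sgl (even_part \<mu>) 1)))"
  by (cases "c = 0") (simp_all add: assoc_graded_def)

lemma dlin_assoc_graded: "dlin (assoc_graded T)"
proof (rule dlinI)
  show add: "assoc_graded T (u + v) = assoc_graded T u + assoc_graded T v" for u v
    unfolding assoc_graded_def by (rule sum_supp_add) (simp_all add: scal_add distrib_right)
  have sum: "assoc_graded T (\<Sum>i\<in>I. f i) = (\<Sum>i\<in>I. assoc_graded T (f i))" for I :: "(nat \<Rightarrow>\<^sub>0 nat) set" and f
  proof (induction I rule: infinite_finite_induct)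
    case (insert i I)
    show ?case unfolding sum.insert[OF insert(1,2)] add insert(3) ..
  qed (simp_all add: assoc_graded_def)
  fix d v assume d: "d \<in> carrier D_alg"
  have "d * v = (\<Sum>k\<in>supp d. sgl k (coef d k)) * (\<Sum>l\<in>supp v. sgl l (coef v l))"
    by (simp only: bpoly_expand'[symmetric])
  also have "\<dots> = (\<Sum>k\<in>supp d. \<Sum>l\<in>supp v. sgl (k + l) (coef d k * coef v l))"
    by (simp add: sum_product mult_single)
  finally have "assoc_graded T (d * v) = (\<Sum>k\<in>supp d. \<Sum>l\<in>supp v. assoc_graded T (sgl (k + l) (coef d k * coef v l)))"
    by (simp add: sum)
  also have "\<dots> = (\<Sum>k\<in>supp d. \<Sum>l\<in>supp v. sgl k (coef d k) * assoc_graded T (sgl l (coef v l)))"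
  proof (intro sum.cong refl)
    fix k l assume "k \<in> supp d"
    then have "even_part k = 0" using d by (simp add: carrier_D_alg')
    then have 1: "odd_part (k + l) = k + odd_part l" "even_part (k + l) = even_part l"
      by (simp_all add: odd_part_add even_part_add even_part_eq_0D)
    have 2: "sgl k (coef d k) = scal (coef d k) * sgl k 1"
      "sgl (k + odd_part l) 1 = sgl k 1 * sgl (odd_part l) (1::complex)" by (simp_all add: mult_single)
    show "assoc_graded T (sgl (k + l) (coef d k * coef v l)) = sgl k (coef d k) * assoc_graded T (sgl l (coef v l))"
      unfolding assoc_graded_sgl 1 2 scal_mult by (simp only: mult_ac)
  qed
  also have "\<dots> = (\<Sum>k\<in>supp d. sgl k (coef d k)) * assoc_graded T (\<Sum>l\<in>supp v. sgl l (coef v l))"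
    unfolding sum sum_product ..
  finally show "assoc_graded T (d * v) = d * assoc_graded T v"
    unfolding bpoly_expand'[of d, symmetric] bpoly_expand'[of v, symmetric] .
qed

lemma dlin_eqI:
  assumes "dlin T" "dlin U" "\<And>\<epsilon>. odd_part \<epsilon> = 0 \<Longrightarrow> T (sgl \<epsilon> 1) = U (sgl \<epsilon> 1)"
  shows "T v = U v"
proof (rule lin_eqI[OF dlin_lin[OF assms(1)] dlin_lin[OF assms(2)]])
  fix \<mu>
  have "T (sgl (even_part \<mu>) 1) = U (sgl (even_part \<mu>) 1)" by (rule assms(3)) simp
  then show "T (sgl \<mu> 1) = U (sgl \<mu> 1)"
    unfolding dlin_sgl[OF assms(1), of \<mu>] dlin_sgl[OF assms(2), of \<mu>] by (rule arg_cong)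
qed

lemma assoc_graded_even:
  assumes "dlin T" "even_poly v" shows "assoc_graded T v = rho (T v)"
proof -
  have *: "sgl (odd_part \<mu>) 1 * rho (T (sgl (even_part \<mu>) 1)) = rho (T (sgl \<mu> 1))" if "\<mu> \<in> supp v" for \<mu>
    using assms(2) that by (simp add: even_poly_def odd_part_eq_0D)
  have "rho (T v) = (\<Sum>\<mu>\<in>supp v. scal (coef v \<mu>) * rho (T (sgl \<mu> 1)))"
    by (rule lin_expand[OF lin_comp[OF lin_rho dlin_lin[OF assms(1)]]])
  then show ?thesis by (simp add: assoc_graded_def *)
qed

section \<open>Conjugating a homogeneous idempotent into its associated graded one\<close>

locale graded_idempotent =
  fixes \<pi> :: "complex bpoly \<Rightarrow> complex bpoly"
  assumes dlin_pi: "dlin \<pi>" and wt_hom_pi: "wt_hom \<pi> 0" and pi_idem: "\<pi> (\<pi> v) = \<pi> v"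
begin

abbreviation "\<pi>' \<equiv> assoc_graded \<pi>"

lemma pi'_idem: "\<pi>' (\<pi>' v) = \<pi>' v"
proof (rule dlin_eqI[OF dlin_comp[OF dlin_assoc_graded dlin_assoc_graded] dlin_assoc_graded])
  fix \<epsilon> assume "odd_part \<epsilon> = 0"
  then have "even_poly (sgl \<epsilon> 1)" by (simp add: even_poly_def)
  then show "\<pi>' (\<pi>' (sgl \<epsilon> 1)) = \<pi>' (sgl \<epsilon> 1)"
    by (simp add: assoc_graded_even[OF dlin_pi] even_rho rho_dlin_rho[OF dlin_pi] pi_idem)
qed

lemma wt_hom_pi': "wt_hom \<pi>' 0"
  unfolding wt_hom_def
proof (intro allI ballI)
  fix P \<nu> assume "\<nu> \<in> supp (\<pi>' P)"
  then have "\<nu> \<in> (\<Union>\<mu>\<in>supp P. supp (scal (coef P \<mu>) * (sgl (odd_part \<mu>) 1 * rho (\<pi> (sgl (even_part \<mu>) 1)))))"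
    unfolding assoc_graded_def by (rule subsetD[OF Poly_Mapping.keys_sum])
  then obtain \<mu> where \<mu>: "\<mu> \<in> supp P" "\<nu> \<in> supp (sgl (odd_part \<mu>) 1 * rho (\<pi> (sgl (even_part \<mu>) 1)))"
    by (auto simp: in_keys_iff lookup_scal_mult)
  then obtain \<nu>' where \<nu>': "\<nu>' \<in> supp (rho (\<pi> (sgl (even_part \<mu>) 1)))" "\<nu> = odd_part \<mu> + \<nu>'"
    using Poly_Mapping.keys_mult[of "sgl (odd_part \<mu>) (1::complex)" "rho (\<pi> (sgl (even_part \<mu>) 1))"] by auto
  then have "\<nu>' \<in> supp (\<pi> (sgl (even_part \<mu>) 1))"
    by (auto simp: in_keys_iff coef_rho split: if_splits)
  then have "wt \<nu>' = wt (even_part \<mu>)" using wt_homD[OF wt_hom_pi] by fastforce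
  then have "wt \<nu> = wt \<mu>" using \<nu>'(2) wt_parts[of \<mu>] by (simp add: wt_add)
  then show "\<exists>\<mu>\<in>supp P. int (wt \<nu>) = int (wt \<mu>) + 0" using \<mu>(1) by auto
qed

text \<open>\<open>phi\<close> conjugates the associated graded idempotent into the given one; it is unipotent for the
  filtration by odd weight.\<close>

definition phi :: "complex bpoly \<Rightarrow> complex bpoly" where
  "phi v = \<pi> (\<pi>' v) + ((v - \<pi>' v) - \<pi> (v - \<pi>' v))"

lemma dlin_phi: "dlin phi"
proof -
  have 1: "dlin (\<lambda>v. v - \<pi>' v)" by (rule dlin_minus[OF dlin_id dlin_assoc_graded])
  show ?thesis
    unfolding phi_def[abs_def]
    by (rule dlin_plus[OF dlin_comp[OF dlin_pi dlin_assoc_graded] dlin_minus[OF 1 dlin_comp[OF dlin_pi 1]]])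
qed

lemma pi_phi: "\<pi> (phi v) = phi (\<pi>' v)"
  by (simp only: phi_def lin_add[OF dlin_lin[OF dlin_pi]] lin_diff[OF dlin_lin[OF dlin_pi]] pi_idem pi'_idem
      diff_self lin_zero[OF dlin_lin[OF dlin_pi]] add_0_right)

lemma phi_fixed: "\<pi>' v = v \<Longrightarrow> phi v = \<pi> v"
  by (simp add: phi_def lin_zero[OF dlin_lin[OF dlin_pi]])

text \<open>1 - phi = (\<pi> - \<pi>')(1 - 2 \<pi>'), and \<pi> - \<pi>' sends even monomials into
  the ideal of the odd variables, hence raises the filtration by one.\<close>

lemma phi_unipotent:
  assumes "odd_filt k v" shows "odd_filt (Suc k) (v - phi v)"
proof -
  have d: "dlin (\<lambda>v. \<pi> v - \<pi>' v)" by (rule dlin_minus[OF dlin_pi dlin_assoc_graded])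
  have step: "odd_filt (k + 1) (\<pi> u - \<pi>' u)" if "odd_filt k u" for u
  proof (rule dlin_odd_filt_gen[OF d _ that])
    fix \<epsilon> assume "odd_part \<epsilon> = 0"
    then have "even_poly (sgl \<epsilon> 1)" by (simp add: even_poly_def)
    then show "odd_filt 1 (\<pi> (sgl \<epsilon> 1) - \<pi>' (sgl \<epsilon> 1))"
      by (simp add: assoc_graded_even[OF dlin_pi] odd_filt_rho[unfolded One_nat_def])
  qed
  let ?u = "v - \<pi>' v - \<pi>' v"
  have "odd_filt k ?u" by (intro odd_filt_diff assms dlin_odd_filt[OF dlin_assoc_graded])
  moreover have "v - phi v = \<pi> ?u - \<pi>' ?u"
    by (simp only: phi_def lin_diff[OF dlin_lin[OF dlin_pi]] lin_diff[OF dlin_lin[OF dlin_assoc_graded]] pi'_idem)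
      simp
  ultimately show ?thesis using step[of ?u] by simp
qed

lemma wt_hom_phi: "wt_hom phi 0"
proof -
  have 1: "wt_hom (\<lambda>v. v - \<pi>' v) 0" by (rule wt_hom_minus[OF wt_hom_id wt_hom_pi'])
  have 2: "wt_hom (\<lambda>v. \<pi> (v - \<pi>' v)) (0 + 0)" by (rule wt_hom_comp[OF wt_hom_pi 1])
  have 3: "wt_hom (\<lambda>v. \<pi> (\<pi>' v)) (0 + 0)" by (rule wt_hom_comp[OF wt_hom_pi wt_hom_pi'])
  show ?thesis
    unfolding phi_def[abs_def] using 2 3 by (intro wt_hom_plus wt_hom_minus[OF 1]) simp_all
qed

lemma wt_hom_diff_phi: "wt_hom (\<lambda>v. v - phi v) 0"
  by (rule wt_hom_minus[OF wt_hom_id wt_hom_phi])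

text \<open>The geometric series for the inverse of a unipotent operator. It is finite because 1 -
  phi preserves weights: beyond the largest weight of v the filtration is 0.\<close>

lemma phi_surj: "\<exists>w. phi w = v"
proof -
  define N where "N = Suc (Max (insert 0 (wt ` supp v)))"
  have N: "\<forall>\<mu>\<in>supp v. wt \<mu> < N" by (auto simp: N_def le_imp_less_Suc)
  have "\<exists>w. phi w = v" if "odd_filt (N - j) v" "\<forall>\<mu>\<in>supp v. wt \<mu> < N" for j v
    using that
  proof (induction j arbitrary: v)
    case 0
    then have "v = 0" by (intro odd_filt_eq_0[of N]) auto
    then show ?case using lin_zero[OF dlin_lin[OF dlin_phi]] by blast
  next
    case (Suc j)
    have "odd_filt (Suc (N - Suc j)) (v - phi v)" by (rule phi_unipotent[OF Suc.prems(1)])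
    then have "odd_filt (N - j) (v - phi v)" by (rule odd_filt_mono) auto
    moreover have "\<forall>\<mu>\<in>supp (v - phi v). wt \<mu> < N"
      using Suc.prems(2) wt_homD[OF wt_hom_diff_phi] by fastforce
    ultimately obtain w where "phi w = v - phi v" using Suc.IH by blast
    then have "phi (v + w) = v" by (simp add: dlin_add[OF dlin_phi])
    then show ?case by blast
  qed
  from this[of N v] show ?thesis using N by simp
qed

lemma phi_inj: assumes "phi v = 0" shows "v = 0"
proof -
  have "odd_filt k v" for k
  proof (induction k)
    case (Suc k)
    then show ?case using phi_unipotent[of k v] assms by simp
  qed simp
  then have "odd_filt (Suc (Max (insert 0 (wt ` supp v)))) v" .
  then show ?thesis by (rule odd_filt_eq_0) (auto simp: le_imp_less_Suc)
qed

end

section \<open>A basis over the odd variables\<close>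

interpretation pm: vector_space "pm_scale :: complex \<Rightarrow> ('x \<Rightarrow>\<^sub>0 complex) \<Rightarrow> ('x \<Rightarrow>\<^sub>0 complex)"
  by unfold_locales (rule poly_mapping_eqI; simp add: lookup_add algebra_simps)+

lemma coef_le_wt: "(k + 1) * coef \<mu> k \<le> wt \<mu>"
proof (cases "k \<in> supp \<mu>")
  case True
  then show ?thesis unfolding wt_def
    using member_le_sum[of k "supp \<mu>" "\<lambda>k. (k + 1) * coef \<mu> k"] by simp
next
  case False
  then have "coef \<mu> k = 0" by (simp add: in_keys_iff)
  then show ?thesis by simp
qed

lemma finite_wt: "finite {\<mu>. wt \<mu> = n}"
proof (rule finite_imageD)
  show "inj_on coef {\<mu>. wt \<mu> = n}" by (rule inj_onI) (simp only: poly_mapping_eq_iff)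
  have "finite {f. \<forall>x. (x \<in> {..<n} \<longrightarrow> f x \<in> {..n}) \<and> (x \<notin> {..<n} \<longrightarrow> f x = (0::nat))}"
    by (rule finite_set_of_finite_funs) auto
  then show "finite (coef ` {\<mu>. wt \<mu> = n})"
  proof (rule rev_finite_subset, clarify)
    fix \<mu> x
    have *: "(x + 1) * coef \<mu> x \<le> wt \<mu>" by (rule coef_le_wt)
    have "1 * coef \<mu> x \<le> (x + 1) * coef \<mu> x" by (rule mult_le_mono1) simp
    from le_trans[OF this *] have "coef \<mu> x \<le> wt \<mu>" by simp
    moreover have "coef \<mu> x = 0" if "\<not> x < wt \<mu>"
    proof (rule ccontr)
      assume "coef \<mu> x \<noteq> 0"
      then have "(x + 1) * 1 \<le> (x + 1) * coef \<mu> x" by (intro mult_le_mono2) simp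
      from le_trans[OF this *] that show False by simp
    qed
    ultimately show "(x \<in> {..<wt \<mu>} \<longrightarrow> coef \<mu> x \<in> {..wt \<mu>}) \<and> (x \<notin> {..<wt \<mu>} \<longrightarrow> coef \<mu> x = 0)"
      by auto
  qed
qed

lemma countable_exponents: "countable (UNIV :: (nat \<Rightarrow>\<^sub>0 nat) set)"
proof -
  have "UNIV = (\<Union>n. {\<mu>. wt \<mu> = n})" by auto
  moreover have "countable (\<Union>n. {\<mu>. wt \<mu> = n})"
    by (rule countable_UN) (auto intro: countable_finite finite_wt)
  ultimately show ?thesis by metis
qed

definition lincomb :: "(nat \<Rightarrow> complex bpoly) \<Rightarrow> (nat \<Rightarrow>\<^sub>0 complex bpoly) \<Rightarrow> complex bpoly" where
  "lincomb u c = (\<Sum>n\<in>supp c. coef c n * u n)"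

text \<open>The free \<D>-module of countable rank, with which both sides of the isomorphism are
  compared.\<close>

definition D_vec :: "(nat \<Rightarrow>\<^sub>0 complex bpoly) set" where
  "D_vec = {c. \<forall>n. coef c n \<in> carrier D_alg}"

lemma D_closed:
  "0 \<in> carrier D_alg" "1 \<in> carrier D_alg"
  "d \<in> carrier D_alg \<Longrightarrow> e \<in> carrier D_alg \<Longrightarrow> d + e \<in> carrier D_alg"
  "d \<in> carrier D_alg \<Longrightarrow> e \<in> carrier D_alg \<Longrightarrow> d * e \<in> carrier D_alg"
  "d \<in> carrier D_alg \<Longrightarrow> - d \<in> carrier D_alg"
proof -
  show "0 \<in> carrier D_alg" by (simp add: carrier_D_alg')
  show "1 \<in> carrier D_alg" using scal_in_D[of 1] by simp
  show "- d \<in> carrier D_alg" if "d \<in> carrier D_alg"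
    using that by (simp add: carrier_D_alg' in_keys_iff)
  show "d + e \<in> carrier D_alg" if "d \<in> carrier D_alg" "e \<in> carrier D_alg"
    using that subsetD[OF Poly_Mapping.keys_add[of d e]] by (auto simp: carrier_D_alg')
  show "d * e \<in> carrier D_alg" if "d \<in> carrier D_alg" "e \<in> carrier D_alg"
    using that subsetD[OF Poly_Mapping.keys_mult[of d e]] by (fastforce simp: carrier_D_alg' even_part_add)
qed

lemma D_vec_closed: "0 \<in> D_vec" "c \<in> D_vec \<Longrightarrow> c' \<in> D_vec \<Longrightarrow> c + c' \<in> D_vec"
  "d \<in> carrier D_alg \<Longrightarrow> c \<in> D_vec \<Longrightarrow> pm_scale d c \<in> D_vec"
  "d \<in> carrier D_alg \<Longrightarrow> sgl n d \<in> D_vec" "c \<in> D_vec \<Longrightarrow> - c \<in> D_vec"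
  by (auto simp: D_vec_def D_closed lookup_add lookup_single when_def)

lemma lincomb_superset: "finite S \<Longrightarrow> supp c \<subseteq> S \<Longrightarrow> lincomb u c = (\<Sum>n\<in>S. coef c n * u n)"
  unfolding lincomb_def by (rule sum_supp_superset[where h = "\<lambda>n d. d * u n"]) auto

lemma lincomb_0 [simp]: "lincomb u 0 = 0"
  by (simp add: lincomb_def)

lemma lincomb_add: "lincomb u (c + c') = lincomb u c + lincomb u c'"
  unfolding lincomb_def by (rule sum_supp_add) (simp_all add: distrib_right)

lemma lincomb_scale: "lincomb u (pm_scale d c) = d * lincomb u c"
proof -
  have "supp (pm_scale d c) \<subseteq> supp c" by (auto simp: in_keys_iff)
  then have eq: "lincomb u (pm_scale d c) = (\<Sum>n\<in>supp c. coef (pm_scale d c) n * u n)"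
    by (rule lincomb_superset[OF finite_keys])
  show ?thesis unfolding eq by (simp add: lincomb_def sum_distrib_left mult.assoc)
qed

lemma lincomb_single [simp]: "lincomb u (sgl n d) = d * u n"
  by (simp add: lincomb_def)

lemma lincomb_diff: "lincomb u (c - c') = lincomb u c - lincomb u c'"
  using lincomb_add[of u "c - c'" c'] by simp

lemma dlin_lincomb:
  assumes "dlin T" "c \<in> D_vec" shows "T (lincomb u c) = lincomb (\<lambda>n. T (u n)) c"
proof -
  have "coef c n \<in> carrier D_alg" for n using assms(2) by (simp add: D_vec_def)
  then show ?thesis
    by (simp add: lincomb_def lin_sum[OF dlin_lin[OF assms(1)]] dlin_mult[OF assms(1)])
qed

text \<open>An exponent splits uniquely into odd and even part, so no other pair of monomials
  contributes. In effect \<D> and the even polynomials are linearly disjoint.\<close>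

lemma coef_odd_times_even:
  assumes "d \<in> carrier D_alg" "even_poly u" "even_part \<alpha> = 0" "odd_part \<epsilon> = 0"
  shows "coef (d * u) (\<alpha> + \<epsilon>) = coef d \<alpha> * coef u \<epsilon>"
proof -
  have "d * u = (\<Sum>k\<in>supp d. sgl k (coef d k)) * (\<Sum>l\<in>supp u. sgl l (coef u l))"
    by (simp only: bpoly_expand'[symmetric])
  also have "\<dots> = (\<Sum>k\<in>supp d. \<Sum>l\<in>supp u. sgl (k + l) (coef d k * coef u l))"
    by (simp add: sum_product mult_single)
  finally have "coef (d * u) (\<alpha> + \<epsilon>) =
      (\<Sum>k\<in>supp d. \<Sum>l\<in>supp u. coef d k * coef u l when k + l = \<alpha> + \<epsilon>)"
    by (simp add: lookup_sum lookup_single)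
  also have "\<dots> = (\<Sum>k\<in>supp d. \<Sum>l\<in>supp u. if l = \<epsilon> then if k = \<alpha> then coef d \<alpha> * coef u \<epsilon> else 0 else 0)"
  proof (intro sum.cong refl)
    fix k l assume "k \<in> supp d" "l \<in> supp u"
    then have k: "even_part k = 0" and l: "odd_part l = 0"
      using assms(1,2) by (auto simp: carrier_D_alg' even_poly_def)
    have "k = \<alpha> \<and> l = \<epsilon>" if "k + l = \<alpha> + \<epsilon>"
      using arg_cong[OF that, of odd_part] arg_cong[OF that, of even_part] k l assms(3,4)
      by (simp add: odd_part_add even_part_add odd_part_eq_0D even_part_eq_0D)
    then show "(coef d k * coef u l when k + l = \<alpha> + \<epsilon>) =
        (if l = \<epsilon> then if k = \<alpha> then coef d \<alpha> * coef u \<epsilon> else 0 else 0)"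
      by (auto simp: when_def)
  qed
  also have "\<dots> = coef d \<alpha> * coef u \<epsilon>"
    by (cases "coef u \<epsilon> = 0"; cases "coef d \<alpha> = 0") (simp_all add: in_keys_iff)
  finally show ?thesis .
qed

context graded_idempotent
begin

text \<open>A complex basis of the reduced values of \<pi> on even monomials is a \<D>-basis of the
  range of \<pi>', and \<open>phi\<close> carries it to a \<D>-basis of the range of \<pi>. The
  hypothesis \<open>large\<close> makes it infinite, so that it can be indexed by all natural
  numbers.\<close>

lemma free_basis:
  assumes large: "\<And>N. \<exists>\<epsilon>. odd_part \<epsilon> = 0 \<and> wt \<epsilon> > N \<and> rho (\<pi> (sgl \<epsilon> 1)) \<noteq> 0"
  obtains w :: "nat \<Rightarrow> complex bpoly" where
    "\<And>c. c \<in> D_vec \<Longrightarrow> lincomb w c = 0 \<Longrightarrow> c = 0"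
    "\<And>v. \<exists>c\<in>D_vec. \<pi> v = lincomb w c" "\<And>n. \<pi> (w n) = w n"
proof -
  define E0 where "E0 = (\<lambda>\<epsilon>. rho (\<pi> (sgl \<epsilon> 1))) ` {\<epsilon>. odd_part \<epsilon> = 0}"
  obtain B where B: "B \<subseteq> E0" "pm.independent B" "E0 \<subseteq> pm.span B"
    using pm.maximal_independent_subset[of E0] by blast
  have "countable E0"
    unfolding E0_def by (intro countable_image countable_subset[OF subset_UNIV countable_exponents])
  with B(1) have "countable B" by (rule countable_subset)
  \<comment> \<open>Finitely many vectors have bounded weights, whereas a nonzero reduced value has
    the weight of its argument, and \<open>large\<close> provides arguments of arbitrarily large
    weight.\<close>
  moreover have "infinite B"
  proof
    assume fin: "finite B"
    then have fin': "finite (\<Union>b\<in>B. wt ` supp b)" by auto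
    then obtain N where "\<forall>k\<in>(\<Union>b\<in>B. wt ` supp b). k \<le> N"
      unfolding finite_nat_set_iff_bounded_le by blast
    then have N: "\<forall>b\<in>B. \<forall>\<mu>\<in>supp b. wt \<mu> \<le> N" by blast
    have "pm.subspace {v. \<forall>\<mu>\<in>supp v. wt \<mu> \<le> N}"
    proof (rule pm.subspaceI)
      fix u v :: "complex bpoly" assume "u \<in> {v. \<forall>\<mu>\<in>supp v. wt \<mu> \<le> N}" "v \<in> {v. \<forall>\<mu>\<in>supp v. wt \<mu> \<le> N}"
      then show "u + v \<in> {v. \<forall>\<mu>\<in>supp v. wt \<mu> \<le> N}"
        using subsetD[OF Poly_Mapping.keys_add[of u v]] by auto
    qed (auto simp: in_keys_iff)
    then have "pm.span B \<subseteq> {v. \<forall>\<mu>\<in>supp v. wt \<mu> \<le> N}"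
      by (intro pm.span_minimal) (use N in auto)
    moreover obtain \<epsilon> where \<epsilon>: "odd_part \<epsilon> = 0" "wt \<epsilon> > N" "rho (\<pi> (sgl \<epsilon> 1)) \<noteq> 0"
      using large by blast
    moreover have "rho (\<pi> (sgl \<epsilon> 1)) \<in> pm.span B"
      using B(3) \<epsilon>(1) by (auto simp: E0_def)
    ultimately have le: "\<forall>\<mu>\<in>supp (rho (\<pi> (sgl \<epsilon> 1))). wt \<mu> \<le> N" by auto
    obtain \<nu> where \<nu>: "\<nu> \<in> supp (rho (\<pi> (sgl \<epsilon> 1)))"
      using \<epsilon>(3) by (auto simp: poly_mapping_eq_iff fun_eq_iff in_keys_iff)
    then have "\<nu> \<in> supp (\<pi> (sgl \<epsilon> 1))" by (auto simp: in_keys_iff coef_rho split: if_splits)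
    then have "wt \<nu> = wt \<epsilon>" using wt_homD[OF wt_hom_pi] by fastforce
    then show False using le \<nu> \<epsilon>(2) by auto
  qed
  ultimately have bij: "bij_betw (from_nat_into B) UNIV B" by (rule bij_betw_from_nat_into)
  define u where "u = from_nat_into B"
  have uB: "u n \<in> B" for n using bij by (auto simp: u_def bij_betw_def)
  have inj: "inj u" using bij by (simp add: u_def bij_betw_def)
  have u_fix: "\<pi>' (u n) = u n" and u_even: "even_poly (u n)" for n
  proof -
    obtain \<epsilon> where "u n = rho (\<pi> (sgl \<epsilon> 1))" using uB[of n] B(1) by (auto simp: E0_def)
    then show "\<pi>' (u n) = u n" "even_poly (u n)"
      by (simp_all add: assoc_graded_even[OF dlin_pi] even_rho rho_dlin_rho[OF dlin_pi] pi_idem)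
  qed
  define S where "S = lincomb u ` D_vec"
  have S_add: "a + b \<in> S" if ab: "a \<in> S" "b \<in> S" for a b
  proof -
    obtain c c' where "c \<in> D_vec" "c' \<in> D_vec" "a = lincomb u c" "b = lincomb u c'"
      using ab unfolding S_def by blast
    then show ?thesis unfolding S_def by (intro image_eqI[of _ _ "c + c'"]) (simp_all add: lincomb_add D_vec_closed)
  qed
  have S_mult: "d * a \<in> S" if d: "d \<in> carrier D_alg" and a: "a \<in> S" for d a
  proof -
    obtain c where "c \<in> D_vec" "a = lincomb u c" using a unfolding S_def by blast
    then show ?thesis unfolding S_def using d
      by (intro image_eqI[of _ _ "pm_scale d c"]) (simp_all add: lincomb_scale D_vec_closed)
  qed
  have S_0: "0 \<in> S" unfolding S_def by (rule image_eqI[of _ _ 0]) (simp_all add: D_vec_closed)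
  have S_u: "u n \<in> S" for n
    unfolding S_def by (rule image_eqI[of _ _ "sgl n 1"]) (simp_all add: D_vec_closed D_closed)
  have "pm.span B \<subseteq> S"
  proof (rule pm.span_minimal)
    have "B = range u" using bij by (simp add: u_def bij_betw_def)
    then show "B \<subseteq> S" using S_u by (simp add: image_subset_iff)
    show "pm.subspace S"
      by (rule pm.subspaceI) (simp_all add: S_0 S_add S_mult pm_scale_eq_mult)
  qed
  then have E0_S: "E0 \<subseteq> S" using B(3) by blast
  have S_sum: "(\<Sum>i\<in>I. f i) \<in> S" if "\<And>i. i \<in> I \<Longrightarrow> f i \<in> S" for I :: "(nat \<Rightarrow>\<^sub>0 nat) set" and f
    using that by (induction I rule: infinite_finite_induct) (simp_all add: S_0 S_add)
  have pi'_S: "\<pi>' v \<in> S" for v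
    unfolding assoc_graded_def
  proof (intro S_sum S_mult scal_in_D)
    fix \<mu> assume "\<mu> \<in> supp v"
    show "sgl (odd_part \<mu>) 1 \<in> carrier D_alg" by (simp add: sgl_in_D)
    have "rho (\<pi> (sgl (even_part \<mu>) 1)) \<in> E0" unfolding E0_def by (rule image_eqI[OF refl]) simp
    then show "rho (\<pi> (sgl (even_part \<mu>) 1)) \<in> S" using E0_S by blast
  qed
  have phi_comb: "phi (lincomb u c) = lincomb (\<lambda>n. \<pi> (u n)) c" if "c \<in> D_vec" for c
    by (simp add: dlin_lincomb[OF dlin_phi that] phi_fixed[OF u_fix])
  show ?thesis
  proof (rule that[of "\<lambda>n. \<pi> (u n)"])
    show "\<pi> (\<pi> (u n)) = \<pi> (u n)" for n by (rule pi_idem)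
    show "\<exists>c\<in>D_vec. \<pi> v = lincomb (\<lambda>n. \<pi> (u n)) c" for v
    proof -
      obtain w where w: "phi w = v" using phi_surj by blast
      obtain c where c: "c \<in> D_vec" "\<pi>' w = lincomb u c" using pi'_S[of w] by (auto simp: S_def)
      then have "\<pi> v = lincomb (\<lambda>n. \<pi> (u n)) c"
        by (simp add: w[symmetric] pi_phi phi_comb)
      then show ?thesis using c(1) by blast
    qed
    show "c = 0" if c: "c \<in> D_vec" "lincomb (\<lambda>n. \<pi> (u n)) c = 0" for c
    proof -
      have 0: "lincomb u c = 0" using phi_comb[OF c(1)] c(2) phi_inj by simp
      have "coef (coef c n) \<alpha> = 0" if n: "n \<in> supp c" for n \<alpha>
      proof (cases "even_part \<alpha> = 0")
        case True
        \<comment> \<open>Comparing coefficients at \<alpha> + \<epsilon> for a fixed odd \<alpha>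
          turns the relation over \<D> into a complex relation between the basis vectors.\<close>
        have "(\<Sum>n\<in>supp c. pm_scale (coef (coef c n) \<alpha>) (u n)) = 0"
        proof (rule poly_mapping_eqI)
          fix \<epsilon>
          show "coef (\<Sum>n\<in>supp c. pm_scale (coef (coef c n) \<alpha>) (u n)) \<epsilon> = coef 0 \<epsilon>"
          proof (cases "odd_part \<epsilon> = 0")
            case odd: True
            have "coef (lincomb u c) (\<alpha> + \<epsilon>) = (\<Sum>n\<in>supp c. coef (coef c n) \<alpha> * coef (u n) \<epsilon>)"
              unfolding lincomb_def lookup_sum
              by (intro sum.cong refl coef_odd_times_even u_even True odd) (use c(1) in \<open>simp add: D_vec_def\<close>)
            then show ?thesis by (simp add: 0 lookup_sum)
          next
            case False
            then have "coef (u n) \<epsilon> = 0" for n using u_even[of n] by (auto simp: even_poly_def in_keys_iff)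
            then show ?thesis by (simp add: lookup_sum)
          qed
        qed
        then have "(\<Sum>b\<in>u ` supp c. pm_scale (coef (coef c (the_inv u b)) \<alpha>) b) = 0"
          by (subst sum.reindex) (use inj in \<open>auto simp: the_inv_f_f inj_on_def\<close>)
        then have "coef (coef c (the_inv u (u n))) \<alpha> = 0"
          by (rule pm.independentD[OF B(2), rotated 2]) (use n uB in auto)
        then show ?thesis by (simp add: the_inv_f_f[OF inj])
      next
        case False
        then have "\<alpha> \<notin> supp (coef c n)" using c(1) by (auto simp: D_vec_def carrier_D_alg')
        then show ?thesis by (simp add: in_keys_iff)
      qed
      then have "coef c n = 0" if "n \<in> supp c" for n using that by (intro poly_mapping_eqI) simp
      then have "coef c n = 0" for n by (cases "n \<in> supp c") (simp_all add: not_in_keys_iff_lookup_eq_zero)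
      then show ?thesis by (intro poly_mapping_eqI) simp
    qed
  qed
qed

end

section \<open>Counting\<close>

lemma wt_hom_linear_combination:
  assumes "lin T" "wt_hom T c" "\<nu> \<in> supp (\<Sum>\<mu>\<in>M. scal (f \<mu>) * T (sgl \<mu> 1))"
  shows "\<exists>\<mu>\<in>M. int (wt \<nu>) = int (wt \<mu>) + c"
proof -
  have "\<nu> \<in> (\<Union>\<mu>\<in>M. supp (scal (f \<mu>) * T (sgl \<mu> 1)))"
    using assms(3) by (rule subsetD[OF Poly_Mapping.keys_sum])
  then obtain \<mu> where \<mu>': "\<mu> \<in> M" "\<nu> \<in> supp (scal (f \<mu>) * T (sgl \<mu> 1))" by blast
  then have "f \<mu> * coef (T (sgl \<mu> 1)) \<nu> \<noteq> 0" by (simp only: in_keys_iff lookup_scal_mult not_False_eq_True)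
  then have \<mu>: "\<mu> \<in> M" "\<nu> \<in> supp (T (sgl \<mu> 1))" using \<mu>'(1) by (auto simp only: in_keys_iff mult_zero_right)
  then show ?thesis using wt_homD[OF assms(2) \<mu>(2)] by (auto split: if_splits)
qed

text \<open>An injective homogeneous map reflects homogeneity: the part of x of the wrong weights
  has an image that can meet neither the given weight nor the image of the rest, so this image is
  0.\<close>

lemma rel_map_homogeneous:
  assumes "m \<ge> 0" "\<And>\<nu>. \<nu> \<in> supp (rel_map m x) \<Longrightarrow> int (wt \<nu>) = w" "\<mu> \<in> supp x"
  shows "int (wt \<mu>) + 2 * m + 2 = w"
proof (rule ccontr)
  assume \<mu>: "int (wt \<mu>) + 2 * m + 2 \<noteq> w"
  define M where "M = {\<mu> \<in> supp x. int (wt \<mu>) + 2 * m + 2 = w}"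
  define M' where "M' = {\<mu> \<in> supp x. int (wt \<mu>) + 2 * m + 2 \<noteq> w}"
  have fin: "finite M" "finite M'" "M \<inter> M' = {}" "supp x = M \<union> M'"
    by (auto simp: M_def M'_def)
  note lin = dlin_lin[OF dlin_rel_map[of m]]
  let ?s = "\<lambda>K. \<Sum>\<mu>\<in>K. scal (coef x \<mu>) * rel_map m (sgl \<mu> 1)"
  have split: "rel_map m x = ?s M + ?s M'"
    by (subst lin_expand[OF lin]) (simp only: fin(4) sum.union_disjoint[OF fin(1,2,3)])
  have M': "rel_map m (\<Sum>\<mu>\<in>M'. scal (coef x \<mu>) * sgl \<mu> 1) = ?s M'"
    by (simp add: lin_sum[OF lin] lin_scal[OF lin])
  have "?s M' = 0"
  proof (rule ccontr)
    assume "?s M' \<noteq> 0"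
    then obtain \<nu> where \<nu>: "\<nu> \<in> supp (?s M')" by (auto simp: poly_mapping_eq_iff fun_eq_iff in_keys_iff)
    then have "int (wt \<nu>) \<noteq> w"
      using wt_hom_linear_combination[OF lin wt_hom_rel_map \<nu>] by (auto simp: M'_def)
    moreover have "?s M' = rel_map m x - ?s M" using split by simp
    then have "\<nu> \<in> supp (rel_map m x) \<union> supp (?s M)"
      using \<nu> Poly_Mapping.keys_diff[of "rel_map m x" "?s M"] by auto
    ultimately show False
      using assms(2) wt_hom_linear_combination[OF lin wt_hom_rel_map, of \<nu> "coef x" M] by (auto simp: M_def)
  qed
  then have 0: "(\<Sum>\<mu>\<in>M'. scal (coef x \<mu>) * sgl \<mu> 1) = 0"
    using rel_map_inject[OF assms(1)] M' by simp
  have "\<mu> \<in> M'" using assms(3) \<mu> by (simp add: M'_def)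
  then have "coef (\<Sum>\<mu>\<in>M'. scal (coef x \<mu>) * sgl \<mu> 1) \<mu> = coef x \<mu>"
    using fin(2) by (simp add: lookup_sum mult_single lookup_single when_def)
  then show False using 0 assms(3) by (simp add: in_keys_iff)
qed

section \<open>Bases of monomials and their images\<close>

lemma pm_independentI:
  assumes "\<And>t u v. finite t \<Longrightarrow> t \<subseteq> B \<Longrightarrow> (\<Sum>v\<in>t. pm_scale (u v) v) = 0 \<Longrightarrow> v \<in> t \<Longrightarrow> u v = (0::complex)"
  shows "pm.independent B"
  unfolding pm.independent_explicit_module using assms by blast

lemma sgl_one_inject: "sgl x (1::complex) = sgl y 1 \<longleftrightarrow> x = y"
proof
  assume "sgl x (1::complex) = sgl y 1"
  then have "coef (sgl x (1::complex)) y = coef (sgl y 1) y" by (rule arg_cong)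
  then show "x = y" by (simp add: lookup_single when_def split: if_splits)
qed simp

lemma independent_monomials: "pm.independent ((\<lambda>\<mu>. sgl \<mu> (1::complex)) ` M)"
proof (rule pm_independentI)
  fix t u and v :: "'a \<Rightarrow>\<^sub>0 complex"
  assume t: "finite t" "t \<subseteq> (\<lambda>\<mu>. sgl \<mu> (1::complex)) ` M" "(\<Sum>v\<in>t. pm_scale (u v) v) = 0" "v \<in> t"
  then obtain \<mu> where v: "v = sgl \<mu> 1" by blast
  have "u v = (\<Sum>w\<in>t. if w = v then u v else 0)" using t by simp
  also have "\<dots> = (\<Sum>w\<in>t. u w * coef w \<mu>)"
  proof (intro sum.cong refl)
    fix w assume "w \<in> t"
    then obtain \<nu> where "w = sgl \<nu> 1" using t(2) by blast
    then show "(if w = v then u v else 0) = u w * coef w \<mu>"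
      by (auto simp: v lookup_single when_def sgl_one_inject)
  qed
  also have "\<dots> = coef (\<Sum>w\<in>t. pm_scale (u w) w) \<mu>" by (simp add: lookup_sum)
  finally show "u v = 0" by (simp add: t(3))
qed

lemma span_monomials: "supp v \<subseteq> M \<Longrightarrow> v \<in> pm.span ((\<lambda>\<mu>. sgl \<mu> (1::complex)) ` M)"
proof -
  assume M: "supp v \<subseteq> M"
  have eq: "v = (\<Sum>\<mu>\<in>supp v. pm_scale (coef v \<mu>) (sgl \<mu> 1))"
    by (rule poly_mapping_eqI) (auto simp: lookup_sum lookup_single when_def in_keys_iff sum.delta')
  have "(\<Sum>\<mu>\<in>supp v. pm_scale (coef v \<mu>) (sgl \<mu> 1)) \<in> pm.span ((\<lambda>\<mu>. sgl \<mu> (1::complex)) ` M)"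
    by (intro pm.span_sum pm.span_scale pm.span_base imageI) (rule subsetD[OF M])
  then show ?thesis unfolding eq[symmetric] .
qed

lemma card_monomials: "card ((\<lambda>\<mu>. sgl \<mu> (1::complex)) ` M) = card M"
  by (rule card_image) (auto simp: inj_on_def sgl_one_inject)

lemma independent_lin_image:
  assumes "lin T" "\<And>v. T v = 0 \<Longrightarrow> v = 0" "pm.independent B"
  shows "pm.independent (T ` B)" "inj_on T B"
proof -
  show inj: "inj_on T B"
  proof (rule inj_onI)
    fix x y assume "T x = T y"
    then have "T (x - y) = 0" by (simp add: lin_diff[OF assms(1)])
    then have "x - y = 0" by (rule assms(2))
    then show "x = y" by simp
  qed
  show "pm.independent (T ` B)"
  proof (rule pm_independentI)
    fix t u v assume t: "finite t" "t \<subseteq> T ` B" "(\<Sum>v\<in>t. pm_scale (u v) v) = 0" "v \<in> t"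
    then obtain s where s: "s \<subseteq> B" "finite s" "t = T ` s"
      using finite_subset_image[OF t(1,2)] by blast
    have inj': "inj_on T s" using inj s(1) inj_on_subset by blast
    have "T (\<Sum>w\<in>s. pm_scale (u (T w)) w) = (\<Sum>v\<in>t. pm_scale (u v) v)"
      unfolding s(3) sum.reindex[OF inj'] by (simp add: lin_sum[OF assms(1)] lin_scal[OF assms(1)] pm_scale_eq_mult)
    then have "(\<Sum>w\<in>s. pm_scale (u (T w)) w) = 0" using assms(2) t(3) by simp
    moreover obtain w where "w \<in> s" "v = T w" using t(4) s(3) by blast
    ultimately show "u v = 0"
      using pm.independentD[OF assms(3) s(2,1), of "\<lambda>w. u (T w)" w] by simp
  qed
qed

lemma independent_Un:
  assumes "pm.independent A" "pm.independent B" "\<And>x. x \<in> pm.span A \<Longrightarrow> x \<in> pm.span B \<Longrightarrow> x = 0"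
  shows "pm.independent (A \<union> B)" "A \<inter> B = {}"
proof -
  show disj: "A \<inter> B = {}"
  proof (rule ccontr)
    assume "A \<inter> B \<noteq> {}"
    then obtain x where "x \<in> A" "x \<in> B" by blast
    then have "0 \<in> A" using assms(3)[OF pm.span_base pm.span_base, of x] by simp
    then show False using assms(1) pm.dependent_zero by blast
  qed
  show "pm.independent (A \<union> B)"
  proof (rule pm_independentI)
    fix t u v assume t: "finite t" "t \<subseteq> A \<union> B" "(\<Sum>v\<in>t. pm_scale (u v) v) = 0" "v \<in> t"
    let ?a = "\<Sum>v\<in>t \<inter> A. pm_scale (u v) v" and ?b = "\<Sum>v\<in>t \<inter> B. pm_scale (u v) v"
    have "(\<Sum>v\<in>t. pm_scale (u v) v) = (\<Sum>v\<in>(t \<inter> A) \<union> (t \<inter> B). pm_scale (u v) v)"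
      by (rule sum.cong) (use t(2) in auto)
    also have "\<dots> = ?a + ?b"
      by (rule sum.union_disjoint) (use t(1) disj in auto)
    finally have ab: "?a + ?b = 0" using t(3) by simp
    have a: "?a \<in> pm.span A" and b: "?b \<in> pm.span B"
      by (intro pm.span_sum pm.span_scale pm.span_base; simp)+
    from ab have neg: "?a = - ?b" by (simp only: eq_neg_iff_add_eq_0)
    have "?a \<in> pm.span B" unfolding neg by (rule pm.span_neg[OF b])
    then have "?a = 0" using a assms(3) by blast
    moreover from this have "?b = 0" using ab by simp
    ultimately show "u v = 0"
      using t(1,2,4) pm.independentD[OF assms(1), of "t \<inter> A" u v] pm.independentD[OF assms(2), of "t \<inter> B" u v]
      by auto
  qed
qed

definition wt_space :: "nat \<Rightarrow> complex bpoly set" where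
  "wt_space w = {v. \<forall>\<mu>\<in>supp v. wt \<mu> = w}"

lemma wt_space_hom: "wt_hom T 0 \<Longrightarrow> v \<in> wt_space w \<Longrightarrow> T v \<in> wt_space w"
  unfolding wt_space_def using wt_homD[of T 0] by fastforce

lemma wt_space_diff: "u \<in> wt_space w \<Longrightarrow> v \<in> wt_space w \<Longrightarrow> u - v \<in> wt_space w"
  using subsetD[OF Poly_Mapping.keys_diff[of u v]] by (auto simp: wt_space_def)

lemma rel_map_span:
  assumes "\<And>\<mu>. \<mu> \<in> supp x \<Longrightarrow> \<mu> \<in> M"
  shows "rel_map m x \<in> pm.span (rel_map m ` (\<lambda>\<mu>. sgl \<mu> 1) ` M)"
proof -
  have "rel_map m x = (\<Sum>\<mu>\<in>supp x. pm_scale (coef x \<mu>) (rel_map m (sgl \<mu> 1)))"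
    unfolding pm_scale_eq_mult by (rule lin_expand[OF dlin_lin[OF dlin_rel_map]])
  also have "\<dots> \<in> pm.span (rel_map m ` (\<lambda>\<mu>. sgl \<mu> 1) ` M)"
    by (intro pm.span_sum pm.span_scale pm.span_base imageI assms)
  finally show ?thesis .
qed

text \<open>The weight space is the direct sum of the range and the kernel of the projector, and its
  kernel is the injective image under \<open>rel_map\<close> of the polynomials of weight w - 2m -
  2. The additive form avoids a truncated difference when w is small.\<close>

theorem dim_A_proj:
  "pm.dim (range (A_proj (int m)) \<inter> wt_space w) + card {\<mu>. wt \<mu> + 2 * m + 2 = w} = card {\<mu>. wt \<mu> = w}"
proof -
  let ?p = "A_proj (int m)" and ?f = "rel_map (int m)"
  let ?M = "{\<mu>. wt \<mu> + 2 * m + 2 = w}" and ?N = "{\<mu>. wt \<mu> = w}"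
  let ?mon = "\<lambda>\<mu>. sgl \<mu> (1::complex)"
  have m: "int m \<ge> 0" by simp
  note dp = dlin_A_proj[OF m] and idem = A_proj_idem[OF m]
  define S where "S = range ?p \<inter> wt_space w"
  obtain B where B: "B \<subseteq> S" "pm.independent B" "S \<subseteq> pm.span B" "card B = pm.dim S"
    using pm.basis_exists[of S] by blast
  define R where "R = ?f ` ?mon ` ?M"
  have R: "pm.independent R" "inj_on ?f (?mon ` ?M)"
    unfolding R_def
    by (rule independent_lin_image[OF dlin_lin[OF dlin_rel_map] rel_map_inject[OF m] independent_monomials]; assumption)+
  have "finite ?M" by (rule finite_subset[OF _ finite_wt[of "w - (2 * m + 2)"]]) auto
  then have finR: "finite R" by (simp add: R_def)
  have cardR: "card R = card ?M"
    unfolding R_def card_image[OF R(2)] by (rule card_monomials)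
  have sub0: "pm.subspace {v. ?p v = 0}" "pm.subspace {v. ?p v = v}"
    by (rule pm.subspaceI;
        simp add: lin_zero[OF dlin_lin[OF dp]] lin_add[OF dlin_lin[OF dp]] lin_scal[OF dlin_lin[OF dp]] pm_scale_eq_mult)+
  have "R \<subseteq> {v. ?p v = 0}"
    using A_proj_rels[OF m] range_rel_map[of "int m"] by (auto simp: R_def)
  then have spR: "pm.span R \<subseteq> {v. ?p v = 0}" by (rule pm.span_minimal[OF _ sub0(1)])
  have "B \<subseteq> {v. ?p v = v}" using B(1) idem by (auto simp: S_def)
  then have spB: "pm.span B \<subseteq> {v. ?p v = v}" by (rule pm.span_minimal[OF _ sub0(2)])
  have RB: "pm.independent (R \<union> B)" "R \<inter> B = {}"
    using independent_Un[OF R(1) B(2)] spR spB by force+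
  have sub: "R \<union> B \<subseteq> wt_space w"
  proof -
    have "?f (?mon \<mu>) \<in> wt_space w" if "\<mu> \<in> ?M" for \<mu>
      using that wt_homD[OF wt_hom_rel_map[of "int m"], of _ "?mon \<mu>"] by (fastforce simp: wt_space_def)
    then show ?thesis using B(1) by (auto simp: S_def R_def)
  qed
  have span: "wt_space w \<subseteq> pm.span (R \<union> B)"
  proof
    fix v assume v: "v \<in> wt_space w"
    then have pv: "?p v \<in> wt_space w" by (rule wt_space_hom[OF wt_hom_A_proj])
    then have "?p v \<in> pm.span B" using B(3) by (auto simp: S_def)
    moreover obtain x where x: "v - ?p v = ?f x"
      using A_proj_compl[OF m, of v] range_rel_map[of "int m"] by blast
    have "\<mu> \<in> ?M" if "\<mu> \<in> supp x" for \<mu>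
    proof -
      have "?f x \<in> wt_space w" using wt_space_diff[OF v pv] x by simp
      then have "int (wt \<mu>) + 2 * int m + 2 = int w"
        using that by (intro rel_map_homogeneous[OF m]) (auto simp: wt_space_def)
      then show ?thesis by simp
    qed
    then have "v - ?p v \<in> pm.span R" unfolding x R_def by (rule rel_map_span)
    ultimately have "(v - ?p v) + ?p v \<in> pm.span (R \<union> B)"
      by (intro pm.span_add) (auto intro: pm.span_mono[THEN subsetD, rotated])
    then show "v \<in> pm.span (R \<union> B)" by simp
  qed
  have finB: "finite B"
  proof -
    have "finite (?mon ` ?N)" using finite_wt by blast
    moreover have "B \<subseteq> pm.span (?mon ` ?N)"
      using sub by (auto simp: wt_space_def intro!: span_monomials)
    ultimately show ?thesis using pm.independent_span_bound[OF _ B(2)] by blast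
  qed
  have "card (R \<union> B) = pm.dim (wt_space w)"
    by (rule pm.basis_card_eq_dim[OF sub span RB(1)])
  also have "\<dots> = card (?mon ` ?N)"
    by (rule pm.basis_card_eq_dim[symmetric]) (auto simp: wt_space_def independent_monomials intro!: span_monomials)
  also have "\<dots> = card ?N" by (rule card_monomials)
  finally show ?thesis
    using card_Un_disjoint[OF finR finB RB(2)] cardR B(4) by (simp add: S_def)
qed

text \<open>If the reduced projector vanished on all even monomials of some weight w, these would
  lie in the span of the reduced images under \<open>rel_map\<close> of even monomials of weight w -
  2m - 2. For suitable w there are strictly fewer of the latter.\<close>

theorem A_proj_large:
  "\<exists>\<epsilon>. odd_part \<epsilon> = 0 \<and> wt \<epsilon> > N \<and> rho (A_proj (int m) (sgl \<epsilon> 1)) \<noteq> 0"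
proof (rule ccontr)
  let ?p = "A_proj (int m)" and ?f = "rel_map (int m)" and ?mon = "\<lambda>\<mu>. sgl \<mu> (1::complex)"
  have m: "int m \<ge> 0" by simp
  assume neg: "\<not> ?thesis"
  \<comment> \<open>A multiple of 2m + 4, so that a pure power of the even variable of weight 2m + 4
    has weight w.\<close>
  define w where "w = (2 * m + 4) * Suc N"
  have "1 * Suc N \<le> (2 * m + 4) * Suc N" by (rule mult_le_mono1) simp
  then have wN: "w > N" unfolding w_def by (simp only: mult_1 Suc_le_eq)
  let ?M = "{\<epsilon>. odd_part \<epsilon> = 0 \<and> wt \<epsilon> + 2 * m + 2 = w}" and ?E = "{\<epsilon>. odd_part \<epsilon> = 0 \<and> wt \<epsilon> = w}"
  have finE: "finite ?E" by (rule finite_subset[OF _ finite_wt[of w]]) auto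
  have finM: "finite ?M" by (rule finite_subset[OF _ finite_wt[of "w - (2 * m + 2)"]]) auto
  define G where "G = (\<lambda>\<epsilon>. rho (?f (?mon \<epsilon>))) ` ?M"
  have "?mon ` ?E \<subseteq> pm.span G"
  proof clarify
    fix \<epsilon> assume \<epsilon>: "odd_part \<epsilon> = 0" "w = wt \<epsilon>"
    then have 0: "rho (?p (?mon \<epsilon>)) = 0" using neg wN by blast
    obtain x where x: "?mon \<epsilon> - ?p (?mon \<epsilon>) = ?f x"
      using A_proj_compl[OF m, of "?mon \<epsilon>"] range_rel_map[of "int m"] by blast
    have hom: "?f x \<in> wt_space w"
      unfolding x[symmetric]
      by (intro wt_space_diff wt_space_hom[OF wt_hom_A_proj]) (auto simp: wt_space_def \<epsilon>(2))
    have "?mon \<epsilon> = rho (?mon \<epsilon>)" using \<epsilon>(1) by (simp add: rho_even even_poly_def)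
    also have "\<dots> = rho (?f x)"
      using arg_cong[OF x, of rho] by (simp add: lin_diff[OF lin_rho] 0)
    \<comment> \<open>The vector x need not be even, but modulo the odd variables only its even part
      matters.\<close>
    also have "\<dots> = rho (?f (rho x))"
      by (rule rho_dlin_rho[OF dlin_rel_map, symmetric])
    also have "\<dots> = (\<Sum>\<mu>\<in>supp (rho x). pm_scale (coef (rho x) \<mu>) (rho (?f (?mon \<mu>))))"
      unfolding pm_scale_eq_mult by (rule lin_expand[OF lin_comp[OF lin_rho dlin_lin[OF dlin_rel_map]]])
    also have "\<dots> \<in> pm.span G"
    proof (intro pm.span_sum pm.span_scale pm.span_base)
      fix \<mu> assume "\<mu> \<in> supp (rho x)"
      then have \<mu>: "\<mu> \<in> supp x" "odd_part \<mu> = 0" by (auto simp: in_keys_iff coef_rho split: if_splits)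
      have "int (wt \<mu>) + 2 * int m + 2 = int w"
        using \<mu>(1) hom by (intro rel_map_homogeneous[OF m]) (auto simp: wt_space_def)
      then show "rho (?f (?mon \<mu>)) \<in> G" unfolding G_def using \<mu>(2) by (intro image_eqI[OF refl]) simp
    qed
    finally show "?mon \<epsilon> \<in> pm.span G" .
  qed
  moreover have "finite G" using finM by (simp add: G_def)
  ultimately have "card (?mon ` ?E) \<le> card G"
    using pm.independent_span_bound[OF _ independent_monomials] by blast
  also have "\<dots> \<le> card ?M" unfolding G_def by (rule card_image_le[OF finM])
  \<comment> \<open>Multiplication by the even variable of weight 2m + 2 embeds the smaller set of
    monomials into the larger one and misses the pure power \<open>?x\<close>.\<close>
  also have "\<dots> = card ((\<lambda>\<epsilon>. \<epsilon> + sgl (2 * m + 1) 1) ` ?M)"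
    by (rule card_image[symmetric]) (auto simp: inj_on_def)
  also have "\<dots> < card ?E"
  proof (rule psubset_card_mono[OF finE], rule psubsetI)
    have odd0: "odd_part (sgl k e) = 0" if "odd k" for k e :: nat
      using that by (intro poly_mapping_eqI) (auto simp: coef_odd_part lookup_single when_def)
    show "(\<lambda>\<epsilon>. \<epsilon> + sgl (2 * m + 1) 1) ` ?M \<subseteq> ?E"
      by (auto simp: odd_part_add odd0 wt_add)
    let ?x = "sgl (2 * m + 3) (Suc N)"
    have "?x \<in> ?E" by (auto simp: odd0 w_def)
    moreover have "?x \<notin> (\<lambda>\<epsilon>. \<epsilon> + sgl (2 * m + 1) 1) ` ?M"
    proof
      assume "?x \<in> (\<lambda>\<epsilon>. \<epsilon> + sgl (2 * m + 1) 1) ` ?M"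
      then obtain \<epsilon> where "?x = \<epsilon> + sgl (2 * m + 1) 1" by blast
      from arg_cong[OF this, of "\<lambda>x. coef x (2 * m + 1)"] show False
        by (simp add: lookup_add lookup_single)
    qed
    ultimately show "(\<lambda>\<epsilon>. \<epsilon> + sgl (2 * m + 1) 1) ` ?M \<noteq> ?E" by blast
  qed
  finally show False by (simp add: card_monomials)
qed

lemma A_basis:
  obtains u :: "nat \<Rightarrow> complex bpoly" where
    "\<And>c. c \<in> D_vec \<Longrightarrow> lincomb u c = 0 \<Longrightarrow> c = 0"
    "\<And>v. \<exists>c\<in>D_vec. A_proj (int m) v = lincomb u c" "\<And>n. A_proj (int m) (u n) = u n"
proof -
  interpret graded_idempotent "A_proj (int m)"
    by unfold_locales (simp_all add: dlin_A_proj wt_hom_A_proj A_proj_idem)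
  show ?thesis using free_basis[OF A_proj_large] that by blast
qed

section \<open>Isomorphisms and bases of modules\<close>

definition mod_iso ::
    "('r, 'c) ring_scheme \<Rightarrow> ('r, 'a, 'x) module_scheme \<Rightarrow> ('r, 'b, 'y) module_scheme \<Rightarrow> ('a \<Rightarrow> 'b) \<Rightarrow> bool" where
  "mod_iso R M N h \<longleftrightarrow> bij_betw h (carrier M) (carrier N) \<and>
    (\<forall>x\<in>carrier M. \<forall>y\<in>carrier M. h (x \<oplus>\<^bsub>M\<^esub> y) = h x \<oplus>\<^bsub>N\<^esub> h y) \<and>
    (\<forall>r\<in>carrier R. \<forall>x\<in>carrier M. h (r \<odot>\<^bsub>M\<^esub> x) = r \<odot>\<^bsub>N\<^esub> h x)"

lemma modules_isomorphic_iff: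
  "modules_isomorphic R M N \<longleftrightarrow> Module.module R M \<and> Module.module R N \<and> (\<exists>h. mod_iso R M N h)"
  by (simp add: modules_isomorphic_def mod_iso_def)

lemma mod_isoD:
  assumes "mod_iso R M N h"
  shows "bij_betw h (carrier M) (carrier N)" "x \<in> carrier M \<Longrightarrow> h x \<in> carrier N" "inj_on h (carrier M)"
    "h ` carrier M = carrier N"
    "x \<in> carrier M \<Longrightarrow> y \<in> carrier M \<Longrightarrow> h (x \<oplus>\<^bsub>M\<^esub> y) = h x \<oplus>\<^bsub>N\<^esub> h y"
    "r \<in> carrier R \<Longrightarrow> x \<in> carrier M \<Longrightarrow> h (r \<odot>\<^bsub>M\<^esub> x) = r \<odot>\<^bsub>N\<^esub> h x"
  using assms by (auto simp: mod_iso_def bij_betw_def)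

lemma mod_iso_inv:
  assumes M: "Module.module R M" and h: "mod_iso R M N h"
  shows "mod_iso R N M (inv_into (carrier M) h)"
proof -
  interpret M: Module.module R M by (rule M)
  let ?g = "inv_into (carrier M) h"
  have bij: "bij_betw ?g (carrier N) (carrier M)"
    by (rule bij_betw_inv_into[OF mod_isoD(1)[OF h]])
  have g: "?g y \<in> carrier M" "h (?g y) = y" if "y \<in> carrier N" for y
    using that mod_isoD(4)[OF h] by (auto intro: inv_into_into f_inv_into_f)
  have g': "?g (h x) = x" if "x \<in> carrier M" for x
    using that by (rule inv_into_f_f[OF mod_isoD(3)[OF h]])
  have "?g (x \<oplus>\<^bsub>N\<^esub> y) = ?g x \<oplus>\<^bsub>M\<^esub> ?g y" if "x \<in> carrier N" "y \<in> carrier N" for x y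
    using g'[of "?g x \<oplus>\<^bsub>M\<^esub> ?g y"] g[OF that(1)] g[OF that(2)] mod_isoD(5)[OF h, of "?g x" "?g y"] by simp
  moreover have "?g (r \<odot>\<^bsub>N\<^esub> x) = r \<odot>\<^bsub>M\<^esub> ?g x" if "r \<in> carrier R" "x \<in> carrier N" for r x
    using g'[of "r \<odot>\<^bsub>M\<^esub> ?g x"] g[OF that(2)] mod_isoD(6)[OF h that(1), of "?g x"] that by simp
  ultimately show ?thesis using bij by (simp add: mod_iso_def)
qed

lemma modules_isomorphic_sym: "modules_isomorphic R M N \<Longrightarrow> modules_isomorphic R N M"
  unfolding modules_isomorphic_iff using mod_iso_inv by blast

lemma modules_isomorphic_trans:
  assumes "modules_isomorphic R M N" "modules_isomorphic R N K"
  shows "modules_isomorphic R M K"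
proof -
  obtain h g where h: "mod_iso R M N h" and g: "mod_iso R N K g"
    using assms by (auto simp: modules_isomorphic_iff)
  have "mod_iso R M K (g \<circ> h)"
    unfolding mod_iso_def using bij_betw_trans[OF mod_isoD(1)[OF h] mod_isoD(1)[OF g]]
    by (simp add: mod_isoD[OF h] mod_isoD[OF g])
  then show ?thesis using assms by (auto simp: modules_isomorphic_iff)
qed

text \<open>\<open>mod_iso\<close> matches only addition and scalar multiplication; the zero of the
  target is a separate record field and has to be matched on its own.\<close>

lemma module_transfer:
  assumes T: "Module.module R T" and h: "mod_iso R T M h" and 0: "h \<zero>\<^bsub>T\<^esub> = \<zero>\<^bsub>M\<^esub>"
  shows "Module.module R M"
proof -
  interpret T: Module.module R T by (rule T)
  have M: "carrier M = h ` carrier T" using mod_isoD(4)[OF h] by simp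
  note hom = mod_isoD(5)[OF h, symmetric] mod_isoD(6)[OF h, symmetric]
  have h_in: "h x \<in> carrier M" if "x \<in> carrier T" for x using that M by blast
  show ?thesis
  proof (rule moduleI)
    show "cring R" by (rule T.R.is_cring)
    show "abelian_group M"
    proof (rule abelian_groupI)
      show "\<zero>\<^bsub>M\<^esub> \<in> carrier M" using h_in[of "\<zero>\<^bsub>T\<^esub>"] by (simp add: 0)
      show "\<exists>y\<in>carrier M. y \<oplus>\<^bsub>M\<^esub> x = \<zero>\<^bsub>M\<^esub>" if x: "x \<in> carrier M" for x
      proof -
        obtain t where t: "t \<in> carrier T" "x = h t" using x M by blast
        then have "h (\<ominus>\<^bsub>T\<^esub> t) \<oplus>\<^bsub>M\<^esub> x = \<zero>\<^bsub>M\<^esub>"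
          by (simp add: hom(1) T.M.l_neg 0)
        then show ?thesis using h_in[of "\<ominus>\<^bsub>T\<^esub> t"] t(1) by auto
      qed
      show "x \<oplus>\<^bsub>M\<^esub> y \<in> carrier M" if "x \<in> carrier M" "y \<in> carrier M" for x y
        using that h_in by (auto simp: M hom)
      show "x \<oplus>\<^bsub>M\<^esub> y \<oplus>\<^bsub>M\<^esub> z = x \<oplus>\<^bsub>M\<^esub> (y \<oplus>\<^bsub>M\<^esub> z)"
        if "x \<in> carrier M" "y \<in> carrier M" "z \<in> carrier M" for x y z
        using that by (auto simp: M hom T.M.add.m_assoc)
      show "x \<oplus>\<^bsub>M\<^esub> y = y \<oplus>\<^bsub>M\<^esub> x" if "x \<in> carrier M" "y \<in> carrier M" for x y
      proof -
        obtain s t where "s \<in> carrier T" "t \<in> carrier T" "x = h s" "y = h t" using \<open>x \<in> carrier M\<close> \<open>y \<in> carrier M\<close> M by blast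
        then show ?thesis by (simp add: hom T.M.add.m_comm[of s t])
      qed
      show "\<zero>\<^bsub>M\<^esub> \<oplus>\<^bsub>M\<^esub> x = x" if "x \<in> carrier M" for x
      proof -
        obtain t where "t \<in> carrier T" "x = h t" using \<open>x \<in> carrier M\<close> M by blast
        then show ?thesis using hom(1)[of "\<zero>\<^bsub>T\<^esub>" t] by (simp add: 0)
      qed
    qed
    show "a \<odot>\<^bsub>M\<^esub> x \<in> carrier M" if "a \<in> carrier R" "x \<in> carrier M" for a x
      using that by (auto simp: M hom)
    show "(a \<oplus>\<^bsub>R\<^esub> b) \<odot>\<^bsub>M\<^esub> x = a \<odot>\<^bsub>M\<^esub> x \<oplus>\<^bsub>M\<^esub> b \<odot>\<^bsub>M\<^esub> x"
      if "a \<in> carrier R" "b \<in> carrier R" "x \<in> carrier M" for a b x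
      using that by (auto simp: M hom T.smult_l_distr)
    show "a \<odot>\<^bsub>M\<^esub> (x \<oplus>\<^bsub>M\<^esub> y) = a \<odot>\<^bsub>M\<^esub> x \<oplus>\<^bsub>M\<^esub> a \<odot>\<^bsub>M\<^esub> y"
      if "a \<in> carrier R" "x \<in> carrier M" "y \<in> carrier M" for a x y
      using that by (auto simp: M hom T.smult_r_distr)
    show "(a \<otimes>\<^bsub>R\<^esub> b) \<odot>\<^bsub>M\<^esub> x = a \<odot>\<^bsub>M\<^esub> (b \<odot>\<^bsub>M\<^esub> x)"
      if "a \<in> carrier R" "b \<in> carrier R" "x \<in> carrier M" for a b x
      using that by (auto simp: M hom T.smult_assoc1)
    show "\<one>\<^bsub>R\<^esub> \<odot>\<^bsub>M\<^esub> x = x" if "x \<in> carrier M" for x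
      using that by (auto simp: M hom)
  qed
qed

lemma mod_iso_finsum:
  assumes M: "Module.module R M" and N: "Module.module R N" and h: "mod_iso R M N h"
    and "finite A" "\<And>a. a \<in> A \<Longrightarrow> f a \<in> carrier M"
  shows "h (\<Oplus>\<^bsub>M\<^esub>a\<in>A. f a) = (\<Oplus>\<^bsub>N\<^esub>a\<in>A. h (f a))"
proof -
  interpret M: Module.module R M by (rule M)
  interpret N: Module.module R N by (rule N)
  have "h \<zero>\<^bsub>M\<^esub> \<oplus>\<^bsub>N\<^esub> h \<zero>\<^bsub>M\<^esub> = h \<zero>\<^bsub>M\<^esub>"
    using mod_isoD(5)[OF h, of "\<zero>\<^bsub>M\<^esub>" "\<zero>\<^bsub>M\<^esub>"] by simp
  then have 0: "h \<zero>\<^bsub>M\<^esub> = \<zero>\<^bsub>N\<^esub>"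
    using mod_isoD(2)[OF h, of "\<zero>\<^bsub>M\<^esub>"] N.M.add.l_cancel_one by simp
  show ?thesis using assms(4,5)
  proof (induction A)
    case (insert a A)
    have fa: "f a \<in> carrier M" and fA: "(\<Oplus>\<^bsub>M\<^esub>a\<in>A. f a) \<in> carrier M"
      using insert.prems by (auto intro!: M.M.finsum_closed)
    have "h (\<Oplus>\<^bsub>M\<^esub>a\<in>insert a A. f a) = h (f a \<oplus>\<^bsub>M\<^esub> (\<Oplus>\<^bsub>M\<^esub>a\<in>A. f a))"
      using insert by (subst M.M.finsum_insert) auto
    also have "\<dots> = h (f a) \<oplus>\<^bsub>N\<^esub> h (\<Oplus>\<^bsub>M\<^esub>a\<in>A. f a)"
      by (rule mod_isoD(5)[OF h fa fA])
    also have "\<dots> = (\<Oplus>\<^bsub>N\<^esub>a\<in>insert a A. h (f a))"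
      using insert by (subst N.M.finsum_insert) (auto simp: mod_isoD(2)[OF h])
    finally show ?case .
  qed (simp add: 0)
qed

text \<open>Uniqueness in \<open>module_basis\<close> concerns coefficient functions on the whole
  type, so transported coefficients have to be extended by zero outside the basis.\<close>

lemma module_basis_transfer:
  assumes M: "Module.module R M" and N: "Module.module R N" and h: "mod_iso R M N h"
    and B: "module_basis R M B"
  shows "module_basis R N (h ` B)"
proof -
  interpret M: Module.module R M by (rule M)
  interpret N: Module.module R N by (rule N)
  have BM: "B \<subseteq> carrier M" using B by (simp add: module_basis_def)
  have inj: "inj_on h B" using mod_isoD(3)[OF h] BM inj_on_subset by blast
  define P where "P x c \<longleftrightarrow> (\<forall>b. c b \<in> carrier R) \<and> finite {b. c b \<noteq> \<zero>\<^bsub>R\<^esub>} \<and> {b. c b \<noteq> \<zero>\<^bsub>R\<^esub>} \<subseteq> B \<and>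
      x = (\<Oplus>\<^bsub>M\<^esub>b\<in>{b. c b \<noteq> \<zero>\<^bsub>R\<^esub>}. c b \<odot>\<^bsub>M\<^esub> b)" for x c
  define Q where "Q y d \<longleftrightarrow> (\<forall>b. d b \<in> carrier R) \<and> finite {b. d b \<noteq> \<zero>\<^bsub>R\<^esub>} \<and> {b. d b \<noteq> \<zero>\<^bsub>R\<^esub>} \<subseteq> h ` B \<and>
      y = (\<Oplus>\<^bsub>N\<^esub>b\<in>{b. d b \<noteq> \<zero>\<^bsub>R\<^esub>}. d b \<odot>\<^bsub>N\<^esub> b)" for y d
  have key: "h (\<Oplus>\<^bsub>M\<^esub>b\<in>A. c b \<odot>\<^bsub>M\<^esub> b) = (\<Oplus>\<^bsub>N\<^esub>z\<in>h ` A. d z \<odot>\<^bsub>N\<^esub> z)"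
    if A: "finite A" "A \<subseteq> B" and c: "\<And>b. c b \<in> carrier R" and d: "\<And>z. d z \<in> carrier R"
      and dc: "\<And>b. b \<in> A \<Longrightarrow> d (h b) = c b" for A c d
  proof -
    have AM: "A \<subseteq> carrier M" using A(2) BM by blast
    have injA: "inj_on h A" using inj A(2) inj_on_subset by blast
    have "h (\<Oplus>\<^bsub>M\<^esub>b\<in>A. c b \<odot>\<^bsub>M\<^esub> b) = (\<Oplus>\<^bsub>N\<^esub>b\<in>A. h (c b \<odot>\<^bsub>M\<^esub> b))"
      by (rule mod_iso_finsum[OF M N h A(1)]) (use c AM in auto)
    also have "\<dots> = (\<Oplus>\<^bsub>N\<^esub>b\<in>A. d (h b) \<odot>\<^bsub>N\<^esub> h b)"
      by (rule N.M.finsum_cong') (use c AM dc d mod_isoD[OF h] in \<open>auto simp: subset_eq\<close>)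
    also have "\<dots> = (\<Oplus>\<^bsub>N\<^esub>z\<in>h ` A. d z \<odot>\<^bsub>N\<^esub> z)"
      by (rule N.M.finsum_reindex[symmetric, OF _ injA]) (use AM d mod_isoD(2)[OF h] in auto)
    finally show ?thesis .
  qed
  have "\<exists>!d. Q (h x) d" if x: "x \<in> carrier M" for x
  proof -
    have ex1: "\<exists>!c. P x c"
      using B x unfolding module_basis_def P_def by (elim conjE) (erule bspec)
    then obtain c where c: "P x c" by blast
    have uniq: "c' = c" if "P x c'" for c' using ex1 c that by blast
    define d where "d z = (if z \<in> h ` B then c (inv_into B h z) else \<zero>\<^bsub>R\<^esub>)" for z
    have dh: "d (h b) = c b" if "b \<in> B" for b using that inj by (simp add: d_def)
    have supp: "{z. d z \<noteq> \<zero>\<^bsub>R\<^esub>} = h ` {b. c b \<noteq> \<zero>\<^bsub>R\<^esub>}"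
    proof
      show "{z. d z \<noteq> \<zero>\<^bsub>R\<^esub>} \<subseteq> h ` {b. c b \<noteq> \<zero>\<^bsub>R\<^esub>}"
      proof clarify
        fix z assume z: "d z \<noteq> \<zero>\<^bsub>R\<^esub>"
        then have "z \<in> h ` B" by (auto simp: d_def split: if_splits)
        then obtain b where "b \<in> B" "z = h b" by blast
        then show "z \<in> h ` {b. c b \<noteq> \<zero>\<^bsub>R\<^esub>}" using z dh[of b] by auto
      qed
      show "h ` {b. c b \<noteq> \<zero>\<^bsub>R\<^esub>} \<subseteq> {z. d z \<noteq> \<zero>\<^bsub>R\<^esub>}"
      proof clarify
        fix b assume b: "c b \<noteq> \<zero>\<^bsub>R\<^esub>" "d (h b) = \<zero>\<^bsub>R\<^esub>"
        then have "b \<in> B" using c by (auto simp: P_def)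
        then show False using b dh[of b] by simp
      qed
    qed
    have dR: "d z \<in> carrier R" for z using c by (simp add: d_def P_def)
    have Qd: "Q (h x) d"
      using c key[of "{b. c b \<noteq> \<zero>\<^bsub>R\<^esub>}" c d] dR dh unfolding Q_def supp by (auto simp: P_def)
    moreover have "d' = d" if d': "Q (h x) d'" for d'
    proof -
      define c' where "c' b = (if b \<in> B then d' (h b) else \<zero>\<^bsub>R\<^esub>)" for b
      have supp': "{z. d' z \<noteq> \<zero>\<^bsub>R\<^esub>} = h ` {b. c' b \<noteq> \<zero>\<^bsub>R\<^esub>}"
        using d' by (auto simp: Q_def c'_def split: if_splits)
      have sub: "{b. c' b \<noteq> \<zero>\<^bsub>R\<^esub>} \<subseteq> B" by (auto simp: c'_def)
      have fin: "finite {b. c' b \<noteq> \<zero>\<^bsub>R\<^esub>}"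
      proof (rule finite_imageD[OF _ inj_on_subset[OF inj sub]])
        show "finite (h ` {b. c' b \<noteq> \<zero>\<^bsub>R\<^esub>})"
          using d' unfolding Q_def supp'[symmetric] by blast
      qed
      have cR: "c' b \<in> carrier R" for b using d' by (simp add: c'_def Q_def)
      have "h (\<Oplus>\<^bsub>M\<^esub>b\<in>{b. c' b \<noteq> \<zero>\<^bsub>R\<^esub>}. c' b \<odot>\<^bsub>M\<^esub> b) = h x"
      proof -
        have d'R: "d' z \<in> carrier R" for z using d' by (simp add: Q_def)
        have d'c: "d' (h b) = c' b" if "b \<in> {b. c' b \<noteq> \<zero>\<^bsub>R\<^esub>}" for b
          using subsetD[OF sub that] by (simp add: c'_def)
        have "h x = (\<Oplus>\<^bsub>N\<^esub>z\<in>h ` {b. c' b \<noteq> \<zero>\<^bsub>R\<^esub>}. d' z \<odot>\<^bsub>N\<^esub> z)"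
          using d' unfolding Q_def supp' by blast
        then show ?thesis using key[of "{b. c' b \<noteq> \<zero>\<^bsub>R\<^esub>}" c' d', OF fin sub cR d'R d'c] by simp
      qed
      moreover have "(\<Oplus>\<^bsub>M\<^esub>b\<in>{b. c' b \<noteq> \<zero>\<^bsub>R\<^esub>}. c' b \<odot>\<^bsub>M\<^esub> b) \<in> carrier M"
        by (rule M.M.finsum_closed) (use cR sub BM in auto)
      ultimately have "x = (\<Oplus>\<^bsub>M\<^esub>b\<in>{b. c' b \<noteq> \<zero>\<^bsub>R\<^esub>}. c' b \<odot>\<^bsub>M\<^esub> b)"
        using mod_isoD(3)[OF h] x by (auto dest: inj_onD)
      then have "c' = c" using cR fin sub by (intro uniq) (auto simp: P_def)
      then show "d' = d"
      proof (intro ext)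
        fix z
        show "d' z = d z"
        proof (cases "z \<in> h ` B")
          case True
          then obtain b where b: "b \<in> B" "z = h b" by blast
          then show ?thesis using dh[OF b(1)] fun_cong[OF \<open>c' = c\<close>, of b] by (simp add: c'_def)
        next
          case False
          then have "d' z = \<zero>\<^bsub>R\<^esub>" using d' by (auto simp: Q_def)
          then show ?thesis using False by (simp add: d_def)
        qed
      qed
    qed
    ultimately show ?thesis by blast
  qed
  then have "\<forall>y\<in>carrier N. \<exists>!d. Q y d"
    unfolding mod_isoD(4)[OF h, symmetric] by blast
  moreover have "h ` B \<subseteq> carrier N" using BM mod_isoD(2)[OF h] by blast
  ultimately show ?thesis by (simp add: module_basis_def Q_def)
qed

lemma free_module_iso:
  assumes "modules_isomorphic R M N" "free_module R N" shows "free_module R M"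
proof -
  obtain h where MN: "Module.module R M" "Module.module R N" and h: "mod_iso R N M h"
    using modules_isomorphic_sym[OF assms(1)] by (auto simp: modules_isomorphic_iff)
  then show ?thesis
    using assms(2) module_basis_transfer[OF MN(2,1) h] by (auto simp: free_module_def)
qed

section \<open>Quotients of spaces of vectors\<close>

text \<open>The fields left undefined agree with those of \<open>free_space\<close>, which makes
  \<open>free_space_eq\<close> an equality of records.\<close>

definition vec_module :: "'a::ab_group_add set \<Rightarrow> ('r \<Rightarrow> 'a \<Rightarrow> 'a) \<Rightarrow> ('r, 'a) module" where
  "vec_module S sm = \<lparr>carrier = S, mult = undefined, one = undefined, zero = 0, add = (+), smult = sm\<rparr>"

lemma vec_module_simps [simp]: "carrier (vec_module S sm) = S" "\<zero>\<^bsub>vec_module S sm\<^esub> = 0"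
  "x \<oplus>\<^bsub>vec_module S sm\<^esub> y = x + y" "r \<odot>\<^bsub>vec_module S sm\<^esub> x = sm r x"
  by (simp_all add: vec_module_def)

lemma module_vec_module:
  assumes "cring R" "0 \<in> S" "\<And>x y. x \<in> S \<Longrightarrow> y \<in> S \<Longrightarrow> x + y \<in> S" "\<And>x. x \<in> S \<Longrightarrow> - x \<in> S"
    "\<And>r x. r \<in> carrier R \<Longrightarrow> x \<in> S \<Longrightarrow> sm r x \<in> S"
    "\<And>r s x. r \<in> carrier R \<Longrightarrow> s \<in> carrier R \<Longrightarrow> x \<in> S \<Longrightarrow> sm (r \<oplus>\<^bsub>R\<^esub> s) x = sm r x + sm s x"
    "\<And>r x y. r \<in> carrier R \<Longrightarrow> x \<in> S \<Longrightarrow> y \<in> S \<Longrightarrow> sm r (x + y) = sm r x + sm r y"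
    "\<And>r s x. r \<in> carrier R \<Longrightarrow> s \<in> carrier R \<Longrightarrow> x \<in> S \<Longrightarrow> sm (r \<otimes>\<^bsub>R\<^esub> s) x = sm r (sm s x)"
    "\<And>x. x \<in> S \<Longrightarrow> sm \<one>\<^bsub>R\<^esub> x = x"
  shows "Module.module R (vec_module S sm)"
proof (rule moduleI)
  show "abelian_group (vec_module S sm)"
  proof (rule abelian_groupI)
    show "\<exists>y\<in>carrier (vec_module S sm). y \<oplus>\<^bsub>vec_module S sm\<^esub> x = \<zero>\<^bsub>vec_module S sm\<^esub>"
      if "x \<in> carrier (vec_module S sm)" for x
      using that assms(4)[of x] by (auto intro!: bexI[of _ "- x"])
  qed (use assms in \<open>auto simp: algebra_simps\<close>)
qed (use assms in auto)

lemma vec_module_finsum: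
  assumes "Module.module R (vec_module S sm)" "finite A" "\<And>a. a \<in> A \<Longrightarrow> f a \<in> S"
  shows "(\<Oplus>\<^bsub>vec_module S sm\<^esub>a\<in>A. f a) = (\<Sum>a\<in>A. f a)"
proof -
  interpret M: Module.module R "vec_module S sm" by (rule assms(1))
  show ?thesis using assms(2,3)
  proof (induction A)
    case (insert a A)
    then show ?case by (subst M.M.finsum_insert) auto
  qed (simp add: M.M.finsum_empty)
qed

text \<open>Scalars act on the quotient through a function \<open>\<sigma>\<close> on representatives, because the scalars of the
  space \<open>M\<close> may differ from those of the quotient, as for an extension of scalars.\<close>

lemma quotient_isomorphic:
  fixes M :: "('s, 'a::ab_group_add, 'x) module_scheme" and Q :: "('r, 'a set) module"
    and T :: "('r, 't, 'y) module_scheme"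
  assumes T: "Module.module R T" and addM: "\<And>x y. x \<oplus>\<^bsub>M\<^esub> y = x + y"
    and S: "\<And>x y. x \<in> S \<Longrightarrow> y \<in> S \<Longrightarrow> x - y \<in> S" "\<And>x y. x \<in> S \<Longrightarrow> y \<in> S \<Longrightarrow> x + y \<in> S" "N \<subseteq> S"
    and \<Phi>: "\<And>x. x \<in> S \<Longrightarrow> \<Phi> x \<in> carrier T" "\<And>x y. x \<in> S \<Longrightarrow> y \<in> S \<Longrightarrow> \<Phi> (x + y) = \<Phi> x \<oplus>\<^bsub>T\<^esub> \<Phi> y"
      "\<And>t. t \<in> carrier T \<Longrightarrow> \<exists>x\<in>S. \<Phi> x = t" "\<And>x. x \<in> S \<Longrightarrow> \<Phi> x = \<zero>\<^bsub>T\<^esub> \<longleftrightarrow> x \<in> N"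
    and \<sigma>: "\<And>r x. r \<in> carrier R \<Longrightarrow> x \<in> S \<Longrightarrow> \<sigma> r x \<in> S"
      "\<And>r x. r \<in> carrier R \<Longrightarrow> x \<in> S \<Longrightarrow> \<Phi> (\<sigma> r x) = r \<odot>\<^bsub>T\<^esub> \<Phi> x"
    and Q: "carrier Q = (\<lambda>x. N +>\<^bsub>M\<^esub> x) ` S" "zero Q = N" "add Q = set_add M"
      "\<And>r X. r \<in> carrier R \<Longrightarrow> X \<in> carrier Q \<Longrightarrow> smult Q r X = (\<Union>x\<in>X. N +>\<^bsub>M\<^esub> \<sigma> r x)"
  shows "modules_isomorphic R Q T"
proof -
  interpret T: Module.module R T by (rule T)
  \<comment> \<open>The cosets of N are the fibres of \<Phi>. Mapping T to Q, and not conversely,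
    lets \<open>module_transfer\<close> supply the module axioms of the quotient as well.\<close>
  define fib where "fib t = {x \<in> S. \<Phi> x = t}" for t
  have diff: "\<Phi> x = \<Phi> y \<longleftrightarrow> x - y \<in> N" if "x \<in> S" "y \<in> S" for x y
  proof -
    have "\<Phi> x = \<Phi> (x - y) \<oplus>\<^bsub>T\<^esub> \<Phi> y" using \<Phi>(2)[of "x - y" y] S(1) that by simp
    then have "\<Phi> x = \<Phi> y \<longleftrightarrow> \<Phi> (x - y) = \<zero>\<^bsub>T\<^esub>"
      using \<Phi>(1) S(1) that T.M.add.r_cancel_one[of "\<Phi> y" "\<Phi> (x - y)"] by auto
    then show ?thesis using \<Phi>(4) S(1) that by simp
  qed
  have coset: "N +>\<^bsub>M\<^esub> x = fib (\<Phi> x)" if "x \<in> S" for x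
  proof -
    have "N +>\<^bsub>M\<^esub> x = (\<lambda>n. n + x) ` N" by (auto simp: a_r_coset_def' addM)
    also have "\<dots> = fib (\<Phi> x)"
    proof
      show "(\<lambda>n. n + x) ` N \<subseteq> fib (\<Phi> x)"
        using that S(2,3) diff by (auto simp: fib_def subset_eq)
      show "fib (\<Phi> x) \<subseteq> (\<lambda>n. n + x) ` N"
      proof
        fix y assume "y \<in> fib (\<Phi> x)"
        then have "y - x \<in> N" using diff[of y x] that by (simp add: fib_def)
        then show "y \<in> (\<lambda>n. n + x) ` N" by (intro image_eqI[of _ _ "y - x"]) auto
      qed
    qed
    finally show ?thesis .
  qed
  have carQ: "carrier Q = fib ` carrier T"
  proof
    show "carrier Q \<subseteq> fib ` carrier T" unfolding Q(1) using coset \<Phi>(1) by auto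
    show "fib ` carrier T \<subseteq> carrier Q"
    proof clarify
      fix t assume "t \<in> carrier T"
      then obtain x where "x \<in> S" "\<Phi> x = t" using \<Phi>(3) by blast
      then show "fib t \<in> carrier Q" unfolding Q(1) using coset[of x] by blast
    qed
  qed
  have nonempty: "\<exists>x. x \<in> fib t" if "t \<in> carrier T" for t using \<Phi>(3)[OF that] by (auto simp: fib_def)
  have inj: "inj_on fib (carrier T)"
  proof (rule inj_onI)
    fix s t assume "s \<in> carrier T" "fib s = fib t"
    then obtain x where "x \<in> fib s" "x \<in> fib t" using nonempty by blast
    then show "s = t" by (simp add: fib_def)
  qed
  have "mod_iso R T Q fib"
    unfolding mod_iso_def
  proof (intro conjI ballI)
    show "bij_betw fib (carrier T) (carrier Q)" using inj carQ by (simp add: bij_betw_def)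
    fix s t assume st: "s \<in> carrier T" "t \<in> carrier T"
    show "fib (s \<oplus>\<^bsub>T\<^esub> t) = fib s \<oplus>\<^bsub>Q\<^esub> fib t"
      unfolding Q(3) set_add_def' addM
    proof (intro Set.set_eqI iffI)
      fix y assume "y \<in> fib (s \<oplus>\<^bsub>T\<^esub> t)"
      then have y: "y \<in> S" "\<Phi> y = s \<oplus>\<^bsub>T\<^esub> t" by (simp_all add: fib_def)
      obtain x where x: "x \<in> S" "\<Phi> x = s" using nonempty[OF st(1)] by (auto simp: fib_def)
      have "\<Phi> x \<oplus>\<^bsub>T\<^esub> \<Phi> (y - x) = \<Phi> y" using \<Phi>(2)[of x "y - x"] S(1) x y by simp
      then have "\<Phi> (y - x) = t" using x y st \<Phi>(1) S(1) by simp
      then have "x \<in> fib s" "y - x \<in> fib t" using x y S(1) by (simp_all add: fib_def)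
      then show "y \<in> (\<Union>h\<in>fib s. \<Union>k\<in>fib t. {h + k})" by force
    next
      fix y assume "y \<in> (\<Union>h\<in>fib s. \<Union>k\<in>fib t. {h + k})"
      then show "y \<in> fib (s \<oplus>\<^bsub>T\<^esub> t)" using S(2) \<Phi>(2) by (auto simp: fib_def)
    qed
  next
    fix r t assume rt: "r \<in> carrier R" "t \<in> carrier T"
    have "fib t \<in> carrier Q" using rt carQ by blast
    then have "r \<odot>\<^bsub>Q\<^esub> fib t = (\<Union>x\<in>fib t. N +>\<^bsub>M\<^esub> \<sigma> r x)" using Q(4) rt by blast
    also have "\<dots> = (\<Union>x\<in>fib t. fib (r \<odot>\<^bsub>T\<^esub> t))"
      using coset \<sigma> rt by (auto simp: fib_def)
    also have "\<dots> = fib (r \<odot>\<^bsub>T\<^esub> t)" using nonempty[OF rt(2)] by auto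
    finally show "fib (r \<odot>\<^bsub>T\<^esub> t) = r \<odot>\<^bsub>Q\<^esub> fib t" by simp
  qed
  moreover have "fib \<zero>\<^bsub>T\<^esub> = \<zero>\<^bsub>Q\<^esub>"
    unfolding Q(2) fib_def using \<Phi>(4) S(3) by auto
  ultimately show ?thesis
    using module_transfer[OF T] T modules_isomorphic_sym[of R T Q] by (auto simp: modules_isomorphic_iff)
qed

section \<open>The free module of countable rank\<close>

lemma D_alg_simps [simp]: "x \<oplus>\<^bsub>D_alg\<^esub> y = x + y" "x \<otimes>\<^bsub>D_alg\<^esub> y = x * y" "\<zero>\<^bsub>D_alg\<^esub> = 0" "\<one>\<^bsub>D_alg\<^esub> = 1"
  "c \<odot>\<^bsub>D_alg\<^esub> x = pm_scale c x"
  by (simp_all add: D_alg_def)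

lemma complex_ring_simps [simp]: "carrier complex_ring = UNIV" "x \<oplus>\<^bsub>complex_ring\<^esub> y = x + y"
  "x \<otimes>\<^bsub>complex_ring\<^esub> y = x * y" "\<zero>\<^bsub>complex_ring\<^esub> = 0" "\<one>\<^bsub>complex_ring\<^esub> = 1"
  by (simp_all add: complex_ring_def)

lemma cring_D_alg: "cring D_alg"
proof (rule cringI)
  show "abelian_group D_alg"
  proof (rule abelian_groupI)
    show "\<exists>y\<in>carrier D_alg. y \<oplus>\<^bsub>D_alg\<^esub> x = \<zero>\<^bsub>D_alg\<^esub>" if "x \<in> carrier D_alg" for x
      using D_closed(5)[OF that] by (intro bexI[of _ "- x"]) auto
  qed (auto simp: D_closed algebra_simps)
  show "Group.comm_monoid D_alg"
    by (rule comm_monoidI) (auto simp: D_closed algebra_simps)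
qed (auto simp: algebra_simps)

lemma cring_complex_ring: "cring complex_ring"
proof (rule cringI)
  show "abelian_group complex_ring"
  proof (rule abelian_groupI)
    show "\<exists>y\<in>carrier complex_ring. y \<oplus>\<^bsub>complex_ring\<^esub> x = \<zero>\<^bsub>complex_ring\<^esub>" for x
      by (intro bexI[of _ "- x"]) auto
  qed (auto simp: algebra_simps)
  show "Group.comm_monoid complex_ring"
    by (rule comm_monoidI) (auto simp: algebra_simps)
qed (auto simp: algebra_simps)

abbreviation free_D :: "(complex bpoly, nat \<Rightarrow>\<^sub>0 complex bpoly) module" where
  "free_D \<equiv> vec_module D_vec pm_scale"

lemma pm_scale_simps:
  "pm_scale (c + d) v = pm_scale c v + pm_scale (d::'r::comm_ring_1) v"
  "pm_scale c (v + w) = pm_scale c v + pm_scale c w"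
  "pm_scale (c * d) v = pm_scale c (pm_scale d v)" "pm_scale 1 v = v"
  by (rule poly_mapping_eqI; simp add: lookup_add algebra_simps)+

lemma module_free_D: "Module.module D_alg free_D"
  by (rule module_vec_module[OF cring_D_alg]) (auto simp: D_vec_closed pm_scale_simps)

lemma subspace_supp: "pm.subspace {v. supp v \<subseteq> X}"
proof (rule pm.subspaceI)
  fix u v :: "'a \<Rightarrow>\<^sub>0 complex" assume "u \<in> {v. supp v \<subseteq> X}" "v \<in> {v. supp v \<subseteq> X}"
  then show "u + v \<in> {v. supp v \<subseteq> X}" using Poly_Mapping.keys_add[of u v] by auto
qed (auto simp: in_keys_iff)

lemma module_pm_subspace: "pm.subspace S \<Longrightarrow> Module.module complex_ring (vec_module S pm_scale)"
  by (rule module_vec_module[OF cring_complex_ring])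
    (auto simp: pm_scale_simps(1,2) pm.subspace_0 pm.subspace_add pm.subspace_neg pm.subspace_scale)

lemma sgl_bpoly_inject: "sgl x (1::complex bpoly) = sgl y 1 \<longleftrightarrow> x = y"
proof
  assume "sgl x (1::complex bpoly) = sgl y 1"
  then have "coef (sgl x (1::complex bpoly)) y = coef (sgl y 1) y" by (rule arg_cong)
  then show "x = y" by (simp add: lookup_single when_def split: if_splits)
qed simp

lemma free_D_basis: "module_basis D_alg free_D (range (\<lambda>n. sgl n 1))"
  unfolding module_basis_def
proof (intro conjI ballI)
  let ?e = "\<lambda>n::nat. sgl n (1::complex bpoly)"
  have inj: "inj ?e" by (auto simp: inj_def sgl_bpoly_inject)
  show "range ?e \<subseteq> carrier free_D" by (auto intro: D_vec_closed D_closed)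
  fix v assume "v \<in> carrier free_D"
  then have v: "v \<in> D_vec" by simp
  have finsum: "(\<Oplus>\<^bsub>free_D\<^esub>b\<in>{b. c b \<noteq> 0}. c b \<odot>\<^bsub>free_D\<^esub> b) = (\<Sum>b\<in>{b. c b \<noteq> 0}. pm_scale (c b) b)"
    if "\<forall>b. c b \<in> carrier D_alg" "finite {b. c b \<noteq> 0}" "{b. c b \<noteq> 0} \<subseteq> range ?e" for c
    unfolding vec_module_simps
    by (rule vec_module_finsum[OF module_free_D that(2)])
      (use that in \<open>auto intro!: D_vec_closed D_closed dest!: subsetD\<close>)
  have coef: "coef (\<Sum>b\<in>{b. c b \<noteq> 0}. pm_scale (c b) b) n = c (?e n)"
    if fin: "finite {b. c b \<noteq> 0}" and sub: "{b. c b \<noteq> 0} \<subseteq> range ?e" for c :: "_ \<Rightarrow> complex bpoly" and n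
  proof -
    have "coef (\<Sum>b\<in>{b. c b \<noteq> 0}. pm_scale (c b) b) n = (\<Sum>b\<in>{b. c b \<noteq> 0}. if b = ?e n then c b else 0)"
      unfolding lookup_sum
    proof (intro sum.cong refl)
      fix b assume "b \<in> {b. c b \<noteq> 0}"
      then obtain k where "b = ?e k" using sub by blast
      then show "coef (pm_scale (c b) b) n = (if b = ?e n then c b else 0)"
        by (auto simp: lookup_single when_def sgl_bpoly_inject)
    qed
    then show ?thesis using fin by simp
  qed
  define c where "c b = (if b \<in> range ?e then coef v (the_inv ?e b) else 0)" for b
  have ce: "c (?e n) = coef v n" for n by (simp add: c_def the_inv_f_f[OF inj])
  have supp: "{b. c b \<noteq> 0} = ?e ` supp v"
  proof
    show "{b. c b \<noteq> 0} \<subseteq> ?e ` supp v"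
    proof clarify
      fix b assume b: "c b \<noteq> 0"
      then obtain n where n: "b = ?e n" by (auto simp: c_def split: if_splits)
      have "n \<in> supp v" using b unfolding n ce by (simp add: in_keys_iff)
      then show "b \<in> ?e ` supp v" using n by blast
    qed
    show "?e ` supp v \<subseteq> {b. c b \<noteq> 0}"
      by (auto simp: ce in_keys_iff)
  qed
  have cD: "\<forall>b. c b \<in> carrier D_alg" using v by (auto simp: c_def D_vec_def D_closed)
  have c: "finite {b. c b \<noteq> 0}" "{b. c b \<noteq> 0} \<subseteq> range ?e" unfolding supp by auto
  have "v = (\<Sum>b\<in>{b. c b \<noteq> 0}. pm_scale (c b) b)"
    by (rule poly_mapping_eqI) (simp only: coef[OF c] ce)
  then show "\<exists>!c. (\<forall>b. c b \<in> carrier D_alg) \<and> finite {b. c b \<noteq> \<zero>\<^bsub>D_alg\<^esub>} \<and>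
      {b. c b \<noteq> \<zero>\<^bsub>D_alg\<^esub>} \<subseteq> range ?e \<and> v = (\<Oplus>\<^bsub>free_D\<^esub>b\<in>{b. c b \<noteq> \<zero>\<^bsub>D_alg\<^esub>}. c b \<odot>\<^bsub>free_D\<^esub> b)"
    unfolding D_alg_simps
  proof (intro ex1I[of _ c])
    assume "v = (\<Sum>b\<in>{b. c b \<noteq> 0}. pm_scale (c b) b)"
    then show "(\<forall>b. c b \<in> carrier D_alg) \<and> finite {b. c b \<noteq> 0} \<and>
        {b. c b \<noteq> 0} \<subseteq> range ?e \<and> v = (\<Oplus>\<^bsub>free_D\<^esub>b\<in>{b. c b \<noteq> 0}. c b \<odot>\<^bsub>free_D\<^esub> b)"
      using cD c finsum[OF cD c] by auto
  next
    fix c' assume c': "(\<forall>b. c' b \<in> carrier D_alg) \<and> finite {b. c' b \<noteq> 0} \<and>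
        {b. c' b \<noteq> 0} \<subseteq> range ?e \<and> v = (\<Oplus>\<^bsub>free_D\<^esub>b\<in>{b. c' b \<noteq> 0}. c' b \<odot>\<^bsub>free_D\<^esub> b)"
    then have f: "finite {b. c' b \<noteq> 0}" "{b. c' b \<noteq> 0} \<subseteq> range ?e" by auto
    have "v = (\<Sum>b\<in>{b. c' b \<noteq> 0}. pm_scale (c' b) b)" 
    proof -
      have "v = (\<Oplus>\<^bsub>free_D\<^esub>b\<in>{b. c' b \<noteq> 0}. c' b \<odot>\<^bsub>free_D\<^esub> b)" using c' by blast
      also have "\<dots> = (\<Sum>b\<in>{b. c' b \<noteq> 0}. pm_scale (c' b) b)" by (rule finsum[OF _ f]) (use c' in blast)
      finally show ?thesis .
    qed
    then have c'e: "c' (?e n) = coef v n" for n using coef[OF f, of n] by (simp only:)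
    show "c' = c"
    proof (intro ext)
      fix b
      show "c' b = c b"
      proof (cases "b \<in> range ?e")
        case True
        then obtain n where "b = ?e n" by blast
        then show ?thesis by (simp only: c'e ce)
      next
        case False
        then show ?thesis using f(2) by (auto simp: c_def)
      qed
    qed
  qed
qed

section \<open>Module bases of complex vector spaces and dimensions\<close>

lemma module_basis_subspace_iff:
  assumes S: "pm.subspace (S :: ('x \<Rightarrow>\<^sub>0 complex) set)"
  shows "module_basis complex_ring (vec_module S pm_scale) B \<longleftrightarrow> B \<subseteq> S \<and> pm.independent B \<and> S \<subseteq> pm.span B"
proof -
  let ?T = "vec_module S pm_scale :: (complex, 'x \<Rightarrow>\<^sub>0 complex) module"
  note M = module_pm_subspace[OF S]
  have finsum: "(\<Oplus>\<^bsub>?T\<^esub>b\<in>{b. c b \<noteq> 0}. c b \<odot>\<^bsub>?T\<^esub> b) = (\<Sum>b\<in>{b. c b \<noteq> 0}. pm_scale (c b) b)"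
    if "finite {b. c b \<noteq> 0}" "{b. c b \<noteq> 0} \<subseteq> S" for c
    unfolding vec_module_simps
    by (rule vec_module_finsum[OF M that(1)]) (use that S pm.subspace_scale in blast)
  have iff: "module_basis complex_ring ?T B \<longleftrightarrow> B \<subseteq> S \<and> (\<forall>x\<in>S. \<exists>!c. finite {b. c b \<noteq> 0} \<and>
      {b. c b \<noteq> 0} \<subseteq> B \<and> x = (\<Sum>b\<in>{b. c b \<noteq> 0}. pm_scale (c b) b))"
  proof (cases "B \<subseteq> S")
    case True
    have "((\<forall>b. c b \<in> UNIV) \<and> finite {b. c b \<noteq> 0} \<and> {b. c b \<noteq> 0} \<subseteq> B \<and>
        x = (\<Oplus>\<^bsub>?T\<^esub>b\<in>{b. c b \<noteq> 0}. c b \<odot>\<^bsub>?T\<^esub> b)) =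
      (finite {b. c b \<noteq> 0} \<and> {b. c b \<noteq> 0} \<subseteq> B \<and> x = (\<Sum>b\<in>{b. c b \<noteq> 0}. pm_scale (c b) b))" for x c
    proof (cases "finite {b. c b \<noteq> 0} \<and> {b. c b \<noteq> 0} \<subseteq> B")
      case fin: True
      then have "{b. c b \<noteq> 0} \<subseteq> S" using True by blast
      with fin show ?thesis using finsum[of c] by simp
    qed auto
    then show ?thesis
      unfolding module_basis_def complex_ring_simps vec_module_simps(1) by (simp only:)
  qed (auto simp: module_basis_def)
  show ?thesis
  proof
    assume "module_basis complex_ring ?T B"
    then have BS: "B \<subseteq> S" and ex1: "\<And>x. x \<in> S \<Longrightarrow> \<exists>!c. finite {b. c b \<noteq> 0} \<and>
      {b. c b \<noteq> 0} \<subseteq> B \<and> x = (\<Sum>b\<in>{b. c b \<noteq> 0}. pm_scale (c b) b)"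
      unfolding iff by auto
    have "S \<subseteq> pm.span B"
    proof
      fix x assume "x \<in> S"
      then obtain c where sub: "{b. c b \<noteq> 0} \<subseteq> B" and x: "x = (\<Sum>b\<in>{b. c b \<noteq> 0}. pm_scale (c b) b)"
        using ex1 by blast
      show "x \<in> pm.span B"
        unfolding x by (intro pm.span_sum pm.span_scale pm.span_base subsetD[OF sub])
    qed
    moreover have "pm.independent B"
    proof (rule pm_independentI)
      fix t u v assume t: "finite t" "t \<subseteq> B" "(\<Sum>v\<in>t. pm_scale (u v) v) = 0" "v \<in> t"
      define c where "c b = (if b \<in> t then u b else 0)" for b
      have ct: "{b. c b \<noteq> 0} \<subseteq> t"
      proof
        fix b assume "b \<in> {b. c b \<noteq> 0}"
        then show "b \<in> t" by (simp add: c_def split: if_splits)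
      qed
      have "(\<Sum>b\<in>{b. c b \<noteq> 0}. pm_scale (c b) b) = (\<Sum>b\<in>t. pm_scale (c b) b)"
        by (rule sum.mono_neutral_left[OF t(1) ct]) simp
      also have "\<dots> = 0" using t(3) by (simp add: c_def)
      finally have 0: "(\<Sum>b\<in>{b. c b \<noteq> 0}. pm_scale (c b) b) = 0" .
      define P where "P c \<longleftrightarrow> finite {b. c b \<noteq> 0} \<and> {b. c b \<noteq> 0} \<subseteq> B \<and> 0 = (\<Sum>b\<in>{b. c b \<noteq> 0}. pm_scale (c b) b)"
        for c :: "('x \<Rightarrow>\<^sub>0 complex) \<Rightarrow> complex"
      have "\<exists>!c. P c" unfolding P_def by (rule ex1[OF pm.subspace_0[OF S]])
      moreover have "P c"
        unfolding P_def by (intro conjI finite_subset[OF ct t(1)] order_trans[OF ct t(2)] 0[symmetric])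
      moreover have "P (\<lambda>b. 0)" by (simp add: P_def)
      ultimately have "c = (\<lambda>b. 0)" by blast
      then have "c v = 0" by simp
      then show "u v = 0" using t(4) by (simp add: c_def)
    qed
    ultimately show "B \<subseteq> S \<and> pm.independent B \<and> S \<subseteq> pm.span B" using BS by blast
  next
    assume B: "B \<subseteq> S \<and> pm.independent B \<and> S \<subseteq> pm.span B"
    show "module_basis complex_ring ?T B"
      unfolding iff
    proof (intro conjI ballI)
      fix x assume "x \<in> S"
      then have x: "x \<in> pm.span B" using B by blast
      let ?r = "pm.representation B x"
      have ind: "pm.independent B" using B by blast
      show "\<exists>!c. finite {b. c b \<noteq> 0} \<and> {b. c b \<noteq> 0} \<subseteq> B \<and> x = (\<Sum>b\<in>{b. c b \<noteq> 0}. pm_scale (c b) b)"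
      proof (rule ex1I[of _ ?r])
        show "finite {b. ?r b \<noteq> 0} \<and> {b. ?r b \<noteq> 0} \<subseteq> B \<and> x = (\<Sum>b\<in>{b. ?r b \<noteq> 0}. pm_scale (?r b) b)"
          using pm.finite_representation[of B x] pm.representation_ne_zero[of B x]
            pm.sum_nonzero_representation_eq[OF ind x] by auto
        fix c assume c: "finite {b. c b \<noteq> 0} \<and> {b. c b \<noteq> 0} \<subseteq> B \<and> x = (\<Sum>b\<in>{b. c b \<noteq> 0}. pm_scale (c b) b)"
        have "?r = c"
        proof (rule pm.representation_eqI[OF ind x])
          show "b \<in> B" if "c b \<noteq> 0" for b using c that by blast
          show "finite {b. c b \<noteq> 0}" using c by blast
          show "(\<Sum>b\<in>{b. c b \<noteq> 0}. pm_scale (c b) b) = x" using c by (elim conjE) (rule sym)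
        qed
        then show "c = ?r" by (rule sym)
      qed
    qed (use B in blast)
  qed
qed

text \<open>\<open>vdim\<close> picks an arbitrary basis. An isomorphism carries each of them to a
  linear basis of S, and all of these have the same \<open>card\<close>, infinite ones
  included.\<close>

lemma vdim_eq_dim:
  assumes "modules_isomorphic complex_ring M (vec_module S pm_scale)" "pm.subspace S"
  shows "vdim complex_ring M = pm.dim S"
proof -
  let ?T = "vec_module S pm_scale"
  obtain h where MT: "Module.module complex_ring M" "Module.module complex_ring ?T"
    and h: "mod_iso complex_ring M ?T h"
    using assms(1) by (auto simp: modules_isomorphic_iff)
  have card: "card B = pm.dim S" if B: "module_basis complex_ring M B" for B
  proof -
    have "module_basis complex_ring ?T (h ` B)" by (rule module_basis_transfer[OF MT h B])
    then have *: "h ` B \<subseteq> S \<and> pm.independent (h ` B) \<and> S \<subseteq> pm.span (h ` B)"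
      unfolding module_basis_subspace_iff[OF assms(2)] .
    note hB = conjunct1[OF *] conjunct2[OF conjunct2[OF *]] conjunct1[OF conjunct2[OF *]]
    have "card (h ` B) = pm.dim S"
      by (rule pm.basis_card_eq_dim[OF hB])
    moreover have "B \<subseteq> carrier M" using B unfolding module_basis_def by (rule conjunct1)
    then have "inj_on h B" by (rule inj_on_subset[OF mod_isoD(3)[OF h]])
    ultimately show ?thesis by (simp add: card_image)
  qed
  obtain B where "B \<subseteq> S" "pm.independent B" "S \<subseteq> pm.span B" "card B = pm.dim S"
    by (rule pm.basis_exists)
  then have "module_basis complex_ring ?T B" by (simp add: module_basis_subspace_iff[OF assms(2)])
  from module_basis_transfer[OF MT(2,1) mod_iso_inv[OF MT(1) h] this]
  have "\<exists>B. module_basis complex_ring M B" by (rule exI)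
  then show ?thesis unfolding vdim_def by (rule card[OF someI_ex])
qed

section \<open>The modules \<open>A\<^bsub>2m+1\<^esub>\<close>\<close>

lemma carrier_quot_module: "carrier (quot_module M N) = (\<lambda>x. N +>\<^bsub>M\<^esub> x) ` carrier M"
  by (auto simp: quot_module_def A_RCOSETS_def')

text \<open>Each v is sent to the coordinates of \<open>A_proj v\<close>. The map is onto because
  the projector fixes the basis vectors, and its kernel is the kernel of the projector, which is the
  space of relations.\<close>

theorem A_mod_free: "modules_isomorphic D_alg (A_mod (int m)) free_D"
proof -
  let ?p = "A_proj (int m)"
  have m: "int m \<ge> 0" by simp
  obtain u :: "nat \<Rightarrow> complex bpoly" where u: "\<And>c. c \<in> D_vec \<Longrightarrow> lincomb u c = 0 \<Longrightarrow> c = 0"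
    "\<And>v. \<exists>c\<in>D_vec. ?p v = lincomb u c" "\<And>n. ?p (u n) = u n"
    using A_basis[of m] by blast
  define \<Phi> where "\<Phi> v = (SOME c. c \<in> D_vec \<and> ?p v = lincomb u c)" for v
  have \<Phi>: "\<Phi> v \<in> D_vec" "?p v = lincomb u (\<Phi> v)" for v
    using someI_ex[of "\<lambda>c. c \<in> D_vec \<and> ?p v = lincomb u c"] u(2)[of v] unfolding \<Phi>_def by auto
  have uniq: "\<Phi> v = c" if "c \<in> D_vec" "?p v = lincomb u c" for v c
  proof -
    have "\<Phi> v + - c \<in> D_vec" using \<Phi>(1) that(1) by (intro D_vec_closed)
    moreover have "lincomb u (\<Phi> v + - c) = 0"
      using \<Phi>(2)[of v] that(2) lincomb_diff[of u "\<Phi> v" c] by simp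
    ultimately have "\<Phi> v + - c = 0" by (rule u(1))
    then show ?thesis by simp
  qed
  show ?thesis
  proof (rule quotient_isomorphic[where M = V_over_D and S = UNIV and N = "A_rels (int m)" and \<Phi> = \<Phi>
        and \<sigma> = "(*)", OF module_free_D])
    show "x \<oplus>\<^bsub>V_over_D\<^esub> y = x + y" for x y by (simp add: V_over_D_def)
    show "\<Phi> (x + y) = \<Phi> x \<oplus>\<^bsub>free_D\<^esub> \<Phi> y" for x y
      by (simp, rule uniq) (simp_all add: \<Phi>(1) \<Phi>(2)[symmetric] D_vec_closed lincomb_add dlin_add[OF dlin_A_proj])
    show "\<exists>x\<in>UNIV. \<Phi> x = t" if "t \<in> carrier free_D" for t
    proof -
      have t: "t \<in> D_vec" using that by simp
      have "?p (lincomb u t) = lincomb u t"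
        by (simp add: dlin_lincomb[OF dlin_A_proj[OF m] t] u(3))
      then show ?thesis using uniq[OF t] by blast
    qed
    show "\<Phi> x = \<zero>\<^bsub>free_D\<^esub> \<longleftrightarrow> x \<in> A_rels (int m)" for x
      using \<Phi>(2)[of x] uniq[of 0 x] A_proj_eq_0_iff[OF m, of x] by (auto simp: D_vec_closed)
    show "\<Phi> (r * x) = r \<odot>\<^bsub>free_D\<^esub> \<Phi> x" if "r \<in> carrier D_alg" for r x
      by (simp, rule uniq) (simp_all add: \<Phi>(1) \<Phi>(2)[symmetric] D_vec_closed lincomb_scale that dlin_mult[OF dlin_A_proj])
    show "carrier (A_mod (int m)) = (\<lambda>x. A_rels (int m) +>\<^bsub>V_over_D\<^esub> x) ` UNIV"
      unfolding A_mod_def carrier_quot_module by (simp add: V_over_D_def)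
  qed (simp_all add: \<Phi> A_mod_def quot_module_def V_over_D_def)
qed

lemma b_deg_eq: "b_deg m \<mu> = - int (wt \<mu>) - m\<^sup>2 - m"
  by (simp add: b_deg_def wt_def sum_negf[symmetric] algebra_simps)

theorem A_deg_dim: "vdim complex_ring (A_deg (int m) d) = pm.dim (range (A_proj (int m)) \<inter> V_deg (int m) d)"
proof -
  let ?p = "A_proj (int m)" and ?N = "A_rels (int m)"
  have m: "int m \<ge> 0" by simp
  note dp = dlin_A_proj[OF m]
  have subV: "pm.subspace (V_deg (int m) d)"
  proof (rule pm.subspaceI)
    fix u v :: "complex bpoly" assume "u \<in> V_deg (int m) d" "v \<in> V_deg (int m) d"
    then show "u + v \<in> V_deg (int m) d"
      using subsetD[OF Poly_Mapping.keys_add[of u v]] by (auto simp: V_deg_def)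
  qed (auto simp: V_deg_def in_keys_iff)
  have sub: "pm.subspace (range ?p \<inter> V_deg (int m) d)"
  proof (rule pm.subspace_inter[OF _ subV])
    show "pm.subspace (range ?p)"
    proof (rule pm.subspaceI)
      show "0 \<in> range ?p" using lin_zero[OF dlin_lin[OF dp]] by (metis rangeI)
      show "x + y \<in> range ?p" if "x \<in> range ?p" "y \<in> range ?p" for x y
        using that by (auto simp: dlin_add[OF dp, symmetric])
      show "pm_scale c x \<in> range ?p" if "x \<in> range ?p" for c x
        using that by (auto simp: pm_scale_eq_mult lin_scal[OF dlin_lin[OF dp], symmetric])
    qed
  qed
  have pV: "?p v \<in> V_deg (int m) d" if v: "v \<in> V_deg (int m) d" for v
    unfolding V_deg_def
  proof clarify
    fix \<mu> assume "\<mu> \<in> supp (?p v)"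
    then obtain \<nu> where \<nu>: "\<nu> \<in> supp v" "int (wt \<mu>) = int (wt \<nu>) + 0" using wt_homD[OF wt_hom_A_proj] by blast
    then have "b_deg (int m) \<mu> = b_deg (int m) \<nu>" by (simp add: b_deg_eq)
    then show "b_deg (int m) \<mu> = d" using v \<nu>(1) by (simp add: V_deg_def)
  qed
  \<comment> \<open>The preimage of the homogeneous component, equal to that component plus all
    relations: the quotient must be taken of a space containing the relations, while the cosets in
    \<open>A_deg\<close> are given by homogeneous representatives only.\<close>
  define S where "S = {x. ?p x \<in> V_deg (int m) d}"
  have coset: "?N +>\<^bsub>V_over_C\<^esub> x = ?N +>\<^bsub>V_over_C\<^esub> y" if "x - y \<in> ?N" for x y
  proof -
    have 1: "(\<lambda>n. n + x) ` ?N \<subseteq> (\<lambda>n. n + y) ` ?N" if "x - y \<in> ?N" for x y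
    proof clarify
      fix n assume "n \<in> ?N"
      then have "n + (x - y) \<in> ?N" using A_rels_add that by blast
      then show "n + x \<in> (\<lambda>n. n + y) ` ?N" by (intro image_eqI[of _ _ "n + (x - y)"]) auto
    qed
    have "y - x \<in> ?N" using A_rels_uminus[OF that] by simp
    with 1[OF that] 1[of y x] have "(\<lambda>n. n + x) ` ?N = (\<lambda>n. n + y) ` ?N" by blast
    moreover have "?N +>\<^bsub>V_over_C\<^esub> x = (\<lambda>n. n + x) ` ?N" for x
      by (auto simp: a_r_coset_def' V_over_C_def free_space_def)
    ultimately show ?thesis by simp
  qed
  have "modules_isomorphic complex_ring (A_deg (int m) d) (vec_module (range ?p \<inter> V_deg (int m) d) pm_scale)"
  proof (rule quotient_isomorphic[where M = V_over_C and S = S and N = ?N and \<Phi> = ?p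
        and \<sigma> = pm_scale, OF module_pm_subspace[OF sub]])
    show "x \<oplus>\<^bsub>V_over_C\<^esub> y = x + y" for x y by (simp add: V_over_C_def free_space_def)
    show "x - y \<in> S" if "x \<in> S" "y \<in> S" for x y
      using that by (simp add: S_def lin_diff[OF dlin_lin[OF dp]] pm.subspace_diff[OF subV])
    show "x + y \<in> S" if "x \<in> S" "y \<in> S" for x y
      using that by (simp add: S_def dlin_add[OF dp] pm.subspace_add[OF subV])
    show "?N \<subseteq> S" using A_proj_rels[OF m] pm.subspace_0[OF subV] by (auto simp: S_def)
    show "?p x \<in> carrier (vec_module (range ?p \<inter> V_deg (int m) d) pm_scale)" if "x \<in> S" for x
      using that by (simp add: S_def)
    show "?p (x + y) = ?p x \<oplus>\<^bsub>vec_module (range ?p \<inter> V_deg (int m) d) pm_scale\<^esub> ?p y" for x y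
      by (simp add: dlin_add[OF dp])
    show "\<exists>x\<in>S. ?p x = t" if "t \<in> carrier (vec_module (range ?p \<inter> V_deg (int m) d) pm_scale)" for t
      using that A_proj_idem[OF m] by (auto simp: S_def)
    show "(?p x = \<zero>\<^bsub>vec_module (range ?p \<inter> V_deg (int m) d) pm_scale\<^esub>) = (x \<in> ?N)" for x
      by (simp add: A_proj_eq_0_iff[OF m])
    show "pm_scale r x \<in> S" if "x \<in> S" for r x
      using that pm.subspace_scale[OF subV, of _ r]
      by (simp add: S_def pm_scale_eq_mult lin_scal[OF dlin_lin[OF dp]])
    show "?p (pm_scale r x) = r \<odot>\<^bsub>vec_module (range ?p \<inter> V_deg (int m) d) pm_scale\<^esub> ?p x" for r x
      by (simp add: pm_scale_eq_mult lin_scal[OF dlin_lin[OF dp]])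
    show "carrier (A_deg (int m) d) = (\<lambda>x. ?N +>\<^bsub>V_over_C\<^esub> x) ` S"
    proof -
      have "carrier (A_deg (int m) d) = (\<lambda>x. ?N +>\<^bsub>V_over_C\<^esub> x) ` V_deg (int m) d"
        by (simp add: A_deg_def)
      also have "\<dots> = (\<lambda>x. ?N +>\<^bsub>V_over_C\<^esub> x) ` S"
      proof
        show "(\<lambda>x. ?N +>\<^bsub>V_over_C\<^esub> x) ` V_deg (int m) d \<subseteq> (\<lambda>x. ?N +>\<^bsub>V_over_C\<^esub> x) ` S"
          using pV by (auto simp: S_def)
        show "(\<lambda>x. ?N +>\<^bsub>V_over_C\<^esub> x) ` S \<subseteq> (\<lambda>x. ?N +>\<^bsub>V_over_C\<^esub> x) ` V_deg (int m) d"
        proof (rule image_subsetI)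
          fix x assume "x \<in> S"
          then show "?N +>\<^bsub>V_over_C\<^esub> x \<in> (\<lambda>x. ?N +>\<^bsub>V_over_C\<^esub> x) ` V_deg (int m) d"
            by (intro image_eqI[of _ _ "?p x"] coset A_proj_compl[OF m]) (simp add: S_def)
        qed
      qed
      finally show ?thesis .
    qed
  qed (simp_all add: A_deg_def quot_module_def V_over_C_def free_space_def)
  then show ?thesis by (rule vdim_eq_dim[OF _ sub])
qed

section \<open>The fermionic side\<close>

lemma omega_term:
  "create k (annihilate l v) = lin_ext (\<lambda>F. if l |\<in>| F \<and> k |\<notin>| F |-| {|l|}
     then sgl (finsert k (F |-| {|l|})) (fsign l F * fsign k (F |-| {|l|})) else 0) v"
  unfolding create_def annihilate_def lin_ext_lin_ext
  by (rule arg_cong2[where f = lin_ext, OF ext refl]) (simp add: lin_ext_single)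

lemma omega_summand:
  "(if n \<ge> 1 then psi (- int n) (psi (int n) v) else 0) =
    lin_ext (\<lambda>F. if n \<ge> 1 \<and> int n |\<in>| F \<and> - int n |\<notin>| F
     then sgl (finsert (- int n) (F |-| {|int n|})) (fsign (int n) F * fsign (- int n) (F |-| {|int n|})) else 0) v"
proof (cases "n \<ge> 1")
  case True
  then have "psi (- int n) (psi (int n) v) = create (- int n) (annihilate (int n) v)"
    by (simp add: psi_def)
  also have "\<dots> = lin_ext (\<lambda>F. if n \<ge> 1 \<and> int n |\<in>| F \<and> - int n |\<notin>| F
     then sgl (finsert (- int n) (F |-| {|int n|})) (fsign (int n) F * fsign (- int n) (F |-| {|int n|})) else 0) v"
    unfolding omega_term by (rule arg_cong2[where f = lin_ext, OF ext refl]) (use True in auto)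
  finally show ?thesis using True by simp
qed simp

lemma omega_finite:
  "\<exists>N. \<forall>n>N. (if n \<ge> 1 then psi (- int n) (psi (int n) v) else 0) = 0"
proof -
  have "finite (nat ` (\<Union>F\<in>supp v. fset F))" by auto
  then obtain N where N: "\<forall>k\<in>nat ` (\<Union>F\<in>supp v. fset F). k \<le> N"
    unfolding finite_nat_set_iff_bounded_le by blast
  show ?thesis
  proof (intro exI[of _ N] allI impI)
    fix n assume "n > N"
    then have "int n |\<notin>| F" if "F \<in> supp v" for F
      using N that by fastforce
    then show "(if n \<ge> 1 then psi (- int n) (psi (int n) v) else 0) = 0"
      unfolding omega_summand lin_ext_def by (intro sum.neutral) auto
  qed
qed

lemma omega_eq_sum:
  assumes "\<forall>n>N. (if n \<ge> 1 then psi (- int n) (psi (int n) v) else 0) = 0"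
  shows "omega v = - (\<Sum>n\<le>N. if n \<ge> 1 then psi (- int n) (psi (int n) v) else 0)"
proof -
  have "{n. (if n \<ge> 1 then psi (- int n) (psi (int n) v) else 0) \<noteq> 0} \<subseteq> {..N}"
  proof
    fix n assume "n \<in> {n. (if n \<ge> 1 then psi (- int n) (psi (int n) v) else 0) \<noteq> 0}"
    then have "\<not> n > N" using assms by blast
    then show "n \<in> {..N}" by simp
  qed
  then show ?thesis unfolding omega_def by (subst Sum_any.expand_superset[of "{..N}"]) auto
qed

lemma omega_add: "omega (u + v) = omega u + omega v"
proof -
  let ?t = "\<lambda>n v. if n \<ge> 1 then psi (- int n) (psi (int n) v) else 0"
  obtain N M where NM: "\<forall>n>N. ?t n u = 0" "\<forall>n>M. ?t n v = 0" using omega_finite by meson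
  have add: "?t n (u + v) = ?t n u + ?t n v" for n
    unfolding omega_summand by (rule lin_ext_add)
  have *: "\<forall>n>max N M. ?t n u = 0" "\<forall>n>max N M. ?t n v = 0" using NM by auto
  then have "\<forall>n>max N M. ?t n (u + v) = 0" unfolding add by auto
  from omega_eq_sum[OF this] omega_eq_sum[OF *(1)] omega_eq_sum[OF *(2)] show ?thesis
    unfolding add sum.distrib by simp
qed

lemma omega_scale: "omega (pm_scale c v) = pm_scale c (omega v)"
proof -
  let ?t = "\<lambda>n v. if n \<ge> 1 then psi (- int n) (psi (int n) v) else 0"
  obtain N where N: "\<forall>n>N. ?t n v = 0" using omega_finite by meson
  have scale: "?t n (pm_scale c v) = pm_scale c (?t n v)" for n
    unfolding omega_summand by (rule lin_ext_scale)
  have "\<forall>n>N. ?t n (pm_scale c v) = 0"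
  proof (intro allI impI)
    fix n assume "n > N"
    then have "?t n v = 0" using N by blast
    then show "?t n (pm_scale c v) = 0" unfolding scale by (simp only: pm.scale_zero_right)
  qed
  from omega_eq_sum[OF this] omega_eq_sum[OF N] show ?thesis
    unfolding scale by (simp add: pm.scale_sum_right)
qed

lemma supp_omega:
  assumes "G \<in> supp (omega v)"
  shows "\<exists>F\<in>supp v. \<exists>n\<ge>1. int n |\<in>| F \<and> - int n |\<notin>| F \<and> G = finsert (- int n) (F |-| {|int n|})"
proof -
  let ?t = "\<lambda>n v. if n \<ge> 1 then psi (- int n) (psi (int n) v) else 0"
  obtain N where N: "\<forall>n>N. ?t n v = 0" using omega_finite by meson
  have "G \<in> supp (\<Sum>n\<le>N. ?t n v)" using assms unfolding omega_eq_sum[OF N] by (simp add: in_keys_iff)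
  then have "G \<in> (\<Union>n\<in>{..N}. supp (?t n v))" by (rule subsetD[OF Poly_Mapping.keys_sum])
  then obtain n where "G \<in> supp (?t n v)" by blast
  then have "G \<in> (\<Union>F\<in>supp v. supp (pm_scale (coef v F) (if n \<ge> 1 \<and> int n |\<in>| F \<and> - int n |\<notin>| F
     then sgl (finsert (- int n) (F |-| {|int n|})) (fsign (int n) F * fsign (- int n) (F |-| {|int n|})) else 0)))"
    unfolding omega_summand lin_ext_def by (rule subsetD[OF Poly_Mapping.keys_sum])
  then obtain F where F: "F \<in> supp v" "G \<in> supp (pm_scale (coef v F) (if n \<ge> 1 \<and> int n |\<in>| F \<and> - int n |\<notin>| F
     then sgl (finsert (- int n) (F |-| {|int n|})) (fsign (int n) F * fsign (- int n) (F |-| {|int n|})) else 0))"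
    by blast
  have n: "n \<ge> 1 \<and> int n |\<in>| F \<and> - int n |\<notin>| F"
  proof (rule ccontr)
    assume *: "\<not> (n \<ge> 1 \<and> int n |\<in>| F \<and> - int n |\<notin>| F)"
    show False using F(2) unfolding if_not_P[OF *] by simp
  qed
  have "G = finsert (- int n) (F |-| {|int n|})"
    using F(2) unfolding if_P[OF n] by (simp split: if_splits)
  then show ?thesis using n F(1) by blast
qed

lemma omega_state:
  assumes F: "F \<in> H_states (m + 2)" and n: "n \<ge> 1" "int n |\<in>| F" "- int n |\<notin>| F"
  shows "finsert (- int n) (F |-| {|int n|}) \<in> H_states m"
proof -
  let ?G = "finsert (- int n) (F |-| {|int n|})"
  have pos: "{s \<in> fset F. s > 0} = insert (int n) {s \<in> fset ?G. s > 0}"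
    using n by auto
  have neg: "{r \<in> fset ?G. r < 0} = insert (- int n) {r \<in> fset F. r < 0}"
    using n by auto
  have "card {s \<in> fset F. s > 0} = Suc (card {s \<in> fset ?G. s > 0})"
    unfolding pos by (rule card_insert_disjoint) (use n in auto)
  moreover have "card {r \<in> fset ?G. r < 0} = Suc (card {r \<in> fset F. r < 0})"
    unfolding neg by (rule card_insert_disjoint) (use n in auto)
  moreover have "0 |\<notin>| ?G" using F n by (auto simp: H_states_def)
  ultimately show ?thesis using F by (simp add: H_states_def)
qed

lemma carrier_H_space: "carrier (H_space m) = {v. supp v \<subseteq> H_states m}"
  by (simp add: H_space_def free_space_def)

lemma subspace_H_space: "pm.subspace (carrier (H_space m))"
  unfolding carrier_H_space by (rule subspace_supp)

lemma subspace_omega_image: "pm.subspace (omega ` carrier (H_space m))"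
proof (rule pm.subspaceI)
  note S = subspace_H_space[of m]
  have "omega 0 = 0" using omega_scale[of 0 0] by simp
  then show "0 \<in> omega ` carrier (H_space m)" using pm.subspace_0[OF S] by (metis imageI)
  fix x c assume x: "x \<in> omega ` carrier (H_space m)"
  show "pm_scale c x \<in> omega ` carrier (H_space m)"
    using x pm.subspace_scale[OF S] by (auto simp: omega_scale[symmetric])
  fix y assume "y \<in> omega ` carrier (H_space m)"
  then show "x + y \<in> omega ` carrier (H_space m)"
    using x pm.subspace_add[OF S] by (auto simp: omega_add[symmetric])
qed

lemma omega_image_subset: "omega ` carrier (H_space (m + 2)) \<subseteq> carrier (H_space m)"
proof (clarsimp simp: carrier_H_space)
  fix v G assume "supp v \<subseteq> H_states (m + 2)" "G \<in> supp (omega v)"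
  then show "G \<in> H_states m" using supp_omega[of G v] omega_state by blast
qed

text \<open>Every state in \<open>omega v\<close> contains some \<open>-n\<close> without \<open>n\<close>. The infinitely many states below do not, so they make
  the quotient by the image of \<open>omega\<close> infinite dimensional.\<close>

definition paired_state :: "nat \<Rightarrow> nat \<Rightarrow> int fset" where
  "paired_state m k = Abs_fset ({1..int m} \<union> {int k, - int k})"

lemma fset_paired_state: "fset (paired_state m k) = {1..int m} \<union> {int k, - int k}"
  unfolding paired_state_def by (rule Abs_fset_inverse) simp

lemma paired_state_in_H: "k > m \<Longrightarrow> paired_state m k \<in> H_states (int m)"
proof -
  assume k: "k > m"
  have "{s \<in> fset (paired_state m k). s > 0} = insert (int k) {1..int m}"
    "{r \<in> fset (paired_state m k). r < 0} = {- int k}"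
    using k by (auto simp: fset_paired_state)
  moreover have "card (insert (int k) {1..int m}) = Suc m"
    using k by (subst card_insert_disjoint) auto
  moreover have "0 |\<notin>| paired_state m k" using k by (simp add: fset_paired_state)
  ultimately show ?thesis by (simp add: H_states_def)
qed

lemma paired_state_not_omega: "paired_state m k \<notin> supp (omega v)"
proof
  assume "paired_state m k \<in> supp (omega v)"
  then obtain F n where n: "n \<ge> 1" "paired_state m k = finsert (- int n) (F |-| {|int n|})"
    using supp_omega by blast
  then have "- int n \<in> fset (paired_state m k)" "int n \<notin> fset (paired_state m k)" by auto
  then show False using n(1) by (auto simp: fset_paired_state)
qed

lemma paired_state_inj: "paired_state m k = paired_state m l \<Longrightarrow> k > m \<Longrightarrow> l > m \<Longrightarrow> k = l"
proof -
  assume kl: "paired_state m k = paired_state m l" "k > m" "l > m"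
  have "int k \<in> fset (paired_state m l)" unfolding kl(1)[symmetric] by (simp add: fset_paired_state)
  then show "k = l" using kl(2,3) by (auto simp: fset_paired_state)
qed

text \<open>A basis of the image of \<open>omega\<close> is extended to one of the whole space, and
  the quotient gets as coordinates the coefficients along the added vectors. It remains to see that
  these form a countably infinite set.\<close>

theorem W_space_countable:
  "modules_isomorphic complex_ring (W_space (int m)) (vec_module (UNIV :: (nat \<Rightarrow>\<^sub>0 complex) set) pm_scale)"
proof -
  let ?H = "carrier (H_space (int m))" and ?T = "vec_module (UNIV :: (nat \<Rightarrow>\<^sub>0 complex) set) pm_scale"
  define N where "N = omega ` carrier (H_space (int m + 2))"
  have subN: "pm.subspace N" unfolding N_def by (rule subspace_omega_image)
  have NH: "N \<subseteq> ?H" unfolding N_def by (rule omega_image_subset)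
  note subH = subspace_H_space[of "int m"]
  define U where "U = (\<lambda>F. sgl F (1::complex)) ` H_states (int m)"
  have UH: "U \<subseteq> ?H" by (auto simp: U_def carrier_H_space)
  obtain B0 where B0: "B0 \<subseteq> N" "pm.independent B0" "N \<subseteq> pm.span B0"
      "card B0 = pm.dim N" by (rule pm.basis_exists)
  have spanB0: "pm.span B0 = N"
    using B0(3) pm.span_minimal[OF B0(1) subN] by blast
  \<comment> \<open>The completion uses states only, so the added vectors inherit countability from
    the finite sets of integers.\<close>
  obtain B where B: "B0 \<subseteq> B" "B \<subseteq> B0 \<union> U" "pm.independent B" "B0 \<union> U \<subseteq> pm.span B"
    using pm.maximal_independent_subset_extend[of B0 "B0 \<union> U"] B0(2) by blast
  have spanB: "pm.span B = ?H"
  proof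
    show "pm.span B \<subseteq> ?H"
      by (rule pm.span_minimal[OF _ subH]) (use B(2) B0(1) NH UH in blast)
    have "U \<subseteq> pm.span B" using B(4) by blast
    then have "pm.span U \<subseteq> pm.span B" by (rule pm.span_minimal[OF _ pm.subspace_span])
    moreover have "?H \<subseteq> pm.span U"
      unfolding U_def carrier_H_space by (auto intro!: span_monomials)
    ultimately show "?H \<subseteq> pm.span B" by blast
  qed
  define C where "C = B - B0"
  have CU: "C \<subseteq> U" using B(2) by (auto simp: C_def)
  have count: "countable C"
  proof -
    have "fset ` H_states (int m) \<subseteq> {A. finite A}" by auto
    then have "countable (fset ` H_states (int m))" using countable_Collect_finite by (rule countable_subset)
    moreover have "inj_on fset (H_states (int m))" by (simp add: inj_on_def fset_inject)
    ultimately have "countable (H_states (int m))" by (rule countable_image_inj_on)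
    then have "countable U" unfolding U_def by (rule countable_image)
    with CU show ?thesis by (rule countable_subset)
  qed
  have inf: "infinite C"
  proof
    assume "finite C"
    then have fin: "finite (\<Union>c\<in>C. supp c)" by (intro finite_UN_I finite_keys)
    have "inj_on (paired_state m) {m<..}" by (rule inj_onI, rule paired_state_inj) auto
    moreover have "infinite {m<..}" by (rule infinite_Ioi)
    ultimately have "infinite (paired_state m ` {m<..})" using finite_imageD by blast
    then have "\<not> paired_state m ` {m<..} \<subseteq> (\<Union>c\<in>C. supp c)" using fin finite_subset by blast
    then obtain k where k: "k > m" "paired_state m k \<notin> (\<Union>c\<in>C. supp c)" by blast
    let ?F = "paired_state m k"
    \<comment> \<open>The coefficient at \<open>?F\<close> vanishes on \<open>B0\<close> by
      \<open>paired_state_not_omega\<close> and on \<open>C\<close> by the choice of k, hence on the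
      whole space; but that space contains the state \<open>?F\<close> itself.\<close>
    have "pm.subspace {v. coef v ?F = 0}"
      by (rule pm.subspaceI) (simp_all add: lookup_add)
    moreover have "coef b ?F = 0" if "b \<in> B" for b
    proof (cases "b \<in> B0")
      case True
      then have "b \<in> N" using B0(1) by blast
      then show ?thesis using paired_state_not_omega[of m k] by (auto simp: N_def in_keys_iff)
    next
      case False
      then show ?thesis using that k(2) by (auto simp: C_def in_keys_iff)
    qed
    ultimately have "pm.span B \<subseteq> {v. coef v ?F = 0}" by (intro pm.span_minimal) auto
    moreover have "sgl ?F 1 \<in> ?H" using paired_state_in_H[OF k(1)] by (simp add: carrier_H_space)
    ultimately show False unfolding spanB by auto
  qed
  define e where "e = from_nat_into C"
  have bij: "bij_betw e UNIV C" unfolding e_def by (rule bij_betw_from_nat_into[OF count inf])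
  have inj: "inj e" and eC: "e n \<in> C" and Ce: "C = range e" for n
    using bij by (auto simp: bij_betw_def)
  let ?r = "pm.representation B"
  define \<Phi> where "\<Phi> v = Abs_poly_mapping (\<lambda>n. ?r v (e n))" for v
  have coef: "coef (\<Phi> v) n = ?r v (e n)" for v n
  proof -
    have "finite {n. ?r v (e n) \<noteq> 0}"
    proof (rule finite_imageD)
      show "finite (e ` {n. ?r v (e n) \<noteq> 0})"
        by (rule finite_subset[OF _ pm.finite_representation[of B v]]) auto
      show "inj_on e {n. ?r v (e n) \<noteq> 0}" using inj inj_on_subset by blast
    qed
    then show ?thesis by (simp add: \<Phi>_def)
  qed
  show ?thesis
  proof (rule quotient_isomorphic[where M = "H_space (int m)" and S = ?H and N = N and \<Phi> = \<Phi>
        and \<sigma> = pm_scale, OF module_pm_subspace[OF pm.subspace_UNIV]])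
    show "x \<oplus>\<^bsub>H_space (int m)\<^esub> y = x + y" for x y by (simp add: H_space_def free_space_def)
    show "\<Phi> (x + y) = \<Phi> x \<oplus>\<^bsub>?T\<^esub> \<Phi> y" if "x \<in> ?H" "y \<in> ?H" for x y
      using that by (intro poly_mapping_eqI) (simp add: lookup_add coef pm.representation_add[OF B(3)] spanB)
    show "\<Phi> (pm_scale r x) = r \<odot>\<^bsub>?T\<^esub> \<Phi> x" if "x \<in> ?H" for r x
      using that by (intro poly_mapping_eqI) (simp add: coef pm.representation_scale[OF B(3)] spanB)
    show "\<exists>x\<in>?H. \<Phi> x = t" for t
    proof
      let ?x = "\<Sum>n\<in>supp t. pm_scale (coef t n) (e n)"
      have eB: "e n \<in> B" for n using eC[of n] by (simp add: C_def)
      have sp: "pm_scale (coef t n) (e n) \<in> pm.span B" for n by (intro pm.span_scale pm.span_base eB)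
      show "?x \<in> ?H" unfolding spanB[symmetric] by (intro pm.span_sum sp)
      show "\<Phi> ?x = t"
      proof (rule poly_mapping_eqI)
        fix k
        have "?r ?x (e k) = (\<Sum>n\<in>supp t. coef t n * ?r (e n) (e k))"
          by (simp add: pm.representation_sum[OF B(3) sp] pm.representation_scale[OF B(3) pm.span_base[OF eB]])
        also have "\<dots> = (\<Sum>n\<in>supp t. if n = k then coef t n else 0)"
          using inj by (intro sum.cong refl) (auto simp: pm.representation_basis[OF B(3) eB] inj_def)
        also have "\<dots> = coef t k" by (simp add: in_keys_iff)
        finally show "coef (\<Phi> ?x) k = coef t k" by (simp only: coef)
      qed
    qed
    show "\<Phi> x = \<zero>\<^bsub>?T\<^esub> \<longleftrightarrow> x \<in> N" if x: "x \<in> ?H" for x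
    proof
      assume "\<Phi> x = \<zero>\<^bsub>?T\<^esub>"
      then have "?r x (e n) = 0" for n using coef[of x n] by simp
      then have "?r x c = 0" if "c \<in> C" for c using that unfolding Ce by blast
      then have rB0: "b \<in> B0" if "?r x b \<noteq> 0" for b
        using that pm.representation_ne_zero[of B x b] by (auto simp: C_def)
      have "x = (\<Sum>b\<in>{b. ?r x b \<noteq> 0}. pm_scale (?r x b) b)"
        using pm.sum_nonzero_representation_eq[OF B(3)] x spanB by simp
      also have "\<dots> \<in> pm.span B0"
        by (intro pm.span_sum pm.span_scale pm.span_base rB0) simp
      finally show "x \<in> N" by (simp add: spanB0)
    next
      assume "x \<in> N"
      then have "?r x = pm.representation B0 x"
        by (intro pm.representation_extend B) (simp add: spanB0)
      moreover have "pm.representation B0 x (e n) = 0" for n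
        using pm.representation_ne_zero[of B0 x "e n"] eC[of n] by (auto simp: C_def)
      ultimately show "\<Phi> x = \<zero>\<^bsub>?T\<^esub>" by (intro poly_mapping_eqI) (simp add: coef)
    qed
    show "carrier (W_space (int m)) = (\<lambda>x. N +>\<^bsub>H_space (int m)\<^esub> x) ` ?H"
      unfolding W_space_def carrier_quot_module N_def ..
  qed (use NH pm.subspace_diff[OF subH] pm.subspace_add[OF subH] pm.subspace_scale[OF subH] in
      \<open>auto simp: W_space_def quot_module_def N_def H_space_def free_space_def\<close>)
qed

section \<open>Extension of scalars\<close>

lemma free_space_eq: "free_space X = vec_module {v. supp v \<subseteq> X} pm_scale"
  by (simp add: free_space_def vec_module_def)

lemma submodule_free_space:
  "submodule U complex_ring (free_space X) \<longleftrightarrow> pm.subspace U \<and> U \<subseteq> {v. supp v \<subseteq> X}"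
proof -
  interpret F: Module.module complex_ring "free_space X"
    unfolding free_space_eq by (rule module_pm_subspace[OF subspace_supp])
  have inv: "\<ominus>\<^bsub>free_space X\<^esub> x = - x" if "supp x \<subseteq> X" for x
    by (rule F.minus_equality) (use that in \<open>auto simp: free_space_eq in_keys_iff\<close>)
  show ?thesis
  proof
    assume U: "submodule U complex_ring (free_space X)"
    note E = F.submoduleE[OF U]
    have sub: "U \<subseteq> {v. supp v \<subseteq> X}" using E(1) by (simp add: free_space_eq)
    have scale: "pm_scale c x \<in> U" if "x \<in> U" for c x using E(4)[of c x] that by (simp add: free_space_eq)
    have "pm.subspace U"
    proof (rule pm.subspaceI)
      obtain x where "x \<in> U" using E(2) by blast
      from scale[OF this, of 0] show "0 \<in> U" by simp
      show "x + y \<in> U" if "x \<in> U" "y \<in> U" for x y using E(5)[OF that] by (simp add: free_space_eq)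
    qed (rule scale)
    then show "pm.subspace U \<and> U \<subseteq> {v. supp v \<subseteq> X}" using sub by (rule conjI)
  next
    assume U: "pm.subspace U \<and> U \<subseteq> {v. supp v \<subseteq> X}"
    then have s: "pm.subspace U" and sub: "U \<subseteq> {v. supp v \<subseteq> X}" by blast+
    show "submodule U complex_ring (free_space X)"
    proof (rule F.submoduleI)
      show "\<ominus>\<^bsub>free_space X\<^esub> a \<in> U" if "a \<in> U" for a
        using inv[of a] sub that pm.subspace_neg[OF s that] by auto
    qed (use sub pm.subspace_0[OF s] pm.subspace_add[OF s] pm.subspace_scale[OF s] in \<open>auto simp: free_space_eq\<close>)
  qed
qed

lemma tensor_null_eq_span:
  assumes "tensor_rels M N \<subseteq> {v. supp v \<subseteq> carrier M \<times> carrier N}"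
  shows "tensor_null M N = pm.span (tensor_rels M N)"
proof
  have "pm.span (tensor_rels M N) \<subseteq> {v. supp v \<subseteq> carrier M \<times> carrier N}"
    by (rule pm.span_minimal[OF assms subspace_supp])
  then show "tensor_null M N \<subseteq> pm.span (tensor_rels M N)"
    unfolding tensor_null_def submodule_free_space
    by (intro Inter_lower CollectI conjI pm.subspace_span pm.span_superset)
  show "pm.span (tensor_rels M N) \<subseteq> tensor_null M N"
    unfolding tensor_null_def submodule_free_space
    by (rule Inter_greatest) (auto dest: pm.span_minimal)
qed

text \<open>The symbols (a, w) of the free space are additive in each argument only modulo the
  tensor relations; this extends such additivity to finite sums.\<close>

lemma sum_mod_subspace:
  assumes N: "pm.subspace N" and "finite K" and t0: "t 0 \<in> N" and u: "\<And>k. k \<in> K \<Longrightarrow> u k \<in> Z"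
    and Z: "0 \<in> Z" "\<And>x y. x \<in> Z \<Longrightarrow> y \<in> Z \<Longrightarrow> x + y \<in> Z"
    and t: "\<And>x y. x \<in> Z \<Longrightarrow> y \<in> Z \<Longrightarrow> t (x + y) - t x - t y \<in> N"
  shows "t (\<Sum>k\<in>K. u k) - (\<Sum>k\<in>K. t (u k)) \<in> N"
proof -
  have "(\<Sum>k\<in>K. u k) \<in> Z \<and> t (\<Sum>k\<in>K. u k) - (\<Sum>k\<in>K. t (u k)) \<in> N"
    using \<open>finite K\<close> u
  proof (induction K rule: finite_induct)
    case (insert k K)
    let ?s = "\<Sum>k\<in>K. u k"
    have IH: "?s \<in> Z" "t ?s - (\<Sum>k\<in>K. t (u k)) \<in> N" and k: "u k \<in> Z" using insert by auto
    have "(t (u k + ?s) - t (u k) - t ?s) + (t ?s - (\<Sum>k\<in>K. t (u k))) \<in> N"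
      by (rule pm.subspace_add[OF N t[OF k IH(1)] IH(2)])
    then show ?case using insert.hyps Z(2)[OF k IH(1)] by (simp add: algebra_simps)
  qed (simp add: t0 Z(1))
  then show ?thesis by (rule conjunct2)
qed

lemma subspace_D_alg: "pm.subspace (carrier D_alg)"
  by (rule pm.subspaceI) (simp_all add: D_closed pm_scale_eq_mult)

lemma sum_single_superset:
  "finite K \<Longrightarrow> supp x \<subseteq> K \<Longrightarrow> x = (\<Sum>n\<in>K. sgl n (coef x n))"
  by (rule poly_mapping_eqI) (auto simp: lookup_sum lookup_single when_def in_keys_iff subset_iff)

text \<open>In coordinates on W, the tensor of a and w becomes the sequence whose n-th entry is a
  times the n-th coordinate of w. That the relations go to 0 is checked on generators; the kernel is
  no larger because every element is congruent to \<Sum> a_n \<otimes> w_n, where the a_n are the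
  entries of its image and the w_n form the basis of W.\<close>

theorem ext_scalars_free:
  fixes W :: "(complex, 'w, 'y) module_scheme"
  assumes "modules_isomorphic complex_ring W (vec_module (UNIV :: (nat \<Rightarrow>\<^sub>0 complex) set) pm_scale)"
  shows "modules_isomorphic D_alg (ext_scalars D_alg W) free_D"
proof -
  let ?T = "vec_module (UNIV :: (nat \<Rightarrow>\<^sub>0 complex) set) pm_scale"
  obtain h where modW: "Module.module complex_ring W" and h: "mod_iso complex_ring W ?T h"
    using assms by (auto simp: modules_isomorphic_iff)
  interpret W: Module.module complex_ring W by (rule modW)
  define g where "g = inv_into (carrier W) h"
  have g: "mod_iso complex_ring ?T W g" unfolding g_def by (rule mod_iso_inv[OF modW h])
  have gW: "g x \<in> carrier W" and g_add: "g (x + y) = g x \<oplus>\<^bsub>W\<^esub> g y"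
    and g_scale: "g (pm_scale c x) = c \<odot>\<^bsub>W\<^esub> g x" for x y c
    using mod_isoD(2)[OF g, of x] mod_isoD(5)[OF g, of x y] mod_isoD(6)[OF g, of c x] by simp_all
  have hg: "h (g x) = x" for x
    unfolding g_def by (rule f_inv_into_f) (simp add: mod_isoD(4)[OF h])
  have gh: "g (h w) = w" if "w \<in> carrier W" for w
    unfolding g_def by (rule inv_into_f_f[OF mod_isoD(3)[OF h] that])
  have h_add: "h (w \<oplus>\<^bsub>W\<^esub> w') = h w + h w'" if "w \<in> carrier W" "w' \<in> carrier W" for w w'
    using mod_isoD(5)[OF h that] by simp
  have h_scale: "h (c \<odot>\<^bsub>W\<^esub> w) = pm_scale c (h w)" if "w \<in> carrier W" for w c
    using mod_isoD(6)[OF h _ that, of c] by simp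
  define S where "S = {v :: complex bpoly \<times> 'w \<Rightarrow>\<^sub>0 complex. supp v \<subseteq> carrier D_alg \<times> carrier W}"
  define N where "N = pm.span (tensor_rels D_alg W)"
  have subS: "pm.subspace S" unfolding S_def by (rule subspace_supp)
  have subN: "pm.subspace N" unfolding N_def by (rule pm.subspace_span)
  have sglS: "sgl (a, w) c \<in> S" if "a \<in> carrier D_alg" "w \<in> carrier W" for a w c
    using that by (simp add: S_def)
  have D_scale: "pm_scale c a \<in> carrier D_alg" if "a \<in> carrier D_alg" for c a
    by (rule pm.subspace_scale[OF subspace_D_alg that])
  have relsS: "tensor_rels D_alg W \<subseteq> S"
    unfolding tensor_rels_def
    by (auto intro!: pm.subspace_diff[OF subS] sglS simp: D_closed D_scale W.smult_closed)
  have null: "tensor_null D_alg W = N"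
    unfolding N_def by (rule tensor_null_eq_span) (use relsS in \<open>simp add: S_def\<close>)
  have NS: "N \<subseteq> S" unfolding N_def by (rule pm.span_minimal[OF relsS subS])
  define G :: "nat \<Rightarrow> complex bpoly \<times> 'w \<Rightarrow> complex bpoly"
    where "G n p = pm_scale (coef (h (snd p)) n) (fst p)" for n p
  define \<phi> where "\<phi> n = lin_ext (G n)" for n
  have \<phi>_single: "\<phi> n (sgl p c) = pm_scale c (G n p)" for n p c by (simp add: \<phi>_def lin_ext_single)
  have \<phi>_add: "\<phi> n (u + v) = \<phi> n u + \<phi> n v" for n u v by (simp add: \<phi>_def lin_ext_add)
  have \<phi>_scale: "\<phi> n (pm_scale c v) = pm_scale c (\<phi> n v)" for n c v by (simp add: \<phi>_def lin_ext_scale)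
  have \<phi>_diff: "\<phi> n (u - v) = \<phi> n u - \<phi> n v" for n u v using \<phi>_add[of n "u - v" v] by simp
  have \<phi>_D: "\<phi> n f \<in> carrier D_alg" if "f \<in> S" for n f
    unfolding \<phi>_def lin_ext_def
  proof (rule pm.subspace_sum[OF subspace_D_alg])
    fix p assume "p \<in> supp f"
    then have "fst p \<in> carrier D_alg" using that by (auto simp: S_def)
    then show "pm_scale (coef f p) (G n p) \<in> carrier D_alg" by (simp add: G_def D_scale)
  qed
  have \<phi>_outside: "\<phi> n f = 0" if "n \<notin> (\<Union>p\<in>supp f. supp (h (snd p)))" for n f
    unfolding \<phi>_def lin_ext_def using that by (intro sum.neutral) (simp add: G_def in_keys_iff)
  have \<phi>_finite: "finite {n. \<phi> n f \<noteq> 0}" for f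
  proof (rule finite_subset)
    show "{n. \<phi> n f \<noteq> 0} \<subseteq> (\<Union>p\<in>supp f. supp (h (snd p)))" using \<phi>_outside by blast
  qed auto
  define \<Phi> where "\<Phi> f = Abs_poly_mapping (\<lambda>n. \<phi> n f)" for f
  have coef: "coef (\<Phi> f) n = \<phi> n f" for f n using \<phi>_finite by (simp add: \<Phi>_def)
  have \<phi>_N: "\<phi> n f = 0" if "f \<in> N" for n f
  proof -
    have "pm.subspace {f. \<phi> n f = 0}"
      by (rule pm.subspaceI) (simp_all add: \<phi>_add \<phi>_scale, simp add: \<phi>_def)
    moreover have "tensor_rels D_alg W \<subseteq> {f. \<phi> n f = 0}"
      unfolding tensor_rels_def
      by (auto simp: \<phi>_diff \<phi>_single G_def h_add h_scale lookup_add pm_scale_simps(1,2) pm.scale_scale mult.commute)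
    ultimately have "N \<subseteq> {f. \<phi> n f = 0}" unfolding N_def by (intro pm.span_minimal)
    then show ?thesis using that by blast
  qed
  have R1: "sgl (a + a', w) 1 - sgl (a, w) 1 - sgl (a', w) 1 \<in> N"
    if "a \<in> carrier D_alg" "a' \<in> carrier D_alg" "w \<in> carrier W" for a a' w
    using that unfolding N_def tensor_rels_def D_alg_simps by (intro pm.span_base) blast
  have R2: "sgl (a, w \<oplus>\<^bsub>W\<^esub> w') 1 - sgl (a, w) 1 - sgl (a, w') 1 \<in> N"
    if "a \<in> carrier D_alg" "w \<in> carrier W" "w' \<in> carrier W" for a w w'
    using that unfolding N_def tensor_rels_def D_alg_simps by (intro pm.span_base) blast
  have R3: "sgl (pm_scale c a, w) 1 - sgl (a, w) c \<in> N"
    if "a \<in> carrier D_alg" "w \<in> carrier W" for a w c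
    using that unfolding N_def tensor_rels_def D_alg_simps by (intro pm.span_base) blast
  have R4: "sgl (a, c \<odot>\<^bsub>W\<^esub> w) 1 - sgl (a, w) c \<in> N"
    if "a \<in> carrier D_alg" "w \<in> carrier W" for a w c
    using that unfolding N_def tensor_rels_def D_alg_simps by (intro pm.span_base) blast
  have chain: "x - z \<in> N" if "x - y \<in> N" "y - z \<in> N" for x y z
    using pm.subspace_add[OF subN that] by simp
  have flip: "y - x \<in> N" if "x - y \<in> N" for x y
    using pm.subspace_neg[OF subN that] by simp
  \<comment> \<open>The symbol of a \<otimes> w_n, where w_n corresponds to the n-th unit
    vector.\<close>
  define e where "e n a = sgl (a, g (sgl n 1)) (1::complex)" for n and a :: "complex bpoly"
  have e0: "e n 0 \<in> N" for n using R3[OF D_closed(1) gW, of 0] by (simp add: e_def)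
  \<comment> \<open>The set \<open>K\<close> may exceed the support of \<open>h w\<close>, so that
    one finite set serves all symbols occurring in an element.\<close>
  have split: "sgl (a, w) c - (\<Sum>n\<in>K. e n (pm_scale c (G n (a, w)))) \<in> N"
    if a: "a \<in> carrier D_alg" and w: "w \<in> carrier W" and K: "finite K" "supp (h w) \<subseteq> K" for a w c K
  proof -
    have ca: "pm_scale c a \<in> carrier D_alg" by (rule D_scale[OF a])
    have "sgl (pm_scale c a, g (\<Sum>n\<in>K. sgl n (coef (h w) n))) 1
        - (\<Sum>n\<in>K. sgl (pm_scale c a, g (sgl n (coef (h w) n))) 1) \<in> N"
    proof (rule sum_mod_subspace[OF subN K(1), where Z = UNIV and t = "\<lambda>x. sgl (pm_scale c a, g x) 1"])
      have "g 0 = 0 \<odot>\<^bsub>W\<^esub> g 0" using g_scale[of 0 0] by simp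
      then show "sgl (pm_scale c a, g 0) 1 \<in> N" using R4[OF ca gW, of 0 0] by simp
      show "sgl (pm_scale c a, g (x + y)) 1 - sgl (pm_scale c a, g x) 1 - sgl (pm_scale c a, g y) 1 \<in> N" for x y
        unfolding g_add by (rule R2[OF ca gW gW])
    qed auto
    then have 1: "sgl (pm_scale c a, w) 1 - (\<Sum>n\<in>K. sgl (pm_scale c a, g (sgl n (coef (h w) n))) 1) \<in> N"
      unfolding sum_single_superset[OF K, symmetric] gh[OF w] .
    have 2: "sgl (pm_scale c a, g (sgl n d)) 1 - e n (pm_scale d (pm_scale c a)) \<in> N" for n d
    proof -
      have "g (sgl n d) = d \<odot>\<^bsub>W\<^esub> g (sgl n 1)" using g_scale[of d "sgl n 1"] by simp
      then show ?thesis unfolding e_def using chain[OF R4[OF ca gW] flip[OF R3[OF ca gW]]] by simp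
    qed
    have "(\<Sum>n\<in>K. sgl (pm_scale c a, g (sgl n (coef (h w) n))) 1)
        - (\<Sum>n\<in>K. e n (pm_scale (coef (h w) n) (pm_scale c a))) \<in> N"
      unfolding sum_subtractf[symmetric] by (rule pm.subspace_sum[OF subN 2])
    from chain[OF flip[OF R3[OF a w]] chain[OF 1 this]] show ?thesis
      by (simp add: G_def pm.scale_scale mult.commute)
  qed
  have expand: "f - (\<Sum>n\<in>K. e n (\<phi> n f)) \<in> N"
    if f: "f \<in> S" and K: "finite K" "(\<Union>p\<in>supp f. supp (h (snd p))) \<subseteq> K" for f K
  proof -
    let ?u = "\<lambda>n p. pm_scale (coef f p) (G n p)"
    have p: "fst p \<in> carrier D_alg" "snd p \<in> carrier W" "supp (h (snd p)) \<subseteq> K" if "p \<in> supp f" for p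
      using f that K(2) by (auto simp: S_def)
    have "(\<Sum>p\<in>supp f. sgl p (coef f p)) - (\<Sum>p\<in>supp f. \<Sum>n\<in>K. e n (?u n p)) \<in> N"
      unfolding sum_subtractf[symmetric]
    proof (rule pm.subspace_sum[OF subN])
      fix q assume "q \<in> supp f"
      from split[OF p(1,2)[OF this] K(1) p(3)[OF this], of "coef f q"]
      show "sgl q (coef f q) - (\<Sum>n\<in>K. e n (?u n q)) \<in> N" by simp
    qed
    then have 1: "f - (\<Sum>n\<in>K. \<Sum>p\<in>supp f. e n (?u n p)) \<in> N"
      unfolding sum_single_superset[OF finite_keys subset_refl, symmetric] sum.swap[of _ K] .
    have "e n (\<Sum>p\<in>supp f. ?u n p) - (\<Sum>p\<in>supp f. e n (?u n p)) \<in> N" for n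
    proof (rule sum_mod_subspace[OF subN finite_keys, where Z = "carrier D_alg" and t = "e n"])
      show "?u n p \<in> carrier D_alg" if "p \<in> supp f" for p using p(1)[OF that] by (simp add: G_def D_scale)
      show "e n (x + y) - e n x - e n y \<in> N" if "x \<in> carrier D_alg" "y \<in> carrier D_alg" for x y
        unfolding e_def by (rule R1[OF that gW])
    qed (simp_all add: D_closed e0)
    then have "(\<Sum>n\<in>K. \<Sum>p\<in>supp f. e n (?u n p)) - (\<Sum>n\<in>K. e n (\<phi> n f)) \<in> N"
      unfolding sum_subtractf[symmetric] \<phi>_def lin_ext_def by (rule pm.subspace_sum[OF subN flip])
    from chain[OF 1 this] show ?thesis .
  qed
  show ?thesis
  proof (rule quotient_isomorphic[where M = "free_space (carrier D_alg \<times> carrier W)" and S = S and N = N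
        and \<Phi> = \<Phi> and \<sigma> = "\<lambda>d. lin_ext (\<lambda>(a, w). sgl (d \<otimes>\<^bsub>D_alg\<^esub> a, w) 1)", OF module_free_D])
    show "x \<oplus>\<^bsub>free_space (carrier D_alg \<times> carrier W)\<^esub> y = x + y" for x y by (simp add: free_space_eq)
    show "\<Phi> x \<in> carrier free_D" if "x \<in> S" for x using \<phi>_D[OF that] by (simp add: D_vec_def coef)
    show "\<Phi> (x + y) = \<Phi> x \<oplus>\<^bsub>free_D\<^esub> \<Phi> y" for x y
      by (rule poly_mapping_eqI) (simp add: coef lookup_add \<phi>_add)
    show "\<exists>x\<in>S. \<Phi> x = t" if "t \<in> carrier free_D" for t
    proof
      let ?x = "\<Sum>n\<in>supp t. e n (coef t n)"
      have "coef t n \<in> carrier D_alg" for n using that by (simp add: D_vec_def)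
      then show "?x \<in> S" unfolding e_def by (intro pm.subspace_sum[OF subS] sglS gW)
      show "\<Phi> ?x = t"
      proof (rule poly_mapping_eqI)
        fix k
        have "\<phi> k ?x = (\<Sum>n\<in>supp t. if n = k then coef t n else 0)"
          unfolding \<phi>_def lin_ext_sum
          by (rule sum.cong[OF refl]) (simp add: e_def lin_ext_single G_def hg lookup_single)
        then show "coef (\<Phi> ?x) k = coef t k" by (simp add: coef in_keys_iff)
      qed
    qed
    show "\<Phi> x = \<zero>\<^bsub>free_D\<^esub> \<longleftrightarrow> x \<in> N" if x: "x \<in> S" for x
    proof
      assume "\<Phi> x = \<zero>\<^bsub>free_D\<^esub>"
      then have \<phi>0: "\<phi> n x = 0" for n using coef[of x n] by simp
      let ?K = "\<Union>p\<in>supp x. supp (h (snd p))"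
      have "x - (\<Sum>n\<in>?K. e n (\<phi> n x)) \<in> N" by (rule expand[OF x]) auto
      moreover have "(\<Sum>n\<in>?K. e n (\<phi> n x)) \<in> N" unfolding \<phi>0 by (rule pm.subspace_sum[OF subN e0])
      ultimately show "x \<in> N" using pm.subspace_add[OF subN] by fastforce
    next
      assume "x \<in> N"
      then show "\<Phi> x = \<zero>\<^bsub>free_D\<^esub>" by (intro poly_mapping_eqI) (simp add: coef \<phi>_N)
    qed
    show "lin_ext (\<lambda>(a, w). sgl (r \<otimes>\<^bsub>D_alg\<^esub> a, w) 1) x \<in> S" if "r \<in> carrier D_alg" "x \<in> S" for r x
      unfolding lin_ext_def
    proof (intro pm.subspace_sum[OF subS] pm.subspace_scale[OF subS])
      fix p assume "p \<in> supp x"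
      then have "p \<in> carrier D_alg \<times> carrier W" using that(2) by (auto simp: S_def)
      then show "(case p of (a, w) \<Rightarrow> sgl (r \<otimes>\<^bsub>D_alg\<^esub> a, w) 1) \<in> S"
        using that(1) by (auto intro!: sglS D_closed)
    qed
    show "\<Phi> (lin_ext (\<lambda>(a, w). sgl (r \<otimes>\<^bsub>D_alg\<^esub> a, w) 1) x) = r \<odot>\<^bsub>free_D\<^esub> \<Phi> x" for r x
    proof (rule poly_mapping_eqI)
      fix n
      have "\<phi> n (lin_ext (\<lambda>(a, w). sgl (r \<otimes>\<^bsub>D_alg\<^esub> a, w) 1) x) = r * \<phi> n x"
        unfolding \<phi>_def lin_ext_def[of _ x] lin_ext_sum lin_ext_scale sum_distrib_left
        by (rule sum.cong[OF refl])
          (simp add: G_def pm_scale_eq_mult lin_ext_single case_prod_beta algebra_simps)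
      then show "coef (\<Phi> (lin_ext (\<lambda>(a, w). sgl (r \<otimes>\<^bsub>D_alg\<^esub> a, w) 1) x)) n = coef (r \<odot>\<^bsub>free_D\<^esub> \<Phi> x) n"
        by (simp add: coef)
    qed
    show "carrier (ext_scalars D_alg W) = (\<lambda>x. N +>\<^bsub>free_space (carrier D_alg \<times> carrier W)\<^esub> x) ` S"
      unfolding ext_scalars_def Let_def null S_def by (auto simp: A_RCOSETS_def' free_space_eq)
  qed (use NS pm.subspace_diff[OF subS] pm.subspace_add[OF subS] in
      \<open>auto simp: ext_scalars_def Let_def null\<close>)
qed

section \<open>Characters\<close>

text \<open>Partitions into parts greater than J, the variable of index i standing for a part i + 1.
  Increasing J strips off the factors of the product one at a time.\<close>

definition parts_gf :: "nat \<Rightarrow> rat fps" where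
  "parts_gf J = Abs_fps (\<lambda>k. of_nat (card {\<mu>. wt \<mu> = k \<and> (\<forall>i\<in>supp \<mu>. J \<le> i)}))"

text \<open>Either no part equals J + 1, or one copy of it can be removed.\<close>

lemma parts_split:
  "{\<mu>. wt \<mu> = k \<and> (\<forall>i\<in>supp \<mu>. J \<le> i)} = {\<mu>. wt \<mu> = k \<and> (\<forall>i\<in>supp \<mu>. Suc J \<le> i)} \<union>
    (\<lambda>\<nu>. \<nu> + sgl J 1) ` {\<nu>. wt \<nu> + Suc J = k \<and> (\<forall>i\<in>supp \<nu>. J \<le> i)}"
proof (intro Set.set_eqI iffI)
  fix \<mu> assume "\<mu> \<in> {\<mu>. wt \<mu> = k \<and> (\<forall>i\<in>supp \<mu>. J \<le> i)}"
  then have \<mu>: "wt \<mu> = k" "\<forall>i\<in>supp \<mu>. J \<le> i" by auto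
  show "\<mu> \<in> {\<mu>. wt \<mu> = k \<and> (\<forall>i\<in>supp \<mu>. Suc J \<le> i)} \<union>
    (\<lambda>\<nu>. \<nu> + sgl J 1) ` {\<nu>. wt \<nu> + Suc J = k \<and> (\<forall>i\<in>supp \<nu>. J \<le> i)}"
  proof (cases "J \<in> supp \<mu>")
    case True
    let ?\<nu> = "\<mu> - sgl J 1"
    have eq: "\<mu> = ?\<nu> + sgl J 1"
      using True by (intro poly_mapping_eqI) (auto simp: lookup_add lookup_minus lookup_single when_def in_keys_iff)
    have "supp ?\<nu> \<subseteq> supp \<mu>" by (auto simp: in_keys_iff lookup_minus)
    moreover have "wt ?\<nu> + Suc J = k" using \<mu>(1) wt_add[of ?\<nu> "sgl J 1"] eq by (simp add: wt_def[of "sgl J 1"])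
    ultimately have "?\<nu> \<in> {\<nu>. wt \<nu> + Suc J = k \<and> (\<forall>i\<in>supp \<nu>. J \<le> i)}" using \<mu>(2) by blast
    then show ?thesis using eq by blast
  next
    case False
    have "Suc J \<le> i" if "i \<in> supp \<mu>" for i
      using \<mu>(2) that False by (metis Suc_leI le_neq_implies_less)
    then show ?thesis using \<mu>(1) by blast
  qed
next
  fix \<mu> assume "\<mu> \<in> {\<mu>. wt \<mu> = k \<and> (\<forall>i\<in>supp \<mu>. Suc J \<le> i)} \<union>
    (\<lambda>\<nu>. \<nu> + sgl J 1) ` {\<nu>. wt \<nu> + Suc J = k \<and> (\<forall>i\<in>supp \<nu>. J \<le> i)}"
  then consider "wt \<mu> = k" "\<forall>i\<in>supp \<mu>. Suc J \<le> i"
    | \<nu> where "\<mu> = \<nu> + sgl J 1" "wt \<nu> + Suc J = k" "\<forall>i\<in>supp \<nu>. J \<le> i" by blast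
  then show "\<mu> \<in> {\<mu>. wt \<mu> = k \<and> (\<forall>i\<in>supp \<mu>. J \<le> i)}"
  proof cases
    case 1
    then show ?thesis using Suc_leD by blast
  next
    case 2
    have "J \<le> i" if "i \<in> supp \<mu>" for i
      using 2(3) subsetD[OF Poly_Mapping.keys_add[of \<nu> "sgl J 1"], of i] that 2(1)
      by (auto split: if_splits)
    moreover have "wt \<mu> = k" using 2(1,2) by (simp add: wt_add wt_def[of "sgl J 1"])
    ultimately show ?thesis by blast
  qed
qed

lemma card_parts:
  "card {\<mu>. wt \<mu> = k \<and> (\<forall>i\<in>supp \<mu>. J \<le> i)} = card {\<mu>. wt \<mu> = k \<and> (\<forall>i\<in>supp \<mu>. Suc J \<le> i)} +
    (if k < Suc J then 0 else card {\<nu>. wt \<nu> = k - Suc J \<and> (\<forall>i\<in>supp \<nu>. J \<le> i)})"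
proof -
  let ?A = "{\<mu>. wt \<mu> = k \<and> (\<forall>i\<in>supp \<mu>. Suc J \<le> i)}"
    and ?B = "{\<nu>. wt \<nu> + Suc J = k \<and> (\<forall>i\<in>supp \<nu>. J \<le> i)}"
  have fin: "finite ?A" by (rule finite_subset[OF _ finite_wt[of k]]) auto
  have finB: "finite ?B" by (rule finite_subset[OF _ finite_wt[of "k - Suc J"]]) auto
  have "?A \<inter> (\<lambda>\<nu>. \<nu> + sgl J 1) ` ?B = {}"
  proof (rule ccontr)
    assume "?A \<inter> (\<lambda>\<nu>. \<nu> + sgl J 1) ` ?B \<noteq> {}"
    then obtain \<mu> where \<mu>: "\<mu> \<in> ?A" "\<mu> \<in> (\<lambda>\<nu>. \<nu> + sgl J 1) ` ?B" by (elim exE[OF ex_in_conv[THEN iffD2]] IntE)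
    from \<mu>(2) obtain \<nu> where "\<mu> = \<nu> + sgl J 1" by (rule imageE)
    then have "J \<in> supp \<mu>" by (simp add: in_keys_iff lookup_add)
    moreover have "\<forall>i\<in>supp \<mu>. Suc J \<le> i" using \<mu>(1) unfolding mem_Collect_eq by (rule conjunct2)
    ultimately have "Suc J \<le> J" by blast
    then show False by simp
  qed
  then have "card {\<mu>. wt \<mu> = k \<and> (\<forall>i\<in>supp \<mu>. J \<le> i)} = card ?A + card ((\<lambda>\<nu>. \<nu> + sgl J 1) ` ?B)"
    unfolding parts_split[of k J] using fin finB by (intro card_Un_disjoint) auto
  also have "card ((\<lambda>\<nu>. \<nu> + sgl J 1) ` ?B) = card ?B"
    by (rule card_image) (rule inj_onI, simp)
  also have "?B = (if k < Suc J then {} else {\<nu>. wt \<nu> = k - Suc J \<and> (\<forall>i\<in>supp \<nu>. J \<le> i)})"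
    by auto
  finally show ?thesis by (simp del: less_Suc_eq_le)
qed

lemma parts_gf_rec: "(1 - fps_X ^ (J + 1)) * parts_gf J = parts_gf (Suc J)"
proof (rule fps_ext)
  fix k
  show "fps_nth ((1 - fps_X ^ (J + 1)) * parts_gf J) k = fps_nth (parts_gf (Suc J)) k"
    using card_parts[of k J] by (simp add: parts_gf_def left_diff_distrib fps_X_power_mult_nth del: power_Suc)
qed

lemma parts_gf_prod: "(\<Prod>i<J. 1 - fps_X ^ (i + 1)) * parts_gf 0 = parts_gf J"
proof (induction J)
  case (Suc J)
  have "(\<Prod>i<Suc J. 1 - fps_X ^ (i + 1)) * parts_gf 0
      = (1 - fps_X ^ (J + 1)) * ((\<Prod>i<J. 1 - fps_X ^ (i + 1)) * parts_gf 0)"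
    by (simp only: prod.lessThan_Suc mult.assoc mult.left_commute mult.commute)
  then show ?case by (simp only: Suc.IH parts_gf_rec)
qed simp

lemma parts_gf_nth: "k \<le> J \<Longrightarrow> fps_nth (parts_gf J) k = (if k = 0 then 1 else 0)"
proof -
  assume k: "k \<le> J"
  have zero: "\<mu> = 0" if "wt \<mu> = k" "\<forall>i\<in>supp \<mu>. J \<le> i" for \<mu>
  proof (rule ccontr)
    assume "\<mu> \<noteq> 0"
    then obtain i where i: "i \<in> supp \<mu>" by (metis keys_eq_empty equals0I)
    then have "coef \<mu> i \<ge> 1" by (simp add: in_keys_iff Suc_le_eq)
    then have "(i + 1) * 1 \<le> (i + 1) * coef \<mu> i" by (rule mult_le_mono2)
    from order_trans[OF this coef_le_wt] have "i + 1 \<le> wt \<mu>" by simp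
    moreover have "J \<le> i" using that(2) i by blast
    ultimately show False using k that(1) by simp
  qed
  then have "wt \<mu> = k \<and> (\<forall>i\<in>supp \<mu>. J \<le> i) \<longleftrightarrow> \<mu> = 0 \<and> k = 0" for \<mu>
    using zero[of \<mu>] by (cases "\<mu> = 0") auto
  then show ?thesis by (simp add: parts_gf_def)
qed

text \<open>The partial products are \<open>parts_gf (Suc n)\<close> divided by
  \<open>parts_gf 0\<close>, and the numerators tend to 1 coefficientwise, since parts greater than
  J cannot add up to a positive number below J + 1.\<close>

lemma prodinf_parts_gf: "prodinf (\<lambda>n. 1 - fps_X ^ (n + 1)) * parts_gf 0 = 1"
proof -
  let ?G = "parts_gf 0"
  have G0: "fps_nth ?G 0 \<noteq> 0" by (simp add: parts_gf_nth)
  then have inv: "?G * inverse ?G = 1" using inverse_mult_eq_1' by blast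
  have prod: "(\<Prod>i\<le>n. 1 - fps_X ^ (i + 0 + 1)) = parts_gf (Suc n) * inverse ?G" for n
  proof -
    have "(\<Prod>i\<le>n. 1 - fps_X ^ (i + 0 + 1)) = (\<Prod>i<Suc n. 1 - fps_X ^ (i + 1)) * (?G * inverse ?G)"
      by (simp only: inv lessThan_Suc_atMost add_0_right mult_1_right)
    also have "\<dots> = parts_gf (Suc n) * inverse ?G" by (simp only: mult.assoc[symmetric] parts_gf_prod)
    finally show ?thesis .
  qed
  have "(\<lambda>n. \<Prod>i\<le>n. 1 - fps_X ^ (i + 0 + 1)) \<longlonglongrightarrow> inverse ?G"
    unfolding prod
  proof (rule tendsto_fpsI)
    fix k
    have "fps_nth (parts_gf (Suc n) * inverse ?G) k = fps_nth (inverse ?G) k" if "n \<ge> k" for n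
    proof -
      have "fps_nth (parts_gf (Suc n) * inverse ?G) k = (\<Sum>i=0..k. (if i = 0 then fps_nth (inverse ?G) (k - i) else 0))"
        unfolding fps_mult_nth using that by (intro sum.cong refl) (simp add: parts_gf_nth)
      then show ?thesis by simp
    qed
    then show "\<forall>\<^sub>F n in sequentially. fps_nth (parts_gf (Suc n) * inverse ?G) k = fps_nth (inverse ?G) k"
      unfolding eventually_sequentially by blast
  qed
  \<comment> \<open>\<open>raw_has_prod\<close> requires a nonzero limit.\<close>
  moreover have "inverse ?G \<noteq> 0" using inv by (metis mult_zero_right zero_neq_one)
  ultimately have "raw_has_prod (\<lambda>n. 1 - fps_X ^ (n + 1)) 0 (inverse ?G)"
    by (simp add: raw_has_prod_def)
  then have "(\<lambda>n. 1 - fps_X ^ (n + 1)) has_prod inverse ?G" by (simp add: has_prod_def)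
  then have "prodinf (\<lambda>n. 1 - fps_X ^ (n + 1)) = inverse ?G" by (rule has_prod_unique[symmetric])
  then show ?thesis using inv by (simp add: mult.commute)
qed

lemma V_deg_eq:
  "V_deg (int m) d = (if d \<le> - (int m)\<^sup>2 - int m then wt_space (nat (- (int m)\<^sup>2 - int m - d)) else {0})"
proof (cases "d \<le> - (int m)\<^sup>2 - int m")
  case True
  then have "b_deg (int m) \<mu> = d \<longleftrightarrow> wt \<mu> = nat (- (int m)\<^sup>2 - int m - d)" for \<mu>
    unfolding b_deg_eq by linarith
  then show ?thesis using True by (simp add: V_deg_def wt_space_def)
next
  case False
  then have "b_deg (int m) \<mu> \<noteq> d" for \<mu> unfolding b_deg_eq by linarith
  then have "V_deg (int m) d = {P. supp P = {}}" unfolding V_deg_def by blast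
  then show ?thesis using False by simp
qed

lemma dim_zero_space: "pm.dim {0 :: 'a \<Rightarrow>\<^sub>0 complex} = 0"
proof -
  obtain B where B: "B \<subseteq> {0 :: 'a \<Rightarrow>\<^sub>0 complex}" "pm.independent B" "{0} \<subseteq> pm.span B"
      "card B = pm.dim {0 :: 'a \<Rightarrow>\<^sub>0 complex}"
    by (rule pm.basis_exists[of "{0}"])
  have "0 \<notin> B" using B(2) pm.dependent_zero by blast
  then have "B = {}" using B(1) by blast
  then show ?thesis using B(4) by simp
qed

text \<open>The exponent m (m + 1) is minus the degree of the vector of weight 0, and below it all
  components are 0. The factor 1 - X^(2m+2) records the weight shift of \<open>rel_map\<close> in
  \<open>dim_A_proj\<close>.\<close>

lemma vdim_A_deg:
  "of_nat (vdim complex_ring (A_deg (int m) (- k))) =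
    fls_nth (fps_to_fls (fps_X ^ (m * (m + 1)) * ((1 - fps_X ^ (2 * m + 2)) * parts_gf 0))) k"
proof -
  let ?c = "int (m * (m + 1))" and ?p = "A_proj (int m)"
  have c: "(int m)\<^sup>2 + int m = ?c" by (simp add: power2_eq_square algebra_simps)
  show ?thesis
  proof (cases "k < ?c")
    case True
    have zero: "A_proj (int m) 0 = 0" by (rule lin_zero[OF dlin_lin[OF dlin_A_proj]]) simp
    have "V_deg (int m) (- k) = {0}" using True c by (subst V_deg_eq) auto
    moreover have "range ?p \<inter> {0} = {0}" using zero by (metis Int_insert_right_if1 inf_bot_right rangeI)
    ultimately have "vdim complex_ring (A_deg (int m) (- k)) = 0" by (simp add: A_deg_dim dim_zero_space)
    then show ?thesis using True by (simp add: fps_X_power_mult_nth nat_less_iff del: of_nat_mult)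
  next
    case False
    define w where "w = nat (k - ?c)"
    have k: "k = int (m * (m + 1) + w)" using False by (simp add: w_def)
    have "V_deg (int m) (- k) = wt_space w"
      using False c by (subst V_deg_eq) (auto simp: w_def algebra_simps)
    then have dim: "vdim complex_ring (A_deg (int m) (- k)) + card {\<mu>. wt \<mu> + 2 * m + 2 = w} = card {\<mu>. wt \<mu> = w}"
      using dim_A_proj[of m w] by (simp add: A_deg_dim)
    have "{\<mu>. wt \<mu> + 2 * m + 2 = w} = (if w < 2 * m + 2 then {} else {\<mu>. wt \<mu> = w - (2 * m + 2)})"
      by auto
    then have "of_nat (vdim complex_ring (A_deg (int m) (- k))) = fps_nth ((1 - fps_X ^ (2 * m + 2)) * parts_gf 0) w"
      using arg_cong[OF dim, of "of_nat :: nat \<Rightarrow> rat"]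
      by (simp add: parts_gf_def left_diff_distrib fps_X_power_mult_nth del: power_Suc split: if_splits)
    moreover have "nat k = m * (m + 1) + w" "\<not> k < 0"
      unfolding k by (rule nat_int, simp only: of_nat_less_0_iff not_False_eq_True)
    ultimately show ?thesis by (simp only: fps_to_fls_nth fps_X_power_mult_nth) simp
  qed
qed

theorem ch_A_deg:
  "ch (A_deg (int m)) = fps_to_fls (fps_X ^ (m * (m + 1)) * (1 - fps_X ^ (2 * m + 2))
     / prodinf (\<lambda>n. 1 - fps_X ^ (n + 1)))"
proof -
  let ?P = "prodinf (\<lambda>n. 1 - fps_X ^ (n + 1)) :: rat fps"
    and ?F = "fps_X ^ (m * (m + 1)) * (1 - fps_X ^ (2 * m + 2)) :: rat fps"
  have inv: "inverse ?P = parts_gf 0" by (rule fps_inverse_unique[OF prodinf_parts_gf])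
  have "fps_nth (?P * parts_gf 0) 0 = 1" unfolding prodinf_parts_gf by simp
  then have P0: "fps_nth ?P 0 \<noteq> 0" by auto
  have "?F / ?P = fps_X ^ (m * (m + 1)) * ((1 - fps_X ^ (2 * m + 2)) * parts_gf 0)"
    unfolding fps_divide_unit[OF P0] inv mult.assoc ..
  moreover have "ch (A_deg (int m)) = fps_to_fls (fps_X ^ (m * (m + 1)) * ((1 - fps_X ^ (2 * m + 2)) * parts_gf 0))"
    \<comment> \<open>\<open>Abs_fls\<close> is meaningful only for coefficients that vanish far
      below; here they are those of a power series.\<close>
    unfolding ch_def vdim_A_deg by (rule fls_eqI, rule nth_Abs_fls) (rule MOST_fls_neg_nth_eq_0)
  ultimately show ?thesis by simp
qed

theorem theorem2:
  fixes m :: nat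
  shows "free_module D_alg (A_mod (int m)) \<and>
         modules_isomorphic D_alg (A_mod (int m)) (ext_scalars D_alg (W_space (int m))) \<and>
         ch (A_deg (int m)) =
         fps_to_fls (fps_X ^ (m * (m + 1)) * (1 - fps_X ^ (2 * m + 2))
           / prodinf (\<lambda>n. 1 - fps_X ^ (n + 1)))"
proof (intro conjI)
  have "free_module D_alg free_D" unfolding free_module_def using module_free_D free_D_basis by blast
  then show "free_module D_alg (A_mod (int m))" by (rule free_module_iso[OF A_mod_free])
  show "modules_isomorphic D_alg (A_mod (int m)) (ext_scalars D_alg (W_space (int m)))"
    by (rule modules_isomorphic_trans[OF A_mod_free
          modules_isomorphic_sym[OF ext_scalars_free[OF W_space_countable]]])
qed (rule ch_A_deg)

end
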